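(* Let $1<p<\infty$, $p\neq2$, and let $X$ be a subspace of the Schatten class $S^p(\ell_2)$ such that every subspace $Y$ of $X$ admits an equivalent convex transitive norm. Then $X$ is isomorphic to $\ell_2$.
   Context: Banach spaces are infinite-dimensional, and "subspace" means closed infinite-dimensional linear subspace. A norm on $Y$ is convex transitive if for every $y$ in the unit sphere of $Y$ the closed convex hull of $\{Ty:T\in\operatorname{Isom}(Y)\}$ equals the closed unit ball of $Y$, where $\operatorname{Isom}(Y)$ is the group of surjective linear isometries of $Y$ for that norm. $S^p(\ell_2)$ is the space of compact operators $T$ on $\ell_2$ with $\|T\|_p=(\operatorname{tr}|T|^p)^{1/p}<\infty$. *)

theory Defs
  imports "HOL-Analysis.Analysis"
begin

section \<open>Scalars\<close>

text \<open>
  Up to isomorphism the only instances of this class are the real and the complex numbers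
  (see \<open>scalar_real_or_complex\<close> below), so that a statement about an arbitrary
  instance covers real as well as complex Banach spaces.
\<close>

class rc_scalar = real_normed_field +
  fixes sconj :: "'a \<Rightarrow> 'a"
  assumes sconj_add: "sconj (x + y) = sconj x + sconj y"
    and sconj_mult: "sconj (x * y) = sconj x * sconj y"
    and sconj_mult_self_scaleR: "sconj x * x = (norm x)\<^sup>2 *\<^sub>R 1"

instantiation real :: rc_scalar
begin
definition sconj_real :: "real \<Rightarrow> real" where "sconj_real x = x"
instance by standard (simp_all add: sconj_real_def power2_eq_square)
end

instantiation complex :: rc_scalar
begin
definition sconj_complex :: "complex \<Rightarrow> complex" where "sconj_complex = cnj"
instance
proof
  fix x y :: complex
  show "sconj x * x = (norm x)\<^sup>2 *\<^sub>R 1"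
    using complex_norm_square[of x] by (simp add: sconj_complex_def mult.commute scaleR_conv_of_real)
qed (simp_all add: sconj_complex_def)
end

lemma sconj_mult_self: "sconj x * x = of_real ((norm (x::'a::rc_scalar))\<^sup>2)"
  by (simp only: of_real_def sconj_mult_self_scaleR)

lemma sconj_eq: "x \<noteq> 0 \<Longrightarrow> sconj x = of_real ((norm x)\<^sup>2) / (x::'a::rc_scalar)"
  using sconj_mult_self[of x] by (simp add: field_simps)

lemma sconj_zero [simp]: "sconj (0::'a::rc_scalar) = 0"
  using sconj_add[of "0::'a" 0] by simp

lemma sconj_of_real [simp]: "sconj (of_real r) = (of_real r :: 'a::rc_scalar)"
  by (cases "r = 0") (simp_all add: sconj_eq power2_eq_square)

lemma norm_sconj [simp]: "norm (sconj x) = norm (x::'a::rc_scalar)"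
  by (cases "x = 0") (simp_all add: sconj_eq norm_divide norm_mult power2_eq_square)

lemma sconj_sconj [simp]: "sconj (sconj x) = (x::'a::rc_scalar)"
proof (cases "x = 0")
  case False
  then have "sconj x \<noteq> 0" using norm_sconj[of x] by (metis norm_eq_zero)
  then show ?thesis
    using sconj_mult_self[of "sconj x"] sconj_mult_self[of x]
    by (metis mult.commute mult_left_cancel norm_sconj)
qed simp

lemma add_sconj_real: "\<exists>r. x + sconj x = of_real r" for x :: "'a::rc_scalar"
proof -
  have "sconj (1 + x) * (1 + x) = of_real ((norm (1 + x))\<^sup>2)"
    by (rule sconj_mult_self)
  moreover have "sconj (1 + x) * (1 + x) = 1 + (x + sconj x) + of_real ((norm x)\<^sup>2)"
    using sconj_of_real[of 1, where 'a='a]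
    by (simp only: sconj_mult_self[symmetric] of_real_1 sconj_add) (simp add: algebra_simps)
  ultimately have "x + sconj x = of_real ((norm (1 + x))\<^sup>2 - 1 - (norm x)\<^sup>2)"
    by (simp add: algebra_simps)
  then show ?thesis ..
qed

lemma sconj_minus: "sconj (- x) = - sconj (x::'a::rc_scalar)"
  using sconj_add[of x "- x"] by (simp add: add_eq_0_iff)

lemma scalar_real_or_complex:
  "(\<forall>z::'a::rc_scalar. \<exists>a. z = of_real a) \<or>
   (\<exists>i::'a. i * i = -1 \<and> (\<forall>z. \<exists>a b. z = of_real a + of_real b * i))"
proof (rule disjCI)
  have half: "\<exists>a w. z = of_real a + w \<and> sconj w = - w" for z :: 'a
  proof -
    obtain r where r: "z + sconj z = of_real r" using add_sconj_real by blast
    define w where "w = z - of_real (r / 2)"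
    have "sconj w = sconj z - of_real (r / 2)"
      using sconj_add[of z "- of_real (r / 2)"] by (simp only: w_def sconj_minus sconj_of_real) simp
    also have "sconj z = of_real r - z" using r by (simp add: algebra_simps)
    finally have "sconj w = - w"
      by (simp add: w_def)
    then show ?thesis by (intro exI[of _ "r / 2"] exI[of _ w]) (simp add: w_def)
  qed
  assume "\<not> (\<exists>i::'a. i * i = -1 \<and> (\<forall>z. \<exists>a b. z = of_real a + of_real b * i))"
  then have no: "\<exists>z. \<forall>a b. z \<noteq> of_real a + of_real b * i" if "i * i = -1" for i :: 'a
    using that by blast
  have skew0: "w = 0" if w: "sconj w = - w" for w :: 'a
  proof (rule ccontr)
    assume "w \<noteq> 0"
    then have n: "norm w > 0" by simp
    define i where "i = of_real (1 / norm w) * w"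
    have ww: "w * w = - of_real ((norm w)\<^sup>2)" using sconj_mult_self[of w] w
      by (metis minus_minus mult_minus_left)
    have "i * i = of_real (1 / (norm w)\<^sup>2) * (w * w)"
      by (simp add: i_def power2_eq_square)
    also have "\<dots> = - of_real (1 / (norm w)\<^sup>2 * (norm w)\<^sup>2)"
      by (simp only: ww of_real_mult mult_minus_right)
    also have "1 / (norm w)\<^sup>2 * (norm w)\<^sup>2 = 1" using n by simp
    finally have ii: "i * i = -1" by simp
    have ci: "sconj i = - i" by (simp only: i_def sconj_mult sconj_of_real w mult_minus_right)
    obtain z where z: "\<And>a b. z \<noteq> of_real a + of_real b * i" using no[OF ii] by blast
    obtain a v where v: "z = of_real a + v" "sconj v = - v" using half by blast
    obtain r where r: "v * i + sconj (v * i) = of_real r" using add_sconj_real by blast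
    have "sconj (v * i) = v * i" by (simp only: sconj_mult ci v) simp
    then have vi: "v * i = of_real (r / 2)" using r by (simp add: field_simps)
    have "v = - ((v * i) * i)" by (simp add: mult.assoc ii)
    also have "\<dots> = of_real (- r / 2) * i" by (simp add: vi)
    finally show False using z[of a "- r / 2"] v(1) by simp
  qed
  show "\<forall>z::'a. \<exists>a. z = of_real a"
    using half skew0 by (metis add.right_neutral)
qed

section \<open>The Hilbert space of square-summable sequences\<close>

typedef (overloaded) ('k::real_normed_field) ell2 =
    "{x :: nat \<Rightarrow> 'k. summable (\<lambda>n. (norm (x n))\<^sup>2)}"
  morphisms coord Abs_ell2
  by (rule exI[of _ "\<lambda>_. 0"]) simp

setup_lifting type_definition_ell2

lemma ell2_summable: "summable (\<lambda>n. (norm (coord x n))\<^sup>2)"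
  using coord[of x] by simp

lemma ell2_minkowski:
  fixes x y :: "nat \<Rightarrow> 'k::real_normed_field"
  assumes x: "summable (\<lambda>n. (norm (x n))\<^sup>2)" and y: "summable (\<lambda>n. (norm (y n))\<^sup>2)"
  shows "summable (\<lambda>n. (norm (x n + y n))\<^sup>2)"
    and "sqrt (\<Sum>n. (norm (x n + y n))\<^sup>2)
           \<le> sqrt (\<Sum>n. (norm (x n))\<^sup>2) + sqrt (\<Sum>n. (norm (y n))\<^sup>2)"
proof -
  let ?a = "sqrt (\<Sum>n. (norm (x n))\<^sup>2)" and ?b = "sqrt (\<Sum>n. (norm (y n))\<^sup>2)"
  have nn: "?a \<ge> 0" "?b \<ge> 0" using x y by (auto intro: suminf_nonneg)
  have bound: "(\<Sum>n<N. (norm (x n + y n))\<^sup>2) \<le> (?a + ?b)\<^sup>2" for N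
  proof -
    have "L2_set (\<lambda>n. norm (x n + y n)) {..<N} \<le> L2_set (\<lambda>n. norm (x n) + norm (y n)) {..<N}"
      by (rule L2_set_mono) (auto intro: norm_triangle_ineq)
    also have "\<dots> \<le> L2_set (\<lambda>n. norm (x n)) {..<N} + L2_set (\<lambda>n. norm (y n)) {..<N}"
      by (rule L2_set_triangle_ineq)
    also have "\<dots> \<le> ?a + ?b"
      unfolding L2_set_def by (intro add_mono real_sqrt_le_mono sum_le_suminf x y) auto
    finally have "sqrt (\<Sum>n<N. (norm (x n + y n))\<^sup>2) \<le> ?a + ?b" by (simp add: L2_set_def)
    then show ?thesis by (rule sqrt_le_D)
  qed
  show s: "summable (\<lambda>n. (norm (x n + y n))\<^sup>2)"
    by (rule summableI_nonneg_bounded[OF _ bound]) simp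
  have "(\<Sum>n. (norm (x n + y n))\<^sup>2) \<le> (?a + ?b)\<^sup>2"
    by (rule suminf_le_const[OF s bound])
  then show "sqrt (\<Sum>n. (norm (x n + y n))\<^sup>2) \<le> ?a + ?b"
    using nn by (intro real_le_lsqrt) auto
qed

lemma ell2_summable_mult:
  "summable (\<lambda>n. (norm (x n))\<^sup>2) \<Longrightarrow> summable (\<lambda>n. (norm (c * x n))\<^sup>2)"
  for x :: "nat \<Rightarrow> 'k::real_normed_field"
  by (simp add: norm_mult power_mult_distrib summable_mult)

lift_definition ell2_scale :: "'k \<Rightarrow> ('k::real_normed_field) ell2 \<Rightarrow> 'k ell2"
  is "\<lambda>c x n. c * x n" by (rule ell2_summable_mult)

instantiation ell2 :: (real_normed_field) real_normed_vector
begin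

lift_definition zero_ell2 :: "'a ell2" is "\<lambda>_. 0" by simp
lift_definition plus_ell2 :: "'a ell2 \<Rightarrow> 'a ell2 \<Rightarrow> 'a ell2" is "\<lambda>x y n. x n + y n"
  by (rule ell2_minkowski(1))
lift_definition uminus_ell2 :: "'a ell2 \<Rightarrow> 'a ell2" is "\<lambda>x n. - x n" by simp
definition minus_ell2 :: "'a ell2 \<Rightarrow> 'a ell2 \<Rightarrow> 'a ell2" where "minus_ell2 x y = x + - y"
definition scaleR_ell2 :: "real \<Rightarrow> 'a ell2 \<Rightarrow> 'a ell2" where
  "scaleR_ell2 r x = ell2_scale (of_real r) x"
lift_definition norm_ell2 :: "'a ell2 \<Rightarrow> real" is "\<lambda>x. sqrt (\<Sum>n. (norm (x n))\<^sup>2)" .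
definition dist_ell2 :: "'a ell2 \<Rightarrow> 'a ell2 \<Rightarrow> real" where "dist_ell2 x y = norm (x - y)"
definition sgn_ell2 :: "'a ell2 \<Rightarrow> 'a ell2" where
  "sgn_ell2 x = ell2_scale (of_real (inverse (norm x))) x"
definition uniformity_ell2 :: "('a ell2 \<times> 'a ell2) filter" where
  "uniformity_ell2 = (INF e\<in>{0 <..}. principal {(x, y). dist x y < e})"
definition open_ell2 :: "'a ell2 set \<Rightarrow> bool" where
  "open_ell2 U \<longleftrightarrow> (\<forall>x\<in>U. \<forall>\<^sub>F (x', y) in uniformity. x' = x \<longrightarrow> y \<in> U)"

instance
proof
  fix x y z :: "'a ell2" and r s :: real
  show "x + y + z = x + (y + z)" by transfer (simp add: add.assoc)
  show "x + y = y + x" by transfer (simp add: add.commute)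
  show "0 + x = x" by transfer simp
  show "- x + x = 0" by transfer simp
  show "x - y = x + - y" by (rule minus_ell2_def)
  show "r *\<^sub>R (x + y) = r *\<^sub>R x + r *\<^sub>R y"
    unfolding scaleR_ell2_def by transfer (simp add: distrib_left)
  show "(r + s) *\<^sub>R x = r *\<^sub>R x + s *\<^sub>R x"
    unfolding scaleR_ell2_def by transfer (simp add: distrib_right)
  show "r *\<^sub>R s *\<^sub>R x = (r * s) *\<^sub>R x"
    unfolding scaleR_ell2_def by transfer (simp add: mult.assoc)
  show "1 *\<^sub>R x = x" unfolding scaleR_ell2_def by transfer simp
  show "dist x y = norm (x - y)" by (rule dist_ell2_def)
  show "sgn x = inverse (norm x) *\<^sub>R x" by (simp only: sgn_ell2_def scaleR_ell2_def)
  show "uniformity = (INF e\<in>{0 <..}. principal {(x, y::'a ell2). dist x y < e})"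
    by (rule uniformity_ell2_def)
  fix U :: "'a ell2 set"
  show "open U \<longleftrightarrow> (\<forall>x\<in>U. \<forall>\<^sub>F (x', y) in uniformity. x' = x \<longrightarrow> y \<in> U)"
    by (rule open_ell2_def)
next
  fix x y :: "'a ell2" and r :: real
  show "norm x = 0 \<longleftrightarrow> x = 0"
    by transfer (simp add: suminf_eq_zero_iff fun_eq_iff)
  show "norm (x + y) \<le> norm x + norm y"
    by transfer (rule ell2_minkowski(2))
  show "norm (r *\<^sub>R x) = \<bar>r\<bar> * norm x"
    unfolding scaleR_ell2_def
    by transfer (simp add: norm_mult power_mult_distrib suminf_mult real_sqrt_mult)
qed

end

definition ell2_inner :: "('k::rc_scalar) ell2 \<Rightarrow> 'k ell2 \<Rightarrow> 'k" where
  "ell2_inner x y = (\<Sum>n. coord x n * sconj (coord y n))"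

lift_definition ell2_unit :: "nat \<Rightarrow> ('k::real_normed_field) ell2"
  is "\<lambda>k n. if n = k then 1 else 0"
proof -
  fix k
  show "summable (\<lambda>n. (norm (if n = k then 1 else (0::'k)))\<^sup>2)"
    by (rule summable_finite[of "{k}"]) auto
qed

lemma ell2_scale_of_real: "ell2_scale (of_real r) x = r *\<^sub>R x"
  by (simp add: scaleR_ell2_def)

lemma norm_ell2_scale: "norm (ell2_scale c x) = norm c * norm x"
  by transfer (simp add: norm_mult power_mult_distrib suminf_mult real_sqrt_mult)

lemma vector_space_ell2_scale: "vector_space ell2_scale"
  by standard (transfer; simp add: algebra_simps)+

lemma bounded_linear_ell2_scale: "bounded_linear (ell2_scale c)"
proof (rule bounded_linear_intro[where K = "norm c"])
  show "ell2_scale c (x + y) = ell2_scale c x + ell2_scale c y" for x y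
    by transfer (simp add: distrib_left)
  show "ell2_scale c (r *\<^sub>R x) = r *\<^sub>R ell2_scale c x" for r x
    unfolding scaleR_ell2_def by transfer (simp add: mult.left_commute)
  show "norm (ell2_scale c x) \<le> norm x * norm c" for x
    by (simp add: norm_ell2_scale mult.commute)
qed

section \<open>Schatten classes\<close>

text \<open>
  The library type of bounded linear operators only knows real linearity; operators on the
  \<open>'k\<close>-Hilbert space are the elements satisfying \<open>scalar_linear\<close>.
\<close>

type_synonym 'k ell2_op = "'k ell2 \<Rightarrow>\<^sub>L 'k ell2"

definition scalar_linear :: "('k::real_normed_field) ell2_op \<Rightarrow> bool" where
  "scalar_linear T \<longleftrightarrow> (\<forall>c x. T (ell2_scale c x) = ell2_scale c (T x))"

definition op_scale :: "('k::real_normed_field) \<Rightarrow> 'k ell2_op \<Rightarrow> 'k ell2_op" where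
  "op_scale c T = Blinfun (ell2_scale c) o\<^sub>L T"

lemma op_scale_apply [simp]: "blinfun_apply (op_scale c T) x = ell2_scale c (T x)"
  by (simp add: op_scale_def bounded_linear_Blinfun_apply[OF bounded_linear_ell2_scale])

lemma op_scale_of_real: "op_scale (of_real r) T = r *\<^sub>R T"
  by (rule blinfun_eqI) (simp add: ell2_scale_of_real scaleR_blinfun.rep_eq)

lemma vector_space_op_scale: "vector_space op_scale"
proof -
  interpret E: vector_space ell2_scale by (rule vector_space_ell2_scale)
  show ?thesis
    by standard
      (auto intro!: blinfun_eqI simp: plus_blinfun.rep_eq E.scale_right_distrib E.scale_left_distrib)
qed

definition compact_op :: "('k::real_normed_field) ell2_op \<Rightarrow> bool" where
  "compact_op T \<longleftrightarrow> compact (closure (blinfun_apply T ` cball 0 1))"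

definition hilbert_adjoint :: "('k::rc_scalar) ell2_op \<Rightarrow> 'k ell2_op" where
  "hilbert_adjoint T = (THE S :: 'k ell2_op. \<forall>x y. ell2_inner (T x) y = ell2_inner x (S y))"

definition positive_op :: "('k::rc_scalar) ell2_op \<Rightarrow> bool" where
  "positive_op A \<longleftrightarrow> scalar_linear A \<and> hilbert_adjoint A = A
     \<and> (\<forall>x. \<exists>r\<ge>0. ell2_inner (A x) x = of_real r)"

definition abs_op :: "('k::rc_scalar) ell2_op \<Rightarrow> 'k ell2_op" where
  "abs_op T = (THE A. positive_op A \<and> A o\<^sub>L A = hilbert_adjoint T o\<^sub>L T)"

text \<open>
  The power \<open>A^p\<close> (\<open>p > 0\<close>) of a compact positive operator \<open>A\<close>, in the sense of the functional
  calculus: by the spectral theorem the eigenvectors of \<open>A\<close> have dense linear span, so a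
  bounded operator is determined by its values on them.
\<close>

definition powr_op :: "('k::rc_scalar) ell2_op \<Rightarrow> real \<Rightarrow> 'k ell2_op" where
  "powr_op A p = (THE B :: 'k ell2_op. \<forall>r\<ge>0. \<forall>x. A x = r *\<^sub>R x \<longrightarrow> B x = (r powr p) *\<^sub>R x)"

definition trace_summable :: "('k::rc_scalar) ell2_op \<Rightarrow> bool" where
  "trace_summable A \<longleftrightarrow> summable (\<lambda>n. ell2_inner (A (ell2_unit n)) (ell2_unit n))"

definition trace_op :: "('k::rc_scalar) ell2_op \<Rightarrow> 'k" where
  "trace_op A = (\<Sum>n. ell2_inner (A (ell2_unit n)) (ell2_unit n))"

definition schatten_class :: "real \<Rightarrow> ('k::rc_scalar) ell2_op set" where
  "schatten_class p =
     {T. scalar_linear T \<and> compact_op T \<and> trace_summable (powr_op (abs_op T) p)}"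

text \<open>
  The trace below is a nonnegative element of \<open>'k\<close>; \<open>norm\<close> merely converts it to type \<open>real\<close>.
\<close>

definition schatten_norm :: "real \<Rightarrow> ('k::rc_scalar) ell2_op \<Rightarrow> real" where
  "schatten_norm p T = norm (trace_op (powr_op (abs_op T) p)) powr (1 / p)"

section \<open>Subspaces, renormings and isomorphisms\<close>

text \<open>
  A normed space is given by a scalar multiplication \<open>s\<close> on the ambient type, a carrier \<open>V\<close>
  and a norm \<open>N\<close>, of which only the values on \<open>V\<close> matter.  Convexity refers to the real
  structure of the ambient type, with which \<open>s\<close> is compatible in the application
  (\<open>op_scale_of_real\<close>).
\<close>

definition closed_inf_dim_subspace ::
    "('k::rc_scalar \<Rightarrow> 'v::real_vector \<Rightarrow> 'v) \<Rightarrow> ('v \<Rightarrow> real) \<Rightarrow> 'v set \<Rightarrow> 'v set \<Rightarrow> bool" where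
  "closed_inf_dim_subspace s N V Y \<longleftrightarrow>
     Y \<subseteq> V \<and> module.subspace s Y
     \<and> (\<forall>f l. (\<forall>n::nat. f n \<in> Y) \<and> l \<in> V \<and> (\<lambda>n. N (f n - l)) \<longlonglongrightarrow> 0 \<longrightarrow> l \<in> Y)
     \<and> \<not> (\<exists>B. finite B \<and> Y \<subseteq> module.span s B)"

definition norm_on ::
    "('k::rc_scalar \<Rightarrow> 'v::real_vector \<Rightarrow> 'v) \<Rightarrow> 'v set \<Rightarrow> ('v \<Rightarrow> real) \<Rightarrow> bool" where
  "norm_on s Y M \<longleftrightarrow>
     (\<forall>y\<in>Y. M y \<ge> 0 \<and> (M y = 0 \<longleftrightarrow> y = 0))
     \<and> (\<forall>c. \<forall>y\<in>Y. M (s c y) = norm c * M y)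
     \<and> (\<forall>y\<in>Y. \<forall>z\<in>Y. M (y + z) \<le> M y + M z)"

definition equivalent_on :: "'v set \<Rightarrow> ('v \<Rightarrow> real) \<Rightarrow> ('v \<Rightarrow> real) \<Rightarrow> bool" where
  "equivalent_on Y N M \<longleftrightarrow> (\<exists>a>0. \<exists>b>0. \<forall>y\<in>Y. a * N y \<le> M y \<and> M y \<le> b * N y)"

definition linear_between ::
    "('k::rc_scalar \<Rightarrow> 'v::real_vector \<Rightarrow> 'v) \<Rightarrow> ('k \<Rightarrow> 'w::real_vector \<Rightarrow> 'w)
     \<Rightarrow> 'v set \<Rightarrow> ('v \<Rightarrow> 'w) \<Rightarrow> bool" where
  "linear_between s t Y U \<longleftrightarrow>
     (\<forall>y\<in>Y. \<forall>z\<in>Y. U (y + z) = U y + U z) \<and> (\<forall>c. \<forall>y\<in>Y. U (s c y) = t c (U y))"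

definition isometries ::
    "('k::rc_scalar \<Rightarrow> 'v::real_vector \<Rightarrow> 'v) \<Rightarrow> 'v set \<Rightarrow> ('v \<Rightarrow> real) \<Rightarrow> ('v \<Rightarrow> 'v) set" where
  "isometries s Y M = {T. linear_between s s Y T \<and> T ` Y = Y \<and> (\<forall>y\<in>Y. M (T y) = M y)}"

definition closed_convex_hull_on ::
    "'v::real_vector set \<Rightarrow> ('v \<Rightarrow> real) \<Rightarrow> 'v set \<Rightarrow> 'v set" where
  "closed_convex_hull_on Y M S = {z \<in> Y. \<forall>e>0. \<exists>w \<in> convex hull S. M (z - w) < e}"

definition convex_transitive ::
    "('k::rc_scalar \<Rightarrow> 'v::real_vector \<Rightarrow> 'v) \<Rightarrow> 'v set \<Rightarrow> ('v \<Rightarrow> real) \<Rightarrow> bool" where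
  "convex_transitive s Y M \<longleftrightarrow>
     (\<forall>y\<in>Y. M y = 1 \<longrightarrow>
        closed_convex_hull_on Y M {T y | T. T \<in> isometries s Y M} = {z \<in> Y. M z \<le> 1})"

definition isomorphic_normed ::
    "('k::rc_scalar \<Rightarrow> 'v::real_vector \<Rightarrow> 'v) \<Rightarrow> 'v set \<Rightarrow> ('v \<Rightarrow> real)
     \<Rightarrow> ('k \<Rightarrow> 'w::real_vector \<Rightarrow> 'w) \<Rightarrow> 'w set \<Rightarrow> ('w \<Rightarrow> real) \<Rightarrow> bool" where
  "isomorphic_normed s V N t W M \<longleftrightarrow>
     (\<exists>U. linear_between s t V U \<and> bij_betw U V W \<and> equivalent_on V N (\<lambda>v. M (U v)))"

end

theory Submission
  imports Defs "HOL-Library.Function_Algebras"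
begin

text \<open>
  The \<open>l\<^sub>2\<close> norm of the matrix entries of \<open>T\<close> in the first \<open>n\<close> rows and columns is at most
  \<open>sqrt (2 * n)\<close> times the operator norm of \<open>T\<close>. If for some \<open>n\<close> it also dominates a multiple of the
  Schatten norm on \<open>X\<close>, then \<open>X\<close> is isomorphic to a closed subspace of \<open>l\<^sub>2\<close>. Otherwise a gliding hump
  yields normalized elements of \<open>X\<close> that are summably close to operators supported in disjoint
  diagonal blocks; their closed span is isomorphic to \<open>l\<^sub>p\<close>, and it remains to see that \<open>l\<^sub>p\<close> has no
  equivalent convex transitive norm \<open>\<mu>\<close>.

  Let \<open>p > 2\<close>. By Khintchine's inequality \<open>l\<^sub>p\<close> contains vectors \<open>z\<^sub>1, \<dots>, z\<^sub>N\<close> that are equivalent to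
  an orthonormal system, uniformly in \<open>N\<close>. Around a unit coefficient vector \<open>a\<close> at which
  \<open>\<mu> (\<Sum>j. a\<^sub>j z\<^sub>j)\<close> is almost minimal, adding random signs of size \<open>\<tau>\<close> to the coefficients raises the
  mean square of \<open>\<mu>\<close> by a definite amount, because the mean Euclidean square grows by \<open>\<tau>\<^sup>2 N\<close>.
  Convex transitivity transfers this growth from \<open>\<Sum>j. a\<^sub>j z\<^sub>j\<close> to every other vector, and for large \<open>N\<close>
  the perturbation can be moved off any finite set of coordinates. Adding \<open>L\<close> such disjointly
  supported perturbations gives a vector whose norm \<open>\<mu>\<close> has order at least \<open>L powr (1/2)\<close> and whose
  \<open>l\<^sub>p\<close> norm has order at most \<open>L powr (1/p)\<close>. For \<open>p < 2\<close> the same argument applies to the dual norm,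
  since convex transitivity makes every orbit of isometries norming.
\<close>

section \<open>Scalars\<close>

text \<open>The sizes \<open>L powr (1/2)\<close> and \<open>L powr (1/p)\<close> contradict each
  other just for p > 2; this is why the other case passes to the conjugate exponent. The comparison
  needs perturbations whose size does not depend on the vector already built, so \<tau> is tied to N
  and to the lower Euclidean constant alone. Near-minimality of a is used because the minimal
  constant bounds \<mu> from below at all perturbed vectors at once. Nothing is known about how an
  isometry of \<mu> acts on coordinates. A transported perturbation is therefore not supported far
  out; only its mean size at each single coordinate is small, of order \<open>1 / sqrt N\<close>,
  which is seen by testing with conjugate coefficients. The Schatten norm is defined by absolute
  value, power and trace, a form unsuited to sums of operators. It is replaced by a supremum over
  pairs of orthonormal systems, from which the triangle inequality, completeness and the bounds for
  compressions follow; singular values serve to identify this supremum, to cut off tails and to add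
  up disjoint blocks.\<close>

lemma sconj_mult_self': "x * sconj x = of_real ((norm (x::'k::rc_scalar))\<^sup>2)"
  by (metis mult.commute sconj_mult_self)

lemma scalar_parallelogram:
  fixes x y :: "'k::rc_scalar"
  shows "(norm (x + y))\<^sup>2 + (norm (x - y))\<^sup>2 = 2 * (norm x)\<^sup>2 + 2 * (norm y)\<^sup>2"
proof -
  have "of_real ((norm (x + y))\<^sup>2 + (norm (x - y))\<^sup>2) =
      sconj (x + y) * (x + y) + sconj (x + - y) * (x + - y)"
    by (simp only: of_real_add sconj_mult_self) simp
  also have "\<dots> = 2 * (sconj x * x) + 2 * (sconj y * y)"
    by (simp only: sconj_add sconj_minus) (simp add: algebra_simps)
  also have "\<dots> = of_real (2 * (norm x)\<^sup>2 + 2 * (norm y)\<^sup>2)"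
    by (simp only: sconj_mult_self) simp
  finally show ?thesis by (simp only: of_real_eq_iff)
qed

text \<open>\<open>i * i = -1\<close> forces \<open>norm i = 1\<close> and hence
  \<open>sconj i = - i\<close>, so the square of the norm is a^2 + b^2. It follows that both real
  coordinates of a Cauchy sequence of scalars are Cauchy.\<close>

lemma abs_le_norm_of_real_add:
  fixes i :: "'k::rc_scalar"
  assumes "i * i = -1"
  shows "\<bar>a\<bar> \<le> norm (of_real a + of_real b * i)" "\<bar>b\<bar> \<le> norm (of_real a + of_real b * i)"
proof -
  have "norm i * norm i = 1" using assms by (metis norm_minus_cancel norm_mult norm_one)
  then have n1: "(norm i)\<^sup>2 = 1" by (simp add: power2_eq_square)
  then have "i \<noteq> 0" by auto
  have "sconj i * i = (- i) * i" using sconj_mult_self[of i] n1 assms by simp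
  then have ci: "sconj i = - i" using \<open>i \<noteq> 0\<close> by (metis mult_right_cancel)
  have "of_real ((norm (of_real a + of_real b * i))\<^sup>2) =
      (of_real a - of_real b * i) * (of_real a + of_real b * i)"
    by (simp only: sconj_mult_self[symmetric] sconj_add sconj_mult sconj_of_real ci) simp
  also have "\<dots> = of_real a * of_real a - of_real b * of_real b * (i * i)"
    by (simp add: algebra_simps)
  also have "\<dots> = of_real (a\<^sup>2 + b\<^sup>2)"
    by (simp only: assms of_real_add power2_eq_square of_real_mult) simp
  finally have "(norm (of_real a + of_real b * i))\<^sup>2 = a\<^sup>2 + b\<^sup>2" by (simp only: of_real_eq_iff)
  then show "\<bar>a\<bar> \<le> norm (of_real a + of_real b * i)" "\<bar>b\<bar> \<le> norm (of_real a + of_real b * i)"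
    by (metis abs_le_square_iff abs_norm_cancel le_add_same_cancel1 zero_le_power2,
        metis abs_le_square_iff abs_norm_cancel le_add_same_cancel2 zero_le_power2)
qed

text \<open>Completeness is inherited from the reals: by \<open>scalar_real_or_complex\<close> a
  scalar is given by one or two real coordinates, each dominated by the norm.\<close>

instance rc_scalar \<subseteq> complete_space
proof
  fix X :: "nat \<Rightarrow> 'a"
  assume X: "Cauchy X"
  have real_part: "Cauchy a" if "\<And>m n. \<bar>a m - a n\<bar> \<le> norm (X m - X n)" for a :: "nat \<Rightarrow> real"
    unfolding Cauchy_def
  proof (intro allI impI)
    fix e :: real assume "e > 0"
    then obtain M where "\<forall>m\<ge>M. \<forall>n\<ge>M. dist (X m) (X n) < e" using X unfolding Cauchy_def by blast
    then have "\<forall>m\<ge>M. \<forall>n\<ge>M. dist (a m) (a n) < e"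
      using that by (metis dist_norm le_less_trans real_norm_def)
    then show "\<exists>M. \<forall>m\<ge>M. \<forall>n\<ge>M. dist (a m) (a n) < e" ..
  qed
  consider "\<forall>z::'a. \<exists>a. z = of_real a"
    | i :: 'a where "i * i = -1" "\<forall>z. \<exists>a b. z = of_real a + of_real b * i"
    using scalar_real_or_complex by blast
  then show "convergent X"
  proof cases
    case 1
    then have "\<forall>n. \<exists>a. X n = of_real a" by blast
    then obtain a where a: "\<And>n. X n = of_real (a n)" by metis
    have "Cauchy a" by (rule real_part) (simp add: a flip: of_real_diff)
    then obtain l where "a \<longlonglongrightarrow> l" using Cauchy_convergent convergent_def by blast
    then have "(\<lambda>n. of_real (a n) :: 'a) \<longlonglongrightarrow> of_real l" by (rule tendsto_of_real)
    moreover have "X = (\<lambda>n. of_real (a n))" using a by auto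
    ultimately show ?thesis unfolding convergent_def by auto
  next
    case 2
    then have "\<forall>n. \<exists>a b. X n = of_real a + of_real b * i" by blast
    then obtain a b where ab: "\<And>n. X n = of_real (a n) + of_real (b n) * i" by metis
    have d: "X m - X n = of_real (a m - a n) + of_real (b m - b n) * i" for m n
      by (simp add: ab algebra_simps)
    have "Cauchy a" by (rule real_part) (unfold d, rule abs_le_norm_of_real_add(1)[OF 2(1)])
    moreover have "Cauchy b" by (rule real_part) (unfold d, rule abs_le_norm_of_real_add(2)[OF 2(1)])
    ultimately obtain l m where "a \<longlonglongrightarrow> l" "b \<longlonglongrightarrow> m"
      by (meson Cauchy_convergent convergent_def)
    then have "(\<lambda>n. of_real (a n) + of_real (b n) * i) \<longlonglongrightarrow> of_real l + of_real m * i"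
      by (intro tendsto_intros)
    moreover have "X = (\<lambda>n. of_real (a n) + of_real (b n) * i)" using ab by auto
    ultimately show ?thesis unfolding convergent_def by auto
  qed
qed

instance rc_scalar \<subseteq> banach ..

lemma exists_unimodular: "\<exists>u::'k::rc_scalar. norm u = 1 \<and> u * z = of_real (norm z)"
proof (cases "z = 0")
  case False
  then show ?thesis
    by (intro exI[of _ "of_real (norm z) / z"]) (simp add: norm_divide)
qed (auto intro: exI[of _ 1])

section \<open>The sequence spaces\<close>

text \<open>For positive a and b this is convexity on the open half-line. If one of them is 0, it
  reduces to \<open>c powr p \<le> c\<close> on the unit interval, applied to the weight of the
  other.\<close>

lemma powr_convex_combination:
  fixes a b l :: real
  assumes p: "p \<ge> 1" and l: "0 \<le> l" "l \<le> 1" and ab: "a \<ge> 0" "b \<ge> 0"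
  shows "((1 - l) * a + l * b) powr p \<le> (1 - l) * a powr p + l * b powr p"
proof -
  have c: "c powr p \<le> c" if "0 \<le> c" "c \<le> 1" for c :: real
  proof (cases "c = 0")
    case False
    then have "c powr p \<le> c powr 1" using that p by (intro powr_mono') auto
    then show ?thesis using that by simp
  qed simp
  show ?thesis
  proof (cases "a = 0 \<or> b = 0")
    case True
    then show ?thesis
      using l ab c[of l] c[of "1 - l"] by (auto simp: powr_mult intro!: mult_right_mono)
  next
    case False
    then have "a > 0" "b > 0" using ab by auto
    then show ?thesis
      using convex_onD[OF powr_convex[OF p], of l a b] l by simp
  qed
qed

text \<open>(x + y) / (A + B) is dominated by the convex combination of x / A and y / B with weights
  A / (A + B) and B / (A + B), so convexity of the power gives the bound term by term; a bound 0
  makes all terms vanish. Working with bounds A, B instead of the norms lets the same lemma serve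
  partial sums of infinite sequences and matrix coefficients of operators.\<close>

lemma minkowski_sum:
  fixes x y :: "'i \<Rightarrow> 'a::real_normed_vector"
  assumes p: "p \<ge> 1" and F: "finite F" and AB: "A \<ge> 0" "B \<ge> 0"
    and x: "(\<Sum>i\<in>F. norm (x i) powr p) \<le> A powr p"
    and y: "(\<Sum>i\<in>F. norm (y i) powr p) \<le> B powr p"
  shows "(\<Sum>i\<in>F. norm (x i + y i) powr p) \<le> (A + B) powr p"
proof -
  have null: "z i = 0" if "(\<Sum>i\<in>F. norm (z i) powr p) \<le> 0 powr p" "i \<in> F"
    for z :: "'i \<Rightarrow> 'a" and i
  proof -
    have "(\<Sum>i\<in>F. norm (z i) powr p) = 0"
      using that p by (intro antisym sum_nonneg) auto
    then have "norm (z i) powr p = 0" using F that(2) by (simp add: sum_nonneg_eq_0_iff)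
    then show ?thesis using p by simp
  qed
  consider "A = 0" | "B = 0" | "A > 0" "B > 0" using AB by linarith
  then show ?thesis
  proof cases
    case 1
    then have "\<And>i. i \<in> F \<Longrightarrow> x i = 0" using null[of x] x by auto
    then have "(\<Sum>i\<in>F. norm (x i + y i) powr p) = (\<Sum>i\<in>F. norm (y i) powr p)"
      by (intro sum.cong) auto
    then show ?thesis using 1 y by simp
  next
    case 2
    then have "\<And>i. i \<in> F \<Longrightarrow> y i = 0" using null[of y] y by auto
    then have "(\<Sum>i\<in>F. norm (x i + y i) powr p) = (\<Sum>i\<in>F. norm (x i) powr p)"
      by (intro sum.cong) auto
    then show ?thesis using 2 x by simp
  next
    case 3
    define l where "l = B / (A + B)"
    have l: "0 \<le> l" "l \<le> 1" "1 - l = A / (A + B)" using 3 by (auto simp: l_def field_simps)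
    have pt: "norm (x i + y i) powr p \<le>
        (A + B) powr p * ((1 - l) * (norm (x i) powr p / A powr p) + l * (norm (y i) powr p / B powr p))" for i
    proof -
      have "norm (x i + y i) \<le> norm (x i) + norm (y i)" by (rule norm_triangle_ineq)
      also have "\<dots> = (A + B) * ((1 - l) * (norm (x i) / A) + l * (norm (y i) / B))"
        proof -
        have "(A + B) * ((1 - l) * (norm (x i) / A)) = norm (x i)" unfolding l(3) using 3 by simp
        moreover have "(A + B) * (l * (norm (y i) / B)) = norm (y i)" unfolding l_def using 3 by simp
        ultimately show ?thesis by (simp only: distrib_left)
      qed
      finally have "norm (x i + y i) powr p \<le>
          ((A + B) * ((1 - l) * (norm (x i) / A) + l * (norm (y i) / B))) powr p"
        using p by (intro powr_mono2) auto
      also have "\<dots> = (A + B) powr p * ((1 - l) * (norm (x i) / A) + l * (norm (y i) / B)) powr p"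
        by (rule powr_mult)
      also have "\<dots> \<le> (A + B) powr p * ((1 - l) * (norm (x i) / A) powr p + l * (norm (y i) / B) powr p)"
        using 3 l(1,2) p by (intro mult_left_mono powr_convex_combination) auto
      finally show ?thesis using 3 by (simp add: powr_divide)
    qed
    have "(\<Sum>i\<in>F. norm (x i + y i) powr p) \<le>
        (\<Sum>i\<in>F. (A + B) powr p * ((1 - l) * (norm (x i) powr p / A powr p) + l * (norm (y i) powr p / B powr p)))"
      by (intro sum_mono pt)
    also have "\<dots> = (A + B) powr p *
        ((1 - l) * ((\<Sum>i\<in>F. norm (x i) powr p) / A powr p) + l * ((\<Sum>i\<in>F. norm (y i) powr p) / B powr p))"
      by (simp only: sum_distrib_left[symmetric] sum.distrib sum_divide_distrib)
    also have "\<dots> \<le> (A + B) powr p * ((1 - l) * 1 + l * 1)"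
      using x y l 3 by (intro mult_left_mono add_mono) (auto simp: divide_le_eq)
    finally show ?thesis by simp
  qed
qed

definition lp :: "real \<Rightarrow> (nat \<Rightarrow> 'k::real_normed_field) set" where
  "lp p = {x. summable (\<lambda>n. norm (x n) powr p)}"

definition lpn :: "real \<Rightarrow> (nat \<Rightarrow> 'k::real_normed_field) \<Rightarrow> real" where
  "lpn p x = (\<Sum>n. norm (x n) powr p) powr (1 / p)"

definition smul :: "'k \<Rightarrow> (nat \<Rightarrow> 'k::real_normed_field) \<Rightarrow> nat \<Rightarrow> 'k" where
  "smul c x = (\<lambda>n. c * x n)"

definition trunc :: "nat \<Rightarrow> (nat \<Rightarrow> 'k::real_normed_field) \<Rightarrow> nat \<Rightarrow> 'k" where
  "trunc m x = (\<lambda>n. if n < m then x n else 0)"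

definition unitseq :: "nat \<Rightarrow> nat \<Rightarrow> 'k::real_normed_field" where
  "unitseq k = (\<lambda>n. if n = k then 1 else 0)"

lemma smul_apply [simp]: "smul c x n = c * x n" by (simp add: smul_def)

lemma minus_fun_app: "(x - y) n = x n - y n" for x y :: "'i \<Rightarrow> 'a::group_add"
  by (simp add: fun_diff_def)

lemma sum_fun_app: "(\<Sum>j\<in>S. f j) n = (\<Sum>j\<in>S. f j n)" for f :: "'j \<Rightarrow> 'i \<Rightarrow> 'a::comm_monoid_add"
  by (induction S rule: infinite_finite_induct) auto

lemma lpn_nonneg [simp]: "lpn p x \<ge> 0" by (simp add: lpn_def)

lemma lpn_powr:
  assumes "p \<ge> 1" "x \<in> lp p"
  shows "lpn p x powr p = (\<Sum>n. norm (x n) powr p)"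
  using assms by (simp add: lpn_def powr_powr lp_def suminf_nonneg)

text \<open>Membership and norm bound are tied together in one condition on finite partial sums.
  Finite inequalities and pointwise limits then transfer to \<open>lp p\<close> without a separate
  summability argument.\<close>

lemma lp_le_iff:
  assumes p: "p \<ge> 1" and C: "C \<ge> 0"
  shows "x \<in> lp p \<and> lpn p x \<le> C \<longleftrightarrow> (\<forall>n. (\<Sum>k<n. norm (x k) powr p) \<le> C powr p)"
proof
  assume x: "x \<in> lp p \<and> lpn p x \<le> C"
  show "\<forall>n. (\<Sum>k<n. norm (x k) powr p) \<le> C powr p"
  proof
    fix n
    have "(\<Sum>k<n. norm (x k) powr p) \<le> (\<Sum>k. norm (x k) powr p)"
      using x by (intro sum_le_suminf) (auto simp: lp_def)
    also have "\<dots> = lpn p x powr p" using lpn_powr[OF p, of x] x by simp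
    also have "\<dots> \<le> C powr p" using x p by (intro powr_mono2) auto
    finally show "(\<Sum>k<n. norm (x k) powr p) \<le> C powr p" .
  qed
next
  assume b: "\<forall>n. (\<Sum>k<n. norm (x k) powr p) \<le> C powr p"
  have s: "summable (\<lambda>n. norm (x n) powr p)"
    by (rule summableI_nonneg_bounded[where x = "C powr p"]) (use b in auto)
  have "(\<Sum>n. norm (x n) powr p) \<le> C powr p"
    by (rule suminf_le_const[OF s]) (use b in auto)
  then have "lpn p x \<le> (C powr p) powr (1 / p)"
    unfolding lpn_def using p s by (intro powr_mono2 suminf_nonneg) auto
  then show "x \<in> lp p \<and> lpn p x \<le> C" using s p C by (simp add: lp_def powr_powr)
qed

lemma lp_leD: "p \<ge> 1 \<Longrightarrow> x \<in> lp p \<Longrightarrow> (\<Sum>k<n. norm (x k) powr p) \<le> lpn p x powr p"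
  using lp_le_iff[of p "lpn p x" x] by simp

lemma lp_leI:
  assumes "p \<ge> 1" "C \<ge> 0" "\<And>n. (\<Sum>k<n. norm (x k) powr p) \<le> C powr p"
  shows "x \<in> lp p" "lpn p x \<le> C"
  using lp_le_iff[of p C x] assms by auto

lemma lp_add:
  assumes p: "p \<ge> 1" and "x \<in> lp p" "y \<in> lp p"
  shows "x + y \<in> lp p" "lpn p (x + y) \<le> lpn p x + lpn p y"
proof -
  have "(\<Sum>k<n. norm ((x + y) k) powr p) \<le> (lpn p x + lpn p y) powr p" for n
    using minkowski_sum[OF p, of "{..<n}" "lpn p x" "lpn p y" x y] lp_leD[OF p assms(2)] lp_leD[OF p assms(3)] by simp
  then show "x + y \<in> lp p" "lpn p (x + y) \<le> lpn p x + lpn p y"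
    using lp_leI[OF p, of "lpn p x + lpn p y" "x + y"] by auto
qed

lemma lp_smul:
  assumes p: "p \<ge> 1" and "x \<in> lp p"
  shows "smul c x \<in> lp p" "lpn p (smul c x) = norm c * lpn p x"
proof -
  have e: "norm (smul c x n) powr p = norm c powr p * norm (x n) powr p" for n
    by (simp add: norm_mult powr_mult)
  show "smul c x \<in> lp p" using assms unfolding lp_def mem_Collect_eq e by (intro summable_mult)
  have "lpn p (smul c x) = (norm c powr p * (\<Sum>n. norm (x n) powr p)) powr (1 / p)"
    unfolding lpn_def e using assms by (simp add: suminf_mult lp_def)
  also have "\<dots> = norm c * lpn p x"
    using assms by (subst powr_mult) (auto simp: powr_powr lpn_def lp_def intro!: suminf_nonneg)
  finally show "lpn p (smul c x) = norm c * lpn p x" .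
qed

lemma lp_uminus: "p \<ge> 1 \<Longrightarrow> x \<in> lp p \<Longrightarrow> - x \<in> lp p" "lpn p (- x) = lpn p x"
  by (simp_all add: lp_def lpn_def fun_Compl_def)

lemma lp_diff:
  assumes p: "p \<ge> 1" and "x \<in> lp p" "y \<in> lp p"
  shows "x - y \<in> lp p" "lpn p (x - y) \<le> lpn p x + lpn p y"
  using lp_add[OF p assms(2) lp_uminus(1)[OF p assms(3)]] lp_uminus(2)[of p y] by simp_all

lemma norm_le_lpn: "p \<ge> 1 \<Longrightarrow> x \<in> lp p \<Longrightarrow> norm (x n) \<le> lpn p x"
proof -
  assume p: "p \<ge> 1" and x: "x \<in> lp p"
  have "norm (x n) powr p \<le> (\<Sum>k<Suc n. norm (x k) powr p)" by (simp add: sum_nonneg)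
  also have "\<dots> \<le> lpn p x powr p" by (rule lp_leD[OF p x])
  finally have "norm (x n) powr p \<le> lpn p x powr p" .
  then show ?thesis using p powr_less_mono2[of p "lpn p x" "norm (x n)"] by (meson less_le_trans lpn_nonneg not_le zero_less_one)
qed

lemma lp_finite_support:
  assumes p: "p \<ge> 1" and z: "\<And>k. k \<ge> m \<Longrightarrow> x k = 0"
  shows "x \<in> lp p" "lpn p x powr p = (\<Sum>k<m. norm (x k) powr p)"
proof -
  show m: "x \<in> lp p" unfolding lp_def mem_Collect_eq
    by (rule summable_finite[of "{..<m}"]) (use z in auto)
  show "lpn p x powr p = (\<Sum>k<m. norm (x k) powr p)"
    unfolding lpn_powr[OF p m] by (rule suminf_finite) (use z in auto)
qed

lemma lp_unitseq: "p \<ge> 1 \<Longrightarrow> unitseq k \<in> lp p"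
  by (rule lp_finite_support[where m = "Suc k"]) (auto simp: unitseq_def)

lemma zero_in_lp: "p \<ge> 1 \<Longrightarrow> 0 \<in> lp p"
  by (rule lp_finite_support[where m = 0]) auto

lemma lp_trunc:
  assumes p: "p \<ge> 1"
  shows "trunc m x \<in> lp p"
  by (rule lp_finite_support[where m = m]) (auto simp: trunc_def p)

lemma lpn_mono:
  assumes p: "p \<ge> 1" and x: "x \<in> lp p" and le: "\<And>k. norm (y k) \<le> norm (x k)"
  shows "y \<in> lp p" "lpn p y \<le> lpn p x"
proof -
  have "(\<Sum>k<n. norm (y k) powr p) \<le> lpn p x powr p" for n
    by (rule order_trans[OF sum_mono lp_leD[OF p x]]) (use le p in \<open>auto intro: powr_mono2\<close>)
  then show "y \<in> lp p" "lpn p y \<le> lpn p x" using lp_leI[OF p, of "lpn p x" y] by auto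
qed

lemma lpn_trunc_le: "p \<ge> 1 \<Longrightarrow> x \<in> lp p \<Longrightarrow> lpn p (trunc m x) \<le> lpn p x"
  by (rule lpn_mono) (auto simp: trunc_def)

lemma lpn_disjoint:
  assumes p: "p \<ge> 1" and x: "x \<in> lp p" and y: "y \<in> lp p" and d: "\<And>k. x k = 0 \<or> y k = 0"
  shows "lpn p (x + y) powr p = lpn p x powr p + lpn p y powr p"
proof -
  have e: "norm ((x + y) k) powr p = norm (x k) powr p + norm (y k) powr p" for k
    using d[of k] p by auto
  show ?thesis
    unfolding lpn_powr[OF p x] lpn_powr[OF p y] lpn_powr[OF p lp_add(1)[OF p x y]] e
    using x y by (intro suminf_add[symmetric]) (auto simp: lp_def)
qed

text \<open>Additivity over disjoint supports turns the tail into the difference between the full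
  sum and a partial sum.\<close>

lemma lpn_trunc_tendsto:
  assumes p: "p \<ge> 1" and x: "x \<in> lp p"
  shows "(\<lambda>m. lpn p (x - trunc m x)) \<longlonglongrightarrow> 0"
proof -
  have e: "lpn p (x - trunc m x) = (lpn p x powr p - (\<Sum>k<m. norm (x k) powr p)) powr (1 / p)" for m
  proof -
    have "lpn p (trunc m x + (x - trunc m x)) powr p =
        lpn p (trunc m x) powr p + lpn p (x - trunc m x) powr p"
      by (rule lpn_disjoint[OF p lp_trunc[OF p] lp_diff(1)[OF p x lp_trunc[OF p]]])
        (simp add: trunc_def minus_fun_app)
    moreover have "lpn p (trunc m x) powr p = (\<Sum>k<m. norm (trunc m x k) powr p)"
      by (rule lp_finite_support(2)[OF p]) (simp add: trunc_def)
    moreover have "(\<Sum>k<m. norm (trunc m x k) powr p) = (\<Sum>k<m. norm (x k) powr p)"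
      by (intro sum.cong) (auto simp: trunc_def)
    ultimately have "lpn p (x - trunc m x) powr p = lpn p x powr p - (\<Sum>k<m. norm (x k) powr p)"
      by simp
    then have "(lpn p (x - trunc m x) powr p) powr (1 / p) =
        (lpn p x powr p - (\<Sum>k<m. norm (x k) powr p)) powr (1 / p)" by simp
    then show ?thesis using p by (simp add: powr_powr)
  qed
  have "(\<lambda>m. \<Sum>k<m. norm (x k) powr p) \<longlonglongrightarrow> lpn p x powr p"
    unfolding lpn_powr[OF p x] using x by (intro summable_LIMSEQ) (simp add: lp_def)
  then have lim: "(\<lambda>m. lpn p x powr p - (\<Sum>k<m. norm (x k) powr p)) \<longlonglongrightarrow> 0"
    using tendsto_diff[OF tendsto_const[of "lpn p x powr p"]] by fastforce
  have "(\<lambda>m. (lpn p x powr p - (\<Sum>k<m. norm (x k) powr p)) powr (1 / p)) \<longlonglongrightarrow> 0 powr (1 / p)"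
    by (rule tendsto_powr'[OF lim tendsto_const])
      (use lp_leD[OF p x] p in \<open>auto intro!: always_eventually\<close>)
  then show ?thesis unfolding e by simp
qed

text \<open>The limit is taken coordinatewise. For fixed n the Cauchy bound survives the limit in m
  on every finite partial sum, and this yields both membership and convergence in norm.\<close>

lemma lp_complete:
  fixes X :: "nat \<Rightarrow> nat \<Rightarrow> 'k::{real_normed_field, complete_space}"
  assumes p: "p \<ge> 1" and X: "\<And>n. X n \<in> lp p"
    and C: "\<And>e. e > 0 \<Longrightarrow> \<exists>N. \<forall>m\<ge>N. \<forall>n\<ge>N. lpn p (X m - X n) \<le> e"
  shows "\<exists>x\<in>lp p. (\<lambda>n. lpn p (X n - x)) \<longlonglongrightarrow> 0"
proof -
  have "Cauchy (\<lambda>n. X n k)" for k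
    unfolding Cauchy_def
  proof (intro allI impI)
    fix e :: real assume "e > 0"
    then obtain N where N: "\<forall>m\<ge>N. \<forall>n\<ge>N. lpn p (X m - X n) \<le> e / 2"
      using C[of "e / 2"] by auto
    have "dist (X m k) (X n k) < e" if "m \<ge> N" "n \<ge> N" for m n
      using norm_le_lpn[OF p lp_diff(1)[OF p X X], of m n k] N that \<open>e > 0\<close>
      by (fastforce simp: dist_norm minus_fun_app)
    then show "\<exists>M. \<forall>m\<ge>M. \<forall>n\<ge>M. dist (X m k) (X n k) < e" by blast
  qed
  then have "\<forall>k. \<exists>l. (\<lambda>n. X n k) \<longlonglongrightarrow> l" by (simp add: Cauchy_convergent_iff convergent_def)
  then obtain x where x: "\<And>k. (\<lambda>n. X n k) \<longlonglongrightarrow> x k" by metis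
  have est: "X n - x \<in> lp p \<and> lpn p (X n - x) \<le> e"
    if "e > 0" "\<forall>m\<ge>N. \<forall>n\<ge>N. lpn p (X m - X n) \<le> e" "n \<ge> N" for e N n
  proof -
    have "(\<Sum>k<K. norm ((X n - x) k) powr p) \<le> e powr p" for K
    proof (rule tendsto_upperbound)
      show "(\<lambda>m. \<Sum>k<K. norm (X n k - X m k) powr p) \<longlonglongrightarrow> (\<Sum>k<K. norm ((X n - x) k) powr p)"
        unfolding minus_fun_app
        by (intro tendsto_sum tendsto_powr' tendsto_norm tendsto_diff x tendsto_const)
          (use p in \<open>auto intro!: always_eventually\<close>)
      show "\<forall>\<^sub>F m in sequentially. (\<Sum>k<K. norm (X n k - X m k) powr p) \<le> e powr p"
        unfolding eventually_sequentially
      proof (intro exI[of _ N] allI impI)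
        fix m assume "m \<ge> N"
        then have "lpn p (X n - X m) \<le> e" using that by auto
        then have "lpn p (X n - X m) powr p \<le> e powr p" using p by (intro powr_mono2) auto
        then show "(\<Sum>k<K. norm (X n k - X m k) powr p) \<le> e powr p"
          using lp_leD[OF p lp_diff(1)[OF p X X], of n m K] by (simp add: minus_fun_app)
      qed
    qed simp
    then show ?thesis using lp_leI[OF p, of e "X n - x"] \<open>e > 0\<close> by auto
  qed
  obtain N where "\<forall>m\<ge>N. \<forall>n\<ge>N. lpn p (X m - X n) \<le> 1" using C[of 1] by auto
  then have "X N - x \<in> lp p" using est[of 1 N N] by simp
  then have "X N - (X N - x) \<in> lp p" by (rule lp_diff(1)[OF p X])
  then have "x \<in> lp p" by simp
  moreover have "(\<lambda>n. lpn p (X n - x)) \<longlonglongrightarrow> 0"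
  proof (rule LIMSEQ_I)
    fix r :: real assume "r > 0"
    then obtain N where "\<forall>m\<ge>N. \<forall>n\<ge>N. lpn p (X m - X n) \<le> r / 2" using C[of "r / 2"] by auto
    then have "\<forall>n\<ge>N. norm (lpn p (X n - x) - 0) < r" using est[of "r / 2" N] \<open>r > 0\<close> by fastforce
    then show "\<exists>N. \<forall>n\<ge>N. norm (lpn p (X n - x) - 0) < r" by blast
  qed
  ultimately show ?thesis by blast
qed

section \<open>Duality between the sequence spaces\<close>

lemma holder_sum:
  assumes pq: "p > 1" "q > 1" "1 / p + 1 / q = 1" and b: "b \<in> lp q" and a: "a \<in> lp p"
  shows "(\<Sum>k<n. norm (b k) * norm (a k)) \<le> lpn q b * lpn p a"
proof (cases "lpn q b = 0 \<or> lpn p a = 0")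
  case True
  then have "norm (b k) * norm (a k) = 0" for k
    using norm_le_lpn[of q b k] norm_le_lpn[of p a k] pq a b by auto
  then have "(\<Sum>k<n. norm (b k) * norm (a k)) = 0" by (simp only: sum.neutral_const)
  then show ?thesis by simp
next
  case False
  then have pos: "lpn q b > 0" "lpn p a > 0" using lpn_nonneg[of q b] lpn_nonneg[of p a] by linarith+
  have y: "norm (b k) / lpn q b * (norm (a k) / lpn p a) \<le>
      norm (b k) powr q / lpn q b powr q / q + norm (a k) powr p / lpn p a powr p / p" for k
    using Youngs_inequality[of q p "norm (b k) / lpn q b" "norm (a k) / lpn p a"] pq pos
    by (simp add: powr_divide add.commute)
  have "(\<Sum>k<n. norm (b k) * norm (a k)) = lpn q b * lpn p a * (\<Sum>k<n. norm (b k) / lpn q b * (norm (a k) / lpn p a))"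
    using pos by (simp add: sum_distrib_left)
  also have "\<dots> \<le> lpn q b * lpn p a *
      (\<Sum>k<n. norm (b k) powr q / lpn q b powr q / q + norm (a k) powr p / lpn p a powr p / p)"
    using pos by (intro mult_left_mono sum_mono y) auto
  also have "(\<Sum>k<n. norm (b k) powr q / lpn q b powr q / q + norm (a k) powr p / lpn p a powr p / p) =
      (\<Sum>k<n. norm (b k) powr q) / lpn q b powr q / q + (\<Sum>k<n. norm (a k) powr p) / lpn p a powr p / p"
    by (simp add: sum.distrib sum_divide_distrib)
  also have "lpn q b * lpn p a * \<dots> \<le> lpn q b * lpn p a * (1 / q + 1 / p)"
    using pos pq lp_leD[of q b n] lp_leD[of p a n] a b
    by (intro mult_left_mono add_mono divide_right_mono) (auto simp: divide_le_eq)
  also have "\<dots> = lpn q b * lpn p a" using pq by (simp add: add.commute)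
  finally show ?thesis .
qed

definition pairing :: "(nat \<Rightarrow> 'k) \<Rightarrow> (nat \<Rightarrow> 'k) \<Rightarrow> 'k::real_normed_field" where
  "pairing b a = (\<Sum>k. b k * a k)"

lemma pairing_bound:
  fixes a b :: "nat \<Rightarrow> 'k::{real_normed_field, banach}"
  assumes pq: "p > 1" "q > 1" "1 / p + 1 / q = 1" and b: "b \<in> lp q" and a: "a \<in> lp p"
  shows "summable (\<lambda>k. b k * a k)" "norm (pairing b a) \<le> lpn q b * lpn p a"
proof -
  have s: "summable (\<lambda>k. norm (b k * a k))"
    by (rule summableI_nonneg_bounded[where x = "lpn q b * lpn p a"])
      (use holder_sum[OF assms] in \<open>auto simp: norm_mult\<close>)
  then show "summable (\<lambda>k. b k * a k)" by (rule summable_norm_cancel)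
  have "norm (pairing b a) \<le> (\<Sum>k. norm (b k * a k))"
    unfolding pairing_def by (rule summable_norm[OF s])
  also have "\<dots> \<le> lpn q b * lpn p a"
    by (rule suminf_le_const[OF s]) (use holder_sum[OF assms] in \<open>auto simp: norm_mult\<close>)
  finally show "norm (pairing b a) \<le> lpn q b * lpn p a" .
qed

lemma pairing_finite_support: "(\<And>k. k \<ge> n \<Longrightarrow> a k = 0) \<Longrightarrow> pairing b a = (\<Sum>k<n. b k * a k)"
  unfolding pairing_def by (rule suminf_finite) auto

text \<open>Testing on the extremal sequence of Hoelder's inequality, with entries of modulus
  |b|^(q-1) and phases that make the products nonnegative, gives
  \<open>S \<le> C * S powr (1 / p)\<close> for each partial sum S of |b|^q; dividing leaves the
  bound. Only finitely supported test sequences occur, so b may be an arbitrary sequence at the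
  outset.\<close>

lemma lp_of_bounded_functional:
  fixes b :: "nat \<Rightarrow> 'k::rc_scalar"
  assumes pq: "p > 1" "q > 1" "1 / p + 1 / q = 1" and C: "C \<ge> 0"
    and bd: "\<And>a n. (\<And>k. k \<ge> n \<Longrightarrow> a k = 0) \<Longrightarrow> norm (\<Sum>k<n. b k * a k) \<le> C * lpn p a"
  shows "b \<in> lp q" "lpn q b \<le> C"
proof -
  have conj: "(q - 1) * p = q" using pq by (simp add: field_simps)
  have le: "(\<Sum>k<n. norm (b k) powr q) \<le> C powr q" for n
  proof -
    define S where "S = (\<Sum>k<n. norm (b k) powr q)"
    have "\<forall>k. \<exists>u. norm u = 1 \<and> u * b k = of_real (norm (b k))" using exists_unimodular by blast
    then obtain u where "\<forall>k. norm (u k) = 1 \<and> u k * b k = of_real (norm (b k))" by metis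
    then have u: "\<And>k. norm (u k) = 1" "\<And>k. u k * b k = of_real (norm (b k))" by auto
    define a where "a = (\<lambda>k. if k < n then of_real (norm (b k) powr (q - 1)) * u k else 0)"
    have na: "norm (a k) powr p = norm (b k) powr q" if "k < n" for k
      using that pq by (simp add: a_def norm_mult u powr_powr conj)
    have "b k * a k = of_real (norm (b k) powr q)" if "k < n" for k
    proof -
      have "b k * a k = of_real (norm (b k) powr (q - 1)) * of_real (norm (b k))"
        using that by (simp add: a_def mult.left_commute[of "b k"] mult.commute[of "b k"] u)
      also have "\<dots> = of_real (norm (b k) powr (q - 1) * norm (b k) powr 1)" by simp
      also have "norm (b k) powr (q - 1) * norm (b k) powr 1 = norm (b k) powr q"
        by (simp only: powr_add[symmetric]) simp
      finally show ?thesis .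
    qed
    then have "(\<Sum>k<n. b k * a k) = of_real S" unfolding S_def of_real_sum by (intro sum.cong) auto
    moreover have S0: "S \<ge> 0" by (simp add: S_def sum_nonneg)
    ultimately have "S \<le> C * lpn p a" using bd[of n a] by (simp add: a_def)
    moreover have "lpn p a powr p = S"
      using lp_finite_support(2)[of p n a] pq na by (simp add: a_def S_def)
    then have "(lpn p a powr p) powr (1 / p) = S powr (1 / p)" by simp
    then have "lpn p a = S powr (1 / p)" using pq by (simp add: powr_powr)
    ultimately have le: "S \<le> C * S powr (1 / p)" by simp
    show ?thesis
    proof (cases "S = 0")
      case False
      then have "S > 0" using S0 by simp
      have "S = S powr (1 / p) * S powr (1 / q)"
        using \<open>S > 0\<close> by (simp only: powr_add[symmetric] pq(3)) simp
      then have "S powr (1 / p) * S powr (1 / q) \<le> S powr (1 / p) * C" using le by (simp add: mult.commute)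
      then have "S powr (1 / q) \<le> C" using \<open>S > 0\<close> by simp
      then have "(S powr (1 / q)) powr q \<le> C powr q" using pq by (intro powr_mono2) auto
      then show ?thesis using \<open>S > 0\<close> pq by (simp add: powr_powr S_def)
    qed (simp add: S_def)
  qed
  show "b \<in> lp q" "lpn q b \<le> C" using lp_leI[of q C b] pq C le by auto
qed

section \<open>Random signs\<close>

text \<open>A set \<open>S \<subseteq> {..<N}\<close> encodes a sign pattern through
  \<open>rad\<close>, with the sign + exactly at its elements, so this is the expectation over N
  independent random signs.\<close>

definition avg :: "nat \<Rightarrow> (nat set \<Rightarrow> real) \<Rightarrow> real" where
  "avg N f = (\<Sum>S\<in>Pow {..<N}. f S) / 2 ^ N"

definition rad :: "nat \<Rightarrow> nat set \<Rightarrow> 'k::real_normed_field" where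
  "rad j S = (if j \<in> S then 1 else - 1)"

lemma norm_rad [simp]: "norm (rad j S) = 1" by (simp add: rad_def)

text \<open>Conditioning on the last sign: the subsets of \<open>{..<Suc N}\<close> split into those
  without and those with N. The inductions over N below rest on this.\<close>

lemma avg_Suc: "avg (Suc N) f = avg N (\<lambda>S. (f S + f (insert N S)) / 2)"
proof -
  have "Pow {..<Suc N} = Pow {..<N} \<union> insert N ` Pow {..<N}"
    by (simp add: lessThan_Suc Pow_insert)
  moreover have "Pow {..<N} \<inter> insert N ` Pow {..<N} = {}" by auto
  ultimately have "(\<Sum>S\<in>Pow {..<Suc N}. f S) = (\<Sum>S\<in>Pow {..<N}. f S) + (\<Sum>S\<in>insert N ` Pow {..<N}. f S)"
    by (simp add: sum.union_disjoint)
  also have "(\<Sum>S\<in>insert N ` Pow {..<N}. f S) = (\<Sum>S\<in>Pow {..<N}. f (insert N S))"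
  proof (rule sum.reindex_cong)
    show "inj_on (insert N) (Pow {..<N})"
    proof (rule inj_onI)
      fix S T assume "S \<in> Pow {..<N}" "T \<in> Pow {..<N}" "insert N S = insert N T"
      moreover from this have "N \<notin> S" "N \<notin> T" by auto
      ultimately show "S = T" by (metis insert_ident)
    qed
  qed auto
  finally show ?thesis
    by (simp add: avg_def sum.distrib flip: sum_divide_distrib)
qed

lemma avg_mono: "(\<And>S. S \<subseteq> {..<N} \<Longrightarrow> f S \<le> g S) \<Longrightarrow> avg N f \<le> avg N g"
  unfolding avg_def by (intro divide_right_mono sum_mono) auto

lemma avg_cong: "(\<And>S. S \<subseteq> {..<N} \<Longrightarrow> f S = g S) \<Longrightarrow> avg N f = avg N g"
  unfolding avg_def by (intro arg_cong2[where f = "(/)"] sum.cong) auto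

lemma avg_add: "avg N (\<lambda>S. f S + g S) = avg N f + avg N g"
  by (simp add: avg_def sum.distrib add_divide_distrib)

lemma avg_diff: "avg N (\<lambda>S. f S - g S) = avg N f - avg N g"
  by (simp add: avg_def sum_subtractf diff_divide_distrib)

lemma avg_cmult: "avg N (\<lambda>S. c * f S) = c * avg N f"
  by (simp add: avg_def sum_distrib_left)

lemma avg_const [simp]: "avg N (\<lambda>S. c) = c"
  by (simp add: avg_def card_Pow)

lemma avg_sum: "avg N (\<lambda>S. \<Sum>i\<in>I. f i S) = (\<Sum>i\<in>I. avg N (f i))"
  unfolding avg_def by (simp add: sum_divide_distrib sum.swap[of _ I])

lemma avg_gt_exists:
  assumes "avg N f > c" shows "\<exists>S. S \<subseteq> {..<N} \<and> f S > c"
proof (rule ccontr)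
  assume "\<not> ?thesis"
  then have "avg N f \<le> avg N (\<lambda>_. c)" by (intro avg_mono) (meson not_le)
  then show False using assms by simp
qed

lemma avg_one_sign:
  assumes "j < N" shows "avg N (\<lambda>S. g (rad j S)) = (g 1 + g (- 1)) / 2"
  using assms
proof (induction N)
  case (Suc N)
  show ?case
  proof (cases "j = N")
    case True
    then have "avg (Suc N) (\<lambda>S. g (rad j S)) = avg N (\<lambda>S. (g (- 1) + g 1) / 2)"
      unfolding avg_Suc by (intro avg_cong) (auto simp: rad_def)
    then show ?thesis by simp
  next
    case False
    then have "avg (Suc N) (\<lambda>S. g (rad j S)) = avg N (\<lambda>S. g (rad j S))"
      unfolding avg_Suc by (intro avg_cong) (auto simp: rad_def)
    then show ?thesis using Suc False by simp
  qed
qed simp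

definition rsum :: "(nat \<Rightarrow> 'k::real_normed_field) \<Rightarrow> nat \<Rightarrow> nat set \<Rightarrow> 'k" where
  "rsum a N S = (\<Sum>j<N. rad j S * a j)"

lemma rsum_Suc:
  assumes "S \<subseteq> {..<N}"
  shows "rsum a (Suc N) S = rsum a N S - a N" "rsum a (Suc N) (insert N S) = rsum a N S + a N"
proof -
  have "N \<notin> S" using assms by auto
  moreover have "(\<Sum>j<N. rad j (insert N S) * a j) = (\<Sum>j<N. rad j S * a j)"
    by (intro sum.cong) (auto simp: rad_def)
  ultimately show "rsum a (Suc N) S = rsum a N S - a N" "rsum a (Suc N) (insert N S) = rsum a N S + a N"
    by (simp_all add: rsum_def rad_def)
qed

text \<open>Averaging over the last sign cancels the cross term by the parallelogram law, for real
  and complex scalars alike.\<close>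

lemma avg_rsum_square:
  fixes a :: "nat \<Rightarrow> 'k::rc_scalar"
  shows "avg N (\<lambda>S. (norm (rsum a N S))\<^sup>2) = (\<Sum>j<N. (norm (a j))\<^sup>2)"
proof (induction N)
  case (Suc N)
  have "avg (Suc N) (\<lambda>S. (norm (rsum a (Suc N) S))\<^sup>2) = avg N (\<lambda>S. (norm (rsum a N S))\<^sup>2 + (norm (a N))\<^sup>2)"
    unfolding avg_Suc
  proof (rule avg_cong)
    fix S assume S: "S \<subseteq> {..<N}"
    show "((norm (rsum a (Suc N) S))\<^sup>2 + (norm (rsum a (Suc N) (insert N S)))\<^sup>2) / 2 =
        (norm (rsum a N S))\<^sup>2 + (norm (a N))\<^sup>2"
      unfolding rsum_Suc[OF S] using scalar_parallelogram[of "rsum a N S" "a N"] by simp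
  qed
  then show ?case by (simp add: avg_add Suc)
qed (simp add: avg_def rsum_def)

lemma two_point_power:
  fixes u v d :: real
  assumes u: "u \<ge> 0" and d: "d \<ge> 0" and v: "v\<^sup>2 \<le> u * d" and k: "k \<le> m"
  defines "U \<equiv> u + real m * d"
  shows "\<bar>((u + v) ^ k + (u - v) ^ k) / 2\<bar> \<le> U ^ k \<and>
    \<bar>((u + v) ^ k - (u - v) ^ k) / 2\<bar> * U \<le> real k * \<bar>v\<bar> * U ^ k"
  using k
proof (induction k)
  case (Suc k)
  define A where "A = ((u + v) ^ k + (u - v) ^ k) / 2"
  define B where "B = ((u + v) ^ k - (u - v) ^ k) / 2"
  have IH: "\<bar>A\<bar> \<le> U ^ k" "\<bar>B\<bar> * U \<le> real k * \<bar>v\<bar> * U ^ k" using Suc by (auto simp: A_def B_def)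
  have A': "((u + v) ^ Suc k + (u - v) ^ Suc k) / 2 = u * A + v * B"
    by (simp add: A_def B_def field_simps)
  have B': "((u + v) ^ Suc k - (u - v) ^ Suc k) / 2 = u * B + v * A"
    by (simp add: A_def B_def field_simps)
  have uU: "u \<le> U" "0 \<le> U" using d u by (auto simp: U_def)
  have vB: "\<bar>v\<bar> * \<bar>B\<bar> \<le> real k * d * U ^ k"
  proof (cases "U = 0")
    case True
    then have "u = 0" using uU u by simp
    then have "v = 0" using v by simp
    then show ?thesis using d uU by simp
  next
    case False
    then have "U > 0" using uU by simp
    have "(\<bar>v\<bar> * \<bar>B\<bar>) * U \<le> \<bar>v\<bar> * (real k * \<bar>v\<bar> * U ^ k)"
      using mult_left_mono[OF IH(2), of "\<bar>v\<bar>"] by (simp add: mult.assoc)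
    also have "\<dots> = real k * v\<^sup>2 * U ^ k"
      by (simp add: power2_eq_square mult.left_commute mult.assoc)
    also have "\<dots> \<le> real k * (U * d) * U ^ k"
      using v uU d mult_right_mono[OF uU(1) d] by (intro mult_right_mono mult_left_mono) auto
    finally have "(\<bar>v\<bar> * \<bar>B\<bar>) * U \<le> (real k * d * U ^ k) * U" by (simp add: mult_ac)
    then show ?thesis using \<open>U > 0\<close> by simp
  qed
  have "\<bar>u * A + v * B\<bar> \<le> u * \<bar>A\<bar> + \<bar>v\<bar> * \<bar>B\<bar>"
    using u by (metis abs_mult abs_of_nonneg abs_triangle_ineq)
  also have "\<dots> \<le> u * U ^ k + real k * d * U ^ k"
    using IH u vB by (intro add_mono mult_left_mono) auto
  also have "\<dots> = (u + real k * d) * U ^ k" by (simp add: algebra_simps)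
  also have "\<dots> \<le> U * U ^ k"
    unfolding U_def using Suc.prems d u by (intro mult_right_mono add_left_mono) (auto intro!: mult_right_mono)
  finally have 1: "\<bar>u * A + v * B\<bar> \<le> U ^ Suc k" by simp
  have "\<bar>u * B + v * A\<bar> * U \<le> (u * \<bar>B\<bar> + \<bar>v\<bar> * \<bar>A\<bar>) * U"
    using u uU by (intro mult_right_mono) (auto simp: abs_mult intro: order_trans[OF abs_triangle_ineq])
  also have "\<dots> = u * (\<bar>B\<bar> * U) + \<bar>v\<bar> * \<bar>A\<bar> * U" by (simp add: algebra_simps)
  also have "\<dots> \<le> U * (real k * \<bar>v\<bar> * U ^ k) + \<bar>v\<bar> * U ^ k * U"
  proof (intro add_mono)
    show "u * (\<bar>B\<bar> * U) \<le> U * (real k * \<bar>v\<bar> * U ^ k)"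
      by (rule mult_mono[OF uU(1) IH(2)]) (use uU in auto)
    show "\<bar>v\<bar> * \<bar>A\<bar> * U \<le> \<bar>v\<bar> * U ^ k * U"
      using IH(1) uU by (intro mult_right_mono mult_left_mono) auto
  qed
  also have "\<dots> = real (Suc k) * \<bar>v\<bar> * U ^ Suc k" by (simp add: algebra_simps)
  finally show ?case using 1 unfolding A' B' by simp
qed (use u d in \<open>auto simp: U_def\<close>)

text \<open>The free summand R collects the signs already averaged out: removing the last sign
  replaces R by R + (4 m + 1) |a_N|^2. Here 4 m comes from \<open>two_point_power\<close> with d = 4
  |a_N|^2, the factor 4 being due to v^2 \<le> 4 |s|^2 |a_N|^2 with s the sum of the other terms,
  and the remaining 1 is the summand |a_N|^2 in u.\<close>

lemma khintchine_even:
  fixes a :: "nat \<Rightarrow> 'k::rc_scalar"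
  assumes "R \<ge> 0"
  shows "avg N (\<lambda>S. ((norm (rsum a N S))\<^sup>2 + R) ^ m) \<le> (R + (4 * real m + 1) * (\<Sum>j<N. (norm (a j))\<^sup>2)) ^ m"
  using assms
proof (induction N arbitrary: R)
  case (Suc N)
  have pt: "(((norm (rsum a (Suc N) S))\<^sup>2 + R) ^ m + ((norm (rsum a (Suc N) (insert N S)))\<^sup>2 + R) ^ m) / 2
      \<le> ((norm (rsum a N S))\<^sup>2 + (R + (4 * real m + 1) * (norm (a N))\<^sup>2)) ^ m"
    if S: "S \<subseteq> {..<N}" for S
  proof -
    define s where "s = rsum a N S"
    define b where "b = a N"
    define u where "u = (norm s)\<^sup>2 + (norm b)\<^sup>2 + R"
    define v where "v = ((norm (s - b))\<^sup>2 - (norm (s + b))\<^sup>2) / 2"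
    have pl: "(norm (s + b))\<^sup>2 + (norm (s - b))\<^sup>2 = 2 * (norm s)\<^sup>2 + 2 * (norm b)\<^sup>2"
      by (rule scalar_parallelogram)
    have e: "(norm (s - b))\<^sup>2 + R = u + v" "(norm (s + b))\<^sup>2 + R = u - v"
      using pl by (simp_all add: u_def v_def field_simps)
    have bounds: "(norm (s + b))\<^sup>2 \<le> (norm s + norm b)\<^sup>2" "(norm (s - b))\<^sup>2 \<le> (norm s + norm b)\<^sup>2"
      by (intro power_mono norm_triangle_ineq norm_triangle_ineq4 norm_ge_zero)+
    have "\<bar>v\<bar> \<le> 2 * (norm s * norm b)"
      using bounds pl by (simp add: v_def power2_sum)
    then have "\<bar>v\<bar>\<^sup>2 \<le> (2 * (norm s * norm b))\<^sup>2" by (intro power_mono) auto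
    also have "\<dots> = (norm s)\<^sup>2 * (4 * (norm b)\<^sup>2)" by (simp add: power_mult_distrib)
    also have "\<dots> \<le> u * (4 * (norm b)\<^sup>2)" unfolding u_def using Suc.prems by (intro mult_right_mono) auto
    finally have "v\<^sup>2 \<le> u * (4 * (norm b)\<^sup>2)" by simp
    then have "\<bar>((u + v) ^ m + (u - v) ^ m) / 2\<bar> \<le> (u + real m * (4 * (norm b)\<^sup>2)) ^ m"
      using two_point_power[of u "4 * (norm b)\<^sup>2" v m m] Suc.prems by (simp add: u_def)
    then show ?thesis
      unfolding rsum_Suc[OF S] s_def[symmetric] b_def[symmetric] e by (simp add: u_def algebra_simps)
  qed
  have "avg (Suc N) (\<lambda>S. ((norm (rsum a (Suc N) S))\<^sup>2 + R) ^ m)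
      \<le> avg N (\<lambda>S. ((norm (rsum a N S))\<^sup>2 + (R + (4 * real m + 1) * (norm (a N))\<^sup>2)) ^ m)"
    unfolding avg_Suc by (rule avg_mono) (rule pt)
  also have "\<dots> \<le> (R + (4 * real m + 1) * (norm (a N))\<^sup>2 + (4 * real m + 1) * (\<Sum>j<N. (norm (a j))\<^sup>2)) ^ m"
    by (rule Suc.IH) (use Suc.prems in auto)
  also have "\<dots> = (R + (4 * real m + 1) * (\<Sum>j<Suc N. (norm (a j))\<^sup>2)) ^ m"
    by (simp add: algebra_simps)
  finally show ?case .
qed (simp add: avg_def rsum_def)

definition lincomb :: "(nat \<Rightarrow> nat \<Rightarrow> 'k) \<Rightarrow> (nat \<Rightarrow> 'k) \<Rightarrow> nat \<Rightarrow> nat \<Rightarrow> 'k::real_normed_field" where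
  "lincomb z a N = (\<Sum>j<N. smul (a j) (z j))"

lemma lincomb_app: "lincomb z a N k = (\<Sum>j<N. a j * z j k)"
  by (simp add: lincomb_def sum_fun_app)

lemma lincomb_lp:
  assumes p: "p \<ge> 1" and z: "\<And>j. z j \<in> lp p" shows "lincomb z a N \<in> lp p"
  unfolding lincomb_def
proof (induction N)
  case 0
  show ?case unfolding lessThan_0 sum.empty by (rule zero_in_lp[OF p])
next
  case (Suc N)
  show ?case unfolding sum.lessThan_Suc by (rule lp_add(1)[OF p Suc lp_smul(1)[OF p z]])
qed

text \<open>The z j are Rademacher functions on a uniform probability space with 2^N atoms, placed
  on the first 2^N coordinates. The lower bound comes from the second moment and the upper one from
  an even moment. The constants are chosen before N, which is what the later use with N tending to
  infinity requires.\<close>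

lemma rademacher_in_lp:
  assumes r: "r \<ge> 2"
  shows "\<exists>\<alpha>>0. \<exists>\<beta>>0. \<forall>N. \<exists>z :: nat \<Rightarrow> nat \<Rightarrow> 'k::rc_scalar. (\<forall>j. z j \<in> lp r) \<and>
     (\<forall>a. \<alpha> * sqrt (\<Sum>j<N. (norm (a j))\<^sup>2) \<le> lpn r (lincomb z a N)
        \<and> lpn r (lincomb z a N) \<le> \<beta> * sqrt (\<Sum>j<N. (norm (a j))\<^sup>2))"
proof -
  define \<rho> where "\<rho> = r / 2"
  have \<rho>: "\<rho> \<ge> 1" using r by (simp add: \<rho>_def)
  obtain m :: nat where m: "real m \<ge> \<rho>" using real_arch_simple by blast
  define C where "C = 4 * real m + 1"
  define a0 where "a0 = (2::real) powr - \<rho>"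
  define b0 where "b0 = 1 + C ^ m"
  have pos: "a0 > 0" "b0 > 0" by (auto simp: a0_def b0_def C_def intro!: add_pos_nonneg)
  \<comment> \<open>This affine minorant of the power vanishes at 1/2; at the mean value 1 it equals
    \<open>2 powr - \<rho>\<close>, the constant \<open>a0\<close>.\<close>
  have lower: "(y - 1/2) * 2 powr (1 - \<rho>) \<le> y powr \<rho>" if "y \<ge> 0" for y :: real
  proof (cases "y \<ge> 1/2")
    case True
    have "(1/2::real) = 2 powr (-1)" by (simp add: powr_minus)
    then have "(1/2::real) powr (\<rho> - 1) = 2 powr ((-1) * (\<rho> - 1))" by (simp only: powr_powr)
    then have e: "(2::real) powr (1 - \<rho>) = (1/2) powr (\<rho> - 1)" by simp
    have "(y - 1/2) * 2 powr (1 - \<rho>) \<le> y * (1/2) powr (\<rho> - 1)"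
      unfolding e by (intro mult_right_mono) auto
    also have "y * (1/2) powr (\<rho> - 1) \<le> y * y powr (\<rho> - 1)"
      using True \<rho> by (intro mult_left_mono powr_mono2) auto
    also have "\<dots> = y powr \<rho>" using True by (simp add: powr_mult_base)
    finally show ?thesis .
  next
    case False
    then have "(y - 1/2) * 2 powr (1 - \<rho>) \<le> 0" by (intro mult_nonpos_nonneg) auto
    also have "\<dots> \<le> y powr \<rho>" by simp
    finally show ?thesis .
  qed
  \<comment> \<open>Dominates the real exponent by an integer one, to which
    \<open>khintchine_even\<close> applies.\<close>
  have upper: "y powr \<rho> \<le> 1 + y ^ m" if "y \<ge> 0" for y :: real
  proof (cases "y \<le> 1")
    case True
    then have "y powr \<rho> \<le> 1 powr \<rho>" using that \<rho> by (intro powr_mono2) auto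
    then show ?thesis using that by (simp add: add_increasing2)
  next
    case False
    then have "y powr \<rho> \<le> y powr real m" using m by (intro powr_mono) auto
    then show ?thesis using False by (simp add: powr_realpow)
  qed
  have main: "\<exists>z :: nat \<Rightarrow> nat \<Rightarrow> 'k. (\<forall>j. z j \<in> lp r) \<and>
     (\<forall>a. a0 powr (1/r) * sqrt (\<Sum>j<N. (norm (a j))\<^sup>2) \<le> lpn r (lincomb z a N)
        \<and> lpn r (lincomb z a N) \<le> b0 powr (1/r) * sqrt (\<Sum>j<N. (norm (a j))\<^sup>2))" for N
  proof -
    have "card (Pow {..<N}) = 2 ^ N" by (simp add: card_Pow)
    then obtain h where h: "bij_betw h {..<(2::nat) ^ N} (Pow {..<N})"
      using ex_bij_betw_nat_finite[of "Pow {..<N}"] by (auto simp: atLeast0LessThan)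
    \<comment> \<open>\<open>h\<close> enumerates the sign patterns, and the scalar factor is the
      r-th root of the mass 2^(-N) of an atom.\<close>
    define z :: "nat \<Rightarrow> nat \<Rightarrow> 'k" where
      "z = (\<lambda>j i. if i < 2 ^ N then of_real ((1 / 2 ^ N) powr (1 / r)) * rad j (h i) else 0)"
    have z: "z j \<in> lp r" for j
      using r by (intro lp_finite_support(1)[where m = "2 ^ N"]) (auto simp: z_def)
    have "a0 powr (1/r) * sqrt (\<Sum>j<N. (norm (a j))\<^sup>2) \<le> lpn r (lincomb z a N)
        \<and> lpn r (lincomb z a N) \<le> b0 powr (1/r) * sqrt (\<Sum>j<N. (norm (a j))\<^sup>2)" for a
    proof -
      define Q where "Q = (\<Sum>j<N. (norm (a j))\<^sup>2)"
      have Q0: "Q \<ge> 0" by (simp add: Q_def sum_nonneg)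
      define Y where "Y = (\<lambda>S. (norm (rsum a N S))\<^sup>2)"
      have Y0: "Y S \<ge> 0" for S by (simp add: Y_def)
      have eY: "avg N Y = Q" by (simp add: Y_def Q_def avg_rsum_square)
      have eYm: "avg N (\<lambda>S. Y S ^ m) \<le> (C * Q) ^ m"
        using khintchine_even[of 0 N a m] by (simp add: Y_def Q_def C_def)
      have n: "norm (lincomb z a N i) powr r = (1 / 2 ^ N) * Y (h i) powr \<rho>" if "i < 2 ^ N" for i
      proof -
        have "lincomb z a N i = of_real ((1 / 2 ^ N) powr (1 / r)) * rsum a N (h i)"
          unfolding lincomb_app rsum_def sum_distrib_left using that by (intro sum.cong) (auto simp: z_def)
        then have "norm (lincomb z a N i) powr r = ((1 / 2 ^ N) powr (1 / r) * norm (rsum a N (h i))) powr r"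
          by (simp add: norm_mult)
        also have "\<dots> = (1 / 2 ^ N) * norm (rsum a N (h i)) powr r"
          using r by (simp add: powr_mult powr_powr)
        also have "norm (rsum a N (h i)) powr r = Y (h i) powr \<rho>"
        proof -
          have "(norm (rsum a N (h i)))\<^sup>2 = norm (rsum a N (h i)) powr 2" by simp
          then have "Y (h i) powr \<rho> = norm (rsum a N (h i)) powr (2 * \<rho>)"
            unfolding Y_def by (simp only: powr_powr)
          then show ?thesis by (simp add: \<rho>_def)
        qed
        finally show ?thesis .
      qed
      have "lpn r (lincomb z a N) powr r = (\<Sum>i<2 ^ N. norm (lincomb z a N i) powr r)"
        using r by (intro lp_finite_support(2)) (auto simp: lincomb_app z_def)
      also have "\<dots> = (\<Sum>i<2 ^ N. Y (h i) powr \<rho>) / 2 ^ N"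
        using n by (simp add: sum_divide_distrib)
      also have "(\<Sum>i<2 ^ N. Y (h i) powr \<rho>) = (\<Sum>S\<in>Pow {..<N}. Y S powr \<rho>)"
        by (rule sum.reindex_bij_betw[OF h])
      finally have lr: "lpn r (lincomb z a N) powr r = avg N (\<lambda>S. Y S powr \<rho>)" by (simp add: avg_def)
      have bounds: "a0 * Q powr \<rho> \<le> avg N (\<lambda>S. Y S powr \<rho>) \<and> avg N (\<lambda>S. Y S powr \<rho>) \<le> b0 * Q powr \<rho>"
      proof (cases "Q = 0")
        case True
        then have "\<And>j. j < N \<Longrightarrow> a j = 0" by (auto simp: Q_def sum_nonneg_eq_0_iff)
        then have "Y S = 0" for S by (simp add: Y_def rsum_def)
        then show ?thesis using True \<rho> by simp
      next
        case False
        then have Q: "Q > 0" using Q0 by simp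
        have s: "Y S powr \<rho> = Q powr \<rho> * (Y S / Q) powr \<rho>" for S
          using Q by (simp add: powr_divide)
        have eq: "avg N (\<lambda>S. Y S powr \<rho>) = Q powr \<rho> * avg N (\<lambda>S. (Y S / Q) powr \<rho>)"
          by (subst s) (rule avg_cmult)
        have "avg N (\<lambda>S. (Y S / Q - 1/2) * 2 powr (1 - \<rho>)) \<le> avg N (\<lambda>S. (Y S / Q) powr \<rho>)"
          by (intro avg_mono lower) (use Y0 Q in auto)
        also have "avg N (\<lambda>S. (Y S / Q - 1/2) * 2 powr (1 - \<rho>)) = avg N (\<lambda>S. 2 powr (1 - \<rho>) * (1 / Q * Y S - 1/2))"
          by (simp add: mult.commute)
        also have "\<dots> = 2 powr (1 - \<rho>) * (1 / Q * avg N Y - 1/2)"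
          by (simp only: avg_cmult avg_diff avg_const)
        also have "\<dots> = a0" 
        proof -
          have "(2::real) powr (1 - \<rho>) = 2 powr 1 * 2 powr - \<rho>" by (simp only: powr_add[symmetric]) simp
          then show ?thesis using Q by (simp add: eY a0_def)
        qed
        finally have l: "a0 \<le> avg N (\<lambda>S. (Y S / Q) powr \<rho>)" .
        have "avg N (\<lambda>S. (Y S / Q) powr \<rho>) \<le> avg N (\<lambda>S. 1 + 1 / Q ^ m * Y S ^ m)"
        proof (rule avg_mono)
          fix S
          have "Y S / Q \<ge> 0" using Y0 Q by simp
          from upper[OF this] show "(Y S / Q) powr \<rho> \<le> 1 + 1 / Q ^ m * Y S ^ m" by (simp add: power_divide)
        qed
        also have "\<dots> = 1 + 1 / Q ^ m * avg N (\<lambda>S. Y S ^ m)" by (simp only: avg_cmult avg_add avg_const)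
        also have "\<dots> \<le> 1 + 1 / Q ^ m * (C * Q) ^ m"
          using eYm Q by (intro add_left_mono mult_left_mono) auto
        also have "\<dots> = b0" using Q by (simp add: b0_def power_mult_distrib)
        finally have u: "avg N (\<lambda>S. (Y S / Q) powr \<rho>) \<le> b0" .
        show ?thesis unfolding eq using l u by (simp add: mult.commute[of _ "Q powr \<rho>"] mult_left_mono)
      qed
      have root: "(c * Q powr \<rho>) powr (1 / r) = c powr (1 / r) * sqrt Q" if "c > 0" for c
      proof -
        have "(c * Q powr \<rho>) powr (1 / r) = c powr (1 / r) * Q powr (\<rho> * (1 / r))"
          by (simp add: powr_mult powr_powr)
        also have "\<rho> * (1 / r) = 1 / 2" using r by (simp add: \<rho>_def)
        finally show ?thesis using Q0 by (simp add: powr_half_sqrt)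
      qed
      have "lpn r (lincomb z a N) = (lpn r (lincomb z a N) powr r) powr (1 / r)"
        using r by (simp add: powr_powr)
      also have "\<dots> = avg N (\<lambda>S. Y S powr \<rho>) powr (1 / r)" by (simp only: lr)
      finally have eq: "lpn r (lincomb z a N) = avg N (\<lambda>S. Y S powr \<rho>) powr (1 / r)" .
      have "(a0 * Q powr \<rho>) powr (1 / r) \<le> avg N (\<lambda>S. Y S powr \<rho>) powr (1 / r)"
        using bounds pos r by (intro powr_mono2) auto
      moreover have "avg N (\<lambda>S. Y S powr \<rho>) powr (1 / r) \<le> (b0 * Q powr \<rho>) powr (1 / r)"
        using bounds pos r
        by (intro powr_mono2) (auto intro: order_trans[of 0 "a0 * Q powr \<rho>"])
      ultimately show ?thesis 
        unfolding eq root[OF pos(1)] root[OF pos(2)] Q_def[symmetric] by simp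
    qed
    then show ?thesis using z by blast
  qed
  show ?thesis
    by (rule exI[of _ "a0 powr (1/r)"], rule conjI, use pos in simp,
        rule exI[of _ "b0 powr (1/r)"], rule conjI, use pos in simp, use main in blast)
qed

section \<open>Renormings of the sequence spaces\<close>

lemma square_diff_bound:
  fixes a b c :: real
  assumes "a \<ge> 0" "b \<ge> 0" "c \<ge> 0" "c \<ge> a - b"
  shows "c\<^sup>2 \<ge> a\<^sup>2 - 2 * a * b"
proof (cases "a \<ge> b")
  case True
  then have "(a - b)\<^sup>2 \<le> c\<^sup>2" using assms by (intro power_mono) auto
  then show ?thesis by (simp add: power2_diff) (smt (verit) zero_le_power2)
next
  case False
  then have "a * a \<le> a * b" using assms by (intro mult_left_mono) auto
  moreover have "0 \<le> a * b" using assms by simp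
  ultimately have "a\<^sup>2 - 2 * a * b \<le> 0" by (simp add: power2_eq_square)
  then show ?thesis by (smt (verit) zero_le_power2)
qed

text \<open>
  The hypothesis \<open>trans\<close> is what convex transitivity (for \<open>p > 2\<close>), respectively its dual form
  (for \<open>p < 2\<close>, with \<open>r\<close> the conjugate exponent), gives: random perturbations of one
  vector can be moved to every other vector of the same norm.
\<close>

locale transitive_renorming =
  fixes r :: real and \<mu> :: "(nat \<Rightarrow> 'k::rc_scalar) \<Rightarrow> real" and A :: real
  assumes r: "r > 2" and A: "A > 0"
    and tri: "\<And>x y. x \<in> lp r \<Longrightarrow> y \<in> lp r \<Longrightarrow> \<mu> (x + y) \<le> \<mu> x + \<mu> y"
    and hom: "\<And>c x. x \<in> lp r \<Longrightarrow> \<mu> (smul c x) = norm c * \<mu> x"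
    and lo: "\<And>x. x \<in> lp r \<Longrightarrow> lpn r x \<le> A * \<mu> x"
    and up: "\<And>x. x \<in> lp r \<Longrightarrow> \<mu> x \<le> A * lpn r x"
    and trans: "\<And>x f z N \<eta>. x \<in> lp r \<Longrightarrow> f \<in> lp r \<Longrightarrow> (\<And>j. z j \<in> lp r) \<Longrightarrow> \<mu> x = \<mu> f \<Longrightarrow>
        \<mu> f > 0 \<Longrightarrow> \<eta> > 0 \<Longrightarrow>
        \<exists>z'. (\<forall>j. z' j \<in> lp r) \<and> (\<forall>a. \<mu> (lincomb z' a N) \<le> \<mu> (lincomb z a N)) \<and>
          avg N (\<lambda>S. (\<mu> (x + lincomb z' (\<lambda>j. rad j S) N))\<^sup>2)
            \<ge> avg N (\<lambda>S. (\<mu> (f + lincomb z (\<lambda>j. rad j S) N))\<^sup>2) - \<eta>"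
begin

lemma r1: "r \<ge> 1" using r by simp

lemma \<mu>_nonneg: "x \<in> lp r \<Longrightarrow> \<mu> x \<ge> 0"
  using lo[of x] lpn_nonneg[of r x] A by (meson order_trans zero_le_mult_iff not_le)

lemma \<mu>_diff: "x \<in> lp r \<Longrightarrow> y \<in> lp r \<Longrightarrow> \<mu> x - \<mu> y \<le> \<mu> (x - y)"
  using tri[OF lp_diff(1)[OF r1], of x y y] by simp

lemma lincomb_smul: "lincomb (\<lambda>j. smul c (z j)) a N = lincomb z (\<lambda>j. c * a j) N"
  by (rule ext) (simp add: lincomb_app mult_ac)

lemma smul_lincomb: "smul c (lincomb z a N) = lincomb z (\<lambda>j. c * a j) N"
  by (rule ext) (simp add: lincomb_app sum_distrib_left mult_ac)

lemma lincomb_add: "lincomb z a N + lincomb z b N = lincomb z (\<lambda>j. a j + b j) N"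
  by (rule ext) (simp add: lincomb_app distrib_right sum.distrib)

text \<open>The gain 1 is independent of N and of x. With m the best constant in
  \<open>m * l2 b \<le> \<mu> (lincomb z b N)\<close>, every perturbed vector is bounded below by m
  times its Euclidean norm, while the unperturbed one loses only the factor m / F, which is nearly
  1. The factor \<open>1 / sqrt N\<close> in the bound for z' is what later makes single coordinates
  small.\<close>

lemma tail_step_random:
  assumes \<alpha>: "\<alpha> > 0"
    and z: "\<And>j. z j \<in> lp r"
    and zl: "\<And>a. \<alpha> * sqrt (\<Sum>j<N. (norm (a j))\<^sup>2) \<le> \<mu> (lincomb z a N)"
    and zu: "\<And>a. \<mu> (lincomb z a N) \<le> \<beta> * sqrt (\<Sum>j<N. (norm (a j))\<^sup>2)"
    and x: "x \<in> lp r" "\<mu> x > 0" and N: "N > 0" and \<epsilon>: "\<epsilon> > 0"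
  shows "\<exists>z'. (\<forall>j. z' j \<in> lp r) \<and>
      (\<forall>a. \<mu> (lincomb z' a N) \<le> \<beta> / \<alpha> / sqrt N * sqrt (\<Sum>j<N. (norm (a j))\<^sup>2)) \<and>
      avg N (\<lambda>S. (\<mu> (x + lincomb z' (\<lambda>j. rad j S) N))\<^sup>2) \<ge> (\<mu> x)\<^sup>2 + 1 - \<epsilon>"
proof -
  define l2 where "l2 = (\<lambda>a :: nat \<Rightarrow> 'k. sqrt (\<Sum>j<N. (norm (a j))\<^sup>2))"
  define s where "s = \<mu> x"
  have s: "s > 0" using x by (simp add: s_def)
  define V where "V = {\<mu> (lincomb z a N) | a. l2 a = 1}"
  define m where "m = Inf V"
  have zlp: "lincomb z a N \<in> lp r" for a by (rule lincomb_lp[OF r1 z])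
  have "l2 (\<lambda>j. if j = 0 then 1 else 0) = 1"
  proof -
    have "(\<Sum>j<N. (norm (if j = 0 then 1 else (0::'k)))\<^sup>2) = (\<Sum>j<N. if j = 0 then 1 else 0)"
      by (intro sum.cong) auto
    also have "\<dots> = (1::real)" using N by simp
    finally show ?thesis by (simp add: l2_def)
  qed
  then have ne: "V \<noteq> {}" unfolding V_def by blast
  have bb: "v \<ge> \<alpha>" if v: "v \<in> V" for v 
  proof -
    obtain a where "v = \<mu> (lincomb z a N)" "l2 a = 1" using v unfolding V_def by blast
    then show ?thesis using zl[of a] by (simp add: l2_def)
  qed
  have m\<alpha>: "m \<ge> \<alpha>" unfolding m_def by (rule cInf_greatest[OF ne bb])
  have m: "m > 0" using m\<alpha> \<alpha> by simp
  have bdd: "bdd_below V" using bb by (rule bdd_belowI)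
  have l2_nonneg: "l2 b \<ge> 0" for b by (simp add: l2_def sum_nonneg)
  have mb: "m * l2 b \<le> \<mu> (lincomb z b N)" for b
  proof (cases "l2 b = 0")
    case False
    then have lb: "l2 b > 0" using l2_nonneg[of b] by simp
    define c where "c = (of_real (1 / l2 b) :: 'k)"
    have "l2 (\<lambda>j. c * b j) = sqrt ((norm c)\<^sup>2 * (\<Sum>j<N. (norm (b j))\<^sup>2))"
      by (simp add: l2_def norm_mult power_mult_distrib sum_distrib_left)
    also have "\<dots> = norm c * l2 b" by (simp add: real_sqrt_mult l2_def)
    also have "\<dots> = 1" using lb by (simp add: c_def norm_divide)
    finally have "\<mu> (lincomb z (\<lambda>j. c * b j) N) \<in> V" unfolding V_def by blast
    then have "m \<le> \<mu> (lincomb z (\<lambda>j. c * b j) N)" unfolding m_def by (rule cInf_lower[OF _ bdd])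
    also have "\<dots> = norm c * \<mu> (lincomb z b N)" by (simp add: hom[OF zlp] flip: smul_lincomb)
    finally show ?thesis using lb by (simp add: c_def norm_divide field_simps)
  qed (use \<mu>_nonneg[OF zlp] in simp)
  \<comment> \<open>The factor (m / F)^2 is at least 1 - 2 \<delta>, a loss of 2 s^2 \<delta> \<le>
    \<epsilon> / 2; the other half of \<epsilon> goes into \<open>trans\<close>.\<close>
  define \<delta> where "\<delta> = \<epsilon> / (4 * (s\<^sup>2 + 1))"
  have \<delta>: "\<delta> > 0" using \<epsilon> s unfolding \<delta>_def by (intro divide_pos_pos) (auto intro: add_nonneg_pos)
  have "m < (1 + \<delta>) * m" using \<delta> m by simp
  then obtain v where "v \<in> V" "v < (1 + \<delta>) * m" unfolding m_def using cInf_lessD[OF ne] by blast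
  then obtain a where a: "l2 a = 1" "\<mu> (lincomb z a N) < (1 + \<delta>) * m" unfolding V_def by blast
  define F where "F = \<mu> (lincomb z a N)"
  have F: "m \<le> F" "F \<le> (1 + \<delta>) * m" "F > 0" using mb[of a] a m by (auto simp: F_def)
  \<comment> \<open>N \<tau>^2 = 1 / \<alpha>^2, so m \<ge> \<alpha> turns the growth of the
    Euclidean square into a gain of at least 1.\<close>
  define \<tau> where "\<tau> = 1 / (\<alpha> * sqrt N)"
  define f where "f = smul (of_real (s / F)) (lincomb z a N)"
  define \<zeta> where "\<zeta> = (\<lambda>j. smul (of_real \<tau>) (z j))"
  have f: "f \<in> lp r" "\<mu> f = s"
    using F s by (simp_all add: f_def lp_smul(1)[OF r1 zlp] hom[OF zlp] F_def[symmetric] norm_divide)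
  have \<zeta>: "\<zeta> j \<in> lp r" for j by (simp only: \<zeta>_def lp_smul(1)[OF r1 z])
  obtain z' where z': "\<forall>j. z' j \<in> lp r" "\<forall>a. \<mu> (lincomb z' a N) \<le> \<mu> (lincomb \<zeta> a N)"
    and z'E: "avg N (\<lambda>S. (\<mu> (x + lincomb z' (\<lambda>j. rad j S) N))\<^sup>2)
            \<ge> avg N (\<lambda>S. (\<mu> (f + lincomb \<zeta> (\<lambda>j. rad j S) N))\<^sup>2) - \<epsilon> / 2"
    using trans[of x f \<zeta> "\<epsilon> / 2" N] \<zeta> f x \<epsilon> s_def by auto
  have bound: "\<mu> (lincomb z' b N) \<le> \<beta> / \<alpha> / sqrt N * l2 b" for b
  proof -
    have "\<mu> (lincomb z' b N) \<le> \<mu> (lincomb \<zeta> b N)" using z' by blast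
    also have "lincomb \<zeta> b N = smul (of_real \<tau>) (lincomb z b N)"
      unfolding \<zeta>_def lincomb_smul smul_lincomb ..
    also have "\<mu> \<dots> = \<tau> * \<mu> (lincomb z b N)" using \<alpha> by (simp add: hom[OF zlp] \<tau>_def norm_divide norm_mult)
    also have "\<dots> \<le> \<tau> * (\<beta> * l2 b)"
      using zu[of b] \<alpha> by (intro mult_left_mono) (auto simp: l2_def \<tau>_def)
    finally show ?thesis by (simp add: \<tau>_def)
  qed
  define g where "g = (\<lambda>S j. of_real (s / F) * a j + of_real \<tau> * rad j S)"
  have fg: "f + lincomb \<zeta> (\<lambda>j. rad j S) N = lincomb z (g S) N" for S
    unfolding f_def \<zeta>_def g_def lincomb_smul smul_lincomb lincomb_add ..
  have one: "avg N (\<lambda>S. (norm (g S j))\<^sup>2) = (s / F)\<^sup>2 * (norm (a j))\<^sup>2 + \<tau>\<^sup>2" if "j < N" for j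
  proof -
    have "avg N (\<lambda>S. (norm (g S j))\<^sup>2) =
        ((norm (of_real (s / F) * a j + of_real \<tau> * 1))\<^sup>2 + (norm (of_real (s / F) * a j + of_real \<tau> * - 1))\<^sup>2) / 2"
      unfolding g_def by (rule avg_one_sign[OF that])
    also have "\<dots> = (norm (of_real (s / F) * a j))\<^sup>2 + (norm (of_real \<tau> :: 'k))\<^sup>2"
      using scalar_parallelogram[of "of_real (s / F) * a j" "of_real \<tau>"] by simp
    also have "\<dots> = (s / F)\<^sup>2 * (norm (a j))\<^sup>2 + \<tau>\<^sup>2"
      by (simp add: norm_mult norm_divide power_mult_distrib power_divide)
    finally show ?thesis .
  qed
  have "(l2 a)\<^sup>2 = 1" by (simp add: a)
  then have a1: "(\<Sum>j<N. (norm (a j))\<^sup>2) = 1" by (simp add: l2_def sum_nonneg)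
  have "avg N (\<lambda>S. (l2 (g S))\<^sup>2) = (\<Sum>j<N. avg N (\<lambda>S. (norm (g S j))\<^sup>2))"
    by (simp add: l2_def sum_nonneg flip: avg_sum)
  also have "\<dots> = (\<Sum>j<N. (s / F)\<^sup>2 * (norm (a j))\<^sup>2 + \<tau>\<^sup>2)" using one by (intro sum.cong) auto
  also have "\<dots> = (s / F)\<^sup>2 + real N * \<tau>\<^sup>2"
    by (simp add: sum.distrib a1 flip: sum_distrib_left)
  also have "real N * \<tau>\<^sup>2 = 1 / \<alpha>\<^sup>2" using N by (simp add: \<tau>_def power_divide power_mult_distrib)
  finally have l2g: "avg N (\<lambda>S. (l2 (g S))\<^sup>2) = (s / F)\<^sup>2 + 1 / \<alpha>\<^sup>2" .
  have "m\<^sup>2 * ((s / F)\<^sup>2 + 1 / \<alpha>\<^sup>2) = avg N (\<lambda>S. m\<^sup>2 * (l2 (g S))\<^sup>2)" by (simp only: avg_cmult l2g)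
  also have "\<dots> \<le> avg N (\<lambda>S. (\<mu> (lincomb z (g S) N))\<^sup>2)"
    unfolding power_mult_distrib[symmetric] using m l2_nonneg by (intro avg_mono power_mono mb) auto
  finally have E: "m\<^sup>2 * ((s / F)\<^sup>2 + 1 / \<alpha>\<^sup>2) \<le> avg N (\<lambda>S. (\<mu> (f + lincomb \<zeta> (\<lambda>j. rad j S) N))\<^sup>2)"
    by (simp only: fg)
  have "m\<^sup>2 * (1 / \<alpha>\<^sup>2) \<ge> 1" using m\<alpha> \<alpha> by (simp add: power_mono)
  moreover have "m\<^sup>2 * (s / F)\<^sup>2 \<ge> s\<^sup>2 - \<epsilon> / 2"
  proof -
    have "m / F \<ge> 1 - \<delta>"
    proof -
      have "(1 - \<delta>) * F \<le> m"
      proof (cases "\<delta> \<le> 1")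
        case True
        then have "(1 - \<delta>) * F \<le> (1 - \<delta>) * ((1 + \<delta>) * m)" using F by (intro mult_left_mono) auto
        also have "\<dots> = m - \<delta>\<^sup>2 * m" by (simp add: algebra_simps power2_eq_square)
        also have "\<dots> \<le> m" using m by simp
        finally show ?thesis .
      next
        case False
        then have "(1 - \<delta>) * F \<le> 0" using F by (intro mult_nonpos_nonneg) auto
        then show ?thesis using m by simp
      qed
      then show ?thesis using F by (simp add: le_divide_eq)
    qed
    then have "(m / F)\<^sup>2 \<ge> 1\<^sup>2 - 2 * 1 * \<delta>"
      using \<delta> m F by (intro square_diff_bound) auto
    then have "s\<^sup>2 * (m / F)\<^sup>2 \<ge> s\<^sup>2 * (1 - 2 * \<delta>)" by (intro mult_left_mono) auto
    moreover have "s\<^sup>2 * (2 * \<delta>) \<le> \<epsilon> / 2"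
    proof -
      have "t * (2 * (\<epsilon> / (4 * q))) = (t / q) * (\<epsilon> / 2)" for t q :: real
        by (cases "q = 0") (simp_all add: field_simps)
      then have "s\<^sup>2 * (2 * \<delta>) = (s\<^sup>2 / (s\<^sup>2 + 1)) * (\<epsilon> / 2)" by (simp only: \<delta>_def)
      also have "\<dots> \<le> 1 * (\<epsilon> / 2)" using \<epsilon> by (intro mult_right_mono) (auto simp: divide_le_eq add_nonneg_pos)
      finally show ?thesis by simp
    qed
    ultimately have "s\<^sup>2 * (m / F)\<^sup>2 \<ge> s\<^sup>2 - \<epsilon> / 2" by (simp add: algebra_simps)
    then show ?thesis by (simp add: power_divide mult.commute)
  qed
  ultimately have "m\<^sup>2 * ((s / F)\<^sup>2 + 1 / \<alpha>\<^sup>2) \<ge> s\<^sup>2 + 1 - \<epsilon> / 2" by (simp add: distrib_left)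
  then have "avg N (\<lambda>S. (\<mu> (x + lincomb z' (\<lambda>j. rad j S) N))\<^sup>2) \<ge> (\<mu> x)\<^sup>2 + 1 - \<epsilon>"
    using E z'E by (simp add: s_def)
  then show ?thesis using z'(1) bound unfolding l2_def by blast
qed

text \<open>C is fixed before x and K, whereas N may depend on both: it is taken so large that the
  random perturbation has little mass on the first K coordinates. Removing these coordinates and
  then a far tail costs only part of the gain 1.\<close>

lemma tail_step:
  "\<exists>C. \<forall>x K. (\<forall>k\<ge>K. x k = 0) \<longrightarrow> \<mu> x > 0 \<longrightarrow>
     (\<exists>w K'. (\<forall>k. k < K \<or> k \<ge> K' \<longrightarrow> w k = 0) \<and> lpn r w \<le> C \<and> (\<mu> (x + w))\<^sup>2 \<ge> (\<mu> x)\<^sup>2 + 1/4)"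
proof -
  obtain \<alpha>0 \<beta>0 where ab: "\<alpha>0 > 0" "\<beta>0 > 0"
    and Z: "\<And>N. \<exists>z :: nat \<Rightarrow> nat \<Rightarrow> 'k. (\<forall>j. z j \<in> lp r) \<and>
     (\<forall>a. \<alpha>0 * sqrt (\<Sum>j<N. (norm (a j))\<^sup>2) \<le> lpn r (lincomb z a N)
        \<and> lpn r (lincomb z a N) \<le> \<beta>0 * sqrt (\<Sum>j<N. (norm (a j))\<^sup>2))"
    using rademacher_in_lp[of r, where 'k = 'k] r by auto
  define \<alpha> where "\<alpha> = \<alpha>0 / A"
  define \<beta> where "\<beta> = A * \<beta>0"
  have \<alpha>: "\<alpha> > 0" and \<beta>: "\<beta> > 0" using ab A by (auto simp: \<alpha>_def \<beta>_def)
  \<comment> \<open>Sign vectors have Euclidean norm sqrt N, which cancels the factor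
    \<open>1 / sqrt N\<close>; hence C0 bounds \<mu> of the perturbation for each sign pattern,
    whatever N is.\<close>
  define C0 where "C0 = \<beta> / \<alpha>"
  have C0: "C0 > 0" using \<alpha> \<beta> by (simp add: C0_def)
  show ?thesis
  proof (intro exI[of _ "A * C0"] allI impI)
    fix x :: "nat \<Rightarrow> 'k" and K
    assume xK: "\<forall>k\<ge>K. x k = 0" and x0: "\<mu> x > 0"
    have x: "x \<in> lp r" by (rule lp_finite_support(1)[OF r1, of K]) (use xK in auto)
    define s where "s = \<mu> x"
    have s: "s > 0" using x0 by (simp add: s_def)
    \<comment> \<open>D / sqrt N will bound the mean loss of \<mu>^2 when the first K coordinates of
      the perturbation are removed.\<close>
    define D where "D = 2 * (s + C0) * (A * (real K * (A * C0)))"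
    have D: "D \<ge> 0" using s C0 A by (simp add: D_def)
    obtain N0 :: nat where N0: "real N0 \<ge> (16 * D)\<^sup>2" using real_arch_simple by blast
    define N where "N = Suc N0"
    have N: "N > 0" "sqrt N > 0" by (auto simp: N_def)
    have "16 * D \<le> sqrt N" using N0 by (intro real_le_rsqrt) (simp add: N_def)
    then have DN: "D / sqrt N \<le> 1/16" using N by (simp add: divide_le_eq)
    obtain z :: "nat \<Rightarrow> nat \<Rightarrow> 'k" where z: "\<And>j. z j \<in> lp r"
      and zb: "\<And>a. \<alpha>0 * sqrt (\<Sum>j<N. (norm (a j))\<^sup>2) \<le> lpn r (lincomb z a N)"
        "\<And>a. lpn r (lincomb z a N) \<le> \<beta>0 * sqrt (\<Sum>j<N. (norm (a j))\<^sup>2)"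
      using Z[of N] by blast
    have zlp: "lincomb z a N \<in> lp r" for a by (rule lincomb_lp[OF r1 z])
    have zl: "\<alpha> * sqrt (\<Sum>j<N. (norm (a j))\<^sup>2) \<le> \<mu> (lincomb z a N)" for a
      using order_trans[OF zb(1)[of a] lo[OF zlp]] A by (simp add: \<alpha>_def field_simps)
    have zu: "\<mu> (lincomb z a N) \<le> \<beta> * sqrt (\<Sum>j<N. (norm (a j))\<^sup>2)" for a
    proof -
      have "A * lpn r (lincomb z a N) \<le> A * (\<beta>0 * sqrt (\<Sum>j<N. (norm (a j))\<^sup>2))"
        using zb(2)[of a] A by (intro mult_left_mono) auto
      then show ?thesis using up[OF zlp, of a] by (simp add: \<beta>_def mult.assoc)
    qed
    obtain z' where z': "\<And>j. z' j \<in> lp r"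
      and z'b: "\<And>a. \<mu> (lincomb z' a N) \<le> C0 / sqrt N * sqrt (\<Sum>j<N. (norm (a j))\<^sup>2)"
      and z'E: "avg N (\<lambda>S. (\<mu> (x + lincomb z' (\<lambda>j. rad j S) N))\<^sup>2) \<ge> (\<mu> x)\<^sup>2 + 1 - 1/16"
      using tail_step_random[OF \<alpha> z zl zu x x0 N(1), of "1/16"] unfolding C0_def by auto
    define W where "W = (\<lambda>S. lincomb z' (\<lambda>j. rad j S) N)"
    have Wlp: "W S \<in> lp r" for S unfolding W_def by (rule lincomb_lp[OF r1 z'])
    have W: "\<mu> (W S) \<le> C0" for S
      using z'b[of "\<lambda>j. rad j S"] N by (simp add: W_def)
    define \<delta> where "\<delta> = A * C0 / sqrt N"
    have \<delta>: "\<delta> > 0" using A C0 N by (simp add: \<delta>_def)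
    \<comment> \<open>The k-th coordinate is a random sum with coefficients \<open>z' j k\<close>.
      Using the conjugates of these as coefficients in the bound for z' gives their Euclidean norm
      twice on the left and once on the right, so it is at most \<delta>. The second moment is thus
      at most \<delta>^2, and \<open>am\<close> passes to the first moment.\<close>
    have coord: "avg N (\<lambda>S. norm (W S k)) \<le> \<delta>" for k
    proof -
      define b where "b = (\<lambda>j. z' j k)"
      define Q where "Q = (\<Sum>j<N. (norm (b j))\<^sup>2)"
      have Q0: "Q \<ge> 0" by (simp add: Q_def sum_nonneg)
      have "lincomb z' (\<lambda>j. sconj (b j)) N k = of_real Q"
        by (simp only: lincomb_app b_def[symmetric] sconj_mult_self Q_def of_real_sum) (simp add: b_def sconj_mult_self)
      then have "Q = norm (lincomb z' (\<lambda>j. sconj (b j)) N k)" using Q0 by simp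
      also have "\<dots> \<le> lpn r (lincomb z' (\<lambda>j. sconj (b j)) N)"
        by (rule norm_le_lpn[OF r1 lincomb_lp[OF r1 z']])
      also have "\<dots> \<le> A * \<mu> (lincomb z' (\<lambda>j. sconj (b j)) N)" by (rule lo[OF lincomb_lp[OF r1 z']])
      also have "\<dots> \<le> A * (C0 / sqrt N * sqrt Q)"
        using z'b[of "\<lambda>j. sconj (b j)"] A by (intro mult_left_mono) (auto simp: Q_def)
      finally have "sqrt Q * sqrt Q \<le> \<delta> * sqrt Q" using Q0 by (simp add: \<delta>_def mult.assoc)
      then have "sqrt Q \<le> \<delta>" using \<delta> 
      proof (cases "sqrt Q = 0")
        case False
        then have "sqrt Q > 0" using Q0 by simp
        then show ?thesis using \<open>sqrt Q * sqrt Q \<le> \<delta> * sqrt Q\<close> by (rule mult_right_le_imp_le[rotated])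
      qed (use \<delta> in simp)
      then have "(sqrt Q)\<^sup>2 \<le> \<delta>\<^sup>2" using Q0 by (intro power_mono) auto
      then have Q: "Q \<le> \<delta>\<^sup>2" using Q0 by simp
      have Wk: "W S k = rsum b N S" for S by (simp add: W_def lincomb_app rsum_def b_def)
      have am: "w \<le> 1 / (2 * \<delta>) * w\<^sup>2 + \<delta> / 2" for w :: real
      proof -
        have "0 \<le> (w - \<delta>)\<^sup>2 / (2 * \<delta>)" using \<delta> by simp
        also have "\<dots> = 1 / (2 * \<delta>) * w\<^sup>2 + \<delta> / 2 - w"
          using \<delta> by (simp add: field_simps power2_eq_square)
        finally show ?thesis by simp
      qed
      have "avg N (\<lambda>S. norm (W S k)) \<le> avg N (\<lambda>S. 1 / (2 * \<delta>) * (norm (rsum b N S))\<^sup>2 + \<delta> / 2)"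
        unfolding Wk by (intro avg_mono am)
      also have "\<dots> = 1 / (2 * \<delta>) * Q + \<delta> / 2"
        unfolding avg_add avg_cmult avg_const avg_rsum_square Q_def ..
      also have "\<dots> \<le> 1 / (2 * \<delta>) * \<delta>\<^sup>2 + \<delta> / 2"
        using Q \<delta> by (intro add_right_mono mult_left_mono) auto
      also have "\<dots> = \<delta>" using \<delta> by (simp add: power2_eq_square)
      finally show ?thesis .
    qed
    define P where "P = (\<lambda>S. trunc K (W S))"
    have Plp: "P S \<in> lp r" for S unfolding P_def by (rule lp_trunc[OF r1])
    have lpn_fin: "lpn r (trunc K y) \<le> (\<Sum>k<K. norm (y k))" for y :: "nat \<Rightarrow> 'k"
    proof (induction K)
      case 0
      have e: "trunc 0 y = smul 0 0" by (rule ext) (simp add: trunc_def)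
      show ?case unfolding e lp_smul(2)[OF r1 zero_in_lp[OF r1]] by simp
    next
      case (Suc K)
      have e: "trunc (Suc K) y = trunc K y + smul (y K) (unitseq K)"
        by (rule ext) (auto simp: trunc_def unitseq_def less_Suc_eq)
      have "lpn r (unitseq K :: nat \<Rightarrow> 'k) powr r = (\<Sum>k<Suc K. norm (unitseq K k :: 'k) powr r)"
        by (rule lp_finite_support(2)[OF r1]) (simp add: unitseq_def)
      also have "\<dots> = 1" using r by (simp add: unitseq_def)
      finally have "(lpn r (unitseq K :: nat \<Rightarrow> 'k) powr r) powr (1 / r) = 1" by simp
      then have "lpn r (unitseq K :: nat \<Rightarrow> 'k) = 1" using r by (simp add: powr_powr)
      then have "lpn r (trunc (Suc K) y) \<le> lpn r (trunc K y) + norm (y K)"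
        unfolding e using lp_add(2)[OF r1 lp_trunc[OF r1] lp_smul(1)[OF r1 lp_unitseq[OF r1]], of K y "y K" K]
          lp_smul(2)[OF r1 lp_unitseq[OF r1], of "y K" K] by simp
      then show ?case using Suc by simp
    qed
    have "avg N (\<lambda>S. \<mu> (P S)) \<le> avg N (\<lambda>S. A * (\<Sum>k<K. norm (W S k)))"
    proof (rule avg_mono)
      fix S
      have "\<mu> (P S) \<le> A * lpn r (P S)" by (rule up[OF Plp])
      also have "\<dots> \<le> A * (\<Sum>k<K. norm (W S k))"
        using A by (intro mult_left_mono) (auto simp: P_def lpn_fin)
      finally show "\<mu> (P S) \<le> A * (\<Sum>k<K. norm (W S k))" .
    qed
    also have "\<dots> = A * (\<Sum>k<K. avg N (\<lambda>S. norm (W S k)))" by (simp only: avg_cmult avg_sum)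
    also have "\<dots> \<le> A * (\<Sum>k<K. \<delta>)" using A by (intro mult_left_mono sum_mono coord) auto
    finally have EP: "avg N (\<lambda>S. \<mu> (P S)) \<le> A * (real K * \<delta>)" by simp
    have pt: "(\<mu> (x + (W S - P S)))\<^sup>2 \<ge> (\<mu> (x + W S))\<^sup>2 - 2 * (s + C0) * \<mu> (P S)" for S
    proof -
      have xW: "x + W S \<in> lp r" "x + (W S - P S) \<in> lp r"
        by (intro lp_add(1)[OF r1] lp_diff(1)[OF r1] x Wlp Plp)+
      have "\<mu> (x + W S) - \<mu> (P S) \<le> \<mu> (x + W S - P S)" by (rule \<mu>_diff[OF xW(1) Plp])
      also have "x + W S - P S = x + (W S - P S)" by (simp add: algebra_simps)
      finally have "(\<mu> (x + (W S - P S)))\<^sup>2 \<ge> (\<mu> (x + W S))\<^sup>2 - 2 * \<mu> (x + W S) * \<mu> (P S)"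
        by (rule square_diff_bound[OF \<mu>_nonneg[OF xW(1)] \<mu>_nonneg[OF Plp] \<mu>_nonneg[OF xW(2)]])
      moreover have "\<mu> (x + W S) \<le> s + C0" using tri[OF x Wlp, of S] W[of S] by (simp add: s_def)
      then have "2 * \<mu> (x + W S) * \<mu> (P S) \<le> 2 * (s + C0) * \<mu> (P S)"
        using \<mu>_nonneg[OF Plp] by (intro mult_right_mono) auto
      ultimately show ?thesis by linarith
    qed
    have "avg N (\<lambda>S. (\<mu> (x + W S))\<^sup>2) - 2 * (s + C0) * avg N (\<lambda>S. \<mu> (P S))
        = avg N (\<lambda>S. (\<mu> (x + W S))\<^sup>2 - 2 * (s + C0) * \<mu> (P S))"
      by (simp only: avg_diff avg_cmult)
    also have "\<dots> \<le> avg N (\<lambda>S. (\<mu> (x + (W S - P S)))\<^sup>2)" by (intro avg_mono pt)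
    finally have "avg N (\<lambda>S. (\<mu> (x + (W S - P S)))\<^sup>2) \<ge>
        s\<^sup>2 + 1 - 1/16 - 2 * (s + C0) * avg N (\<lambda>S. \<mu> (P S))"
      using z'E by (simp add: W_def s_def)
    moreover have "2 * (s + C0) * avg N (\<lambda>S. \<mu> (P S)) \<le> 2 * (s + C0) * (A * (real K * \<delta>))"
      using EP s C0 by (intro mult_left_mono) auto
    moreover have "2 * (s + C0) * (A * (real K * \<delta>)) = D / sqrt N" by (simp add: D_def \<delta>_def)
    \<comment> \<open>1 - 1/16 - 1/16 exceeds 1/2, and the margin over 1/4 pays for truncating v
      below.\<close>
    ultimately have "avg N (\<lambda>S. (\<mu> (x + (W S - P S)))\<^sup>2) > s\<^sup>2 + 1/2" using DN by linarith
    then obtain S where S: "(\<mu> (x + (W S - P S)))\<^sup>2 > s\<^sup>2 + 1/2" using avg_gt_exists by blast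
    define v where "v = W S - P S"
    have v: "v \<in> lp r" unfolding v_def by (rule lp_diff(1)[OF r1 Wlp Plp])
    have vK: "v k = 0" if "k < K" for k using that by (simp add: v_def P_def minus_fun_app trunc_def)
    have tm: "trunc m v \<in> lp r" "x + trunc m v \<in> lp r" "x + v \<in> lp r" "v - trunc m v \<in> lp r" for m
      by (intro lp_add(1)[OF r1] lp_diff(1)[OF r1] x v lp_trunc[OF r1])+
    have lim: "(\<lambda>m. \<mu> (x + v) - A * lpn r (v - trunc m v)) \<longlonglongrightarrow> \<mu> (x + v) - A * 0"
      by (intro tendsto_intros lpn_trunc_tendsto[OF r1 v])
    have "sqrt (s\<^sup>2 + 1/4) < \<mu> (x + v)"
    proof (rule real_less_lsqrt)
      show "s\<^sup>2 + 1/4 < (\<mu> (x + v))\<^sup>2" using S by (simp add: v_def)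
    qed (use \<mu>_nonneg[OF tm(3)] in auto)
    then have "\<forall>\<^sub>F m in sequentially. \<mu> (x + v) - A * lpn r (v - trunc m v) > sqrt (s\<^sup>2 + 1/4)"
      using order_tendstoD(1)[OF lim, of "sqrt (s\<^sup>2 + 1/4)"] by simp
    then obtain m where m: "\<mu> (x + v) - A * lpn r (v - trunc m v) > sqrt (s\<^sup>2 + 1/4)"
      using eventually_happens' sequentially_bot by blast
    have "\<mu> (x + v) - \<mu> (v - trunc m v) \<le> \<mu> (x + v - (v - trunc m v))" by (rule \<mu>_diff[OF tm(3,4)])
    also have "x + v - (v - trunc m v) = x + trunc m v" by (simp add: algebra_simps)
    finally have "sqrt (s\<^sup>2 + 1/4) \<le> \<mu> (x + trunc m v)" using m up[OF tm(4), of m] by linarith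
    then have fin: "s\<^sup>2 + 1/4 \<le> (\<mu> (x + trunc m v))\<^sup>2" by (rule sqrt_le_D)
    have "lpn r (trunc m v) \<le> lpn r (W S)"
      by (rule lpn_mono(2)[OF r1 Wlp]) (auto simp: trunc_def v_def P_def minus_fun_app)
    also have "\<dots> \<le> A * \<mu> (W S)" by (rule lo[OF Wlp])
    also have "\<dots> \<le> A * C0" using W A by (intro mult_left_mono) auto
    finally have "lpn r (trunc m v) \<le> A * C0" .
    moreover have "\<forall>k. k < K \<or> k \<ge> m \<longrightarrow> trunc m v k = 0" using vK by (auto simp: trunc_def)
    ultimately show "\<exists>w K'. (\<forall>k. k < K \<or> k \<ge> K' \<longrightarrow> w k = 0) \<and> lpn r w \<le> A * C0 \<and> (\<mu> (x + w))\<^sup>2 \<ge> (\<mu> x)\<^sup>2 + 1/4"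
      using fin unfolding s_def by blast
  qed
qed

theorem contradiction: False
proof -
  obtain C where C: "\<And>x K. (\<forall>k\<ge>K. x k = 0) \<Longrightarrow> \<mu> x > 0 \<Longrightarrow>
     (\<exists>w K'. (\<forall>k. k < K \<or> k \<ge> K' \<longrightarrow> w k = 0) \<and> lpn r w \<le> C \<and> (\<mu> (x + w))\<^sup>2 \<ge> (\<mu> x)\<^sup>2 + 1/4)"
    using tail_step by blast
  define D where "D = \<bar>C\<bar> powr r"
  define c where "c = lpn r (unitseq 0 :: nat \<Rightarrow> 'k) powr r"
  have growth: "\<exists>x K. (\<forall>k\<ge>K. x k = 0) \<and> lpn r x powr r \<le> c + real L * D \<and> \<mu> x > 0 \<and> (\<mu> x)\<^sup>2 \<ge> real L / 4" for L
  proof (induction L)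
    case 0
    have "0 < norm (unitseq 0 0 :: 'k)" by (simp add: unitseq_def)
    also have "\<dots> \<le> lpn r (unitseq 0 :: nat \<Rightarrow> 'k)" by (rule norm_le_lpn[OF r1 lp_unitseq[OF r1]])
    also have "\<dots> \<le> A * \<mu> (unitseq 0)" by (rule lo[OF lp_unitseq[OF r1]])
    finally have "\<mu> (unitseq 0) > 0" using A by (simp add: zero_less_mult_iff)
    then show ?case by (intro exI[of _ "unitseq 0"] exI[of _ 1]) (auto simp: unitseq_def c_def)
  next
    case (Suc L)
    then obtain x K where x: "\<forall>k\<ge>K. x k = 0" "lpn r x powr r \<le> c + real L * D" "\<mu> x > 0" "(\<mu> x)\<^sup>2 \<ge> real L / 4"
      by blast
    obtain w K' where w: "\<forall>k. k < K \<or> k \<ge> K' \<longrightarrow> w k = 0" "lpn r w \<le> C" "(\<mu> (x + w))\<^sup>2 \<ge> (\<mu> x)\<^sup>2 + 1/4"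
      using C[OF x(1,3)] by blast
    have xlp: "x \<in> lp r" by (rule lp_finite_support(1)[OF r1, of K]) (use x in auto)
    have wlp: "w \<in> lp r" by (rule lp_finite_support(1)[OF r1, of K']) (use w in auto)
    have "lpn r (x + w) powr r = lpn r x powr r + lpn r w powr r"
      by (rule lpn_disjoint[OF r1 xlp wlp]) (use x w in \<open>metis not_le\<close>)
    moreover have "lpn r w powr r \<le> D" unfolding D_def using w(2) r by (intro powr_mono2) auto
    ultimately have "lpn r (x + w) powr r \<le> c + real (Suc L) * D" using x(2) by (simp add: algebra_simps)
    moreover have "\<mu> (x + w) \<noteq> 0" 
    proof
      assume "\<mu> (x + w) = 0"
      then have "(\<mu> x)\<^sup>2 + 1/4 \<le> 0" using w(3) by simp
      moreover have "(\<mu> x)\<^sup>2 \<ge> 0" by simp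
      ultimately show False by linarith
    qed
    then have "\<mu> (x + w) > 0" using \<mu>_nonneg[OF lp_add(1)[OF r1 xlp wlp]] by simp
    moreover have "(\<mu> (x + w))\<^sup>2 \<ge> real (Suc L) / 4" using w(3) x(4) by simp
    moreover have "\<forall>k\<ge>max K K'. (x + w) k = 0" using x w by simp
    ultimately show ?case by blast
  qed
  \<comment> \<open>The two growth rates combine to \<open>real L powr e \<le> B\<close>, which
    fails for large L because r > 2 makes e positive.\<close>
  define e where "e = 1 - 2 / r"
  have e: "e > 0" using r by (simp add: e_def)
  define B where "B = 4 * A\<^sup>2 * (c + D) powr (2 / r)"
  obtain L0 :: nat where L0: "real L0 > (B + 1) powr (1 / e)" using reals_Archimedean2 by blast
  define L where "L = Suc L0"
  have B0: "B \<ge> 0" by (simp add: B_def)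
  have L: "real L > 0" "real L > (B + 1) powr (1 / e)" using L0 by (auto simp: L_def)
  have cD: "c \<ge> 0" "D \<ge> 0" by (auto simp: c_def D_def)
  obtain x K where x: "\<forall>k\<ge>K. x k = 0" "lpn r x powr r \<le> c + real L * D" "(\<mu> x)\<^sup>2 \<ge> real L / 4" "\<mu> x > 0"
    using growth[of L] by blast
  have xlp: "x \<in> lp r" by (rule lp_finite_support(1)[OF r1, of K]) (use x in auto)
  have "(lpn r x)\<^sup>2 = lpn r x powr 2" by simp
  also have "\<dots> = (lpn r x powr r) powr (2 / r)" using r by (simp only: powr_powr) simp
  also have "\<dots> \<le> (c + real L * D) powr (2 / r)" using x(2) r by (intro powr_mono2) auto
  also have "\<dots> \<le> (real L * (c + D)) powr (2 / r)"
    using cD r by (intro powr_mono2) (auto simp: L_def algebra_simps)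
  also have "\<dots> = real L powr (2 / r) * (c + D) powr (2 / r)" by (rule powr_mult)
  finally have lx: "(lpn r x)\<^sup>2 \<le> real L powr (2 / r) * (c + D) powr (2 / r)" .
  have "real L / 4 \<le> (A * lpn r x)\<^sup>2"
    by (rule order_trans[OF x(3)]) (use up[OF xlp] x(4) in \<open>auto intro!: power_mono\<close>)
  also have "\<dots> \<le> A\<^sup>2 * (real L powr (2 / r) * (c + D) powr (2 / r))"
    unfolding power_mult_distrib by (rule mult_left_mono[OF lx]) simp
  finally have "real L \<le> real L powr (2 / r) * B" by (simp add: B_def mult_ac)
  moreover have "real L = real L powr (2 / r) * real L powr e"
    using L by (simp add: e_def flip: powr_add)
  ultimately have "real L powr e \<le> B" using L by (metis mult_le_cancel_left_pos powr_gt_zero order_less_irrefl)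
  moreover have "real L powr e > ((B + 1) powr (1 / e)) powr e"
    using L e by (intro powr_less_mono2) auto
  then have "real L powr e > B + 1" using B0 e by (simp add: powr_powr)
  ultimately show False by simp
qed

end

section \<open>Transfer of random perturbations by a convex transitive group\<close>

lemma square_convex_combination:
  fixes l t :: "'i \<Rightarrow> real"
  assumes "\<And>i. i \<in> I \<Longrightarrow> l i \<ge> 0" and "sum l I = 1"
  shows "(\<Sum>i\<in>I. l i * t i)\<^sup>2 \<le> (\<Sum>i\<in>I. l i * (t i)\<^sup>2)"
proof -
  define T where "T = (\<Sum>i\<in>I. l i * t i)"
  have "0 \<le> (\<Sum>i\<in>I. l i * (t i - T)\<^sup>2)" using assms by (intro sum_nonneg) auto
  also have "\<dots> = (\<Sum>i\<in>I. l i * (t i)\<^sup>2 - 2 * T * (l i * t i) + T\<^sup>2 * l i)"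
    by (intro sum.cong) (auto simp: power2_diff algebra_simps)
  also have "\<dots> = (\<Sum>i\<in>I. l i * (t i)\<^sup>2) - 2 * T * T + T\<^sup>2"
    by (simp add: sum.distrib sum_subtractf assms T_def flip: sum_distrib_left)
  finally show ?thesis by (simp add: T_def power2_eq_square)
qed

lemma convex_combination_exists_ge:
  fixes l t :: "'i \<Rightarrow> real"
  assumes l: "\<And>i. i \<in> I \<Longrightarrow> l i \<ge> 0" "sum l I = 1" and c: "c \<le> (\<Sum>i\<in>I. l i * t i)"
  shows "\<exists>i\<in>I. c \<le> t i"
proof (rule ccontr)
  assume "\<not> ?thesis"
  then have lt: "t i < c" if "i \<in> I" for i using that by force
  have fin: "finite I" using l(2) by (metis sum.infinite zero_neq_one)
  obtain i0 where i0: "i0 \<in> I" "l i0 \<noteq> 0" using l(2) by (metis sum.neutral zero_neq_one)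
  have "(\<Sum>i\<in>I. l i * t i) < (\<Sum>i\<in>I. l i * c)"
  proof (rule sum_strict_mono_ex1[OF fin])
    show "\<forall>i\<in>I. l i * t i \<le> l i * c" by (intro ballI mult_left_mono less_imp_le[OF lt] l(1))
    show "\<exists>i\<in>I. l i * t i < l i * c"
      using i0 lt[OF i0(1)] l(1)[OF i0(1)] by (intro bexI[OF _ i0(1)]) simp
  qed
  also have "\<dots> = c" using l(2) by (simp flip: sum_distrib_right)
  finally show False using c by simp
qed

text \<open>Sequences carry the pulled-back norm, and G the lifted isometries. Members of G are
  total functions whose behaviour is prescribed on \<open>lp p\<close> only, which is why all laws
  are relative to it. \<open>G_unimodular\<close> allows the value of a functional on an orbit to be
  rotated to a nonnegative real in the dual argument.\<close>

locale lp_convex_transitive =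
  fixes p :: real and \<mu> :: "(nat \<Rightarrow> 'k::rc_scalar) \<Rightarrow> real" and A :: real
    and G :: "((nat \<Rightarrow> 'k) \<Rightarrow> (nat \<Rightarrow> 'k)) set"
  assumes p: "p > 1" and A: "A > 0"
    and tri: "\<And>x y. x \<in> lp p \<Longrightarrow> y \<in> lp p \<Longrightarrow> \<mu> (x + y) \<le> \<mu> x + \<mu> y"
    and hom: "\<And>c x. x \<in> lp p \<Longrightarrow> \<mu> (smul c x) = norm c * \<mu> x"
    and lo: "\<And>x. x \<in> lp p \<Longrightarrow> lpn p x \<le> A * \<mu> x"
    and up: "\<And>x. x \<in> lp p \<Longrightarrow> \<mu> x \<le> A * lpn p x"
    and G_lp: "\<And>g x. g \<in> G \<Longrightarrow> x \<in> lp p \<Longrightarrow> g x \<in> lp p"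
    and G_add: "\<And>g x y. g \<in> G \<Longrightarrow> x \<in> lp p \<Longrightarrow> y \<in> lp p \<Longrightarrow> g (x + y) = g x + g y"
    and G_smul: "\<And>g c x. g \<in> G \<Longrightarrow> x \<in> lp p \<Longrightarrow> g (smul c x) = smul c (g x)"
    and G_isometry: "\<And>g x. g \<in> G \<Longrightarrow> x \<in> lp p \<Longrightarrow> \<mu> (g x) = \<mu> x"
    and G_inverse: "\<And>g. g \<in> G \<Longrightarrow> \<exists>h\<in>G. \<forall>x\<in>lp p. h (g x) = x \<and> g (h x) = x"
    and G_unimodular: "\<And>g u. g \<in> G \<Longrightarrow> norm u = 1 \<Longrightarrow> (\<lambda>x. smul u (g x)) \<in> G"
    and transitive: "\<And>x y e. x \<in> lp p \<Longrightarrow> y \<in> lp p \<Longrightarrow> \<mu> x = 1 \<Longrightarrow> \<mu> y \<le> 1 \<Longrightarrow> e > 0 \<Longrightarrow>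
      \<exists>(I :: nat set) l gs. finite I \<and> (\<forall>i\<in>I. l i \<ge> (0::real) \<and> gs i \<in> G) \<and> sum l I = 1 \<and>
        \<mu> (y - (\<Sum>i\<in>I. smul (of_real (l i)) (gs i x))) < e"
begin

lemma p1: "p \<ge> 1" using p by simp

lemma \<mu>_nonneg: "x \<in> lp p \<Longrightarrow> \<mu> x \<ge> 0"
  using lo[of x] lpn_nonneg[of p x] A by (meson order_trans zero_le_mult_iff not_le)

lemma zero_eq_smul: "(0 :: nat \<Rightarrow> 'k) = smul 0 0" by (rule ext) simp

lemma \<mu>_zero: "\<mu> 0 = 0" by (subst zero_eq_smul, subst hom[OF zero_in_lp[OF p1]]) simp

lemma G_zero: "g \<in> G \<Longrightarrow> g 0 = 0"
  by (subst zero_eq_smul, subst G_smul[OF _ zero_in_lp[OF p1]]) (auto intro!: ext)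

lemma lp_sum: "(\<And>i. i \<in> I \<Longrightarrow> f i \<in> lp p) \<Longrightarrow> sum f I \<in> lp p"
proof (induction I rule: infinite_finite_induct)
  case (insert i I)
  have "f i + sum f I \<in> lp p" by (rule lp_add(1)[OF p1]) (use insert in auto)
  then show ?case unfolding sum.insert[OF insert(1,2)] .
qed (simp_all only: sum.infinite sum.empty zero_in_lp[OF p1] not_False_eq_True)

lemma \<mu>_sum: "(\<And>i. i \<in> I \<Longrightarrow> f i \<in> lp p) \<Longrightarrow> \<mu> (sum f I) \<le> (\<Sum>i\<in>I. \<mu> (f i))"
proof (induction I rule: infinite_finite_induct)
  case (insert i I)
  have "\<mu> (f i + sum f I) \<le> \<mu> (f i) + \<mu> (sum f I)"
    by (rule tri) (use insert in \<open>auto intro: lp_sum\<close>)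
  then have "\<mu> (f i + sum f I) \<le> \<mu> (f i) + (\<Sum>i\<in>I. \<mu> (f i))" using insert by fastforce
  then show ?case unfolding sum.insert[OF insert(1,2)] .
qed (simp_all only: sum.infinite sum.empty \<mu>_zero not_False_eq_True order_refl)

lemma G_sum:
  assumes g: "g \<in> G" shows "(\<And>i. i \<in> I \<Longrightarrow> f i \<in> lp p) \<Longrightarrow> g (sum f I) = (\<Sum>i\<in>I. g (f i))"
proof (induction I rule: infinite_finite_induct)
  case (insert i I)
  have "g (f i + sum f I) = g (f i) + g (sum f I)"
    by (rule G_add[OF g]) (use insert in \<open>auto intro: lp_sum\<close>)
  also have "g (sum f I) = (\<Sum>i\<in>I. g (f i))" using insert by blast
  finally show ?case unfolding sum.insert[OF insert(1,2)] .
qed (simp_all only: sum.infinite sum.empty G_zero[OF g] not_False_eq_True)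

lemma G_lincomb:
  assumes g: "g \<in> G" and z: "\<And>j. z j \<in> lp p"
  shows "g (lincomb z a N) = lincomb (\<lambda>j. g (z j)) a N"
  unfolding lincomb_def G_sum[OF g lp_smul(1)[OF p1 z]] G_smul[OF g z] ..

text \<open>Convexity of the mean square moves a random perturbation of \<open>f\<close> to the points of the orbit of \<open>x\<close>.\<close>

lemma transfer_primal:
  assumes x: "x \<in> lp p" and f: "f \<in> lp p" and z: "\<And>j. z j \<in> lp p"
    and eq: "\<mu> x = \<mu> f" "\<mu> f > 0" and \<eta>: "\<eta> > 0"
  shows "\<exists>z'. (\<forall>j. z' j \<in> lp p) \<and> (\<forall>a. \<mu> (lincomb z' a N) \<le> \<mu> (lincomb z a N)) \<and>
          avg N (\<lambda>S. (\<mu> (x + lincomb z' (\<lambda>j. rad j S) N))\<^sup>2)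
            \<ge> avg N (\<lambda>S. (\<mu> (f + lincomb z (\<lambda>j. rad j S) N))\<^sup>2) - \<eta>"
proof -
  define s where "s = \<mu> x"
  have s: "s > 0" using eq by (simp add: s_def)
  define \<omega> where "\<omega> = (\<lambda>S. lincomb z (\<lambda>j. rad j S) N)"
  have \<omega>: "\<omega> S \<in> lp p" for S unfolding \<omega>_def by (rule lincomb_lp[OF p1 z])
  define B where "B = s + (\<Sum>j<N. \<mu> (z j))"
  have B: "B \<ge> 0" using s \<mu>_nonneg[OF z] by (auto simp: B_def intro!: add_nonneg_nonneg sum_nonneg)
  have \<omega>B: "\<mu> (\<omega> S) \<le> (\<Sum>j<N. \<mu> (z j))" for S
  proof -
    have "\<mu> (\<omega> S) \<le> (\<Sum>j<N. \<mu> (smul (rad j S) (z j)))"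
      unfolding \<omega>_def lincomb_def by (rule \<mu>_sum) (rule lp_smul(1)[OF p1 z])
    then show ?thesis by (simp add: hom[OF z])
  qed
  \<comment> \<open>An approximation error e of f changes the squared norm by at most e (1 + 2 B),
    because the averaged norms T are bounded by B and e \<le> 1.\<close>
  define e where "e = min 1 (\<eta> / (1 + 2 * B))"
  have e: "e > 0" "e \<le> 1" "e * (1 + 2 * B) \<le> \<eta>"
  proof -
    show "e > 0" "e \<le> 1" using \<eta> B by (auto simp: e_def)
    have "e * (1 + 2 * B) \<le> \<eta> / (1 + 2 * B) * (1 + 2 * B)"
      using B by (intro mult_right_mono) (auto simp: e_def)
    then show "e * (1 + 2 * B) \<le> \<eta>" using B by simp
  qed
  define x1 where "x1 = smul (of_real (1 / s)) x"
  define f1 where "f1 = smul (of_real (1 / s)) f"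
  have x1: "x1 \<in> lp p" "\<mu> x1 = 1"
    using lp_smul(1)[OF p1 x] hom[OF x, of "of_real (1 / s)"] s by (auto simp: x1_def s_def norm_divide)
  have f1: "f1 \<in> lp p" "\<mu> f1 \<le> 1"
    using lp_smul(1)[OF p1 f] hom[OF f, of "of_real (1 / s)"] s eq by (auto simp: f1_def s_def norm_divide)
  obtain I :: "nat set" and l gs where I: "finite I" "\<And>i. i \<in> I \<Longrightarrow> l i \<ge> 0" "\<And>i. i \<in> I \<Longrightarrow> gs i \<in> G" "sum l I = 1"
    and close: "\<mu> (f1 - (\<Sum>i\<in>I. smul (of_real (l i)) (gs i x1))) < e / s"
    using transitive[OF x1(1) f1(1) x1(2) f1(2) divide_pos_pos[OF e(1) s]] by blast
  define c where "c = (\<Sum>i\<in>I. smul (of_real (l i)) (gs i x))"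
  have gx: "gs i x \<in> lp p" if "i \<in> I" for i by (rule G_lp[OF I(3)[OF that] x])
  have c: "c \<in> lp p" unfolding c_def by (rule lp_sum) (rule lp_smul(1)[OF p1 gx])
  have "f - c = smul (of_real s) (f1 - (\<Sum>i\<in>I. smul (of_real (l i)) (gs i x1)))"
  proof -
    have "gs i x1 = smul (of_real (1 / s)) (gs i x)" if "i \<in> I" for i
      unfolding x1_def by (rule G_smul[OF I(3)[OF that] x])
    then have e: "(\<Sum>i\<in>I. smul (of_real (l i)) (gs i x1)) = (\<Sum>i\<in>I. smul (of_real (l i)) (smul (of_real (1 / s)) (gs i x)))"
      by (intro sum.cong refl) (simp only:)
    have cancel: "of_real s * (c * (of_real (1 / s) * v)) = c * v" "of_real s * (of_real (1 / s) * v) = v"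
      for c v :: 'k using s by simp_all
    show ?thesis
      unfolding e unfolding c_def f1_def
      by (rule ext) (simp only: minus_fun_app sum_fun_app smul_apply right_diff_distrib sum_distrib_left cancel)
  qed
  moreover have "f1 - (\<Sum>i\<in>I. smul (of_real (l i)) (gs i x1)) \<in> lp p"
    by (rule lp_diff(1)[OF p1 f1(1)], rule lp_sum, rule lp_smul(1)[OF p1], rule G_lp[OF I(3) x1(1)])
  ultimately have fc: "\<mu> (f - c) \<le> e"
    using hom[of "f1 - (\<Sum>i\<in>I. smul (of_real (l i)) (gs i x1))" "of_real s"] close s
    by (simp add: field_simps)
  have "\<forall>i. \<exists>h. i \<in> I \<longrightarrow> h \<in> G \<and> (\<forall>x\<in>lp p. h (gs i x) = x \<and> gs i (h x) = x)"
    using G_inverse I(3) by blast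
  then obtain h where h: "\<And>i. i \<in> I \<Longrightarrow> h i \<in> G"
    and hinv: "\<And>i x. i \<in> I \<Longrightarrow> x \<in> lp p \<Longrightarrow> h i (gs i x) = x \<and> gs i (h i x) = x"
    by metis
  have h\<omega>: "h i (\<omega> S) \<in> lp p" if "i \<in> I" for i S by (rule G_lp[OF h[OF that] \<omega>])
  have pt: "(\<mu> (f + \<omega> S))\<^sup>2 \<le> e * (1 + 2 * B) + (\<Sum>i\<in>I. l i * (\<mu> (x + h i (\<omega> S)))\<^sup>2)" for S
  proof -
    define t where "t = (\<lambda>i. \<mu> (x + h i (\<omega> S)))"
    define T where "T = (\<Sum>i\<in>I. l i * t i)"
    \<comment> \<open>The weights sum to 1, so c + \<omega> S is the same convex combination of the
      points gs i x + \<omega> S; the inverse of gs i turns each of these into x + h i (\<omega> S)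
      without changing \<mu>.\<close>
    have sum_eq: "c + \<omega> S = (\<Sum>i\<in>I. smul (of_real (l i)) (gs i x + \<omega> S))"
    proof (rule ext)
      fix k
      have "(\<Sum>i\<in>I. of_real (l i) * (gs i x k + \<omega> S k)) =
          (\<Sum>i\<in>I. of_real (l i) * gs i x k) + of_real (sum l I) * \<omega> S k"
        by (simp add: distrib_left sum.distrib sum_distrib_right)
      then show "(c + \<omega> S) k = (\<Sum>i\<in>I. smul (of_real (l i)) (gs i x + \<omega> S)) k"
        by (simp add: c_def sum_fun_app I(4))
    qed
    have "\<mu> (c + \<omega> S) \<le> (\<Sum>i\<in>I. \<mu> (smul (of_real (l i)) (gs i x + \<omega> S)))"
      unfolding sum_eq by (rule \<mu>_sum) (rule lp_smul(1)[OF p1 lp_add(1)[OF p1 gx \<omega>]])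
    also have "\<dots> = T"
      unfolding T_def
    proof (rule sum.cong[OF refl])
      fix i assume i: "i \<in> I"
      have "gs i x + \<omega> S = gs i (x + h i (\<omega> S))"
        using G_add[OF I(3)[OF i] x h\<omega>[OF i]] hinv[OF i \<omega>] by metis
      then have "\<mu> (gs i x + \<omega> S) = t i"
        unfolding t_def using G_isometry[OF I(3)[OF i] lp_add(1)[OF p1 x h\<omega>[OF i]]] by metis
      then show "\<mu> (smul (of_real (l i)) (gs i x + \<omega> S)) = l i * t i"
        using hom[OF lp_add(1)[OF p1 gx[OF i] \<omega>]] I(2)[OF i] by simp
    qed
    finally have 1: "\<mu> (c + \<omega> S) \<le> T" .
    have "f + \<omega> S = (f - c) + (c + \<omega> S)" by (simp add: algebra_simps)
    then have "\<mu> (f + \<omega> S) \<le> \<mu> (f - c) + \<mu> (c + \<omega> S)"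
      using tri[OF lp_diff(1)[OF p1 f c] lp_add(1)[OF p1 c \<omega>]] by metis
    then have le: "\<mu> (f + \<omega> S) \<le> e + T" using fc 1 by linarith
    have "t i \<le> B" if i: "i \<in> I" for i
      using tri[OF x h\<omega>[OF i], of S] G_isometry[OF h[OF i] \<omega>, of S] \<omega>B[of S] by (simp add: t_def B_def s_def)
    then have "T \<le> (\<Sum>i\<in>I. l i * B)" unfolding T_def by (intro sum_mono mult_left_mono) (use I(2) in auto)
    then have TB: "T \<le> B" by (simp add: I(4) flip: sum_distrib_right)
    have "(\<mu> (f + \<omega> S))\<^sup>2 \<le> (e + T)\<^sup>2"
      by (rule power_mono[OF le \<mu>_nonneg[OF lp_add(1)[OF p1 f \<omega>]]])
    also have "\<dots> = e * (e + 2 * T) + T\<^sup>2" by (simp add: power2_eq_square algebra_simps)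
    also have "\<dots> \<le> e * (1 + 2 * B) + (\<Sum>i\<in>I. l i * (t i)\<^sup>2)"
      using TB e square_convex_combination[of I l t] I(2,4)
      by (intro add_mono mult_left_mono) (auto simp: T_def)
    finally show ?thesis by (simp only: t_def)
  qed
  have "avg N (\<lambda>S. (\<mu> (f + \<omega> S))\<^sup>2) \<le> avg N (\<lambda>S. e * (1 + 2 * B) + (\<Sum>i\<in>I. l i * (\<mu> (x + h i (\<omega> S)))\<^sup>2))"
    by (rule avg_mono) (rule pt)
  also have "\<dots> = e * (1 + 2 * B) + (\<Sum>i\<in>I. l i * avg N (\<lambda>S. (\<mu> (x + h i (\<omega> S)))\<^sup>2))"
    by (simp only: avg_add avg_const avg_sum avg_cmult)
  finally have le: "avg N (\<lambda>S. (\<mu> (f + \<omega> S))\<^sup>2) - \<eta> \<le> (\<Sum>i\<in>I. l i * avg N (\<lambda>S. (\<mu> (x + h i (\<omega> S)))\<^sup>2))"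
    using e by linarith
  \<comment> \<open>The index is chosen after averaging over S, so one isometry serves all sign
    patterns.\<close>
  obtain i where i: "i \<in> I" "avg N (\<lambda>S. (\<mu> (f + \<omega> S))\<^sup>2) - \<eta> \<le> avg N (\<lambda>S. (\<mu> (x + h i (\<omega> S)))\<^sup>2)"
    using convex_combination_exists_ge[OF I(2,4) le] by blast
  show ?thesis
  proof (intro exI[of _ "\<lambda>j. h i (z j)"] conjI allI)
    show "h i (z j) \<in> lp p" for j by (rule G_lp[OF h[OF i(1)] z])
    have e: "lincomb (\<lambda>j. h i (z j)) a N = h i (lincomb z a N)" for a
      by (rule G_lincomb[OF h[OF i(1)] z, symmetric])
    show "\<mu> (lincomb (\<lambda>j. h i (z j)) a N) \<le> \<mu> (lincomb z a N)" for a
      unfolding e using G_isometry[OF h[OF i(1)] lincomb_lp[OF p1 z]] by simp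
    show "avg N (\<lambda>S. (\<mu> (f + lincomb z (\<lambda>j. rad j S) N))\<^sup>2) - \<eta>
        \<le> avg N (\<lambda>S. (\<mu> (x + lincomb (\<lambda>j. h i (z j)) (\<lambda>j. rad j S) N))\<^sup>2)"
      unfolding e using i(2) by (simp only: \<omega>_def)
  qed
qed

lemma not_gt_2: "\<not> p > 2"
proof
  assume "p > 2"
  interpret transitive_renorming p \<mu> A
  proof
    show "2 < p" "0 < A" by (fact, rule A)
    fix x y :: "nat \<Rightarrow> 'k" and c :: 'k
    assume x: "x \<in> lp p"
    show "\<mu> (smul c x) = norm c * \<mu> x" by (rule hom[OF x])
    show "lpn p x \<le> A * \<mu> x" by (rule lo[OF x])
    show "\<mu> x \<le> A * lpn p x" by (rule up[OF x])
    show "\<mu> (x + y) \<le> \<mu> x + \<mu> y" if "y \<in> lp p" by (rule tri[OF x that])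
    show "\<exists>z'. (\<forall>j. z' j \<in> lp p) \<and> (\<forall>a. \<mu> (lincomb z' a N) \<le> \<mu> (lincomb z a N)) \<and>
          avg N (\<lambda>S. (\<mu> (x + lincomb z' (\<lambda>j. rad j S) N))\<^sup>2)
            \<ge> avg N (\<lambda>S. (\<mu> (f + lincomb z (\<lambda>j. rad j S) N))\<^sup>2) - \<eta>"
      if "f \<in> lp p" "\<And>j. z j \<in> lp p" "\<mu> x = \<mu> f" "\<mu> f > 0" "\<eta> > 0"
      for f z N \<eta>
      by (rule transfer_primal[OF x that])
  qed
  show False by (rule contradiction)
qed

end

section \<open>The dual norm and exponents below 2\<close>

lemma pairing_smul_left: "summable (\<lambda>k. b k * a k) \<Longrightarrow> pairing (smul c b) a = c * pairing b a"
  unfolding pairing_def by (simp add: mult.assoc suminf_mult)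

lemma pairing_smul_right: "summable (\<lambda>k. b k * a k) \<Longrightarrow> pairing b (smul c a) = c * pairing b a"
  unfolding pairing_def by (simp add: mult.left_commute[of _ c] suminf_mult)

lemma pairing_add_left:
  "summable (\<lambda>k. b k * a k) \<Longrightarrow> summable (\<lambda>k. b' k * a k) \<Longrightarrow> pairing (b + b') a = pairing b a + pairing b' a"
  unfolding pairing_def by (simp add: distrib_right suminf_add)

lemma pairing_add_right:
  "summable (\<lambda>k. b k * a k) \<Longrightarrow> summable (\<lambda>k. b k * a' k) \<Longrightarrow> pairing b (a + a') = pairing b a + pairing b a'"
  unfolding pairing_def by (simp add: distrib_left suminf_add)

locale lp_convex_transitive_dual = lp_convex_transitive +
  fixes q :: real
  assumes q: "q > 1" and pq: "1 / p + 1 / q = 1"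
begin

lemma q1: "q \<ge> 1" using q by simp

lemmas pb = pairing_bound[OF p q pq]

lemma pair_smul_left: "b \<in> lp q \<Longrightarrow> a \<in> lp p \<Longrightarrow> pairing (smul c b) a = c * pairing b a"
  for a b :: "nat \<Rightarrow> 'a" by (rule pairing_smul_left[OF pb(1)])

lemma pair_smul_right: "b \<in> lp q \<Longrightarrow> a \<in> lp p \<Longrightarrow> pairing b (smul c a) = c * pairing b a"
  for a b :: "nat \<Rightarrow> 'a" by (rule pairing_smul_right[OF pb(1)])

lemma pair_add_left: "b \<in> lp q \<Longrightarrow> b' \<in> lp q \<Longrightarrow> a \<in> lp p \<Longrightarrow> pairing (b + b') a = pairing b a + pairing b' a"
  for a b :: "nat \<Rightarrow> 'a" by (rule pairing_add_left[OF pb(1) pb(1)])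

lemma pair_add_right: "b \<in> lp q \<Longrightarrow> a \<in> lp p \<Longrightarrow> a' \<in> lp p \<Longrightarrow> pairing b (a + a') = pairing b a + pairing b a'"
  for a b :: "nat \<Rightarrow> 'a" by (rule pairing_add_right[OF pb(1) pb(1)])

lemma pair_sum_right:
  fixes b :: "nat \<Rightarrow> 'a"
  assumes b: "b \<in> lp q"
  shows "(\<And>i. i \<in> I \<Longrightarrow> f i \<in> lp p) \<Longrightarrow> pairing b (sum f I) = (\<Sum>i\<in>I. pairing b (f i))"
proof (induction I rule: infinite_finite_induct)
  case (insert i I)
  have "pairing b (f i + sum f I) = pairing b (f i) + pairing b (sum f I)"
    by (rule pair_add_right[OF b]) (use insert in \<open>auto intro: lp_sum\<close>)
  also have "pairing b (sum f I) = (\<Sum>i\<in>I. pairing b (f i))" using insert by blast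
  finally show ?case unfolding sum.insert[OF insert(1,2)] .
qed (auto simp: pairing_def)

text \<open>The norm dual to \<mu>, with \<open>lp q\<close> in the role of the dual space. The
  pairing is bilinear, without conjugation, so that adjoints for it are linear.\<close>

definition dnorm :: "(nat \<Rightarrow> 'a) \<Rightarrow> real" where
  "dnorm b = Sup {norm (pairing b a) | a. a \<in> lp p \<and> \<mu> a \<le> 1}"

lemma pairing_le_A:
  assumes b: "b \<in> lp q" and a: "a \<in> lp p" "\<mu> a \<le> 1"
  shows "norm (pairing b a) \<le> A * lpn q b"
proof -
  have "lpn p a \<le> A * 1" using lo[OF a(1)] a(2) A by (meson mult_le_cancel_left_pos order_trans)
  then have "lpn q b * lpn p a \<le> lpn q b * A" by (intro mult_left_mono) auto
  then show ?thesis using pb(2)[OF b a(1)] by (simp add: mult.commute)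
qed

lemma dnorm_ne: "{norm (pairing b a) | a. a \<in> lp p \<and> \<mu> a \<le> 1} \<noteq> {}"
proof -
  have "norm (pairing b 0) \<in> {norm (pairing b a) | a. a \<in> lp p \<and> \<mu> a \<le> 1}"
    using zero_in_lp[OF p1, where 'a = 'a] \<mu>_zero by force
  then show ?thesis by blast
qed

lemma dnorm_bdd: "b \<in> lp q \<Longrightarrow> bdd_above {norm (pairing b a) | a. a \<in> lp p \<and> \<mu> a \<le> 1}"
  by (rule bdd_aboveI[of _ "A * lpn q b"]) (use pairing_le_A in blast)

lemma dnorm_upper1: "b \<in> lp q \<Longrightarrow> a \<in> lp p \<Longrightarrow> \<mu> a \<le> 1 \<Longrightarrow> norm (pairing b a) \<le> dnorm b"
  unfolding dnorm_def by (rule cSup_upper[OF _ dnorm_bdd]) blast+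

lemma dnorm_least: "(\<And>a. a \<in> lp p \<Longrightarrow> \<mu> a \<le> 1 \<Longrightarrow> norm (pairing b a) \<le> C) \<Longrightarrow> dnorm b \<le> C"
  unfolding dnorm_def by (rule cSup_least[OF dnorm_ne]) blast

lemma dnorm_nonneg: assumes "b \<in> lp q" shows "dnorm b \<ge> 0"
proof -
  have "norm (pairing b 0) \<le> dnorm b"
    by (rule dnorm_upper1[OF assms zero_in_lp[OF p1]]) (simp only: \<mu>_zero zero_le_one)
  then show ?thesis by (rule order_trans[OF norm_ge_zero])
qed

lemma dnorm_upper: assumes b: "b \<in> lp q" and a: "a \<in> lp p" shows "norm (pairing b a) \<le> dnorm b * \<mu> a"
proof (cases "\<mu> a = 0")
  case True
  then have "lpn p a \<le> 0" using lo[OF a] by simp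
  then have "lpn p a = 0" using lpn_nonneg[of p a] by linarith
  then have "norm (pairing b a) \<le> 0" using pb(2)[OF b a] by simp
  then show ?thesis using True by simp
next
  case False
  then have m: "\<mu> a > 0" using \<mu>_nonneg[OF a] by simp
  let ?c = "of_real (1 / \<mu> a)"
  have "norm (pairing b (smul ?c a)) \<le> dnorm b"
    by (rule dnorm_upper1[OF b lp_smul(1)[OF p1 a]]) (use m in \<open>simp add: hom[OF a] norm_divide\<close>)
  then show ?thesis using m by (simp add: pair_smul_right[OF b a] norm_mult norm_divide field_simps)
qed

lemma dnorm_tri: "b \<in> lp q \<Longrightarrow> b' \<in> lp q \<Longrightarrow> dnorm (b + b') \<le> dnorm b + dnorm b'"
  by (rule dnorm_least) (metis add_mono dnorm_upper1 norm_triangle_le pair_add_left)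

lemma dnorm_smul_le: "b \<in> lp q \<Longrightarrow> dnorm (smul c b) \<le> norm c * dnorm b"
  by (rule dnorm_least) (simp add: pair_smul_left norm_mult mult_left_mono dnorm_upper1)

lemma dnorm_hom: assumes b: "b \<in> lp q" shows "dnorm (smul c b) = norm c * dnorm b"
proof (cases "c = 0")
  case True
  then show ?thesis
    using dnorm_smul_le[OF b, of c] dnorm_nonneg[OF lp_smul(1)[OF q1 b], of c] by simp
next
  case False
  then have "smul (inverse c) (smul c b) = b" by (intro ext) simp
  then have "dnorm b \<le> norm (inverse c) * dnorm (smul c b)"
    using dnorm_smul_le[OF lp_smul(1)[OF q1 b], of "inverse c" c] by simp
  then have "norm c * dnorm b \<le> dnorm (smul c b)" using False by (simp add: norm_inverse norm_divide field_simps)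
  then show ?thesis using dnorm_smul_le[OF b, of c] by simp
qed

lemma dnorm_up: "b \<in> lp q \<Longrightarrow> dnorm b \<le> A * lpn q b"
  by (rule dnorm_least) (rule pairing_le_A)

lemma dnorm_lo: assumes b: "b \<in> lp q" shows "lpn q b \<le> A * dnorm b"
proof (rule lp_of_bounded_functional(2)[OF p q pq])
  show "0 \<le> A * dnorm b" using A dnorm_nonneg[OF b] by simp
  fix a :: "nat \<Rightarrow> 'a" and n assume an: "\<And>k. k \<ge> n \<Longrightarrow> a k = 0"
  have a: "a \<in> lp p" by (rule lp_finite_support(1)[OF p1 an])
  have "norm (pairing b a) \<le> dnorm b * \<mu> a" by (rule dnorm_upper[OF b a])
  also have "\<dots> \<le> dnorm b * (A * lpn p a)" by (rule mult_left_mono[OF up[OF a] dnorm_nonneg[OF b]])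
  finally show "norm (\<Sum>k<n. b k * a k) \<le> A * dnorm b * lpn p a"
    by (simp add: pairing_finite_support[OF an] mult_ac)
qed

lemma near_norming:
  assumes b: "b \<in> lp q" and e: "e > 0"
  shows "\<exists>a\<in>lp p. \<mu> a \<le> 1 \<and> (\<exists>\<rho>\<ge>dnorm b - e. pairing b a = of_real \<rho>)"
proof -
  have "dnorm b - e < dnorm b" using e by simp
  then obtain v where "v \<in> {norm (pairing b a) | a. a \<in> lp p \<and> \<mu> a \<le> 1}" "dnorm b - e < v"
    using less_cSupD[OF dnorm_ne] unfolding dnorm_def by blast
  then obtain a where a: "a \<in> lp p" "\<mu> a \<le> 1" "dnorm b - e < norm (pairing b a)" by blast
  obtain u where u: "norm u = 1" "u * pairing b a = of_real (norm (pairing b a))"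
    using exists_unimodular by blast
  show ?thesis
    by (rule bexI[of _ "smul u a"])
      (use a u in \<open>auto simp: hom pair_smul_right[OF b] lp_smul(1)[OF p1] intro: less_imp_le\<close>)
qed

text \<open>The adjoint of g for the pairing, prescribed by its coordinates. Boundedness of g and
  the density of finitely supported sequences extend the defining identity to \<open>lp p\<close> in
  \<open>adj_pairing\<close>.\<close>

definition adj :: "((nat \<Rightarrow> 'a) \<Rightarrow> nat \<Rightarrow> 'a) \<Rightarrow> (nat \<Rightarrow> 'a) \<Rightarrow> nat \<Rightarrow> 'a" where
  "adj g b = (\<lambda>k. pairing b (g (unitseq k)))"

lemma lpn_G: assumes g: "g \<in> G" and a: "a \<in> lp p" shows "lpn p (g a) \<le> A * A * lpn p a"
proof -
  have "lpn p (g a) \<le> A * \<mu> (g a)" by (rule lo[OF G_lp[OF g a]])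
  also have "\<dots> = A * \<mu> a" by (simp only: G_isometry[OF g a])
  also have "\<dots> \<le> A * (A * lpn p a)" using up[OF a] A by (intro mult_left_mono) auto
  finally show ?thesis by (simp add: mult.assoc)
qed

lemma adj_finite:
  assumes g: "g \<in> G" and b: "b \<in> lp q"
  shows "(\<Sum>k<n. adj g b k * a k) = pairing b (g (trunc n a))"
proof -
  have t: "trunc n a = (\<Sum>k<n. smul (a k) (unitseq k))"
    by (rule ext) (auto simp: trunc_def sum_fun_app unitseq_def if_distrib cong: if_cong)
  have u: "smul (a k) (unitseq k) \<in> lp p" for k by (rule lp_smul(1)[OF p1 lp_unitseq[OF p1]])
  have "g (trunc n a) = (\<Sum>k<n. smul (a k) (g (unitseq k)))"
    unfolding t G_sum[OF g u] G_smul[OF g lp_unitseq[OF p1]] ..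
  then have "pairing b (g (trunc n a)) = pairing b (\<Sum>k<n. smul (a k) (g (unitseq k)))" by simp
  also have "\<dots> = (\<Sum>k<n. pairing b (smul (a k) (g (unitseq k))))"
    by (rule pair_sum_right[OF b]) (rule lp_smul(1)[OF p1 G_lp[OF g lp_unitseq[OF p1]]])
  also have "\<dots> = (\<Sum>k<n. adj g b k * a k)"
    by (intro sum.cong refl)
      (simp add: pair_smul_right[OF b G_lp[OF g lp_unitseq[OF p1]]] adj_def mult.commute)
  finally show ?thesis by simp
qed

lemma adj_lp: assumes g: "g \<in> G" and b: "b \<in> lp q" shows "adj g b \<in> lp q"
proof (rule lp_of_bounded_functional(1)[OF p q pq])
  show "0 \<le> lpn q b * (A * A)" using A by simp
  fix a :: "nat \<Rightarrow> 'a" and n assume an: "\<And>k. k \<ge> n \<Longrightarrow> a k = 0"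
  have a: "a \<in> lp p" by (rule lp_finite_support(1)[OF p1 an])
  have ta: "trunc n a = a" by (rule ext) (use an in \<open>auto simp: trunc_def not_less\<close>)
  have "norm (pairing b (g a)) \<le> lpn q b * lpn p (g a)" by (rule pb(2)[OF b G_lp[OF g a]])
  also have "\<dots> \<le> lpn q b * (A * A * lpn p a)" by (rule mult_left_mono[OF lpn_G[OF g a]]) simp
  finally show "norm (\<Sum>k<n. adj g b k * a k) \<le> lpn q b * (A * A) * lpn p a"
    unfolding adj_finite[OF g b] ta by (simp add: mult.assoc)
qed

lemma adj_pairing:
  assumes g: "g \<in> G" and b: "b \<in> lp q" and a: "a \<in> lp p"
  shows "pairing (adj g b) a = pairing b (g a)"
proof -
  have "(\<lambda>n. \<Sum>k<n. adj g b k * a k) \<longlonglongrightarrow> pairing (adj g b) a"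
    unfolding pairing_def by (rule summable_LIMSEQ[OF pb(1)[OF adj_lp[OF g b] a]])
  then have l1: "(\<lambda>n. pairing b (g (trunc n a))) \<longlonglongrightarrow> pairing (adj g b) a"
    by (simp only: adj_finite[OF g b])
  have "(\<lambda>n. pairing b (g (trunc n a)) - pairing b (g a)) \<longlonglongrightarrow> 0"
  proof (rule tendsto_norm_zero_cancel, rule tendsto_sandwich[OF _ _ tendsto_const])
    show "\<forall>\<^sub>F n in sequentially. 0 \<le> norm (pairing b (g (trunc n a)) - pairing b (g a))" by simp
    have le: "norm (pairing b (g (trunc n a)) - pairing b (g a)) \<le> lpn q b * (A * A) * lpn p (a - trunc n a)" for n
    proof -
      have d: "a - trunc n a \<in> lp p" by (rule lp_diff(1)[OF p1 a lp_trunc[OF p1]])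
      have "g a = g (trunc n a + (a - trunc n a))" by simp
      also have "\<dots> = g (trunc n a) + g (a - trunc n a)" by (rule G_add[OF g lp_trunc[OF p1] d])
      finally have "pairing b (g a) = pairing b (g (trunc n a)) + pairing b (g (a - trunc n a))"
        using pair_add_right[OF b G_lp[OF g lp_trunc[OF p1]] G_lp[OF g d]] by metis
      then have "norm (pairing b (g (trunc n a)) - pairing b (g a)) = norm (pairing b (g (a - trunc n a)))" by simp
      also have "\<dots> \<le> lpn q b * lpn p (g (a - trunc n a))" by (rule pb(2)[OF b G_lp[OF g d]])
      also have "\<dots> \<le> lpn q b * (A * A * lpn p (a - trunc n a))" by (rule mult_left_mono[OF lpn_G[OF g d]]) simp
      finally show ?thesis by (simp add: mult.assoc)
    qed
    then show "\<forall>\<^sub>F n in sequentially. norm (pairing b (g (trunc n a)) - pairing b (g a)) \<le> lpn q b * (A * A) * lpn p (a - trunc n a)"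
      by simp
    show "(\<lambda>n. lpn q b * (A * A) * lpn p (a - trunc n a)) \<longlonglongrightarrow> 0"
      using tendsto_mult_left[OF lpn_trunc_tendsto[OF p1 a]] by simp
  qed
  then have "(\<lambda>n. pairing b (g (trunc n a))) \<longlonglongrightarrow> pairing b (g a)" by (rule LIM_zero_cancel)
  then show ?thesis using l1 LIMSEQ_unique by blast
qed

lemma dnorm_adj: "g \<in> G \<Longrightarrow> b \<in> lp q \<Longrightarrow> dnorm (adj g b) \<le> dnorm b"
  by (rule dnorm_least) (simp add: adj_pairing dnorm_upper1 G_lp G_isometry)

lemma adj_lincomb:
  assumes g: "g \<in> G" and w: "\<And>j. w j \<in> lp q"
  shows "adj g (lincomb w a N) = lincomb (\<lambda>j. adj g (w j)) a N"
proof (rule ext)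
  fix k
  have u: "g (unitseq k) \<in> lp p" by (rule G_lp[OF g lp_unitseq[OF p1]])
  have "pairing (lincomb w a N) (g (unitseq k)) = (\<Sum>j<N. a j * pairing (w j) (g (unitseq k)))"
  proof (induction N)
    case (Suc N)
    have e: "lincomb w a (Suc N) = lincomb w a N + smul (a N) (w N)" unfolding lincomb_def by (rule sum.lessThan_Suc)
    have "pairing (lincomb w a (Suc N)) (g (unitseq k)) =
        pairing (lincomb w a N) (g (unitseq k)) + pairing (smul (a N) (w N)) (g (unitseq k))"
      unfolding e by (rule pair_add_left[OF lincomb_lp[OF q1 w] lp_smul(1)[OF q1 w] u])
    then show ?case using Suc pair_smul_left[OF w u] by simp
  qed (simp add: lincomb_def pairing_def)
  then show "adj g (lincomb w a N) k = lincomb (\<lambda>j. adj g (w j)) a N k"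
    by (simp add: adj_def lincomb_app)
qed

text \<open>A vector that nearly norms \<phi> is approximated by a convex combination of the orbit
  of the normalized y. Some point of this combination pairs with \<phi> at least as strongly as the
  whole, and a unimodular multiple makes the pairing a nonnegative real.\<close>

lemma dual_transitive:
  assumes \<phi>: "\<phi> \<in> lp q" and y: "y \<in> lp p" and e: "e > 0"
  shows "\<exists>g\<in>G. \<exists>R\<ge>dnorm \<phi> * \<mu> y - e. pairing \<phi> (g y) = of_real R"
proof -
  have "\<exists>g\<in>G. norm (pairing \<phi> (g y)) \<ge> dnorm \<phi> * \<mu> y - e"
  proof (cases "\<mu> y = 0")
    case True
    \<comment> \<open>Any member of G will do here. Transitivity at a normalized vector supplies
      one, since weights with sum 1 need a nonempty index set.\<close>
    define c where "c = 1 / \<mu> (unitseq 0)"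
    have "\<mu> (unitseq 0) \<noteq> 0"
    proof
      assume "\<mu> (unitseq 0) = 0"
      then have "lpn p (unitseq 0 :: nat \<Rightarrow> 'a) \<le> 0" using lo[OF lp_unitseq[OF p1], of 0] by simp
      moreover have "norm (unitseq 0 0 :: 'a) \<le> lpn p (unitseq 0 :: nat \<Rightarrow> 'a)"
        by (rule norm_le_lpn[OF p1 lp_unitseq[OF p1]])
      ultimately have "norm (unitseq 0 0 :: 'a) \<le> 0" by (rule order_trans[rotated])
      then show False by (simp add: unitseq_def)
    qed
    then have "\<mu> (unitseq 0) > 0" using \<mu>_nonneg[OF lp_unitseq[OF p1], of 0] by simp
    then have a1: "\<mu> (smul (of_real c) (unitseq 0)) = 1"
      by (simp add: hom[OF lp_unitseq[OF p1]] c_def norm_divide)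
    have a0: "\<mu> 0 \<le> 1" by (simp only: \<mu>_zero zero_le_one)
    obtain I :: "nat set" and l :: "nat \<Rightarrow> real" and gs
      where I: "\<forall>i\<in>I. l i \<ge> 0 \<and> gs i \<in> G" "sum l I = 1"
      using transitive[OF lp_smul(1)[OF p1 lp_unitseq[OF p1]] zero_in_lp[OF p1] a1 a0 zero_less_one] by blast
    then have "I \<noteq> {}" by auto
    then obtain g where "g \<in> G" using I(1) by blast
    moreover have "dnorm \<phi> * \<mu> y - e \<le> norm (pairing \<phi> (g y))"
      using True e norm_ge_zero[of "pairing \<phi> (g y)"] by (simp del: norm_ge_zero)
    ultimately show ?thesis by blast
  next
    case False
    then have m: "\<mu> y > 0" using \<mu>_nonneg[OF y] by simp
    define d where "d = dnorm \<phi>"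
    have d: "d \<ge> 0" using dnorm_nonneg[OF \<phi>] by (simp add: d_def)
    \<comment> \<open>Chosen so that the losses e' and d e', multiplied by \<mu> y, add up to
      e.\<close>
    define e' where "e' = e / ((1 + d) * \<mu> y)"
    have e': "e' > 0" using e m d by (simp add: e'_def)
    define x where "x = smul (of_real (1 / \<mu> y)) y"
    have x: "x \<in> lp p" "\<mu> x = 1"
      using m by (simp_all add: x_def lp_smul(1)[OF p1 y] hom[OF y] norm_divide)
    obtain a \<rho> where a: "a \<in> lp p" "\<mu> a \<le> 1" "\<rho> \<ge> d - e'" "pairing \<phi> a = of_real \<rho>"
      using near_norming[OF \<phi> e'] unfolding d_def by blast
    obtain I :: "nat set" and l gs where I: "finite I" "\<And>i. i \<in> I \<Longrightarrow> l i \<ge> 0" "\<And>i. i \<in> I \<Longrightarrow> gs i \<in> G" "sum l I = 1"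
      and close: "\<mu> (a - (\<Sum>i\<in>I. smul (of_real (l i)) (gs i x))) < e'"
      using transitive[OF x(1) a(1) x(2) a(2) e'] by blast
    define c where "c = (\<Sum>i\<in>I. smul (of_real (l i)) (gs i x))"
    have gx: "gs i x \<in> lp p" if "i \<in> I" for i by (rule G_lp[OF I(3)[OF that] x(1)])
    have c: "c \<in> lp p" unfolding c_def by (rule lp_sum) (rule lp_smul(1)[OF p1 gx])
    have ac: "a - c \<in> lp p" by (rule lp_diff(1)[OF p1 a(1) c])
    have "pairing \<phi> (c + (a - c)) = pairing \<phi> c + pairing \<phi> (a - c)" by (rule pair_add_right[OF \<phi> c ac])
    then have "pairing \<phi> c = of_real \<rho> - pairing \<phi> (a - c)" using a(4) by simp
    then have "norm (pairing \<phi> c) \<ge> \<bar>\<rho>\<bar> - norm (pairing \<phi> (a - c))"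
      by (metis norm_of_real norm_triangle_ineq2)
    moreover have "norm (pairing \<phi> (a - c)) \<le> d * e'"
    proof -
      have "norm (pairing \<phi> (a - c)) \<le> d * \<mu> (a - c)" unfolding d_def by (rule dnorm_upper[OF \<phi> ac])
      also have "\<dots> \<le> d * e'" using close d by (intro mult_left_mono) (auto simp: c_def)
      finally show ?thesis .
    qed
    ultimately have "d - e' - d * e' \<le> norm (pairing \<phi> c)" using a(3) by linarith
    also have "pairing \<phi> c = (\<Sum>i\<in>I. of_real (l i) * pairing \<phi> (gs i x))"
    proof -
      have "pairing \<phi> c = (\<Sum>i\<in>I. pairing \<phi> (smul (of_real (l i)) (gs i x)))"
        unfolding c_def by (rule pair_sum_right[OF \<phi>]) (rule lp_smul(1)[OF p1 gx])
      then show ?thesis using pair_smul_right[OF \<phi> gx] by (simp cong: sum.cong)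
    qed
    also have "norm \<dots> \<le> (\<Sum>i\<in>I. l i * norm (pairing \<phi> (gs i x)))"
      by (rule order_trans[OF norm_sum]) (simp add: norm_mult I(2) cong: sum.cong)
    finally have le: "d - e' - d * e' \<le> (\<Sum>i\<in>I. l i * norm (pairing \<phi> (gs i x)))" .
    obtain i where i: "i \<in> I" "d - e' - d * e' \<le> norm (pairing \<phi> (gs i x))"
      using convex_combination_exists_ge[OF I(2,4) le] by blast
    have "pairing \<phi> (gs i x) = of_real (1 / \<mu> y) * pairing \<phi> (gs i y)"
      unfolding x_def G_smul[OF I(3)[OF i(1)] y] by (rule pair_smul_right[OF \<phi> G_lp[OF I(3)[OF i(1)] y]])
    then have "norm (pairing \<phi> (gs i y)) = \<mu> y * norm (pairing \<phi> (gs i x))"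
      using m by (simp add: norm_mult norm_divide)
    also have "\<dots> \<ge> \<mu> y * (d - e' - d * e')" using i(2) m by (intro mult_left_mono) auto
    also have "\<mu> y * (d - e' - d * e') = d * \<mu> y - (1 + d) * \<mu> y * e'" by (simp add: algebra_simps)
    also have "(1 + d) * \<mu> y * e' = e" using m d by (simp add: e'_def)
    finally show ?thesis using I(3)[OF i(1)] unfolding d_def by (intro bexI[of _ "gs i"]) auto
  qed
  then obtain g where g: "g \<in> G" "norm (pairing \<phi> (g y)) \<ge> dnorm \<phi> * \<mu> y - e" by blast
  obtain u where u: "norm u = 1" "u * pairing \<phi> (g y) = of_real (norm (pairing \<phi> (g y)))"
    using exists_unimodular by blast
  show ?thesis
  proof (intro bexI[of _ "\<lambda>x. smul u (g x)"] exI[of _ "norm (pairing \<phi> (g y))"] conjI)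
    show "pairing \<phi> (smul u (g y)) = of_real (norm (pairing \<phi> (g y)))"
      using u(2) pair_smul_right[OF \<phi> G_lp[OF g(1) y]] by simp
  qed (use g G_unimodular u in auto)
qed

text \<open>One isometry has to serve all sign patterns. The vectors y S that nearly norm f +
  \<omega> S are merged into one vector Y, and g is chosen so that \<phi> nearly attains
  \<open>dnorm \<phi> * \<mu> Y\<close> at g Y. If \<omega> S is moved by the adjoint of the inverse
  of g, then the weighted sum of the pairings of \<phi> + \<omega>' S with g (y S) differs from that
  of f + \<omega> S with y S only in the exchange of f at Y for \<phi> at g Y. Nothing substantial
  is lost there, as f at Y is at most \<open>dnorm f * \<mu> Y\<close> and the dual norms
  agree.\<close>

lemma transfer_dual:
  assumes \<phi>: "\<phi> \<in> lp q" and f: "f \<in> lp q" and w: "\<And>j. w j \<in> lp q"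
    and eq: "dnorm \<phi> = dnorm f" and \<eta>: "\<eta> > 0"
  shows "\<exists>w'. (\<forall>j. w' j \<in> lp q) \<and> (\<forall>a. dnorm (lincomb w' a N) \<le> dnorm (lincomb w a N)) \<and>
          avg N (\<lambda>S. (dnorm (\<phi> + lincomb w' (\<lambda>j. rad j S) N))\<^sup>2)
            \<ge> avg N (\<lambda>S. (dnorm (f + lincomb w (\<lambda>j. rad j S) N))\<^sup>2) - \<eta>"
proof -
  define \<omega> where "\<omega> = (\<lambda>S. lincomb w (\<lambda>j. rad j S) N)"
  have \<omega>: "\<omega> S \<in> lp q" for S unfolding \<omega>_def by (rule lincomb_lp[OF q1 w])
  define \<theta> where "\<theta> = (\<lambda>S. dnorm (f + \<omega> S))"
  have \<theta>: "\<theta> S \<ge> 0" for S unfolding \<theta>_def by (rule dnorm_nonneg[OF lp_add(1)[OF q1 f \<omega>]])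
  define m where "m = avg N \<theta>"
  have "avg N (\<lambda>_. 0) \<le> m" unfolding m_def by (rule avg_mono) (rule \<theta>)
  then have m: "m \<ge> 0" by simp
  \<comment> \<open>2 e (1 + m) = \<eta>: \<open>dual_transitive\<close> costs e and the nearly
    norming vectors cost e m, and both are doubled when the product is estimated by squares.\<close>
  define e where "e = \<eta> / (2 * (1 + m))"
  have e: "e > 0" using \<eta> m by (simp add: e_def)
  have "\<forall>S. \<exists>a. a \<in> lp p \<and> \<mu> a \<le> 1 \<and> (\<exists>\<rho>\<ge>\<theta> S - e. pairing (f + \<omega> S) a = of_real \<rho>)"
    using near_norming[OF lp_add(1)[OF q1 f \<omega>] e] unfolding \<theta>_def by blast
  then obtain y where "\<forall>S. y S \<in> lp p \<and> \<mu> (y S) \<le> 1 \<and> (\<exists>\<rho>\<ge>\<theta> S - e. pairing (f + \<omega> S) (y S) = of_real \<rho>)"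
    by metis
  moreover from this obtain \<rho> where "\<forall>S. \<rho> S \<ge> \<theta> S - e \<and> pairing (f + \<omega> S) (y S) = of_real (\<rho> S)" by metis
  ultimately have y: "\<And>S. y S \<in> lp p" "\<And>S. \<mu> (y S) \<le> 1"
    and \<rho>: "\<And>S. \<rho> S \<ge> \<theta> S - e" "\<And>S. pairing (f + \<omega> S) (y S) = of_real (\<rho> S)" by auto
  \<comment> \<open>Weights proportional to \<theta> S make the sum of t S \<rho> S as large as the
    mean of \<theta>^2, up to e m.\<close>
  define t where "t = (\<lambda>S. \<theta> S / 2 ^ N)"
  have t: "t S \<ge> 0" for S using \<theta> by (simp add: t_def)
  define P where "P = Pow {..<N}"
  have avg_t: "(\<Sum>S\<in>P. t S * F S) = avg N (\<lambda>S. \<theta> S * F S)" for F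
    by (simp add: avg_def P_def t_def sum_divide_distrib)
  define Y where "Y = (\<Sum>S\<in>P. smul (of_real (t S)) (y S))"
  have Y: "Y \<in> lp p" unfolding Y_def by (rule lp_sum) (rule lp_smul(1)[OF p1 y(1)])
  have pY: "pairing b Y = (\<Sum>S\<in>P. of_real (t S) * pairing b (y S))" if "b \<in> lp q" for b
  proof -
    have "pairing b Y = (\<Sum>S\<in>P. pairing b (smul (of_real (t S)) (y S)))"
      unfolding Y_def by (rule pair_sum_right[OF that]) (rule lp_smul(1)[OF p1 y(1)])
    then show ?thesis by (simp only: pair_smul_right[OF that y(1)])
  qed
  obtain g R where g: "g \<in> G" and R: "R \<ge> dnorm \<phi> * \<mu> Y - e" "pairing \<phi> (g Y) = of_real R"
    using dual_transitive[OF \<phi> Y e] by blast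
  obtain h where h: "h \<in> G" and hg: "\<And>x. x \<in> lp p \<Longrightarrow> h (g x) = x" using G_inverse[OF g] by blast
  define \<omega>' where "\<omega>' = (\<lambda>S. adj h (\<omega> S))"
  have \<omega>': "\<omega>' S \<in> lp q" for S unfolding \<omega>'_def by (rule adj_lp[OF h \<omega>])
  define M where "M = (\<lambda>S. dnorm (\<phi> + \<omega>' S))"
  have gY: "pairing \<phi> (g Y) = (\<Sum>S\<in>P. of_real (t S) * pairing \<phi> (g (y S)))"
  proof -
    have e: "g Y = (\<Sum>S\<in>P. smul (of_real (t S)) (g (y S)))"
      unfolding Y_def G_sum[OF g lp_smul(1)[OF p1 y(1)]] G_smul[OF g y(1)] ..
    have "pairing \<phi> (g Y) = (\<Sum>S\<in>P. pairing \<phi> (smul (of_real (t S)) (g (y S))))"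
      unfolding e by (rule pair_sum_right[OF \<phi> lp_smul(1)[OF p1 G_lp[OF g y(1)]]])
    then show ?thesis by (simp only: pair_smul_right[OF \<phi> G_lp[OF g y(1)]])
  qed
  have split1: "pairing (\<phi> + \<omega>' S) (g (y S)) = pairing \<phi> (g (y S)) + pairing (\<omega> S) (y S)" for S
  proof -
    have "pairing (\<omega>' S) (g (y S)) = pairing (\<omega> S) (y S)"
      unfolding \<omega>'_def adj_pairing[OF h \<omega> G_lp[OF g y(1)]] hg[OF y(1)] ..
    then show ?thesis using pair_add_left[OF \<phi> \<omega>' G_lp[OF g y(1)]] by simp
  qed
  have split2: "pairing (\<omega> S) (y S) = of_real (\<rho> S) - pairing f (y S)" for S
    using pair_add_left[OF f \<omega> y(1), of S S] \<rho>(2)[of S] by simp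
  have "(\<Sum>S\<in>P. of_real (t S) * pairing (\<phi> + \<omega>' S) (g (y S))) =
      (\<Sum>S\<in>P. of_real (t S) * pairing \<phi> (g (y S)) + of_real (t S * \<rho> S) - of_real (t S) * pairing f (y S))"
    unfolding split1 split2 by (intro sum.cong refl) (simp add: algebra_simps)
  also have "\<dots> = pairing \<phi> (g Y) + of_real (\<Sum>S\<in>P. t S * \<rho> S) - pairing f Y"
    unfolding gY pY[OF f] by (simp add: sum.distrib sum_subtractf)
  also have "\<dots> = of_real (R + (\<Sum>S\<in>P. t S * \<rho> S)) - pairing f Y" by (simp add: R(2))
  finally have eqn: "(\<Sum>S\<in>P. of_real (t S) * pairing (\<phi> + \<omega>' S) (g (y S))) =
      of_real (R + (\<Sum>S\<in>P. t S * \<rho> S)) - pairing f Y" .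
  have "R + (\<Sum>S\<in>P. t S * \<rho> S) - norm (pairing f Y)
      \<le> norm (of_real (R + (\<Sum>S\<in>P. t S * \<rho> S)) - pairing f Y)"
    using norm_triangle_ineq2[of "of_real (R + (\<Sum>S\<in>P. t S * \<rho> S))" "pairing f Y"]
      abs_ge_self[of "R + (\<Sum>S\<in>P. t S * \<rho> S)"]
    unfolding norm_of_real by linarith
  also have "\<dots> \<le> (\<Sum>S\<in>P. t S * M S)"
    unfolding eqn[symmetric]
  proof (rule order_trans[OF norm_sum], rule sum_mono)
    fix S
    have "norm (pairing (\<phi> + \<omega>' S) (g (y S))) \<le> M S"
      unfolding M_def
      by (rule dnorm_upper1[OF lp_add(1)[OF q1 \<phi> \<omega>'] G_lp[OF g y(1)]]) (simp only: G_isometry[OF g y(1)] y(2))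
    then show "norm (of_real (t S) * pairing (\<phi> + \<omega>' S) (g (y S))) \<le> t S * M S"
      using t[of S] by (simp add: norm_mult mult_left_mono)
  qed
  finally have 1: "R + (\<Sum>S\<in>P. t S * \<rho> S) - norm (pairing f Y) \<le> avg N (\<lambda>S. \<theta> S * M S)"
    by (simp only: avg_t)
  have "norm (pairing f Y) \<le> dnorm \<phi> * \<mu> Y" unfolding eq by (rule dnorm_upper[OF f Y])
  then have 2: "(\<Sum>S\<in>P. t S * \<rho> S) - e \<le> avg N (\<lambda>S. \<theta> S * M S)" using 1 R(1) by linarith
  have "avg N (\<lambda>S. (\<theta> S)\<^sup>2 - e * \<theta> S) \<le> avg N (\<lambda>S. \<theta> S * \<rho> S)"
  proof (rule avg_mono)
    fix S
    have "\<theta> S * (\<theta> S - e) \<le> \<theta> S * \<rho> S" by (rule mult_left_mono[OF \<rho>(1) \<theta>])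
    then show "(\<theta> S)\<^sup>2 - e * \<theta> S \<le> \<theta> S * \<rho> S" by (simp add: power2_eq_square algebra_simps)
  qed
  then have 3: "avg N (\<lambda>S. (\<theta> S)\<^sup>2) - e * m \<le> (\<Sum>S\<in>P. t S * \<rho> S)"
    by (simp only: avg_diff avg_cmult avg_t m_def)
  have "avg N (\<lambda>S. 2 * (\<theta> S * M S)) \<le> avg N (\<lambda>S. (\<theta> S)\<^sup>2 + (M S)\<^sup>2)"
  proof (rule avg_mono)
    fix S
    show "2 * (\<theta> S * M S) \<le> (\<theta> S)\<^sup>2 + (M S)\<^sup>2"
      using zero_le_power2[of "\<theta> S - M S"] by (simp add: power2_diff)
  qed
  then have 4: "2 * avg N (\<lambda>S. \<theta> S * M S) \<le> avg N (\<lambda>S. (\<theta> S)\<^sup>2) + avg N (\<lambda>S. (M S)\<^sup>2)"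
    by (simp only: avg_cmult avg_add)
  have "1 + m \<noteq> 0" using m by simp
  then have "e * (2 * (1 + m)) = \<eta>" unfolding e_def by simp
  then have "2 * e + 2 * (e * m) = \<eta>" by (simp add: algebra_simps)
  then have fin: "avg N (\<lambda>S. (\<theta> S)\<^sup>2) - \<eta> \<le> avg N (\<lambda>S. (M S)\<^sup>2)" using 2 3 4 by linarith
  show ?thesis
  proof (intro exI[of _ "\<lambda>j. adj h (w j)"] conjI allI)
    show "adj h (w j) \<in> lp q" for j by (rule adj_lp[OF h w])
    show "dnorm (lincomb (\<lambda>j. adj h (w j)) a N) \<le> dnorm (lincomb w a N)" for a
      unfolding adj_lincomb[OF h w, symmetric] by (rule dnorm_adj[OF h lincomb_lp[OF q1 w]])
    show "avg N (\<lambda>S. (dnorm (f + lincomb w (\<lambda>j. rad j S) N))\<^sup>2) - \<eta>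
        \<le> avg N (\<lambda>S. (dnorm (\<phi> + lincomb (\<lambda>j. adj h (w j)) (\<lambda>j. rad j S) N))\<^sup>2)"
      unfolding adj_lincomb[OF h w, symmetric] using fin unfolding \<theta>_def M_def \<omega>'_def \<omega>_def .
  qed
qed

lemma q_not_gt_2: "\<not> q > 2"
proof
  assume "q > 2"
  interpret D: transitive_renorming q dnorm A
  proof
    show "2 < q" "0 < A" by (fact, rule A)
    fix x y :: "nat \<Rightarrow> 'a" and c :: 'a
    assume x: "x \<in> lp q"
    show "dnorm (smul c x) = norm c * dnorm x" by (rule dnorm_hom[OF x])
    show "lpn q x \<le> A * dnorm x" by (rule dnorm_lo[OF x])
    show "dnorm x \<le> A * lpn q x" by (rule dnorm_up[OF x])
    show "dnorm (x + y) \<le> dnorm x + dnorm y" if "y \<in> lp q" by (rule dnorm_tri[OF x that])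
    show "\<exists>z'. (\<forall>j. z' j \<in> lp q) \<and> (\<forall>a. dnorm (lincomb z' a N) \<le> dnorm (lincomb z a N)) \<and>
          avg N (\<lambda>S. (dnorm (x + lincomb z' (\<lambda>j. rad j S) N))\<^sup>2)
            \<ge> avg N (\<lambda>S. (dnorm (f + lincomb z (\<lambda>j. rad j S) N))\<^sup>2) - \<eta>"
      if "f \<in> lp q" "\<And>j. z j \<in> lp q" "dnorm x = dnorm f" "dnorm f > 0" "\<eta> > 0"
      for f z N \<eta>
      by (rule transfer_dual[OF x that(1-3,5)])
  qed
  show False by (rule D.contradiction)
qed

end

theorem (in lp_convex_transitive) p_eq_2: "p = 2"
proof (rule ccontr)
  assume "p \<noteq> 2"
  then have p2: "p < 2" using not_gt_2 by simp
  define q where "q = p / (p - 1)"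
  have "q > 2" using p p2 by (simp add: q_def field_simps)
  have "1 / p + 1 / q = 1" using p by (simp add: q_def field_simps)
  interpret lp_convex_transitive_dual p \<mu> A G q
    by unfold_locales (use \<open>q > 2\<close> in simp, fact)
  show False using q_not_gt_2 \<open>q > 2\<close> by blast
qed

section \<open>Geometry of the Hilbert space\<close>

lemma coord_add [simp]: "coord (x + y) n = coord x n + coord y n" by (simp add: plus_ell2.rep_eq)
lemma coord_zero [simp]: "coord 0 n = 0" by (simp add: zero_ell2.rep_eq)
lemma coord_uminus [simp]: "coord (- x) n = - coord x n" by (simp add: uminus_ell2.rep_eq)
lemma coord_diff [simp]: "coord (x - y) n = coord x n - coord y n"
  unfolding minus_ell2_def coord_add coord_uminus by simp
lemma coord_scale [simp]: "coord (ell2_scale c x) n = c * coord x n" by (simp add: ell2_scale.rep_eq)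
lemma coord_unit [simp]: "coord (ell2_unit k) n = (if n = k then 1 else 0)" by (simp add: ell2_unit.rep_eq)

lemma ell2_eqI: "(\<And>n. coord x n = coord y n) \<Longrightarrow> x = y"
  by (metis coord_inject ext)

lemma coord_sum [simp]: "coord (sum f I) n = (\<Sum>i\<in>I. coord (f i) n)"
  by (induction I rule: infinite_finite_induct) auto

lemma mem_lp_2: "x \<in> lp 2 \<longleftrightarrow> summable (\<lambda>n. (norm (x n))\<^sup>2)"
  by (simp add: lp_def)

lemma coord_lp: "coord x \<in> lp 2" by (simp add: mem_lp_2 ell2_summable)

lemma norm_ell2_eq: "norm x = lpn 2 (coord x)"
proof -
  have "(\<Sum>n. (norm (coord x n))\<^sup>2) \<ge> 0" by (rule suminf_nonneg[OF ell2_summable]) simp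
  then show ?thesis by (simp add: norm_ell2.rep_eq lpn_def powr_half_sqrt)
qed

lemma coord_Abs: "x \<in> lp 2 \<Longrightarrow> coord (Abs_ell2 x) = x"
  by (simp add: Abs_ell2_inverse mem_lp_2)

lemma coord_minus_fun: "coord (x - y) = coord x - coord y"
  by (rule ext) (simp add: minus_fun_app)

instance ell2 :: (rc_scalar) complete_space
proof
  fix X :: "nat \<Rightarrow> 'a ell2"
  assume X: "Cauchy X"
  have "\<exists>x\<in>lp 2. (\<lambda>n. lpn 2 (coord (X n) - x)) \<longlonglongrightarrow> 0"
  proof (rule lp_complete)
    fix e :: real assume "e > 0"
    then obtain N where "\<forall>m\<ge>N. \<forall>n\<ge>N. dist (X m) (X n) < e" using X unfolding Cauchy_def by blast
    then show "\<exists>N. \<forall>m\<ge>N. \<forall>n\<ge>N. lpn 2 (coord (X m) - coord (X n)) \<le> e"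
      by (metis coord_minus_fun dist_norm less_imp_le norm_ell2_eq)
  qed (auto simp: coord_lp)
  then obtain x where x: "x \<in> lp 2" "(\<lambda>n. lpn 2 (coord (X n) - x)) \<longlonglongrightarrow> 0" by blast
  have "norm (X n - Abs_ell2 x) = lpn 2 (coord (X n) - x)" for n
    by (simp only: norm_ell2_eq coord_minus_fun coord_Abs[OF x(1)])
  then have "(\<lambda>n. norm (X n - Abs_ell2 x)) \<longlonglongrightarrow> 0" using x(2) by (simp only:)
  then have "X \<longlonglongrightarrow> Abs_ell2 x" by (rule LIM_zero_cancel[OF tendsto_norm_zero_cancel])
  then show "convergent X" unfolding convergent_def by blast
qed

instance ell2 :: (rc_scalar) banach ..

interpretation ell2: vector_space ell2_scale by (rule vector_space_ell2_scale)

lemma sconj_scaleR: "sconj (r *\<^sub>R x) = r *\<^sub>R sconj (x::'k::rc_scalar)"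
  by (simp add: scaleR_conv_of_real sconj_mult)

lemma bounded_linear_sconj: "bounded_linear (sconj :: 'k::rc_scalar \<Rightarrow> 'k)"
  by (rule bounded_linear_intro[where K = 1]) (auto simp: sconj_add sconj_scaleR)

lemma sconj_one [simp]: "sconj 1 = (1::'k::rc_scalar)" using sconj_of_real[of 1] by simp

lemma sconj_lp: "(\<lambda>n. sconj (coord y n)) \<in> lp 2" "lpn 2 (\<lambda>n. sconj (coord y n)) = norm y"
  by (simp_all add: mem_lp_2 ell2_summable norm_ell2_eq lpn_def)

notation ell2_inner ("\<langle>_,/ _\<rangle>")

lemma inner_eq_pairing: "\<langle>x, y\<rangle> = pairing (coord x) (\<lambda>n. sconj (coord y n))"
  by (simp add: ell2_inner_def pairing_def)

lemma inner_summable: "summable (\<lambda>n. coord x n * sconj (coord y n))"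
  by (rule pairing_bound(1)[of 2 2]) (auto simp: coord_lp sconj_lp)

lemma Cauchy_Schwarz: "norm \<langle>x, y\<rangle> \<le> norm x * norm y"
  unfolding inner_eq_pairing
  by (rule order_trans[OF pairing_bound(2)[of 2 2]]) (auto simp: coord_lp sconj_lp norm_ell2_eq)

lemma inner_add_left: "\<langle>x + y, z\<rangle> = \<langle>x, z\<rangle> + \<langle>y, z\<rangle>"
  unfolding ell2_inner_def by (simp add: distrib_right suminf_add inner_summable)

lemma inner_add_right: "\<langle>x, y + z\<rangle> = \<langle>x, y\<rangle> + \<langle>x, z\<rangle>"
  unfolding ell2_inner_def by (simp add: distrib_left sconj_add suminf_add inner_summable)

lemma inner_scale_left: "\<langle>ell2_scale c x, y\<rangle> = c * \<langle>x, y\<rangle>"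
  unfolding ell2_inner_def by (simp add: mult.assoc suminf_mult inner_summable)

lemma inner_scale_right: "\<langle>x, ell2_scale c y\<rangle> = sconj c * \<langle>x, y\<rangle>"
  unfolding ell2_inner_def
  by (simp add: sconj_mult mult.left_commute[of _ "sconj c"] suminf_mult inner_summable)

lemma inner_commute: "\<langle>y, x\<rangle> = sconj \<langle>x, y\<rangle>"
  unfolding ell2_inner_def bounded_linear.suminf[OF bounded_linear_sconj inner_summable]
  by (simp add: sconj_mult mult.commute)

lemma bounded_bilinear_inner: "bounded_bilinear (ell2_inner :: 'k::rc_scalar ell2 \<Rightarrow> _)"
proof
  show "\<exists>K. \<forall>a b :: 'k ell2. norm \<langle>a, b\<rangle> \<le> norm a * norm b * K"
    by (rule exI[of _ 1]) (simp add: Cauchy_Schwarz)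
qed (simp_all add: inner_add_left inner_add_right scaleR_ell2_def inner_scale_left inner_scale_right
    scaleR_conv_of_real)

interpretation inner: bounded_bilinear "ell2_inner :: 'k::rc_scalar ell2 \<Rightarrow> _"
  by (rule bounded_bilinear_inner)

lemma inner_self: "\<langle>x, x\<rangle> = of_real ((norm x)\<^sup>2)"
proof -
  have "\<langle>x, x\<rangle> = (\<Sum>n. of_real ((norm (coord x n))\<^sup>2))"
    unfolding ell2_inner_def by (simp only: sconj_mult_self')
  also have "\<dots> = of_real (\<Sum>n. (norm (coord x n))\<^sup>2)"
    by (rule suminf_of_real[OF ell2_summable, symmetric])
  also have "(\<Sum>n. (norm (coord x n))\<^sup>2) = (norm x)\<^sup>2"
    by (simp add: norm_ell2.rep_eq suminf_nonneg ell2_summable)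
  finally show ?thesis .
qed

lemma inner_unit: "\<langle>x, ell2_unit n\<rangle> = coord x n"
proof -
  have "\<langle>x, ell2_unit n\<rangle> = (\<Sum>m. if m = n then coord x m else 0)"
    unfolding ell2_inner_def by (intro suminf_cong) simp
  also have "\<dots> = (\<Sum>m\<in>{n}. if m = n then coord x m else 0)" by (rule suminf_finite) auto
  finally show ?thesis by simp
qed

lemma norm_unit [simp]: "norm (ell2_unit n :: 'k::rc_scalar ell2) = 1"
proof -
  have "of_real ((norm (ell2_unit n :: 'k ell2))\<^sup>2) = (of_real 1 :: 'k)"
    by (simp only: inner_self[symmetric] inner_unit) simp
  then show ?thesis by (simp only: of_real_eq_iff) (simp add: abs_square_eq_1)
qed

lemma inner_eqI: assumes "\<And>z. \<langle>z, x\<rangle> = \<langle>z, y\<rangle>" shows "x = y"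
proof (rule ell2_eqI)
  fix n
  have "\<langle>x, ell2_unit n\<rangle> = \<langle>y, ell2_unit n\<rangle>" using assms by (metis inner_commute)
  then show "coord x n = coord y n" by (simp only: inner_unit)
qed

lemma parallelogram:
  fixes x y :: "'k::rc_scalar ell2"
  shows "(norm (x + y))\<^sup>2 + (norm (x - y))\<^sup>2 = 2 * (norm x)\<^sup>2 + 2 * (norm y)\<^sup>2"
proof -
  have "of_real ((norm (x + y))\<^sup>2 + (norm (x - y))\<^sup>2) = (of_real (2 * (norm x)\<^sup>2 + 2 * (norm y)\<^sup>2) :: 'k)"
    by (simp only: of_real_add of_real_mult inner_self[symmetric] inner.add_left inner.add_right
        inner.diff_left inner.diff_right) simp
  then show ?thesis by (simp only: of_real_eq_iff)
qed

definition orthosystem :: "'i set \<Rightarrow> ('i \<Rightarrow> 'k::rc_scalar ell2) \<Rightarrow> bool" where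
  "orthosystem I u \<longleftrightarrow> (\<forall>i\<in>I. \<forall>j\<in>I. i \<noteq> j \<longrightarrow> \<langle>u i, u j\<rangle> = 0) \<and> (\<forall>i\<in>I. u i = 0 \<or> norm (u i) = 1)"

lemma orthosystem_subset: "orthosystem I u \<Longrightarrow> J \<subseteq> I \<Longrightarrow> orthosystem J u"
  unfolding orthosystem_def by blast

lemma orthosystemD:
  assumes "orthosystem I u"
  shows "i \<in> I \<Longrightarrow> j \<in> I \<Longrightarrow> i \<noteq> j \<Longrightarrow> \<langle>u i, u j\<rangle> = 0"
    "i \<in> I \<Longrightarrow> u i = 0 \<or> norm (u i) = 1" "i \<in> I \<Longrightarrow> norm (u i) \<le> 1"
  using assms unfolding orthosystem_def by auto

lemma inner_sum_orthosystem:
  assumes u: "orthosystem I u" and F: "finite F" "F \<subseteq> I" and k: "k \<in> I"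
  shows "\<langle>\<Sum>i\<in>F. ell2_scale (c i) (u i), u k\<rangle> = (if k \<in> F then c k * of_real ((norm (u k))\<^sup>2) else 0)"
proof -
  have "\<langle>\<Sum>i\<in>F. ell2_scale (c i) (u i), u k\<rangle> = (\<Sum>i\<in>F. c i * \<langle>u i, u k\<rangle>)"
    by (simp add: inner.sum_left inner_scale_left)
  also have "\<dots> = (\<Sum>i\<in>F. if i = k then c k * of_real ((norm (u k))\<^sup>2) else 0)"
    using F k by (intro sum.cong refl) (auto simp: orthosystemD(1)[OF u] inner_self)
  finally show ?thesis using F by simp
qed

lemma norm_sum_orthosystem:
  assumes u: "orthosystem I u" and F: "finite F" "F \<subseteq> I"
  shows "(norm (\<Sum>i\<in>F. ell2_scale (c i) (u i)))\<^sup>2 = (\<Sum>i\<in>F. (norm (c i))\<^sup>2 * (norm (u i))\<^sup>2)"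
proof -
  let ?y = "\<Sum>i\<in>F. ell2_scale (c i) (u i)"
  have "of_real ((norm ?y)\<^sup>2) = \<langle>?y, ?y\<rangle>" by (simp only: inner_self)
  also have "\<dots> = (\<Sum>k\<in>F. sconj (c k) * \<langle>?y, u k\<rangle>)"
    by (simp add: inner.sum_right inner_scale_right)
  also have "\<dots> = (\<Sum>k\<in>F. sconj (c k) * (c k * of_real ((norm (u k))\<^sup>2)))"
    by (intro sum.cong refl) (use F in \<open>auto simp: inner_sum_orthosystem[OF u F] simp del: of_real_power\<close>)
  also have "\<dots> = of_real (\<Sum>i\<in>F. (norm (c i))\<^sup>2 * (norm (u i))\<^sup>2)"
    by (simp only: mult.assoc[symmetric] sconj_mult_self of_real_sum of_real_mult)
  finally show ?thesis by (simp only: of_real_eq_iff)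
qed

lemma bessel:
  fixes u :: "'i \<Rightarrow> 'k::rc_scalar ell2"
  assumes u: "orthosystem I u" and F: "finite F" "F \<subseteq> I"
  shows "(\<Sum>i\<in>F. (norm \<langle>x, u i\<rangle>)\<^sup>2) \<le> (norm x)\<^sup>2"
proof -
  define y where "y = (\<Sum>i\<in>F. ell2_scale \<langle>x, u i\<rangle> (u i))"
  define B where "B = (\<Sum>i\<in>F. (norm \<langle>x, u i\<rangle>)\<^sup>2)"
  have "(norm y)\<^sup>2 = (\<Sum>i\<in>F. (norm \<langle>x, u i\<rangle>)\<^sup>2 * (norm (u i))\<^sup>2)"
    unfolding y_def by (rule norm_sum_orthosystem[OF u F])
  also have "\<dots> = B"
    unfolding B_def
  proof (rule sum.cong[OF refl])
    fix i assume "i \<in> F"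
    then have "u i = 0 \<or> norm (u i) = 1" using orthosystemD(2)[OF u, of i] F by blast
    then show "(norm \<langle>x, u i\<rangle>)\<^sup>2 * (norm (u i))\<^sup>2 = (norm \<langle>x, u i\<rangle>)\<^sup>2"
      by (auto simp: inner.zero_right)
  qed
  finally have ny: "(norm y)\<^sup>2 = B" .
  have "\<langle>x, y\<rangle> = (\<Sum>i\<in>F. sconj \<langle>x, u i\<rangle> * \<langle>x, u i\<rangle>)"
    unfolding y_def by (simp add: inner.sum_right inner_scale_right)
  also have "\<dots> = of_real B" by (simp only: sconj_mult_self B_def of_real_sum)
  finally have xy: "\<langle>x, y\<rangle> = of_real B" .
  then have yx: "\<langle>y, x\<rangle> = of_real B" by (metis inner_commute sconj_of_real)
  have "(of_real ((norm (x - y))\<^sup>2) :: 'k) = of_real ((norm x)\<^sup>2) - of_real B - of_real B + of_real ((norm y)\<^sup>2)"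
    by (simp only: inner_self[symmetric] inner.diff_left inner.diff_right xy yx) simp
  also have "\<dots> = of_real ((norm x)\<^sup>2 - B)" by (simp only: ny) simp
  finally have "(norm (x - y))\<^sup>2 = (norm x)\<^sup>2 - B" by (simp only: of_real_eq_iff)
  then show ?thesis unfolding B_def[symmetric] by (metis diff_ge_0_iff_ge zero_le_power2)
qed

lemma bessel_summable:
  fixes u :: "nat \<Rightarrow> _"
  assumes u: "orthosystem UNIV u"
  shows "summable (\<lambda>i. (norm \<langle>x, u i\<rangle>)\<^sup>2)" "(\<Sum>i. (norm \<langle>x, u i\<rangle>)\<^sup>2) \<le> (norm x)\<^sup>2"
proof -
  show s: "summable (\<lambda>i. (norm \<langle>x, u i\<rangle>)\<^sup>2)"
    by (rule summableI_nonneg_bounded[where x = "(norm x)\<^sup>2"]) (use bessel[OF u] in auto)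
  show "(\<Sum>i. (norm \<langle>x, u i\<rangle>)\<^sup>2) \<le> (norm x)\<^sup>2"
    by (rule suminf_le_const[OF s]) (use bessel[OF u] in auto)
qed

lemma orthosystem_sums:
  fixes u :: "nat \<Rightarrow> 'k::rc_scalar ell2"
  assumes u: "orthosystem UNIV u" and c: "summable (\<lambda>i. (norm (c i))\<^sup>2)"
  shows "summable (\<lambda>i. ell2_scale (c i) (u i))"
    "\<langle>(\<Sum>i. ell2_scale (c i) (u i)), u k\<rangle> = c k * of_real ((norm (u k))\<^sup>2)"
    "(norm (\<Sum>i. ell2_scale (c i) (u i)))\<^sup>2 \<le> (\<Sum>i. (norm (c i))\<^sup>2)"
proof -
  have nle: "(norm (\<Sum>i\<in>F. ell2_scale (c i) (u i)))\<^sup>2 \<le> (\<Sum>i\<in>F. (norm (c i))\<^sup>2)" if F: "finite F" for F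
  proof -
    have "(norm (c i))\<^sup>2 * (norm (u i))\<^sup>2 \<le> (norm (c i))\<^sup>2 * 1" for i
      using orthosystemD(3)[OF u] by (intro mult_left_mono) (auto simp: power_le_one)
    then show ?thesis unfolding norm_sum_orthosystem[OF u F subset_UNIV] by (intro sum_mono) simp
  qed
  show s: "summable (\<lambda>i. ell2_scale (c i) (u i))"
    unfolding summable_Cauchy
  proof (intro allI impI)
    fix e :: real assume e: "e > 0"
    then obtain N where N: "\<And>m n. m \<ge> N \<Longrightarrow> norm (\<Sum>i=m..<n. (norm (c i))\<^sup>2) < e\<^sup>2"
      using c unfolding summable_Cauchy by (metis zero_less_power)
    have "norm (\<Sum>i=m..<n. ell2_scale (c i) (u i)) < e" if "m \<ge> N" for m n
    proof -
      have "(norm (\<Sum>i=m..<n. ell2_scale (c i) (u i)))\<^sup>2 < e\<^sup>2"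
        using N[OF that, of n] nle[of "{m..<n}"] by simp
      then show ?thesis using e by (simp add: power2_less_imp_less)
    qed
    then show "\<exists>N. \<forall>m\<ge>N. \<forall>n. norm (\<Sum>i=m..<n. ell2_scale (c i) (u i)) < e" by blast
  qed
  have "(\<lambda>n. \<langle>\<Sum>i<n. ell2_scale (c i) (u i), u k\<rangle>) \<longlonglongrightarrow> \<langle>(\<Sum>i. ell2_scale (c i) (u i)), u k\<rangle>"
    by (intro inner.tendsto summable_LIMSEQ[OF s] tendsto_const)
  moreover have "(\<lambda>n. \<langle>\<Sum>i<n. ell2_scale (c i) (u i), u k\<rangle>) \<longlonglongrightarrow> c k * of_real ((norm (u k))\<^sup>2)"
    unfolding inner_sum_orthosystem[OF u finite_lessThan subset_UNIV UNIV_I]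
    by (rule tendsto_eventually) (auto simp: eventually_sequentially intro: exI[of _ "Suc k"])
  ultimately show "\<langle>(\<Sum>i. ell2_scale (c i) (u i)), u k\<rangle> = c k * of_real ((norm (u k))\<^sup>2)"
    by (rule LIMSEQ_unique)
  have "(\<lambda>n. (norm (\<Sum>i<n. ell2_scale (c i) (u i)))\<^sup>2) \<longlonglongrightarrow> (norm (\<Sum>i. ell2_scale (c i) (u i)))\<^sup>2"
    by (intro tendsto_intros summable_LIMSEQ[OF s])
  then show "(norm (\<Sum>i. ell2_scale (c i) (u i)))\<^sup>2 \<le> (\<Sum>i. (norm (c i))\<^sup>2)"
  proof (rule tendsto_upperbound)
    show "\<forall>\<^sub>F n in sequentially. (norm (\<Sum>i<n. ell2_scale (c i) (u i)))\<^sup>2 \<le> (\<Sum>i. (norm (c i))\<^sup>2)"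
      by (intro always_eventually allI order_trans[OF nle] sum_le_suminf[OF c]) auto
  qed simp
qed

lemma expansion_orthogonal:
  fixes u :: "nat \<Rightarrow> 'k::rc_scalar ell2"
  assumes u: "orthosystem UNIV u"
  shows "\<langle>x - (\<Sum>i. ell2_scale \<langle>x, u i\<rangle> (u i)), u k\<rangle> = 0"
proof -
  have "u k = 0 \<or> norm (u k) = 1" using orthosystemD(2)[OF u] by simp
  then have "\<langle>x, u k\<rangle> * of_real ((norm (u k))\<^sup>2) = \<langle>x, u k\<rangle>" by (auto simp: inner.zero_right)
  then show ?thesis
    using orthosystem_sums(2)[OF u bessel_summable(1)[OF u], of x k] by (simp add: inner.diff_left)
qed

lemma orthobasis_expansion:
  fixes u :: "nat \<Rightarrow> 'k::rc_scalar ell2"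
  assumes u: "orthosystem UNIV u" and total: "\<And>x. (\<And>i. \<langle>x, u i\<rangle> = 0) \<Longrightarrow> x = 0"
  shows "(\<lambda>i. ell2_scale \<langle>x, u i\<rangle> (u i)) sums x" "(\<lambda>i. (norm \<langle>x, u i\<rangle>)\<^sup>2) sums (norm x)\<^sup>2"
proof -
  let ?s = "\<Sum>i. ell2_scale \<langle>x, u i\<rangle> (u i)"
  have "x - ?s = 0" by (rule total) (rule expansion_orthogonal[OF u])
  then have x: "?s = x" by simp
  then show "(\<lambda>i. ell2_scale \<langle>x, u i\<rangle> (u i)) sums x"
    using orthosystem_sums(1)[OF u bessel_summable(1)[OF u], of x] by (metis summable_sums)
  have "(norm x)\<^sup>2 \<le> (\<Sum>i. (norm \<langle>x, u i\<rangle>)\<^sup>2)"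
    using orthosystem_sums(3)[OF u bessel_summable(1)[OF u], of x] by (simp only: x)
  then have "(\<Sum>i. (norm \<langle>x, u i\<rangle>)\<^sup>2) = (norm x)\<^sup>2" using bessel_summable(2)[OF u, of x] by simp
  then show "(\<lambda>i. (norm \<langle>x, u i\<rangle>)\<^sup>2) sums (norm x)\<^sup>2"
    using bessel_summable(1)[OF u, of x] by (metis summable_sums)
qed

text \<open>By Bessel's inequality for the n-th unit vector, only finitely many members have an n-th
  coordinate above a given threshold, and every nonzero vector exceeds one of countably many
  thresholds at some coordinate.\<close>

lemma orthonormal_set_countable:
  fixes U :: "'k::rc_scalar ell2 set"
  assumes o: "orthosystem U (\<lambda>u. u)" and n: "\<And>u. u \<in> U \<Longrightarrow> u \<noteq> 0"
  shows "countable U"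
proof -
  define V where "V = (\<lambda>n m. {u \<in> U. norm (coord u n) > 1 / real (Suc m)})"
  have "finite (V n m)" for n m
  proof (rule ccontr)
    assume "infinite (V n m)"
    then obtain F where F: "F \<subseteq> V n m" "finite F" "card F = (Suc m)\<^sup>2 + 1"
      by (meson infinite_arbitrarily_large)
    have "(\<Sum>u\<in>F. (1 / real (Suc m))\<^sup>2) \<le> (\<Sum>u\<in>F. (norm \<langle>ell2_unit n, u\<rangle>)\<^sup>2)"
    proof (rule sum_mono)
      fix u assume "u \<in> F"
      then have "1 / real (Suc m) \<le> norm (coord u n)" using F(1) by (auto simp: V_def)
      also have "norm (coord u n) = norm \<langle>ell2_unit n, u\<rangle>"
        by (metis inner_commute inner_unit norm_sconj)
      finally show "(1 / real (Suc m))\<^sup>2 \<le> (norm \<langle>ell2_unit n, u\<rangle>)\<^sup>2" by (intro power_mono) auto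
    qed
    also have "\<dots> \<le> (norm (ell2_unit n :: 'k ell2))\<^sup>2"
      using bessel[OF o F(2), of "ell2_unit n"] F(1) by (auto simp: V_def)
    also have "\<dots> = 1" by simp
    finally have "real (card F) * (1 / real (Suc m))\<^sup>2 \<le> 1" by simp
    then have "real (card F) \<le> (real (Suc m))\<^sup>2" by (simp add: power_divide divide_le_eq)
    then have "real (card F) \<le> real ((Suc m)\<^sup>2)" by simp
    then show False unfolding of_nat_le_iff F(3) by simp
  qed
  then have "countable (\<Union>n m. V n m)" by (intro countable_UN) (auto intro: countable_finite)
  moreover have "U \<subseteq> (\<Union>n m. V n m)"
  proof
    fix u assume u: "u \<in> U"
    then have "\<exists>n. coord u n \<noteq> 0" using n[OF u] ell2_eqI[of u 0] by auto
    then obtain n where "norm (coord u n) > 0" by auto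
    then obtain m where "norm (coord u n) > 1 / real (Suc m)" by (metis nat_approx_posE)
    then show "u \<in> (\<Union>n m. V n m)" using u by (auto simp: V_def)
  qed
  ultimately show ?thesis by (rule countable_subset[rotated])
qed

text \<open>Zorn's lemma for orthonormal subsets of Q. Keeping Q general covers two uses: the unit
  eigenvectors of an operator, and the unit sphere of a subspace. The final alternative lets an
  infinite system be recognized as one without zero vectors.\<close>

lemma maximal_orthosystem:
  fixes Q :: "'k::rc_scalar ell2 set"
  assumes Q: "\<And>q. q \<in> Q \<Longrightarrow> norm q = 1"
  shows "\<exists>u :: nat \<Rightarrow> 'k ell2. orthosystem UNIV u \<and> range u \<subseteq> insert 0 Q \<and> (\<forall>q\<in>Q. \<exists>i. \<langle>q, u i\<rangle> \<noteq> 0) \<and>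
    ((\<forall>i. u i \<noteq> 0) \<or> finite (range u))"
proof -
  define \<A> where "\<A> = {U. U \<subseteq> Q \<and> (\<forall>x\<in>U. \<forall>y\<in>U. x \<noteq> y \<longrightarrow> \<langle>x, y\<rangle> = 0)}"
  have "\<exists>M\<in>\<A>. \<forall>X\<in>\<A>. M \<subseteq> X \<longrightarrow> X = M"
  proof (rule subset_Zorn')
    fix C assume C: "subset.chain \<A> C"
    show "\<Union>C \<in> \<A>"
      unfolding \<A>_def
    proof (intro CollectI conjI ballI impI)
      show "\<Union>C \<subseteq> Q" using C unfolding subset.chain_def \<A>_def by blast
      fix x y assume "x \<in> \<Union>C" "y \<in> \<Union>C" "x \<noteq> y"
      then obtain X Y where XY: "X \<in> C" "x \<in> X" "Y \<in> C" "y \<in> Y" by blast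
      then have "X \<subseteq> Y \<or> Y \<subseteq> X" "X \<in> \<A>" "Y \<in> \<A>" using C unfolding subset_chain_def by blast+
      then show "\<langle>x, y\<rangle> = 0" using XY \<open>x \<noteq> y\<close> unfolding \<A>_def by blast
    qed
  qed
  then obtain U where U: "U \<in> \<A>" and max: "\<And>X. X \<in> \<A> \<Longrightarrow> U \<subseteq> X \<Longrightarrow> X = U" by blast
  have UQ: "U \<subseteq> Q" and orth: "\<And>x y. x \<in> U \<Longrightarrow> y \<in> U \<Longrightarrow> x \<noteq> y \<Longrightarrow> \<langle>x, y\<rangle> = 0"
    using U unfolding \<A>_def by auto
  have oU: "orthosystem U (\<lambda>u. u)" unfolding orthosystem_def using orth UQ Q by auto
  have U0: "u \<noteq> 0" if "u \<in> U" for u using that UQ Q by force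
  have cU: "countable U" by (rule orthonormal_set_countable[OF oU U0])
  define u where "u = (\<lambda>i. if i \<in> to_nat_on U ` U then from_nat_into U i else 0)"
  have inj: "inj_on (to_nat_on U) U" by (rule inj_on_to_nat_on[OF cU])
  have uU: "u (to_nat_on U x) = x" if "x \<in> U" for x using that cU by (simp add: u_def)
  have ui: "u i = 0 \<or> (\<exists>x\<in>U. i = to_nat_on U x \<and> u i = x)" for i
    using uU by (cases "i \<in> to_nat_on U ` U") (auto simp: u_def)
  have "orthosystem UNIV u"
    unfolding orthosystem_def
  proof (intro conjI ballI impI)
    fix i j :: nat assume "i \<noteq> j"
    then show "\<langle>u i, u j\<rangle> = 0" using ui[of i] ui[of j] orth by (metis inner.zero_left inner.zero_right)
  next
    fix i show "u i = 0 \<or> norm (u i) = 1" using ui[of i] UQ Q by auto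
  qed
  moreover have "range u \<subseteq> insert 0 Q" using ui UQ by blast
  moreover have "\<forall>q\<in>Q. \<exists>i. \<langle>q, u i\<rangle> \<noteq> 0"
  proof (intro ballI, rule ccontr)
    fix q assume q: "q \<in> Q" "\<nexists>i. \<langle>q, u i\<rangle> \<noteq> 0"
    then have qU: "\<langle>q, x\<rangle> = 0" if "x \<in> U" for x using uU[OF that] by metis
    then have xq: "\<langle>x, q\<rangle> = 0" if "x \<in> U" for x using that by (metis inner_commute sconj_zero)
    have "insert q U \<in> \<A>" using q(1) UQ orth qU xq unfolding \<A>_def by auto
    then have "q \<in> U" using max by blast
    then have "\<langle>q, q\<rangle> = 0" by (rule qU)
    then show False using Q[OF q(1)] by (simp add: inner_self)
  qed
  moreover have "(\<forall>i. u i \<noteq> 0) \<or> finite (range u)"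
  proof (cases "finite U")
    case True
    have "range u \<subseteq> insert 0 U" using ui by blast
    then show ?thesis using True finite_subset by blast
  next
    case False
    then have "bij_betw (to_nat_on U) U UNIV" by (rule to_nat_on_infinite[OF cU])
    then have "to_nat_on U ` U = UNIV" by (simp add: bij_betw_def)
    then have "\<exists>x\<in>U. i = to_nat_on U x" for i by blast
    then show ?thesis using uU U0 by metis
  qed
  ultimately show ?thesis by blast
qed

section \<open>Adjoints and the singular value decomposition\<close>

lemma orthosystem_unit: "orthosystem I (ell2_unit :: nat \<Rightarrow> 'k::rc_scalar ell2)"
  by (auto simp: orthosystem_def inner_unit)

lemma ell2_expansion: "(\<lambda>n. ell2_scale (coord x n) (ell2_unit n)) sums (x :: 'k::rc_scalar ell2)"
  using orthobasis_expansion(1)[OF orthosystem_unit, of x] by (simp add: inner_unit ell2_eqI)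

lemma blinfun_sums: "f sums x \<Longrightarrow> (\<lambda>n. blinfun_apply T (f n)) sums T x"
  by (rule bounded_linear.sums[OF blinfun.bounded_linear_right])

lemma scalar_linearD: "scalar_linear T \<Longrightarrow> T (ell2_scale c x) = ell2_scale c (T x)"
  by (simp add: scalar_linear_def)

text \<open>The coordinates of the adjoint at y are dictated by the images of the unit vectors.
  Their bounded action on finitely supported sequences puts them into the Hilbert space, by the
  converse of Hoelder's inequality at exponent 2.\<close>

lemma adjoint_exists:
  fixes T :: "'k::rc_scalar ell2_op"
  assumes T: "scalar_linear T"
  shows "\<exists>S :: 'k ell2_op. scalar_linear S \<and> (\<forall>x y. \<langle>T x, y\<rangle> = \<langle>x, S y\<rangle>)"
proof -
  define b where "b = (\<lambda>y n. \<langle>T (ell2_unit n), y\<rangle>)"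
  have fin: "norm (\<Sum>k<n. b y k * a k) \<le> norm T * norm y * lpn 2 a"
    if a: "\<And>k. k \<ge> n \<Longrightarrow> a k = 0" for n a y
  proof -
    define x where "x = (\<Sum>k<n. ell2_scale (a k) (ell2_unit k))"
    have "coord x = a"
    proof (rule ext)
      fix i
      have "coord x i = (\<Sum>k<n. if k = i then a i else 0)"
        unfolding x_def coord_sum by (intro sum.cong) auto
      also have "\<dots> = a i" using a[of i] by (simp add: not_less)
      finally show "coord x i = a i" .
    qed
    then have nx: "norm x = lpn 2 a" by (simp add: norm_ell2_eq)
    have "T x = (\<Sum>k<n. ell2_scale (a k) (T (ell2_unit k)))"
      by (simp add: x_def blinfun.sum_right scalar_linearD[OF T])
    then have "(\<Sum>k<n. b y k * a k) = \<langle>T x, y\<rangle>"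
      by (simp add: inner.sum_left inner_scale_left b_def mult.commute)
    also have "norm \<dots> \<le> norm (T x) * norm y" by (rule Cauchy_Schwarz)
    also have "\<dots> \<le> (norm T * norm x) * norm y" by (intro mult_right_mono norm_blinfun) auto
    finally show ?thesis by (simp add: nx mult_ac)
  qed
  have b: "b y \<in> lp 2" "lpn 2 (b y) \<le> norm T * norm y" for y
    using lp_of_bounded_functional[of 2 2 "norm T * norm y" "b y"] fin[where y = y] by auto
  define S where "S = (\<lambda>y. Abs_ell2 (\<lambda>n. sconj (b y n)))"
  have "(\<lambda>n. sconj (b y n)) \<in> lp 2" for y using b(1)[of y] by (simp add: mem_lp_2)
  then have cS: "coord (S y) n = sconj (b y n)" for y n unfolding S_def by (simp only: coord_Abs)
  then have cS': "coord (S y) n = \<langle>y, T (ell2_unit n)\<rangle>" for y n by (simp add: b_def inner_commute[of y])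
  have nS: "norm (S y) \<le> norm T * norm y" for y
  proof -
    have "norm (S y) = lpn 2 (b y)" unfolding norm_ell2_eq lpn_def cS by simp
    then show ?thesis using b(2)[of y] by simp
  qed
  have bl: "bounded_linear S"
    by (rule bounded_linear_intro[where K = "norm T"])
      (use nS in \<open>auto intro!: ell2_eqI simp: cS' inner.add_left inner.scaleR_left scaleR_ell2_def inner_scale_left mult.commute\<close>)
  have SS: "blinfun_apply (Blinfun S) y = S y" for y by (simp add: bounded_linear_Blinfun_apply[OF bl])
  have "scalar_linear (Blinfun S)"
    unfolding scalar_linear_def SS by (auto intro!: ell2_eqI simp: cS' inner_scale_left)
  moreover have "\<langle>T x, y\<rangle> = \<langle>x, S y\<rangle>" for x y
  proof -
    have "(\<lambda>n. \<langle>T (ell2_scale (coord x n) (ell2_unit n)), y\<rangle>) sums \<langle>T x, y\<rangle>"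
      by (rule bounded_linear.sums[OF inner.bounded_linear_left blinfun_sums[OF ell2_expansion]])
    then have "(\<lambda>n. coord x n * sconj (coord (S y) n)) sums \<langle>T x, y\<rangle>"
      by (simp add: scalar_linearD[OF T] inner_scale_left cS b_def)
    then show ?thesis by (simp add: ell2_inner_def sums_iff)
  qed
  ultimately show ?thesis using SS by (intro exI[of _ "Blinfun S"]) auto
qed

lemma hilbert_adjointI:
  fixes T S :: "'k::rc_scalar ell2_op"
  assumes "\<And>x y. \<langle>T x, y\<rangle> = \<langle>x, S y\<rangle>"
  shows "hilbert_adjoint T = S"
  unfolding hilbert_adjoint_def
proof (rule the_equality)
  fix R :: "'k ell2_op" assume "\<forall>x y. \<langle>T x, y\<rangle> = \<langle>x, R y\<rangle>"
  then have "R y = S y" for y using assms by (intro inner_eqI) metis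
  then show "R = S" by (rule blinfun_eqI)
qed (use assms in auto)

lemma hilbert_adjoint:
  assumes "scalar_linear T"
  shows "\<langle>T x, y\<rangle> = \<langle>x, hilbert_adjoint T y\<rangle>" "scalar_linear (hilbert_adjoint T)"
  using adjoint_exists[OF assms] hilbert_adjointI[of T] by metis+

text \<open>Elements of the operator type are only real linear, so agreement is required at all
  scalar multiples of the basis. The description in \<open>powr_op\<close> ranges over such
  operators.\<close>

lemma blinfun_eq_on_basis:
  fixes S T :: "'k::rc_scalar ell2_op"
  assumes u: "orthosystem UNIV u" and total: "\<And>x. (\<And>i::nat. \<langle>x, u i\<rangle> = 0) \<Longrightarrow> x = 0"
    and eq: "\<And>c i. S (ell2_scale c (u i)) = T (ell2_scale c (u i))"
  shows "S = T"
proof (rule blinfun_eqI)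
  fix x
  have "(\<lambda>i. S (ell2_scale \<langle>x, u i\<rangle> (u i))) sums S x" "(\<lambda>i. T (ell2_scale \<langle>x, u i\<rangle> (u i))) sums T x"
    by (rule blinfun_sums[OF orthobasis_expansion(1)[OF u total]]; assumption)+
  then show "S x = T x" unfolding eq by (rule sums_unique2)
qed

lemma adjoint_op_op_inner:
  "scalar_linear T \<Longrightarrow> \<langle>hilbert_adjoint T (T x), y\<rangle> = \<langle>T x, T y\<rangle>"
  by (metis hilbert_adjoint(1) inner_commute)

text \<open>Take a maximal orthonormal system of eigenvectors of \<open>C\<close>, the product of
  the adjoint of T with T, and let H be its orthogonal complement, which C maps into itself. If H
  were nonzero, the supremum \<sigma> of \<open>norm (T z)\<close> over the unit ball of H would be
  attained by compactness, at a unit vector that is an eigenvector of C for \<sigma>^2, against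
  maximality; for \<sigma> = 0 every unit vector of H is one.\<close>

lemma spectral_basis:
  fixes T :: "'k::rc_scalar ell2_op"
  assumes T: "scalar_linear T" and c: "compact_op T"
  shows "\<exists>(u :: nat \<Rightarrow> 'k ell2) s. orthosystem UNIV u \<and> (\<forall>x. (\<forall>i. \<langle>x, u i\<rangle> = 0) \<longrightarrow> x = 0) \<and>
    (\<forall>i. s i \<ge> (0::real) \<and> (u i = 0 \<longrightarrow> s i = 0) \<and> hilbert_adjoint T (T (u i)) = (s i)\<^sup>2 *\<^sub>R u i)"
proof -
  define C where "C = (\<lambda>x. hilbert_adjoint T (T x))"
  have Cin: "\<langle>C x, y\<rangle> = \<langle>T x, T y\<rangle>" "\<langle>x, C y\<rangle> = \<langle>T x, T y\<rangle>" for x y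
    unfolding C_def using adjoint_op_op_inner[OF T] hilbert_adjoint(1)[OF T] by metis+
  define Q where "Q = {q. norm q = 1 \<and> (\<exists>s\<ge>0. C q = (s::real)\<^sup>2 *\<^sub>R q)}"
  obtain u :: "nat \<Rightarrow> 'k ell2" where u: "orthosystem UNIV u" "range u \<subseteq> insert 0 Q"
    and max: "\<forall>q\<in>Q. \<exists>i. \<langle>q, u i\<rangle> \<noteq> 0"
    using maximal_orthosystem[of Q] unfolding Q_def by blast
  have "\<forall>i. \<exists>s\<ge>(0::real). (u i = 0 \<longrightarrow> s = 0) \<and> C (u i) = s\<^sup>2 *\<^sub>R u i"
  proof
    fix i
    have "u i = 0 \<or> u i \<in> Q" using u(2) by blast
    then show "\<exists>s\<ge>(0::real). (u i = 0 \<longrightarrow> s = 0) \<and> C (u i) = s\<^sup>2 *\<^sub>R u i"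
      unfolding Q_def by (cases "u i = 0") (auto simp: C_def blinfun.zero_right)
  qed
  then obtain s where s: "\<And>i. s i \<ge> (0::real)" "\<And>i. u i = 0 \<Longrightarrow> s i = 0" "\<And>i. C (u i) = (s i)\<^sup>2 *\<^sub>R u i"
    by metis
  define H where "H = {x. \<forall>i. \<langle>x, u i\<rangle> = 0}"
  have Hadd: "x + y \<in> H" and Hdiff: "x - y \<in> H" and HR: "r *\<^sub>R x \<in> H" if "x \<in> H" "y \<in> H" for x y and r :: real
    using that unfolding H_def by (auto simp: inner.add_left inner.diff_left inner.scaleR_left)
  have HC: "C x \<in> H" if "x \<in> H" for x
  proof -
    have "\<langle>C x, u i\<rangle> = \<langle>x, C (u i)\<rangle>" for i by (simp only: Cin)
    then show ?thesis using that unfolding H_def by (simp add: s(3) inner.scaleR_right)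
  qed
  have "x = 0" if "x \<in> H" for x
  proof (rule ccontr)
    assume "x \<noteq> 0"
    define B where "B = {x \<in> H. norm x \<le> 1}"
    have unit: "(1 / norm z) *\<^sub>R z \<in> B" "norm ((1 / norm z) *\<^sub>R z) = 1" if "z \<in> H" "z \<noteq> 0" for z
      using that HR[OF that(1) that(1)] by (auto simp: B_def)
    have noQ: False if "q \<in> H" "q \<in> Q" for q using max that unfolding H_def by blast
    define \<sigma> where "\<sigma> = (SUP z\<in>B. norm (T z))"
    have bdd: "bdd_above ((\<lambda>z. norm (T z)) ` B)"
    proof (rule bdd_aboveI2)
      fix z assume "z \<in> B"
      then have "norm z \<le> 1" by (simp add: B_def)
      then have "norm T * norm z \<le> norm T" by (simp add: mult_left_le)
      then show "norm (T z) \<le> norm T" using norm_blinfun[of T z] by simp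
    qed
    have le: "norm (T z) \<le> \<sigma> * norm z" if "z \<in> H" for z
    proof (cases "z = 0")
      case False
      have "norm (T ((1 / norm z) *\<^sub>R z)) \<le> \<sigma>"
        unfolding \<sigma>_def by (rule cSUP_upper[OF unit(1)[OF that False] bdd])
      then show ?thesis using False by (simp add: blinfun.scaleR_right field_simps)
    qed (simp add: blinfun.zero_right)
    have B0: "0 \<in> B" by (simp add: B_def H_def inner.zero_left)
    have \<sigma>0: "\<sigma> \<ge> 0" using cSUP_upper[OF B0 bdd] by (simp add: \<sigma>_def blinfun.zero_right)
    show False
    proof (cases "\<sigma> = 0")
      case True
      define z where "z = (1 / norm x) *\<^sub>R x"
      have z: "z \<in> H" "norm z = 1" using unit[OF \<open>x \<in> H\<close> \<open>x \<noteq> 0\<close>] by (auto simp: z_def B_def)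
      then have "T z = 0" using le[OF z(1)] True by simp
      then have "C z = 0\<^sup>2 *\<^sub>R z" by (simp add: C_def blinfun.zero_right)
      then have "z \<in> Q" unfolding Q_def using z(2) by blast
      then show False using noQ z(1) by blast
    next
      case False
      then have \<sigma>: "\<sigma> > 0" using \<sigma>0 by simp
      have "\<exists>z\<in>B. norm (T z) > \<sigma> - 1 / real (Suc n)" for n
        using less_cSUP_iff[of B "\<lambda>z. norm (T z)" "\<sigma> - 1 / real (Suc n)"] B0 bdd unfolding \<sigma>_def by auto
      then obtain z where z: "\<And>n. z n \<in> B" "\<And>n. norm (T (z n)) > \<sigma> - 1 / real (Suc n)" by metis
      have zH: "z n \<in> H" "norm (z n) \<le> 1" for n using z(1)[of n] by (auto simp: B_def)
      have "\<forall>n. T (z n) \<in> closure (T ` cball 0 1)" using zH closure_subset by fastforce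
      moreover have "seq_compact (closure (T ` cball 0 1))"
        using c unfolding compact_op_def by (simp add: compact_imp_seq_compact)
      ultimately obtain l r where "strict_mono r" "((\<lambda>n. T (z n)) \<circ> r) \<longlonglongrightarrow> l"
        by (meson seq_compactE)
      then have r: "strict_mono r" "(\<lambda>n. T (z (r n))) \<longlonglongrightarrow> l" by (simp_all add: comp_def)
      define w where "w = (\<lambda>n. z (r n))"
      have wH: "w n \<in> H" "norm (w n) \<le> 1" for n using zH by (auto simp: w_def)
      have Tw: "(\<lambda>n. T (w n)) \<longlonglongrightarrow> l" using r(2) by (simp add: w_def)
      have nTw: "(\<lambda>n. norm (T (w n))) \<longlonglongrightarrow> \<sigma>"
      proof (rule tendsto_sandwich)
        show "\<forall>\<^sub>F n in sequentially. \<sigma> - 1 / real (Suc n) \<le> norm (T (w n))"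
        proof (rule always_eventually, rule allI)
          fix n
          have "1 / real (Suc (r n)) \<le> 1 / real (Suc n)"
            using seq_suble[OF r(1), of n] by (intro divide_left_mono) auto
          then show "\<sigma> - 1 / real (Suc n) \<le> norm (T (w n))" using z(2)[of "r n"] by (simp add: w_def)
        qed
        have "norm (T (w n)) \<le> \<sigma>" for n
          using le[OF wH(1)[of n]] wH(2)[of n] \<sigma> by (meson mult_left_le order_trans less_imp_le)
        then show "\<forall>\<^sub>F n in sequentially. norm (T (w n)) \<le> \<sigma>" by simp
        show "(\<lambda>n. \<sigma> - 1 / real (Suc n)) \<longlonglongrightarrow> \<sigma>"
          using tendsto_diff[OF tendsto_const lim_1_over_n[THEN LIMSEQ_Suc]] by fastforce
      qed simp
      have ln: "norm l = \<sigma>" using LIMSEQ_unique[OF tendsto_norm[OF Tw] nTw] .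
      \<comment> \<open>Convergence of the images forces \<open>norm (T (w m + w n))\<close> close
        to 2 \<sigma>, hence \<open>norm (w m + w n)\<close> close to 2, and the parallelogram law
        makes w m - w n small.\<close>
      have "Cauchy w"
        unfolding Cauchy_def
      proof (intro allI impI)
        fix e :: real assume e: "e > 0"
        define \<delta> where "\<delta> = min 1 (e\<^sup>2 / 16)"
        have \<delta>: "\<delta> > 0" "\<delta> \<le> 1" "\<delta> \<le> e\<^sup>2 / 16" using e by (auto simp: \<delta>_def)
        obtain N where N: "\<And>n. n \<ge> N \<Longrightarrow> norm (T (w n) - l) < \<sigma> * \<delta>"
          using LIMSEQ_D[OF Tw, of "\<sigma> * \<delta>"] \<sigma> \<delta> by auto
        have "dist (w m) (w n) < e" if mn: "m \<ge> N" "n \<ge> N" for m n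
        proof -
          have "norm (2 *\<^sub>R l) \<le> norm (T (w m) + T (w n)) + norm (T (w m) - l) + norm (T (w n) - l)"
          proof -
            have e: "2 *\<^sub>R l = (T (w m) + T (w n)) - (T (w m) - l) - (T (w n) - l)" by (simp add: scaleR_2)
            show ?thesis
              unfolding e
              using norm_triangle_ineq4[of "(T (w m) + T (w n)) - (T (w m) - l)" "T (w n) - l"]
                norm_triangle_ineq4[of "T (w m) + T (w n)" "T (w m) - l"] by linarith
          qed
          then have "2 * \<sigma> - 2 * (\<sigma> * \<delta>) \<le> norm (T (w m) + T (w n))"
            using N[OF mn(1)] N[OF mn(2)] ln by simp
          also have "\<dots> = norm (T (w m + w n))" by (simp add: blinfun.add_right)
          also have "\<dots> \<le> \<sigma> * norm (w m + w n)" by (rule le[OF Hadd[OF wH(1) wH(1)]])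
          finally have "\<sigma> * (2 - 2 * \<delta>) \<le> \<sigma> * norm (w m + w n)" by (simp add: algebra_simps)
          then have "2 - 2 * \<delta> \<le> norm (w m + w n)" using \<sigma> by simp
          then have "(2 - 2 * \<delta>)\<^sup>2 \<le> (norm (w m + w n))\<^sup>2" using \<delta> by (intro power_mono) auto
          moreover have "(2 - 2 * \<delta>)\<^sup>2 \<ge> 4 - 8 * \<delta>" by (simp add: power2_diff)
          moreover have "(norm (w m))\<^sup>2 \<le> 1" "(norm (w n))\<^sup>2 \<le> 1" using wH(2) by (auto simp: power_le_one)
          ultimately have "(norm (w m - w n))\<^sup>2 \<le> 8 * \<delta>" using parallelogram[of "w m" "w n"] by linarith
          also have "\<dots> < e\<^sup>2" using \<delta>(3) e zero_less_power[OF e, of 2] by linarith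
          finally show ?thesis using e by (simp add: dist_norm power2_less_imp_less)
        qed
        then show "\<exists>M. \<forall>m\<ge>M. \<forall>n\<ge>M. dist (w m) (w n) < e" by blast
      qed
      then obtain y where y: "w \<longlonglongrightarrow> y" using Cauchy_convergent convergent_def by blast
      have yH: "y \<in> H"
        unfolding H_def
      proof (intro CollectI allI)
        fix i
        have "(\<lambda>n. \<langle>w n, u i\<rangle>) \<longlonglongrightarrow> \<langle>y, u i\<rangle>" by (rule inner.tendsto[OF y tendsto_const])
        moreover have "(\<lambda>n. \<langle>w n, u i\<rangle>) = (\<lambda>n. 0)" using wH(1) unfolding H_def by auto
        ultimately show "\<langle>y, u i\<rangle> = 0" by (metis LIMSEQ_unique tendsto_const)
      qed
      have ny: "norm y \<le> 1" by (rule tendsto_upperbound[OF tendsto_norm[OF y]]) (use wH in auto)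
      have "(\<lambda>n. T (w n)) \<longlonglongrightarrow> T y" by (rule blinfun.tendsto[OF tendsto_const y])
      then have nTy: "norm (T y) = \<sigma>" using ln LIMSEQ_unique[OF Tw] by metis
      have "norm y = 1" using le[OF yH] nTy \<sigma> ny by (simp add: mult_le_cancel_left)
      \<comment> \<open>Equality case: with \<open>norm (C y) \<le> \<sigma>\<^sup>2\<close> and the
        pairing of C y with y equal to \<sigma>^2, expanding the square of C y - \<sigma>^2 y gives
        at most 0.\<close>
      have "(norm (C y))\<^sup>2 \<le> \<sigma>\<^sup>2 * norm (C y)"
      proof -
        have "(norm (C y))\<^sup>2 = norm \<langle>C y, C y\<rangle>" by (simp add: inner_self norm_power)
        also have "\<dots> = norm \<langle>T y, T (C y)\<rangle>" by (simp only: Cin(1)[of y "C y"])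
        also have "\<dots> \<le> norm (T y) * norm (T (C y))" by (rule Cauchy_Schwarz)
        also have "\<dots> \<le> \<sigma> * (\<sigma> * norm (C y))" unfolding nTy using \<sigma> le[OF HC[OF yH]] by (intro mult_left_mono) auto
        finally show ?thesis by (simp add: power2_eq_square)
      qed
      then have nC: "norm (C y) \<le> \<sigma>\<^sup>2"
        by (cases "norm (C y) = 0") (auto simp: power2_eq_square mult_le_cancel_right)
      have Cyy: "\<langle>C y, y\<rangle> = of_real (\<sigma>\<^sup>2)" "\<langle>y, C y\<rangle> = of_real (\<sigma>\<^sup>2)" by (simp_all only: Cin inner_self nTy)
      have "(of_real ((norm (C y - \<sigma>\<^sup>2 *\<^sub>R y))\<^sup>2) :: 'k) =
          of_real ((norm (C y))\<^sup>2 - \<sigma>\<^sup>2 * \<sigma>\<^sup>2 - \<sigma>\<^sup>2 * \<sigma>\<^sup>2 + \<sigma>\<^sup>2 * (\<sigma>\<^sup>2 * (norm y)\<^sup>2))"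
        unfolding inner_self[symmetric] inner.diff_left inner.diff_right inner.scaleR_left inner.scaleR_right
          Cyy of_real_add of_real_diff of_real_mult scaleR_conv_of_real
        by (simp add: algebra_simps del: of_real_power)
      then have "(norm (C y - \<sigma>\<^sup>2 *\<^sub>R y))\<^sup>2 =
          (norm (C y))\<^sup>2 - \<sigma>\<^sup>2 * \<sigma>\<^sup>2 - \<sigma>\<^sup>2 * \<sigma>\<^sup>2 + \<sigma>\<^sup>2 * (\<sigma>\<^sup>2 * (norm y)\<^sup>2)" by (simp only: of_real_eq_iff)
      moreover have "(norm (C y))\<^sup>2 \<le> (\<sigma>\<^sup>2)\<^sup>2" using nC by (intro power_mono) auto
      ultimately have "(norm (C y - \<sigma>\<^sup>2 *\<^sub>R y))\<^sup>2 \<le> 0"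
        using \<open>norm y = 1\<close> by (simp add: power2_eq_square)
      then have "C y = \<sigma>\<^sup>2 *\<^sub>R y" by simp
      then have "y \<in> Q" unfolding Q_def using \<open>norm y = 1\<close> \<sigma>0 by blast
      then show False using noQ yH by blast
    qed
  qed
  then have total: "\<forall>x. (\<forall>i. \<langle>x, u i\<rangle> = 0) \<longrightarrow> x = 0" unfolding H_def by blast
  have "\<forall>i. s i \<ge> 0 \<and> (u i = 0 \<longrightarrow> s i = 0) \<and> hilbert_adjoint T (T (u i)) = (s i)\<^sup>2 *\<^sub>R u i"
    using s unfolding C_def by simp
  with u(1) total show ?thesis by (intro exI conjI)
qed

lemma diagonal_op:
  fixes u :: "nat \<Rightarrow> 'k::rc_scalar ell2"
  assumes u: "orthosystem UNIV u" and d: "\<And>i. \<bar>d i\<bar> \<le> (D::real)"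
  shows "\<exists>B :: 'k ell2_op. scalar_linear B \<and> (\<forall>x. (\<lambda>i. ell2_scale (of_real (d i) * \<langle>x, u i\<rangle>) (u i)) sums B x)"
proof -
  define B where "B = (\<lambda>x. \<Sum>i. ell2_scale (of_real (d i) * \<langle>x, u i\<rangle>) (u i))"
  have D: "D \<ge> 0" using d[of 0] by simp
  have le: "(norm (of_real (d i) * \<langle>x, u i\<rangle>))\<^sup>2 \<le> D\<^sup>2 * (norm \<langle>x, u i\<rangle>)\<^sup>2" for x i
    using power_mono[OF d[of i], of 2] by (simp add: norm_mult power_mult_distrib mult_right_mono)
  have sm: "summable (\<lambda>i. (norm (of_real (d i) * \<langle>x, u i\<rangle>))\<^sup>2)" for x
    by (rule summable_comparison_test'[OF summable_mult[OF bessel_summable(1)[OF u], of "D\<^sup>2"], where N = 0])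
      (use le in simp)
  have B: "(\<lambda>i. ell2_scale (of_real (d i) * \<langle>x, u i\<rangle>) (u i)) sums B x" for x
    unfolding B_def by (rule summable_sums[OF orthosystem_sums(1)[OF u sm]])
  have nB: "norm (B x) \<le> D * norm x" for x
  proof -
    have "(norm (B x))\<^sup>2 \<le> (\<Sum>i. (norm (of_real (d i) * \<langle>x, u i\<rangle>))\<^sup>2)"
      unfolding B_def by (rule orthosystem_sums(3)[OF u sm])
    also have "\<dots> \<le> (\<Sum>i. D\<^sup>2 * (norm \<langle>x, u i\<rangle>)\<^sup>2)"
      by (rule suminf_le[OF le sm summable_mult[OF bessel_summable(1)[OF u]]])
    also have "\<dots> = D\<^sup>2 * (\<Sum>i. (norm \<langle>x, u i\<rangle>)\<^sup>2)" by (rule suminf_mult[OF bessel_summable(1)[OF u]])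
    also have "\<dots> \<le> D\<^sup>2 * (norm x)\<^sup>2" by (intro mult_left_mono bessel_summable(2)[OF u]) simp
    finally have "(norm (B x))\<^sup>2 \<le> (D * norm x)\<^sup>2" by (simp add: power_mult_distrib)
    then show ?thesis by (rule power2_le_imp_le) (use D in simp)
  qed
  have Badd: "B (x + y) = B x + B y" for x y
  proof -
    have "(\<lambda>i. ell2_scale (of_real (d i) * \<langle>x + y, u i\<rangle>) (u i)) sums (B x + B y)"
      using sums_add[OF B[of x] B[of y]] by (simp add: inner.add_left distrib_left ell2.scale_left_distrib)
    then show ?thesis using B[of "x + y"] sums_unique2 by blast
  qed
  have Bscale: "B (ell2_scale c x) = ell2_scale c (B x)" for c x
  proof -
    have "(\<lambda>i. ell2_scale (of_real (d i) * \<langle>ell2_scale c x, u i\<rangle>) (u i)) sums (ell2_scale c (B x))"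
      using bounded_linear.sums[OF bounded_linear_ell2_scale[of c] B[of x]]
      by (simp add: inner_scale_left mult.left_commute mult.assoc)
    then show ?thesis using B[of "ell2_scale c x"] sums_unique2 by blast
  qed
  have bl: "bounded_linear B"
    by (rule bounded_linear_intro[where K = D]) (use nB Badd Bscale in \<open>auto simp: scaleR_ell2_def mult.commute\<close>)
  then have "blinfun_apply (Blinfun B) = B" by (rule bounded_linear_Blinfun_apply)
  then show ?thesis by (intro exI[of _ "Blinfun B"]) (simp add: scalar_linear_def B Bscale)
qed

section \<open>Schatten norms and orthonormal systems\<close>

text \<open>An upper bound for the Schatten norm in variational form. Each test uses finitely many
  matrix coefficients, so sums, limits and compressions of operators can be handled without
  comparing their singular values.\<close>

definition schatten_le :: "real \<Rightarrow> ('k::rc_scalar) ell2_op \<Rightarrow> real \<Rightarrow> bool" where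
  "schatten_le p T C \<longleftrightarrow> (\<forall>(n::nat) e f. orthosystem {..<n} e \<longrightarrow> orthosystem {..<n} f \<longrightarrow>
     (\<Sum>j<n. norm \<langle>T (e j), f j\<rangle> powr p) \<le> C powr p)"

text \<open>The Schmidt expansion. The singular values are not ordered, and indices with value 0
  carry zero vectors, so finite rank fits the same index set and two expansions can be merged by
  interleaving.\<close>

definition svd :: "('k::rc_scalar) ell2_op \<Rightarrow> (nat \<Rightarrow> real) \<Rightarrow> (nat \<Rightarrow> 'k ell2) \<Rightarrow> (nat \<Rightarrow> 'k ell2) \<Rightarrow> bool" where
  "svd T s u v \<longleftrightarrow> orthosystem UNIV u \<and> orthosystem UNIV v \<and>
     (\<forall>i. (s i = 0 \<and> u i = 0 \<and> v i = 0) \<or> (s i > 0 \<and> norm (u i) = 1 \<and> norm (v i) = 1)) \<and>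
     (\<forall>x. (\<lambda>i. ell2_scale (of_real (s i) * \<langle>x, u i\<rangle>) (v i)) sums T x)"

text \<open>Weights of sum A \<le> 1 are normalized before Jensen's inequality; the factor
  \<open>A powr p\<close> left over is at most A.\<close>

lemma powr_jensen:
  fixes a t :: "'i \<Rightarrow> real"
  assumes p: "p \<ge> 1" and I: "finite I" and a: "\<And>i. i \<in> I \<Longrightarrow> a i \<ge> 0" "sum a I \<le> 1"
    and t: "\<And>i. i \<in> I \<Longrightarrow> t i \<ge> 0"
  shows "(\<Sum>i\<in>I. a i * t i) powr p \<le> (\<Sum>i\<in>I. a i * t i powr p)"
proof (cases "sum a I = 0")
  case True
  then have "a i = 0" if "i \<in> I" for i using that I a(1) by (simp add: sum_nonneg_eq_0_iff)
  then show ?thesis by simp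
next
  case False
  define A where "A = sum a I"
  have A: "A > 0" "A \<le> 1" using False a sum_nonneg[of I a] by (auto simp: A_def less_le)
  have "convex_on {0..} (\<lambda>x::real. x powr p)"
    by (rule convex_onI) (use powr_convex_combination[OF p] in auto)
  moreover have "I \<noteq> {}" using False by auto
  moreover have "(\<Sum>i\<in>I. a i / A) = 1" using A by (simp add: A_def flip: sum_divide_distrib)
  ultimately have "(\<Sum>i\<in>I. (a i / A) *\<^sub>R t i) powr p \<le> (\<Sum>i\<in>I. a i / A * t i powr p)"
    using convex_on_sum[OF I, of "{0..}" "\<lambda>x. x powr p" "\<lambda>i. a i / A" t] a(1) t A by simp
  then have le: "((\<Sum>i\<in>I. a i * t i) / A) powr p \<le> (\<Sum>i\<in>I. a i * t i powr p) / A"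
    by (simp add: sum_divide_distrib)
  have nn: "(\<Sum>i\<in>I. a i * t i powr p) / A \<ge> 0" using A a(1) by (intro divide_nonneg_pos sum_nonneg) auto
  have "A powr p \<le> A powr 1" using A p by (intro powr_mono') auto
  then have Ap: "A powr p \<le> A" using A by simp
  have "(\<Sum>i\<in>I. a i * t i) powr p = (A * ((\<Sum>i\<in>I. a i * t i) / A)) powr p" using A by simp
  also have "\<dots> = A powr p * ((\<Sum>i\<in>I. a i * t i) / A) powr p" by (rule powr_mult)
  also have "\<dots> \<le> A * ((\<Sum>i\<in>I. a i * t i powr p) / A)" using le Ap A nn by (intro mult_mono) auto
  finally show ?thesis using A by simp
qed

lemma inner_norm_commute: "norm \<langle>x, y\<rangle> = norm \<langle>y, x\<rangle>" by (metis inner_commute norm_sconj)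

lemma svdD:
  assumes "svd T s u v"
  shows "orthosystem UNIV u" "orthosystem UNIV v" "s i \<ge> 0"
    "s i = 0 \<Longrightarrow> u i = 0 \<and> v i = 0" "s i > 0 \<Longrightarrow> norm (u i) = 1 \<and> norm (v i) = 1"
    "(\<lambda>i. ell2_scale (of_real (s i) * \<langle>x, u i\<rangle>) (v i)) sums T x"
proof -
  have d: "(s i = 0 \<and> u i = 0 \<and> v i = 0) \<or> (s i > 0 \<and> norm (u i) = 1 \<and> norm (v i) = 1)"
    using assms unfolding svd_def by blast
  show "s i \<ge> 0" "s i = 0 \<Longrightarrow> u i = 0 \<and> v i = 0" "s i > 0 \<Longrightarrow> norm (u i) = 1 \<and> norm (v i) = 1"
    using d by auto
qed (use assms in \<open>simp_all add: svd_def\<close>)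

lemma svd_apply:
  fixes T :: "'k::rc_scalar ell2_op"
  assumes "svd T s u v" shows "T (u k) = s k *\<^sub>R v k"
proof -
  have "(\<lambda>i. ell2_scale (of_real (s i) * \<langle>u k, u i\<rangle>) (v i)) = (\<lambda>i. if i = k then s k *\<^sub>R v k else 0)"
  proof
    fix i
    consider "i \<noteq> k" | "i = k" "s k = 0" | "i = k" "s k > 0" using svdD(3)[OF assms, of k] by fastforce
    then show "ell2_scale (of_real (s i) * \<langle>u k, u i\<rangle>) (v i) = (if i = k then s k *\<^sub>R v k else 0)"
    proof cases
      case 1
      then show ?thesis using orthosystemD(1)[OF svdD(1)[OF assms], of k i] by simp
    next
      case 2
      then show ?thesis by simp
    next
      case 3
      then show ?thesis using svdD(5)[OF assms, of k] by (simp add: inner_self ell2_scale_of_real)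
    qed
  qed
  then have "(\<lambda>i. if i = k then s k *\<^sub>R v k else 0) sums T (u k)" using svdD(6)[OF assms, of "u k"] by simp
  moreover have "(\<lambda>i. if i = k then s k *\<^sub>R v k else 0) sums (s k *\<^sub>R v k)" using sums_single[of k "\<lambda>_. s k *\<^sub>R v k"] by simp
  ultimately show ?thesis by (rule sums_unique2)
qed

text \<open>The singular vectors themselves are a test that reproduces the partial sums. Conversely,
  the moduli of the matrix coefficients are at most the sums of a j i * s i, where a j i averages
  the squared coefficients of e j along u i and of f j along v i. Bessel's inequality bounds all row
  and column sums of a by 1, so Jensen's inequality in i followed by summation over j gives the
  claim. The expansion is cut at K to keep the sums finite.\<close>

lemma svd_schatten_le:
  assumes p: "p \<ge> 1" and svd: "svd T s u v"
  shows "schatten_le p T C \<longleftrightarrow> (\<forall>n. (\<Sum>i<n. s i powr p) \<le> C powr p)"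
proof
  assume T: "schatten_le p T C"
  show "\<forall>n. (\<Sum>i<n. s i powr p) \<le> C powr p"
  proof
    fix n
    have "norm \<langle>T (u j), v j\<rangle> = s j" for j
    proof (cases "s j = 0")
      case True
      then show ?thesis using svdD(4)[OF svd, of j] by (simp add: inner.zero_right)
    next
      case False
      then have "s j > 0" using svdD(3)[OF svd, of j] by simp
      then show ?thesis using svdD(5)[OF svd, of j] by (simp add: svd_apply[OF svd] inner.scaleR_left inner_self)
    qed
    then have "(\<Sum>i<n. s i powr p) = (\<Sum>j<n. norm \<langle>T (u j), v j\<rangle> powr p)" by simp
    also have "\<dots> \<le> C powr p"
      using T orthosystem_subset[OF svdD(1)[OF svd] subset_UNIV] orthosystem_subset[OF svdD(2)[OF svd] subset_UNIV]
      unfolding schatten_le_def by blast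
    finally show "(\<Sum>i<n. s i powr p) \<le> C powr p" .
  qed
next
  assume b: "\<forall>n. (\<Sum>i<n. s i powr p) \<le> C powr p"
  show "schatten_le p T C"
    unfolding schatten_le_def
  proof (intro allI impI)
    fix n and e f :: "nat \<Rightarrow> 'a ell2"
    assume e: "orthosystem {..<n} e" and f: "orthosystem {..<n} f"
    define TK where "TK = (\<lambda>K x. \<Sum>i<K. ell2_scale (of_real (s i) * \<langle>x, u i\<rangle>) (v i))"
    have lim: "(\<lambda>K. TK K x) \<longlonglongrightarrow> T x" for x
      using svdD(6)[OF svd, of x] by (simp add: sums_def TK_def)
    define a where "a = (\<lambda>j i. ((norm \<langle>e j, u i\<rangle>)\<^sup>2 + (norm \<langle>f j, v i\<rangle>)\<^sup>2) / 2)"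
    have sq: "(norm (w j))\<^sup>2 \<le> 1" if "orthosystem I w" "j \<in> I" for w :: "nat \<Rightarrow> 'a ell2" and j I
      using orthosystemD(3)[OF that] by (simp add: power_le_one)
    have row: "(\<Sum>i<K. a j i) \<le> 1" if "j < n" for j K
    proof -
      have "(\<Sum>i<K. (norm \<langle>e j, u i\<rangle>)\<^sup>2) \<le> 1"
        using bessel[OF svdD(1)[OF svd], of "{..<K}" "e j"] sq[OF e, of j] that by simp
      moreover have "(\<Sum>i<K. (norm \<langle>f j, v i\<rangle>)\<^sup>2) \<le> 1"
        using bessel[OF svdD(2)[OF svd], of "{..<K}" "f j"] sq[OF f, of j] that by simp
      ultimately show ?thesis by (simp add: a_def sum.distrib flip: sum_divide_distrib)
    qed
    have col: "(\<Sum>j<n. a j i) \<le> 1" for i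
    proof -
      have "(\<Sum>j<n. (norm \<langle>u i, e j\<rangle>)\<^sup>2) \<le> 1"
        using bessel[OF e, of "{..<n}" "u i"] sq[OF svdD(1)[OF svd], of i] by simp
      moreover have "(\<Sum>j<n. (norm \<langle>v i, f j\<rangle>)\<^sup>2) \<le> 1"
        using bessel[OF f, of "{..<n}" "v i"] sq[OF svdD(2)[OF svd], of i] by simp
      ultimately show ?thesis
        by (simp add: a_def sum.distrib inner_norm_commute[of "e _"] inner_norm_commute[of "f _"] flip: sum_divide_distrib)
    qed
    have est: "(\<Sum>j<n. norm \<langle>TK K (e j), f j\<rangle> powr p) \<le> C powr p" for K
    proof -
      have "norm \<langle>TK K (e j), f j\<rangle> powr p \<le> (\<Sum>i<K. a j i * s i powr p)" if j: "j < n" for j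
      proof -
        have "norm \<langle>TK K (e j), f j\<rangle> \<le> (\<Sum>i<K. norm (of_real (s i) * \<langle>e j, u i\<rangle> * \<langle>v i, f j\<rangle>))"
          unfolding TK_def inner.sum_left inner_scale_left by (rule norm_sum)
        also have "\<dots> \<le> (\<Sum>i<K. a j i * s i)"
        proof (rule sum_mono)
          fix i
          have "norm \<langle>e j, u i\<rangle> * norm \<langle>f j, v i\<rangle> \<le> a j i"
            using zero_le_power2[of "norm \<langle>e j, u i\<rangle> - norm \<langle>f j, v i\<rangle>"] by (simp add: a_def power2_diff)
          then have "s i * (norm \<langle>e j, u i\<rangle> * norm \<langle>f j, v i\<rangle>) \<le> s i * a j i"
            using svdD(3)[OF svd] by (rule mult_left_mono)
          then show "norm (of_real (s i) * \<langle>e j, u i\<rangle> * \<langle>v i, f j\<rangle>) \<le> a j i * s i"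
            using svdD(3)[OF svd, of i] by (simp add: norm_mult inner_norm_commute[of "v i"] ac_simps)
        qed
        finally have "norm \<langle>TK K (e j), f j\<rangle> powr p \<le> (\<Sum>i<K. a j i * s i) powr p" using p by (intro powr_mono2) auto
        also have "\<dots> \<le> (\<Sum>i<K. a j i * s i powr p)"
          by (rule powr_jensen[OF p finite_lessThan _ row[OF j]]) (use svdD(3)[OF svd] in \<open>auto simp: a_def\<close>)
        finally show ?thesis .
      qed
      then have "(\<Sum>j<n. norm \<langle>TK K (e j), f j\<rangle> powr p) \<le> (\<Sum>j<n. \<Sum>i<K. a j i * s i powr p)"
        by (intro sum_mono) auto
      also have "\<dots> = (\<Sum>i<K. (\<Sum>j<n. a j i) * s i powr p)"
        by (subst sum.swap) (simp add: sum_distrib_right)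
      also have "\<dots> \<le> (\<Sum>i<K. 1 * s i powr p)" by (intro sum_mono mult_right_mono col) auto
      also have "\<dots> \<le> C powr p" using b by simp
      finally show ?thesis .
    qed
    show "(\<Sum>j<n. norm \<langle>T (e j), f j\<rangle> powr p) \<le> C powr p"
    proof (rule tendsto_upperbound)
      show "(\<lambda>K. \<Sum>j<n. norm \<langle>TK K (e j), f j\<rangle> powr p) \<longlonglongrightarrow> (\<Sum>j<n. norm \<langle>T (e j), f j\<rangle> powr p)"
        by (intro tendsto_sum tendsto_powr' tendsto_norm inner.tendsto lim tendsto_const)
          (use p in \<open>auto intro!: always_eventually\<close>)
    qed (use est in auto)
  qed
qed

lemma tonelli_le:
  fixes g :: "nat \<Rightarrow> nat \<Rightarrow> real"
  assumes g: "\<And>n i. g n i \<ge> 0" and c: "\<And>i. summable (\<lambda>n. g n i)" and r: "\<And>n. summable (\<lambda>i. g n i)"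
    and s: "summable (\<lambda>n. \<Sum>i. g n i)"
  shows "summable (\<lambda>i. \<Sum>n. g n i)" "(\<Sum>i. \<Sum>n. g n i) \<le> (\<Sum>n. \<Sum>i. g n i)"
proof -
  have le: "(\<Sum>i<I. \<Sum>n. g n i) \<le> (\<Sum>n. \<Sum>i. g n i)" for I
  proof -
    have "(\<Sum>i<I. \<Sum>n. g n i) = (\<Sum>n. \<Sum>i<I. g n i)" by (rule suminf_sum[symmetric]) (rule c)
    also have "\<dots> \<le> (\<Sum>n. \<Sum>i. g n i)"
      by (rule suminf_le[OF _ summable_sum s]) (auto intro: sum_le_suminf r g c)
    finally show ?thesis .
  qed
  show 1: "summable (\<lambda>i. \<Sum>n. g n i)"
    by (rule summableI_nonneg_bounded[OF _ le]) (rule suminf_nonneg[OF c g])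
  show "(\<Sum>i. \<Sum>n. g n i) \<le> (\<Sum>n. \<Sum>i. g n i)" by (rule suminf_le_const[OF 1 le])
qed

text \<open>Evaluates the definite descriptions behind the Schatten norm: in an eigenbasis u,
  \<open>abs_op T\<close> is diagonal with entries s i and its power is diagonal with entries
  \<open>s i powr p\<close>. The trace over the unit vectors is exchanged with the sum over u by
  Tonelli's theorem.\<close>

lemma schatten_svd:
  fixes T :: "'k::rc_scalar ell2_op"
  assumes T: "scalar_linear T" and c: "compact_op T" and p: "p > 0"
  shows "\<exists>s u v. svd T s u v \<and> (T \<in> schatten_class p \<longleftrightarrow> summable (\<lambda>i. s i powr p)) \<and>
    (T \<in> schatten_class p \<longrightarrow> schatten_norm p T = (\<Sum>i. s i powr p) powr (1 / p))"
proof -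
  obtain u :: "nat \<Rightarrow> 'k ell2" and s where us: "orthosystem UNIV u \<and> (\<forall>x. (\<forall>i. \<langle>x, u i\<rangle> = 0) \<longrightarrow> x = 0) \<and>
    (\<forall>i. s i \<ge> (0::real) \<and> (u i = 0 \<longrightarrow> s i = 0) \<and> hilbert_adjoint T (T (u i)) = (s i)\<^sup>2 *\<^sub>R u i)"
    using spectral_basis[OF T c] by metis
  have u: "orthosystem UNIV u" and total: "\<And>x. (\<And>i. \<langle>x, u i\<rangle> = 0) \<Longrightarrow> x = 0"
    and s: "\<And>i. s i \<ge> (0::real)" "\<And>i. u i = 0 \<Longrightarrow> s i = 0"
    and eig: "\<And>i. hilbert_adjoint T (T (u i)) = (s i)\<^sup>2 *\<^sub>R u i"
    using us by simp_all
  have TT: "\<langle>T (u i), T y\<rangle> = of_real ((s i)\<^sup>2) * \<langle>u i, y\<rangle>" for i y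
    using adjoint_op_op_inner[OF T, of "u i" y] by (simp add: eig inner.scaleR_left scaleR_conv_of_real)
  have nu: "norm (u i) = 1" if "s i \<noteq> 0" for i using orthosystemD(2)[OF u, of i] s(2) that by auto
  have nTu: "norm (T (u i)) = s i" for i
  proof -
    have "(of_real ((norm (T (u i)))\<^sup>2) :: 'k) = of_real ((s i)\<^sup>2)"
      unfolding inner_self[symmetric] TT using nu[of i] by (cases "s i = 0") (auto simp: inner_self)
    then have "(norm (T (u i)))\<^sup>2 = (s i)\<^sup>2" by (simp only: of_real_eq_iff)
    then show ?thesis using s(1)[of i] by simp
  qed
  \<comment> \<open>The basis u keeps its vectors from the kernel of T in order to be total, whereas
    \<open>svd\<close> asks for zero vectors there. In \<open>v\<close> the same is achieved by
    division by zero.\<close>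
  define u' where "u' = (\<lambda>i. if s i = 0 then 0 else u i)"
  define v where "v = (\<lambda>i. (1 / s i) *\<^sub>R T (u i))"
  have Tu: "T (u i) = s i *\<^sub>R v i" for i using nTu[of i] by (cases "s i = 0") (auto simp: v_def)
  have sb: "s i \<le> norm T" for i
  proof (cases "s i = 0")
    case False
    then show ?thesis using norm_blinfun[of T "u i"] nu[of i] nTu[of i] by simp
  qed simp
  have svd: "svd T s u' v"
    unfolding svd_def
  proof (intro conjI allI)
    show "orthosystem UNIV u'" using u by (auto simp: orthosystem_def u'_def inner.zero_left inner.zero_right)
    show "orthosystem UNIV v"
      unfolding orthosystem_def
    proof (intro conjI ballI impI)
      fix i j :: nat assume "i \<noteq> j"
      then show "\<langle>v i, v j\<rangle> = 0"
        using orthosystemD(1)[OF u, of i j] by (simp add: v_def inner.scaleR_left inner.scaleR_right TT)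
    next
      fix i show "v i = 0 \<or> norm (v i) = 1" using s(1)[of i] by (cases "s i = 0") (auto simp: v_def nTu)
    qed
    fix i
    show "s i = 0 \<and> u' i = 0 \<and> v i = 0 \<or> 0 < s i \<and> norm (u' i) = 1 \<and> norm (v i) = 1"
      using s(1)[of i] nu[of i] by (cases "s i = 0") (auto simp: v_def nTu u'_def)
  next
    fix x
    have "(\<lambda>i. T (ell2_scale \<langle>x, u i\<rangle> (u i))) sums T x"
      by (rule blinfun_sums[OF orthobasis_expansion(1)[OF u total]])
    moreover have "T (ell2_scale \<langle>x, u i\<rangle> (u i)) = ell2_scale (of_real (s i) * \<langle>x, u' i\<rangle>) (v i)" for i
      unfolding scalar_linearD[OF T] Tu
      by (cases "s i = 0") (auto simp: u'_def scaleR_ell2_def mult.commute)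
    ultimately show "(\<lambda>i. ell2_scale (of_real (s i) * \<langle>x, u' i\<rangle>) (v i)) sums T x" by simp
  qed
  have absle: "\<bar>s i\<bar> \<le> norm T" for i using s(1)[of i] sb by simp
  obtain A :: "'k ell2_op" where A: "scalar_linear A"
    and As: "\<And>x. (\<lambda>i. ell2_scale (of_real (s i) * \<langle>x, u i\<rangle>) (u i)) sums A x"
    using diagonal_op[of u s "norm T", OF u absle] by blast
  have uu: "\<langle>x, u k\<rangle> * of_real ((norm (u k))\<^sup>2) = \<langle>x, u k\<rangle>" for x k
    using orthosystemD(2)[OF u, of k] by (auto simp: inner.zero_right)
  have diag_inner: "\<langle>B x, y\<rangle> = (\<Sum>i. of_real (d i) * \<langle>x, u i\<rangle> * \<langle>u i, y\<rangle>)"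
    "summable (\<lambda>i. of_real (d i) * \<langle>x, u i\<rangle> * \<langle>u i, y\<rangle>)"
    if B: "\<And>x. (\<lambda>i. ell2_scale (of_real (d i) * \<langle>x, u i\<rangle>) (u i)) sums B x"
    for B :: "'k ell2 \<Rightarrow> 'k ell2" and d :: "nat \<Rightarrow> real" and x y
    using bounded_linear.sums[OF inner.bounded_linear_left B[of x], of y] by (auto simp: inner_scale_left sums_iff)
  have diag_coef: "\<langle>B x, u k\<rangle> = of_real (d k) * \<langle>x, u k\<rangle>"
    if B: "\<And>x. (\<lambda>i. ell2_scale (of_real (d i) * \<langle>x, u i\<rangle>) (u i)) sums B x"
    for B :: "'k ell2 \<Rightarrow> 'k ell2" and d :: "nat \<Rightarrow> real" and x k
  proof -
    have "\<langle>B x, u k\<rangle> = (\<Sum>i. of_real (d i) * \<langle>x, u i\<rangle> * \<langle>u i, u k\<rangle>)" by (rule diag_inner(1)[OF B])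
    also have "\<dots> = (\<Sum>i\<in>{k}. of_real (d i) * \<langle>x, u i\<rangle> * \<langle>u i, u k\<rangle>)"
      by (rule suminf_finite) (auto simp: orthosystemD(1)[OF u])
    finally show ?thesis using uu[of x k] by (simp add: inner_self mult.assoc)
  qed
  have coef_eqI: "x = y" if "\<And>k. \<langle>x, u k\<rangle> = \<langle>y, u k\<rangle>" for x y
  proof -
    have "x - y = 0" by (rule total) (simp add: that inner.diff_left)
    then show ?thesis by simp
  qed
  have Auk: "A (u k) = s k *\<^sub>R u k" for k
  proof (rule coef_eqI)
    fix j
    have "of_real (s j) * \<langle>u k, u j\<rangle> = of_real (s k) * \<langle>u k, u j\<rangle>"
      using orthosystemD(1)[OF u, of k j] by (cases "k = j") auto
    then show "\<langle>A (u k), u j\<rangle> = \<langle>s k *\<^sub>R u k, u j\<rangle>"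
      unfolding diag_coef[OF As] by (simp add: inner.scaleR_left scaleR_conv_of_real)
  qed
  have Apos: "positive_op A"
    unfolding positive_op_def
  proof (intro conjI allI A)
    show "hilbert_adjoint A = A"
    proof (rule hilbert_adjointI)
      fix x y
      have "\<langle>x, A y\<rangle> = sconj \<langle>A y, x\<rangle>" by (rule inner_commute)
      also have "\<dots> = (\<Sum>i. sconj (of_real (s i) * \<langle>y, u i\<rangle> * \<langle>u i, x\<rangle>))"
        unfolding diag_inner(1)[OF As]
        by (rule bounded_linear.suminf[OF bounded_linear_sconj diag_inner(2)[OF As]])
      also have "\<dots> = (\<Sum>i. of_real (s i) * \<langle>x, u i\<rangle> * \<langle>u i, y\<rangle>)"
        by (intro suminf_cong) (simp add: sconj_mult inner_commute[symmetric] mult_ac)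
      also have "\<dots> = \<langle>A x, y\<rangle>" by (rule diag_inner(1)[OF As, symmetric])
      finally show "\<langle>A x, y\<rangle> = \<langle>x, A y\<rangle>" ..
    qed
    fix x
    have e: "of_real (s i) * \<langle>x, u i\<rangle> * \<langle>u i, x\<rangle> = of_real (s i * (norm \<langle>x, u i\<rangle>)\<^sup>2)" for i
      unfolding inner_commute[of "u i" x] mult.assoc sconj_mult_self' by simp
    have "(\<lambda>i. of_real (s i) * \<langle>x, u i\<rangle> * \<langle>u i, x\<rangle>) sums \<langle>A x, x\<rangle>"
      using diag_inner[OF As, where x = x and y = x] by (simp add: sums_iff)
    then have sm: "(\<lambda>i. of_real (s i * (norm \<langle>x, u i\<rangle>)\<^sup>2)) sums \<langle>A x, x\<rangle>" by (simp only: e)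
    have sr: "summable (\<lambda>i. s i * (norm \<langle>x, u i\<rangle>)\<^sup>2)"
      by (rule summable_comparison_test'[OF summable_mult[OF bessel_summable(1)[OF u], of "norm T" x], where N = 0])
        (use s sb in \<open>auto intro!: mult_right_mono\<close>)
    have "\<langle>A x, x\<rangle> = of_real (\<Sum>i. s i * (norm \<langle>x, u i\<rangle>)\<^sup>2)"
      using sm suminf_of_real[OF sr, where 'a = 'k] by (simp add: sums_iff)
    moreover have "(\<Sum>i. s i * (norm \<langle>x, u i\<rangle>)\<^sup>2) \<ge> 0" using s by (intro suminf_nonneg[OF sr]) auto
    ultimately show "\<exists>r\<ge>0. \<langle>A x, x\<rangle> = of_real r" by blast
  qed
  have Asq: "A o\<^sub>L A = hilbert_adjoint T o\<^sub>L T"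
    by (rule blinfun_eq_on_basis[OF u total])
      (simp_all add: scalar_linearD[OF A] scalar_linearD[OF T] scalar_linearD[OF hilbert_adjoint(2)[OF T]]
        Auk eig blinfun.scaleR_right power2_eq_square)
  have absA: "abs_op T = A"
    unfolding abs_op_def
  proof (rule the_equality)
    show "positive_op A \<and> A o\<^sub>L A = hilbert_adjoint T o\<^sub>L T" using Apos Asq by blast
    fix A' :: "'k ell2_op" assume A': "positive_op A' \<and> A' o\<^sub>L A' = hilbert_adjoint T o\<^sub>L T"
    then have lin: "scalar_linear A'" and sa: "\<And>x y. \<langle>A' x, y\<rangle> = \<langle>x, A' y\<rangle>"
      and pos: "\<And>x. \<exists>r\<ge>0. \<langle>A' x, x\<rangle> = of_real r"
      using hilbert_adjoint(1)[of A'] unfolding positive_op_def by auto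
    have sq: "A' (A' x) = hilbert_adjoint T (T x)" for x
      using A' by (metis blinfun_apply_blinfun_compose)
    have "A' (u k) = s k *\<^sub>R u k" for k
    proof (cases "s k = 0")
      case True
      have "\<langle>A' (u k), A' (u k)\<rangle> = \<langle>A' (A' (u k)), u k\<rangle>" by (rule sa[symmetric])
      also have "\<dots> = 0" by (simp add: sq eig True inner.zero_left)
      finally have "(norm (A' (u k)))\<^sup>2 = 0" unfolding inner_self by (simp only: of_real_eq_0_iff)
      then show ?thesis using True by simp
    next
      case False
      then have sk: "s k > 0" using s(1)[of k] by simp
      \<comment> \<open>As the square of A' acts on u k as multiplication by (s k)^2, this vector
        satisfies A' y = - s k y, which positivity of A' allows only for y = 0.\<close>
      define y where "y = A' (u k) - s k *\<^sub>R u k"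
      have "A' y = - (s k *\<^sub>R y)"
        by (simp add: y_def blinfun.diff_right blinfun.scaleR_right sq eig scaleR_diff_right power2_eq_square)
      then have "\<langle>A' y, y\<rangle> = of_real (- (s k * (norm y)\<^sup>2))"
        by (simp only: inner.minus_left inner.scaleR_left inner_self scaleR_conv_of_real of_real_mult of_real_minus)
      then have "\<exists>r\<ge>0. (of_real (- (s k * (norm y)\<^sup>2)) :: 'k) = of_real r" using pos[of y] by simp
      then have "- (s k * (norm y)\<^sup>2) \<ge> 0" by (simp only: of_real_eq_iff) blast
      then have "y = 0" using sk by (smt (verit) mult_pos_pos zero_less_norm_iff zero_less_power)
      then show ?thesis by (simp add: y_def)
    qed
    then show "A' = A"
      by (intro blinfun_eq_on_basis[OF u total]) (simp_all add: scalar_linearD[OF lin] scalar_linearD[OF A] Auk)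
  qed
  have dle: "\<bar>s i powr p\<bar> \<le> norm T powr p" for i using s(1)[of i] sb[of i] p by (simp add: powr_mono2)
  obtain B :: "'k ell2_op" where B: "scalar_linear B"
    and Bs: "\<And>x. (\<lambda>i. ell2_scale (of_real (s i powr p) * \<langle>x, u i\<rangle>) (u i)) sums B x"
    using diagonal_op[of u "\<lambda>i. s i powr p" "norm T powr p", OF u dle] by blast
  \<comment> \<open>An eigenvector of A for r has nonzero coefficients only at indices with s k = r,
    so B acts on it as a scalar.\<close>
  have Buk: "B x = (r powr p) *\<^sub>R x" if r: "A x = r *\<^sub>R x" for r x
  proof (rule coef_eqI)
    fix k
    have "of_real (s k) * \<langle>x, u k\<rangle> = \<langle>A x, u k\<rangle>" by (rule diag_coef[OF As, symmetric])
    also have "\<dots> = of_real r * \<langle>x, u k\<rangle>" unfolding r by (simp add: inner.scaleR_left scaleR_conv_of_real)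
    finally have "\<langle>x, u k\<rangle> = 0 \<or> s k = r" by (metis mult_right_cancel of_real_eq_iff)
    then show "\<langle>B x, u k\<rangle> = \<langle>(r powr p) *\<^sub>R x, u k\<rangle>"
      unfolding diag_coef[OF Bs] by (auto simp: inner.scaleR_left scaleR_conv_of_real)
  qed
  have powB: "powr_op A p = B"
    unfolding powr_op_def
  proof (rule the_equality)
    show "\<forall>r\<ge>0. \<forall>x. A x = r *\<^sub>R x \<longrightarrow> B x = (r powr p) *\<^sub>R x" using Buk by blast
    fix B' :: "'k ell2_op" assume B': "\<forall>r\<ge>0. \<forall>x. A x = r *\<^sub>R x \<longrightarrow> B' x = (r powr p) *\<^sub>R x"
    show "B' = B"
    proof (rule blinfun_eq_on_basis[OF u total])
      fix c i
      have "A (ell2_scale c (u i)) = s i *\<^sub>R ell2_scale c (u i)"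
        by (simp add: scalar_linearD[OF A] Auk scaleR_ell2_def mult.commute)
      then show "B' (ell2_scale c (u i)) = B (ell2_scale c (u i))" using B' Buk s(1) by metis
    qed
  qed
  \<comment> \<open>Rows of this array sum to the diagonal entries of B at the unit vectors, columns
    to \<open>s i powr p\<close>.\<close>
  define g where "g = (\<lambda>n i. s i powr p * (norm \<langle>ell2_unit n, u i\<rangle>)\<^sup>2)"
  define t where "t = (\<lambda>n. \<Sum>i. g n i)"
  have g0: "g n i \<ge> 0" for n i by (simp add: g_def)
  have grow: "summable (\<lambda>i. g n i)" for n
    by (rule summable_comparison_test'[OF summable_mult[OF bessel_summable(1)[OF u], of "norm T powr p" "ell2_unit n"], where N = 0])
      (use dle in \<open>auto simp: g_def intro!: mult_right_mono\<close>)
  have gcol: "(\<lambda>n. g n i) sums (s i powr p)" for i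
  proof -
    have "(\<lambda>n. (norm \<langle>u i, ell2_unit n\<rangle>)\<^sup>2) sums (norm (u i))\<^sup>2"
      by (rule orthobasis_expansion(2)[OF orthosystem_unit]) (simp add: inner_unit ell2_eqI)
    then have "(\<lambda>n. g n i) sums (s i powr p * (norm (u i))\<^sup>2)"
      unfolding g_def inner_norm_commute[of "ell2_unit _"] by (rule sums_mult)
    then show ?thesis using nu[of i] by (cases "s i = 0") auto
  qed
  have diagt: "\<langle>B (ell2_unit n), ell2_unit n\<rangle> = of_real (t n)" for n
  proof -
    have e: "of_real (s i powr p) * \<langle>ell2_unit n, u i\<rangle> * \<langle>u i, ell2_unit n\<rangle> = of_real (g n i)" for i
      unfolding inner_commute[of "u i" "ell2_unit n"] mult.assoc sconj_mult_self' g_def by simp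
    show ?thesis unfolding diag_inner(1)[OF Bs] e t_def by (rule suminf_of_real[OF grow, symmetric])
  qed
  have t0: "t n \<ge> 0" for n unfolding t_def by (rule suminf_nonneg[OF grow g0])
  have iff1: "summable (\<lambda>n. (of_real (t n) :: 'k)) \<longleftrightarrow> summable t"
  proof
    assume "summable (\<lambda>n. (of_real (t n) :: 'k))"
    then obtain N where N: "\<And>e. e > 0 \<Longrightarrow> \<forall>m\<ge>N e. \<forall>n. norm (\<Sum>i=m..<n. (of_real (t i) :: 'k)) < e"
      unfolding summable_Cauchy by metis
    show "summable t"
      unfolding summable_Cauchy
    proof (intro allI impI)
      fix e :: real assume "e > 0"
      then show "\<exists>N. \<forall>m\<ge>N. \<forall>n. norm (sum t {m..<n}) < e"
        using N[of e] by (intro exI[of _ "N e"]) (simp flip: of_real_sum)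
    qed
  qed (rule summable_of_real)
  have gs: "(\<Sum>n. g n i) = s i powr p" for i using gcol by (simp add: sums_iff)
  have gcs: "summable (\<lambda>n. g n i)" for i using gcol by (simp add: sums_iff)
  have iff2: "summable t \<longleftrightarrow> summable (\<lambda>i. s i powr p)"
  proof
    assume "summable t"
    then show "summable (\<lambda>i. s i powr p)"
      using tonelli_le(1)[of g, OF g0 gcs grow] unfolding t_def gs by blast
  next
    assume "summable (\<lambda>i. s i powr p)"
    then show "summable t"
      using tonelli_le(1)[of "\<lambda>i n. g n i", OF g0 grow gcs] unfolding t_def gs by blast
  qed
  have "trace_summable (powr_op (abs_op T) p) \<longleftrightarrow> summable (\<lambda>i. s i powr p)"
    unfolding absA powB trace_summable_def diagt iff1 iff2 ..
  then have cls: "T \<in> schatten_class p \<longleftrightarrow> summable (\<lambda>i. s i powr p)"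
    using T c by (simp add: schatten_class_def)
  have nrm: "schatten_norm p T = (\<Sum>i. s i powr p) powr (1 / p)" if "T \<in> schatten_class p"
  proof -
    have True: "summable (\<lambda>i. s i powr p)" using that cls by blast
    then have st: "summable t" using iff2 by blast
    have "suminf t = (\<Sum>i. s i powr p)"
    proof (rule antisym)
      show "suminf t \<le> (\<Sum>i. s i powr p)"
        using tonelli_le(2)[of "\<lambda>i n. g n i", OF g0 grow gcs] True unfolding t_def gs by blast
      show "(\<Sum>i. s i powr p) \<le> suminf t"
        using tonelli_le(2)[of g, OF g0 gcs grow] st unfolding t_def gs by blast
    qed
    moreover have "trace_op B = of_real (suminf t)"
      unfolding trace_op_def diagt by (rule suminf_of_real[OF st, symmetric])
    ultimately show ?thesis
      using suminf_nonneg[OF st t0] by (simp add: schatten_norm_def absA powB)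
  qed
  show ?thesis using svd cls nrm by blast
qed

lemma schatten_le_iff:
  assumes p: "p \<ge> 1" and T: "scalar_linear T" "compact_op T" and C: "C \<ge> 0"
  shows "T \<in> schatten_class p \<and> schatten_norm p T \<le> C \<longleftrightarrow> schatten_le p T C"
proof -
  have "p > 0" using p by simp
  obtain s u v where svd: "svd T s u v" and cls: "T \<in> schatten_class p \<longleftrightarrow> summable (\<lambda>i. s i powr p)"
    and nrm: "T \<in> schatten_class p \<longrightarrow> schatten_norm p T = (\<Sum>i. s i powr p) powr (1 / p)"
    using schatten_svd[OF T \<open>p > 0\<close>] by metis
  have "norm (s i) = s i" for i using svdD(3)[OF svd] by simp
  then show ?thesis
    using lp_le_iff[OF p C, of s] nrm cls unfolding svd_schatten_le[OF p svd] by (auto simp: lp_def lpn_def)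
qed

lemma schatten_classD: "T \<in> schatten_class p \<Longrightarrow> scalar_linear T" "T \<in> schatten_class p \<Longrightarrow> compact_op T"
  by (simp_all add: schatten_class_def)

lemma schatten_norm_nonneg [simp]: "schatten_norm p T \<ge> 0" by (simp add: schatten_norm_def)

lemma schatten_le_norm: "p \<ge> 1 \<Longrightarrow> T \<in> schatten_class p \<Longrightarrow> schatten_le p T (schatten_norm p T)"
  using schatten_le_iff[of p T "schatten_norm p T"] by (simp add: schatten_classD)

lemma schatten_leI:
  assumes "p \<ge> 1" "scalar_linear T" "compact_op T" "C \<ge> 0" "schatten_le p T C"
  shows "T \<in> schatten_class p" "schatten_norm p T \<le> C"
  using schatten_le_iff[OF assms(1-4)] assms(5) by auto

lemma svd_norm:
  assumes p: "p \<ge> 1" and T: "scalar_linear T" "compact_op T" and svd: "svd T s u v"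
  shows "T \<in> schatten_class p \<longleftrightarrow> s \<in> lp p" "T \<in> schatten_class p \<Longrightarrow> schatten_norm p T = lpn p s"
proof -
  have "norm (s i) = s i" for i using svdD(3)[OF svd] by simp
  then have iff: "T \<in> schatten_class p \<and> schatten_norm p T \<le> C \<longleftrightarrow> s \<in> lp p \<and> lpn p s \<le> C" if "C \<ge> 0" for C
    using lp_le_iff[OF p that, of s] schatten_le_iff[OF p T that] unfolding svd_schatten_le[OF p svd] by simp
  show "T \<in> schatten_class p \<longleftrightarrow> s \<in> lp p"
    using iff[of "schatten_norm p T"] iff[of "lpn p s"] by auto
  show "schatten_norm p T = lpn p s" if "T \<in> schatten_class p"
    using iff[of "schatten_norm p T"] iff[of "lpn p s"] that by (auto intro: antisym)
qed

lemma svd_exists: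
  assumes "scalar_linear T" "compact_op T"
  shows "\<exists>s u v. svd T s u v"
  using schatten_svd[OF assms zero_less_one] by metis

lemma schatten_le_mono: "p \<ge> 1 \<Longrightarrow> schatten_le p T C \<Longrightarrow> 0 \<le> C \<Longrightarrow> C \<le> D \<Longrightarrow> schatten_le p T D"
  unfolding schatten_le_def by (meson order_trans powr_mono2 zero_le_one)

lemma schatten_le_add:
  assumes "p \<ge> 1" "A \<ge> 0" "B \<ge> 0" "schatten_le p S A" "schatten_le p T B"
  shows "schatten_le p (S + T) (A + B)"
  unfolding schatten_le_def
proof (intro allI impI)
  fix n :: nat and e f :: "nat \<Rightarrow> 'a ell2"
  assume "orthosystem {..<n} e" "orthosystem {..<n} f"
  then have "(\<Sum>j<n. norm (\<langle>S (e j), f j\<rangle> + \<langle>T (e j), f j\<rangle>) powr p) \<le> (A + B) powr p"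
    using assms(4,5) unfolding schatten_le_def by (intro minkowski_sum[OF assms(1) finite_lessThan assms(2,3)]) auto
  then show "(\<Sum>j<n. norm \<langle>(S + T) (e j), f j\<rangle> powr p) \<le> (A + B) powr p"
    by (simp add: plus_blinfun.rep_eq inner.add_left)
qed

lemma schatten_le_scale:
  assumes "schatten_le p T C"
  shows "schatten_le p (op_scale c T) (norm c * C)"
  unfolding schatten_le_def
proof (intro allI impI)
  fix n :: nat and e f :: "nat \<Rightarrow> 'a ell2"
  assume "orthosystem {..<n} e" "orthosystem {..<n} f"
  then have "norm c powr p * (\<Sum>j<n. norm \<langle>T (e j), f j\<rangle> powr p) \<le> norm c powr p * C powr p"
    using assms by (intro mult_left_mono) (auto simp: schatten_le_def)
  then show "(\<Sum>j<n. norm \<langle>op_scale c T (e j), f j\<rangle> powr p) \<le> (norm c * C) powr p"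
    by (simp add: inner_scale_left norm_mult powr_mult sum_distrib_left)
qed

lemma schatten_le_scaleR: "schatten_le p T C \<Longrightarrow> schatten_le p (r *\<^sub>R T) (\<bar>r\<bar> * C)"
  using schatten_le_scale[of p T C "of_real r"] by (simp add: op_scale_of_real)

text \<open>Every test involves finitely many matrix coefficients, so the bound is preserved already
  under convergence in the operator norm.\<close>

lemma schatten_le_limit:
  assumes p: "p \<ge> 1" and lim: "X \<longlonglongrightarrow> T" and le: "\<forall>\<^sub>F n in sequentially. schatten_le p (X n) C"
  shows "schatten_le p T C"
  unfolding schatten_le_def
proof (intro allI impI)
  fix n :: nat and e f :: "nat \<Rightarrow> 'a ell2"
  assume o: "orthosystem {..<n} e" "orthosystem {..<n} f"
  show "(\<Sum>j<n. norm \<langle>T (e j), f j\<rangle> powr p) \<le> C powr p"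
  proof (rule tendsto_upperbound)
    show "(\<lambda>m. \<Sum>j<n. norm \<langle>X m (e j), f j\<rangle> powr p) \<longlonglongrightarrow> (\<Sum>j<n. norm \<langle>T (e j), f j\<rangle> powr p)"
      by (intro tendsto_sum tendsto_powr' tendsto_norm inner.tendsto blinfun.tendsto lim tendsto_const)
        (use p in \<open>auto intro!: always_eventually\<close>)
    show "\<forall>\<^sub>F m in sequentially. (\<Sum>j<n. norm \<langle>X m (e j), f j\<rangle> powr p) \<le> C powr p"
      using le by eventually_elim (use o in \<open>simp add: schatten_le_def\<close>)
  qed simp
qed

lemma norm_le_schatten_le:
  assumes p: "p \<ge> 1" and C: "C \<ge> 0" and T: "schatten_le p T C"
  shows "norm T \<le> C"
proof (rule norm_blinfun_bound[OF C])
  fix x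
  show "norm (T x) \<le> C * norm x"
  proof (cases "T x = 0")
    case False
    then have x: "x \<noteq> 0" by (auto simp: blinfun.zero_right)
    define e where "e = (\<lambda>j::nat. (1 / norm x) *\<^sub>R x)"
    define f where "f = (\<lambda>j::nat. (1 / norm (T x)) *\<^sub>R T x)"
    have o: "orthosystem {..<Suc 0} e" "orthosystem {..<Suc 0} f"
      using x False by (auto simp: orthosystem_def e_def f_def)
    have "\<langle>T (e 0), f 0\<rangle> = of_real (norm (T x) / norm x)"
      using x False
      by (simp add: e_def f_def blinfun.scaleR_right inner.scaleR_left inner.scaleR_right inner_self
          scaleR_conv_of_real power2_eq_square)
    then have "norm \<langle>T (e 0), f 0\<rangle> = norm (T x) / norm x" by (simp add: norm_divide)
    moreover have "(\<Sum>j<Suc 0. norm \<langle>T (e j), f j\<rangle> powr p) \<le> C powr p"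
      using T o unfolding schatten_le_def by blast
    ultimately have "(norm (T x) / norm x) powr p \<le> C powr p" by simp
    then have "norm (T x) / norm x \<le> C"
      using powr_less_mono2[of p C "norm (T x) / norm x"] p C by (meson less_le_trans not_le zero_less_one)
    then show ?thesis using x by (simp add: divide_le_eq)
  qed (use C in simp)
qed

text \<open>For one term, the Cauchy-Schwarz and Bessel inequalities bound the sum over j of the
  products by M, hence each product by M, and so the sum of their p-th powers by
  \<open>M powr (p - 1) * M\<close>. Minkowski's inequality adds the terms. R is only assumed to be
  dominated by rank one forms, so these need not be built as operators.\<close>

lemma schatten_le_sum_rank_one:
  fixes R :: "'k::rc_scalar ell2_op" and a b :: "nat \<Rightarrow> 'k ell2"
  assumes p: "p \<ge> 1" and R: "\<And>x y. norm \<langle>R x, y\<rangle> \<le> (\<Sum>i<K. norm \<langle>x, a i\<rangle> * norm \<langle>y, b i\<rangle>)"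
  shows "schatten_le p R (\<Sum>i<K. norm (a i) * norm (b i))"
  unfolding schatten_le_def
proof (intro allI impI)
  fix n :: nat and e f :: "nat \<Rightarrow> 'k ell2"
  assume e: "orthosystem {..<n} e" and f: "orthosystem {..<n} f"
  define X where "X = (\<lambda>i j. norm \<langle>e j, a i\<rangle> * norm \<langle>f j, b i\<rangle>)"
  have X0: "X i j \<ge> 0" for i j by (simp add: X_def)
  have one: "(\<Sum>j<n. norm (X i j) powr p) \<le> (norm (a i) * norm (b i)) powr p" for i
  proof -
    define M where "M = norm (a i) * norm (b i)"
    have M0: "M \<ge> 0" by (simp add: M_def)
    have sq: "L2_set (\<lambda>j. norm \<langle>w j, c\<rangle>) {..<n} \<le> norm c" if "orthosystem {..<n} w" for w :: "nat \<Rightarrow> 'k ell2" and c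
      unfolding L2_set_def inner_norm_commute[of "w _"]
      by (rule real_le_lsqrt) (use bessel[OF that, of "{..<n}" c] in \<open>auto intro: sum_nonneg\<close>)
    have "(\<Sum>j<n. X i j) = (\<Sum>j<n. \<bar>norm \<langle>e j, a i\<rangle>\<bar> * \<bar>norm \<langle>f j, b i\<rangle>\<bar>)" by (simp add: X_def)
    also have "\<dots> \<le> L2_set (\<lambda>j. norm \<langle>e j, a i\<rangle>) {..<n} * L2_set (\<lambda>j. norm \<langle>f j, b i\<rangle>) {..<n}"
      by (rule L2_set_mult_ineq)
    also have "\<dots> \<le> M" unfolding M_def by (intro mult_mono sq e f) auto
    finally have s: "(\<Sum>j<n. X i j) \<le> M" .
    have XM: "X i j \<le> M" if "j < n" for j
      by (rule order_trans[OF member_le_sum s]) (use that X0 in auto)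
    have "norm (X i j) powr p \<le> X i j * M powr (p - 1)" if "j < n" for j
    proof (cases "X i j = 0")
      case False
      have "X i j powr p = X i j * X i j powr (p - 1)" using X0[of i j] False by (simp add: powr_mult_base)
      also have "\<dots> \<le> X i j * M powr (p - 1)"
        using p X0 XM[OF that] by (intro mult_left_mono powr_mono2) auto
      finally show ?thesis using X0[of i j] by simp
    qed (use p in simp)
    then have "(\<Sum>j<n. norm (X i j) powr p) \<le> (\<Sum>j<n. X i j * M powr (p - 1))" by (intro sum_mono) auto
    also have "\<dots> = (\<Sum>j<n. X i j) * M powr (p - 1)" by (simp add: sum_distrib_right)
    also have "\<dots> \<le> M * M powr (p - 1)" using s by (intro mult_right_mono) auto
    also have "\<dots> = M powr p" using M0 by (cases "M = 0") (use p in \<open>auto simp: powr_mult_base\<close>)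
    finally show ?thesis by (simp only: M_def)
  qed
  have "(\<Sum>j<n. norm (\<Sum>i<k. X i j) powr p) \<le> (\<Sum>i<k. norm (a i) * norm (b i)) powr p" for k
  proof (induction k)
    case (Suc k)
    have "(\<Sum>j<n. norm ((\<Sum>i<k. X i j) + X k j) powr p)
        \<le> ((\<Sum>i<k. norm (a i) * norm (b i)) + norm (a k) * norm (b k)) powr p"
      by (rule minkowski_sum[OF p finite_lessThan _ _ Suc one]) (auto intro: sum_nonneg)
    then show ?case by simp
  qed (use p in simp)
  from this[of K] have "(\<Sum>j<n. (\<Sum>i<K. X i j) powr p) \<le> (\<Sum>i<K. norm (a i) * norm (b i)) powr p"
    by (simp add: sum_nonneg X0 abs_of_nonneg)
  moreover have "(\<Sum>j<n. norm \<langle>R (e j), f j\<rangle> powr p) \<le> (\<Sum>j<n. (\<Sum>i<K. X i j) powr p)"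
    unfolding X_def using p R by (intro sum_mono powr_mono2) auto
  ultimately show "(\<Sum>j<n. norm \<langle>R (e j), f j\<rangle> powr p) \<le> (\<Sum>i<K. norm (a i) * norm (b i)) powr p"
    by (rule order_trans[rotated])
qed

section \<open>Coordinate projections\<close>

definition prj :: "nat set \<Rightarrow> 'k::rc_scalar ell2_op" where
  "prj S = Blinfun (\<lambda>x. Abs_ell2 (\<lambda>n. if n \<in> S then coord x n else 0))"

lemma coord_prj [simp]: "coord (prj S x) n = (if n \<in> S then coord x n else 0)"
proof -
  define f where "f = (\<lambda>x :: 'a ell2. Abs_ell2 (\<lambda>n. if n \<in> S then coord x n else 0))"
  have m: "(\<lambda>n. if n \<in> S then coord x n else 0) \<in> lp 2"
    "lpn 2 (\<lambda>n. if n \<in> S then coord x n else 0) \<le> norm x" for x :: "'a ell2"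
    using lpn_mono[OF _ coord_lp[of x], where y = "\<lambda>n. if n \<in> S then coord x n else 0"] by (auto simp: norm_ell2_eq)
  have c: "coord (f x) n = (if n \<in> S then coord x n else 0)" for x n
    unfolding f_def by (simp only: coord_Abs[OF m(1)])
  have n: "norm (f x) \<le> norm x" for x
    using m(2)[of x] unfolding norm_ell2_eq[of "f x"] by (simp add: f_def coord_Abs[OF m(1)])
  have "bounded_linear f"
    by (rule bounded_linear_intro[where K = 1])
      (use n in \<open>auto intro!: ell2_eqI simp: c scaleR_ell2_def\<close>)
  then have "prj S x = f x" unfolding prj_def f_def[symmetric] by (simp add: bounded_linear_Blinfun_apply)
  then show ?thesis by (simp add: c)
qed

lemma scalar_linear_prj: "scalar_linear (prj S)"
  by (auto simp: scalar_linear_def intro!: ell2_eqI)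

lemma prj_prj: "prj S (prj R x) = prj (S \<inter> R) x"
  by (rule ell2_eqI) simp

lemma prj_selfadjoint: "\<langle>prj S x, y\<rangle> = \<langle>x, prj S y\<rangle>"
  unfolding ell2_inner_def by (intro suminf_cong) simp

lemma norm_prj_le: "norm (prj S x) \<le> norm x"
  unfolding norm_ell2_eq by (rule lpn_mono(2)[OF _ coord_lp]) auto

lemma prj_tail_tendsto: "(\<lambda>m. norm (prj {m..} x)) \<longlonglongrightarrow> 0"
proof -
  have e: "coord (prj {m..} x) = coord x - trunc m (coord x)" for m
    by (rule ext) (simp add: minus_fun_app trunc_def)
  show ?thesis unfolding norm_ell2_eq e by (rule lpn_trunc_tendsto[OF _ coord_lp]) simp
qed

lemma prj_lessThan: "prj {..<n} x = (\<Sum>i<n. ell2_scale (coord x i) (ell2_unit i))"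
  by (rule ell2_eqI) (auto simp: if_distrib cong: if_cong)

text \<open>
  A coordinate projection is the mean of the identity and a self-adjoint coordinate isometry,
  which preserves orthonormal systems.
\<close>

lemma prj_decomposition:
  fixes S :: "nat set"
  defines "R \<equiv> prj S - prj (- S)"
  shows "prj S = (1/2) *\<^sub>R (id_blinfun + R)" "\<langle>R x, y\<rangle> = \<langle>x, R y\<rangle>" "orthosystem I e \<Longrightarrow> orthosystem I (\<lambda>i. R (e i))"
proof -
  have Rx: "R x = prj S x - prj (- S) x" for x by (simp add: R_def minus_blinfun.rep_eq)
  show "prj S = (1/2) *\<^sub>R (id_blinfun + R)"
    by (intro blinfun_eqI ell2_eqI) (simp add: scaleR_blinfun.rep_eq plus_blinfun.rep_eq Rx scaleR_ell2_def)
  show sa: "\<langle>R x, y\<rangle> = \<langle>x, R y\<rangle>" for x y by (simp add: Rx inner.diff_left inner.diff_right prj_selfadjoint)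
  have RR: "R (R x) = x" for x by (rule ell2_eqI) (simp add: Rx)
  have iso: "\<langle>R x, R y\<rangle> = \<langle>x, y\<rangle>" for x y by (simp add: sa RR)
  have nR: "norm (R x) = norm x" for x
  proof -
    have "of_real ((norm (R x))\<^sup>2) = (of_real ((norm x)\<^sup>2) :: 'a)" by (simp only: inner_self[symmetric] iso)
    then show ?thesis by (simp only: of_real_eq_iff) simp
  qed
  show "orthosystem I (\<lambda>i. R (e i))" if "orthosystem I e"
    using that unfolding orthosystem_def iso nR by (metis norm_eq_zero nR)
qed

lemma schatten_le_prj_right:
  assumes p: "p \<ge> 1" and C: "C \<ge> 0" and T: "schatten_le p T C"
  shows "schatten_le p (T o\<^sub>L prj S) C"
proof -
  define R :: "'a ell2_op" where "R = prj S - prj (- S)"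
  have half: "prj S x = (1/2) *\<^sub>R (x + R x)" for x
    by (subst prj_decomposition(1)[of S]) (simp add: scaleR_blinfun.rep_eq plus_blinfun.rep_eq R_def)
  have h: "schatten_le p (T o\<^sub>L R) C"
    unfolding schatten_le_def R_def
  proof (intro allI impI)
    fix n :: nat and e f :: "nat \<Rightarrow> 'a ell2"
    assume "orthosystem {..<n} e" "orthosystem {..<n} f"
    then show "(\<Sum>j<n. norm \<langle>(T o\<^sub>L (prj S - prj (- S))) (e j), f j\<rangle> powr p) \<le> C powr p"
      using T prj_decomposition(3)[of "{..<n}" e S] unfolding schatten_le_def blinfun_apply_blinfun_compose by blast
  qed
  have "schatten_le p ((1/2) *\<^sub>R (T + (T o\<^sub>L R))) (\<bar>1/2\<bar> * (C + C))"
    using schatten_le_scaleR[of p "T + (T o\<^sub>L R)" "C + C" "1/2"] schatten_le_add[OF p C C T h] by simp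
  moreover have "(1/2) *\<^sub>R (T + (T o\<^sub>L R)) = T o\<^sub>L prj S"
    by (rule blinfun_eqI) (simp add: half scaleR_blinfun.rep_eq plus_blinfun.rep_eq blinfun.scaleR_right blinfun.add_right)
  ultimately show ?thesis by simp
qed

lemma schatten_le_prj_left:
  assumes p: "p \<ge> 1" and C: "C \<ge> 0" and T: "schatten_le p T C"
  shows "schatten_le p (prj S o\<^sub>L T) C"
proof -
  define R :: "'a ell2_op" where "R = prj S - prj (- S)"
  have half: "prj S x = (1/2) *\<^sub>R (x + R x)" for x
    by (subst prj_decomposition(1)[of S]) (simp add: scaleR_blinfun.rep_eq plus_blinfun.rep_eq R_def)
  have h: "schatten_le p (R o\<^sub>L T) C"
    unfolding schatten_le_def R_def
  proof (intro allI impI)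
    fix n :: nat and e f :: "nat \<Rightarrow> 'a ell2"
    assume "orthosystem {..<n} e" "orthosystem {..<n} f"
    then show "(\<Sum>j<n. norm \<langle>((prj S - prj (- S)) o\<^sub>L T) (e j), f j\<rangle> powr p) \<le> C powr p"
      using T prj_decomposition(3)[of "{..<n}" f S]
      unfolding schatten_le_def blinfun_apply_blinfun_compose prj_decomposition(2) by blast
  qed
  have "schatten_le p ((1/2) *\<^sub>R (T + (R o\<^sub>L T))) (\<bar>1/2\<bar> * (C + C))"
    using schatten_le_scaleR[of p "T + (R o\<^sub>L T)" "C + C" "1/2"] schatten_le_add[OF p C C T h] by simp
  moreover have "(1/2) *\<^sub>R (T + (R o\<^sub>L T)) = prj S o\<^sub>L T"
    by (rule blinfun_eqI) (simp add: half scaleR_blinfun.rep_eq plus_blinfun.rep_eq)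
  ultimately show ?thesis by simp
qed

section \<open>Compact operators\<close>

lemma compact_opI:
  fixes T :: "('k::real_normed_field) ell2_op"
  shows "compact K \<Longrightarrow> blinfun_apply T ` cball 0 1 \<subseteq> K \<Longrightarrow> compact_op T"
  unfolding compact_op_def by (metis closed_Int_compact closed_closure closure_minimal compact_imp_closed inf.absorb1)

lemma compact_op_comp_left: "compact_op T \<Longrightarrow> compact_op (A o\<^sub>L T)"
  by (rule compact_opI[of "blinfun_apply A ` closure (blinfun_apply T ` cball 0 1)"])
    (auto simp: compact_op_def intro!: compact_continuous_image blinfun.continuous_on continuous_on_id
        continuous_on_const closure_subset[THEN subsetD])

lemma compact_op_prj_right: "compact_op T \<Longrightarrow> compact_op (T o\<^sub>L prj S)"
  by (rule compact_opI[of "closure (blinfun_apply T ` cball 0 1)"])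
    (auto simp: compact_op_def intro!: closure_subset[THEN subsetD] imageI order_trans[OF norm_prj_le])

lemma compact_op_add: "compact_op S \<Longrightarrow> compact_op T \<Longrightarrow> compact_op (S + T)"
  by (rule compact_opI[of "(\<lambda>(x, y). x + y) ` (closure (blinfun_apply S ` cball 0 1) \<times> closure (blinfun_apply T ` cball 0 1))"])
    (auto simp: compact_op_def plus_blinfun.rep_eq split_beta
       intro!: compact_continuous_image compact_Times continuous_intros
         image_eqI[where x = "(S _, T _)"] closure_subset[THEN subsetD])

lemma compact_op_limit:
  fixes T :: "'k::rc_scalar ell2_op"
  assumes lim: "X \<longlonglongrightarrow> T" and X: "\<And>n. compact_op (X n)"
  shows "compact_op T"
  unfolding compact_op_def compact_eq_totally_bounded
proof (intro conjI allI impI)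
  show "complete (closure (blinfun_apply T ` cball 0 1))" by (simp add: complete_eq_closed)
  fix e :: real assume e: "e > 0"
  obtain n where n: "norm (X n - T) < e / 4" using LIMSEQ_D[OF lim, of "e / 4"] e by auto
  have "\<exists>k. finite k \<and> closure (blinfun_apply (X n) ` cball 0 1) \<subseteq> (\<Union>x\<in>k. ball x (e / 4))"
    using X[of n] e unfolding compact_op_def compact_eq_totally_bounded by simp
  then obtain k where k: "finite k" "closure (blinfun_apply (X n) ` cball 0 1) \<subseteq> (\<Union>x\<in>k. ball x (e / 4))" by blast
  have "closure (blinfun_apply T ` cball 0 1) \<subseteq> (\<Union>x\<in>k. ball x e)"
  proof
    fix y assume "y \<in> closure (blinfun_apply T ` cball 0 1)"
    then obtain x where x: "norm x \<le> 1" "dist (T x) y < e / 4"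
      using e unfolding closure_approachable by (metis (no_types, lifting) divide_pos_pos imageE mem_cball_0 zero_less_numeral)
    have "X n x \<in> closure (blinfun_apply (X n) ` cball 0 1)" using x(1) closure_subset by fastforce
    then obtain z where z: "z \<in> k" "dist z (X n x) < e / 4" using k(2) by auto
    have "dist (X n x) (T x) = norm ((X n - T) x)" by (simp add: dist_norm minus_blinfun.rep_eq)
    also have "\<dots> \<le> norm (X n - T) * norm x" by (rule norm_blinfun)
    also have "\<dots> \<le> norm (X n - T)" using x(1) by (simp add: mult_left_le)
    finally have "dist (X n x) (T x) < e / 4" using n by simp
    then have "dist z y < e"
      using z(2) x(2) dist_triangle[of z y "X n x"] dist_triangle[of "X n x" y "T x"] e by linarith
    then show "y \<in> (\<Union>x\<in>k. ball x e)" using z(1) by auto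
  qed
  then show "\<exists>k. finite k \<and> closure (blinfun_apply T ` cball 0 1) \<subseteq> (\<Union>x\<in>k. ball x e)" using k(1) by blast
qed

lemma compact_op_scale:
  assumes "compact_op T" shows "compact_op (op_scale c T)"
  unfolding op_scale_def by (rule compact_op_comp_left[OF assms])

lemma scalar_linear_intros:
  "scalar_linear S \<Longrightarrow> scalar_linear T \<Longrightarrow> scalar_linear (S + T)"
  "scalar_linear S \<Longrightarrow> scalar_linear T \<Longrightarrow> scalar_linear (S - T)"
  "scalar_linear T \<Longrightarrow> scalar_linear (op_scale c T)"
  "scalar_linear S \<Longrightarrow> scalar_linear T \<Longrightarrow> scalar_linear (S o\<^sub>L T)"
  by (auto simp: scalar_linear_def plus_blinfun.rep_eq minus_blinfun.rep_eq ell2.scale_right_distrib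
      ell2.scale_right_diff_distrib mult.commute)

lemma scalar_linear_limit:
  fixes T :: "'k::rc_scalar ell2_op"
  assumes lim: "X \<longlonglongrightarrow> T" and X: "\<And>n. scalar_linear (X n)"
  shows "scalar_linear T"
  unfolding scalar_linear_def
proof (intro allI)
  fix c x
  have "(\<lambda>n. X n (ell2_scale c x)) \<longlonglongrightarrow> T (ell2_scale c x)" by (rule blinfun.tendsto[OF lim tendsto_const])
  moreover have "(\<lambda>n. ell2_scale c (X n x)) \<longlonglongrightarrow> ell2_scale c (T x)"
    by (rule bounded_linear.tendsto[OF bounded_linear_ell2_scale blinfun.tendsto[OF lim tendsto_const]])
  ultimately show "T (ell2_scale c x) = ell2_scale c (T x)"
    unfolding scalar_linearD[OF X] by (rule LIMSEQ_unique)
qed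

section \<open>The Schatten class as a normed space\<close>

lemma schatten_class_add:
  assumes p: "p \<ge> 1" and S: "S \<in> schatten_class p" and T: "T \<in> schatten_class p"
  shows "S + T \<in> schatten_class p" "schatten_norm p (S + T) \<le> schatten_norm p S + schatten_norm p T"
proof -
  have "schatten_le p (S + T) (schatten_norm p S + schatten_norm p T)"
    by (intro schatten_le_add schatten_le_norm p S T) auto
  then show "S + T \<in> schatten_class p" "schatten_norm p (S + T) \<le> schatten_norm p S + schatten_norm p T"
    using schatten_leI[OF p scalar_linear_intros(1) compact_op_add] schatten_classD S T
    by (metis add_nonneg_nonneg schatten_norm_nonneg)+
qed

lemma schatten_class_scale:
  assumes p: "p \<ge> 1" and T: "T \<in> schatten_class p"
  shows "op_scale c T \<in> schatten_class p" "schatten_norm p (op_scale c T) = norm c * schatten_norm p T"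
proof -
  have le: "op_scale c T \<in> schatten_class p \<and> schatten_norm p (op_scale c T) \<le> norm c * schatten_norm p T"
    if T: "T \<in> schatten_class p" for c and T :: "'a ell2_op"
    using schatten_leI[OF p scalar_linear_intros(3) compact_op_scale _ schatten_le_scale[OF schatten_le_norm[OF p T]]]
      schatten_classD[OF T] by simp
  show "op_scale c T \<in> schatten_class p" using le[OF T] by blast
  show "schatten_norm p (op_scale c T) = norm c * schatten_norm p T"
  proof (cases "c = 0")
    case True
    then show ?thesis using le[OF T, of 0] by (simp add: antisym)
  next
    case False
    have "op_scale (inverse c) (op_scale c T) = T"
      using False by (intro blinfun_eqI) simp
    then have "schatten_norm p T \<le> norm (inverse c) * schatten_norm p (op_scale c T)"
      using le[of "op_scale c T" "inverse c"] le[OF T, of c] by simp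
    then have "norm c * schatten_norm p T \<le> schatten_norm p (op_scale c T)"
      using False by (simp add: norm_inverse norm_divide field_simps)
    then show ?thesis using le[OF T, of c] by simp
  qed
qed

lemma op_scale_minus_one: "op_scale (- 1) T = - T"
  using op_scale_of_real[of "- 1" T] by simp

lemma schatten_class_diff:
  assumes p: "p \<ge> 1" and S: "S \<in> schatten_class p" and T: "T \<in> schatten_class p"
  shows "S - T \<in> schatten_class p" "schatten_norm p (S - T) \<le> schatten_norm p S + schatten_norm p T"
  using schatten_class_add[OF p S schatten_class_scale(1)[OF p T, of "- 1"]] schatten_class_scale(2)[OF p T, of "- 1"]
  by (simp_all add: op_scale_minus_one)

lemma norm_le_schatten_norm: "p \<ge> 1 \<Longrightarrow> T \<in> schatten_class p \<Longrightarrow> norm T \<le> schatten_norm p T"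
  by (rule norm_le_schatten_le) (auto intro: schatten_le_norm)

text \<open>The operator norm is dominated by the Schatten norm, which produces a limit;
  \<open>schatten_le_limit\<close> then upgrades the convergence to the Schatten norm.\<close>

lemma schatten_class_complete:
  fixes X :: "nat \<Rightarrow> 'k::rc_scalar ell2_op"
  assumes p: "p \<ge> 1" and X: "\<And>n. X n \<in> schatten_class p"
    and C: "\<And>e. e > 0 \<Longrightarrow> \<exists>N. \<forall>m\<ge>N. \<forall>n\<ge>N. schatten_norm p (X m - X n) \<le> e"
  shows "\<exists>T\<in>schatten_class p. (\<lambda>n. schatten_norm p (X n - T)) \<longlonglongrightarrow> 0"
proof -
  have "Cauchy X"
    unfolding Cauchy_def
  proof (intro allI impI)
    fix e :: real assume "e > 0"
    then obtain N where N: "\<forall>m\<ge>N. \<forall>n\<ge>N. schatten_norm p (X m - X n) \<le> e / 2" using C[of "e / 2"] by auto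
    have "dist (X m) (X n) < e" if "m \<ge> N" "n \<ge> N" for m n
      using norm_le_schatten_norm[OF p schatten_class_diff(1)[OF p X X], of m n] N that \<open>e > 0\<close>
      by (fastforce simp: dist_norm)
    then show "\<exists>M. \<forall>m\<ge>M. \<forall>n\<ge>M. dist (X m) (X n) < e" by blast
  qed
  then obtain T where T: "X \<longlonglongrightarrow> T" using Cauchy_convergent convergent_def by blast
  have TS: "scalar_linear T" "compact_op T"
    by (rule scalar_linear_limit[OF T], rule schatten_classD(1)[OF X])
      (rule compact_op_limit[OF T], rule schatten_classD(2)[OF X])
  have "compact_op (X n - T)" for n
    using compact_op_add[OF schatten_classD(2)[OF X[of n]] compact_op_scale[OF TS(2), of "- 1"]]
    by (simp add: op_scale_minus_one)
  note dT = scalar_linear_intros(2)[OF schatten_classD(1)[OF X] TS(1)] this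
  have est: "X n - T \<in> schatten_class p \<and> schatten_norm p (X n - T) \<le> e"
    if "e > 0" "\<forall>m\<ge>N. \<forall>n\<ge>N. schatten_norm p (X m - X n) \<le> e" "n \<ge> N" for e N n
  proof -
    have "schatten_le p (X n - T) e"
    proof (rule schatten_le_limit[OF p])
      show "(\<lambda>m. X n - X m) \<longlonglongrightarrow> X n - T" by (intro tendsto_intros T)
      show "\<forall>\<^sub>F m in sequentially. schatten_le p (X n - X m) e"
        unfolding eventually_sequentially
        using that schatten_le_mono[OF p schatten_le_norm[OF p schatten_class_diff(1)[OF p X X]] schatten_norm_nonneg]
        by blast
    qed
    then show ?thesis using schatten_leI[OF p dT less_imp_le[OF that(1)]] by blast
  qed
  obtain N where "\<forall>m\<ge>N. \<forall>n\<ge>N. schatten_norm p (X m - X n) \<le> 1" using C[of 1] by auto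
  then have "X N - T \<in> schatten_class p" using est[of 1 N N] by simp
  then have "X N - (X N - T) \<in> schatten_class p" by (rule schatten_class_diff(1)[OF p X])
  then have "T \<in> schatten_class p" by simp
  moreover have "(\<lambda>n. schatten_norm p (X n - T)) \<longlonglongrightarrow> 0"
  proof (rule LIMSEQ_I)
    fix r :: real assume "r > 0"
    then obtain N where "\<forall>m\<ge>N. \<forall>n\<ge>N. schatten_norm p (X m - X n) \<le> r / 2" using C[of "r / 2"] by auto
    then have "\<forall>n\<ge>N. norm (schatten_norm p (X n - T) - 0) < r" using est[of "r / 2" N] \<open>r > 0\<close> by fastforce
    then show "\<exists>N. \<forall>n\<ge>N. norm (schatten_norm p (X n - T) - 0) < r" by blast
  qed
  ultimately show ?thesis by blast
qed

lemma schatten_class_prj: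
  assumes p: "p \<ge> 1" and T: "T \<in> schatten_class p"
  shows "prj S o\<^sub>L T \<in> schatten_class p" "schatten_norm p (prj S o\<^sub>L T) \<le> schatten_norm p T"
    "T o\<^sub>L prj S \<in> schatten_class p" "schatten_norm p (T o\<^sub>L prj S) \<le> schatten_norm p T"
  using schatten_leI[OF p scalar_linear_intros(4)[OF scalar_linear_prj schatten_classD(1)[OF T]]
      compact_op_comp_left[OF schatten_classD(2)[OF T]] _ schatten_le_prj_left[OF p _ schatten_le_norm[OF p T]]]
    schatten_leI[OF p scalar_linear_intros(4)[OF schatten_classD(1)[OF T] scalar_linear_prj]
      compact_op_prj_right[OF schatten_classD(2)[OF T]] _ schatten_le_prj_right[OF p _ schatten_le_norm[OF p T]]]
  by auto

text \<open>Cutting the Schmidt expansion after K terms leaves a remainder of Schatten norm at most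
  \<epsilon> / 2, which projections do not increase. For the K rank one terms the tails of the
  finitely many vectors u i and v i tend to 0.\<close>

lemma schatten_tail:
  fixes T :: "'k::rc_scalar ell2_op"
  assumes p: "p \<ge> 1" and T: "T \<in> schatten_class p" and e: "\<epsilon> > 0"
  shows "\<exists>m0. \<forall>m\<ge>m0. schatten_le p (prj {m..} o\<^sub>L T) \<epsilon> \<and> schatten_le p (T o\<^sub>L prj {m..}) \<epsilon>"
proof -
  obtain s u v where svd: "svd T s u v" using svd_exists[OF schatten_classD[OF T]] by blast
  have s: "s \<in> lp p" using svd_norm(1)[OF p schatten_classD[OF T] svd] T by blast
  have "\<forall>\<^sub>F K in sequentially. lpn p (s - trunc K s) < \<epsilon> / 2"
    by (rule order_tendstoD(2)[OF lpn_trunc_tendsto[OF p s]]) (use e in simp)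
  then obtain K where K: "lpn p (s - trunc K s) < \<epsilon> / 2" using eventually_happens' sequentially_bot by blast
  define t where "t = (\<lambda>x i. ell2_scale (of_real (s i) * \<langle>x, u i\<rangle>) (v i))"
  define S where "S = (\<lambda>x. \<Sum>i<K. t x i)"
  have "bounded_linear (\<lambda>x. t x i)" for i
  proof (rule bounded_linear_intro[where K = "s i"])
    fix x
    have "norm (\<langle>x, u i\<rangle>) \<le> norm x"
      using order_trans[OF Cauchy_Schwarz mult_left_le[OF orthosystemD(3)[OF svdD(1)[OF svd] UNIV_I] norm_ge_zero]] .
    moreover have "norm (v i) \<le> 1" by (rule orthosystemD(3)[OF svdD(2)[OF svd] UNIV_I])
    ultimately have "norm \<langle>x, u i\<rangle> * norm (v i) \<le> norm x * 1" by (intro mult_mono) auto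
    then have "s i * (norm \<langle>x, u i\<rangle> * norm (v i)) \<le> s i * norm x"
      using svdD(3)[OF svd, of i] by (intro mult_left_mono) auto
    then show "norm (t x i) \<le> norm x * s i"
      using svdD(3)[OF svd, of i] by (simp add: t_def norm_ell2_scale norm_mult mult_ac)
  qed (simp_all add: t_def inner.add_left distrib_left ell2.scale_left_distrib
      scaleR_ell2_def inner_scale_left mult_ac)
  then have "bounded_linear S" unfolding S_def by (intro bounded_linear_sum)
  then have S: "blinfun_apply (Blinfun S) = S" by (rule bounded_linear_Blinfun_apply)
  define R where "R = T - Blinfun S"
  have Rx: "R x = T x - S x" for x by (simp add: R_def minus_blinfun.rep_eq S)
  \<comment> \<open>Setting the first K singular values and vectors to zero gives an expansion of
    the remainder directly.\<close>
  have "svd R (s - trunc K s) (\<lambda>i. if i < K then 0 else u i) (\<lambda>i. if i < K then 0 else v i)"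
    unfolding svd_def
  proof (intro conjI allI)
    show "orthosystem UNIV (\<lambda>i. if i < K then 0 else u i)" "orthosystem UNIV (\<lambda>i. if i < K then 0 else v i)"
      using svdD(1,2)[OF svd] by (auto simp: orthosystem_def inner.zero_left inner.zero_right)
    fix i
    show "(s - trunc K s) i = 0 \<and> (if i < K then 0 else u i) = 0 \<and> (if i < K then 0 else v i) = 0 \<or>
        0 < (s - trunc K s) i \<and> norm (if i < K then 0 else u i) = 1 \<and> norm (if i < K then 0 else v i) = 1"
      using svdD(3-5)[OF svd, of i] by (cases "s i = 0") (auto simp: minus_fun_app trunc_def less_le)
  next
    fix x
    have "(\<lambda>i. t x i - (if i \<in> {..<K} then t x i else 0)) sums (T x - S x)"
      unfolding S_def by (intro sums_diff sums_If_finite_set) (auto simp: t_def svdD(6)[OF svd])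
    moreover have "t x i - (if i \<in> {..<K} then t x i else 0) =
        ell2_scale (of_real ((s - trunc K s) i) * \<langle>x, if i < K then 0 else u i\<rangle>) (if i < K then 0 else v i)" for i
      by (simp add: t_def minus_fun_app trunc_def)
    ultimately show "(\<lambda>i. ell2_scale (of_real ((s - trunc K s) i) * \<langle>x, if i < K then 0 else u i\<rangle>)
        (if i < K then 0 else v i)) sums R x" by (simp add: Rx)
  qed
  note svdR = this
  have "schatten_le p R (\<epsilon> / 2)"
    unfolding svd_schatten_le[OF p svdR]
  proof
    fix n
    have "(\<Sum>i<n. (s - trunc K s) i powr p) = (\<Sum>i<n. norm ((s - trunc K s) i) powr p)"
      using svdD(3)[OF svdR] by (intro sum.cong) auto
    also have "\<dots> \<le> lpn p (s - trunc K s) powr p"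
      by (rule lp_leD[OF p lp_diff(1)[OF p s lp_trunc[OF p]]])
    also have "\<dots> \<le> (\<epsilon> / 2) powr p" using K p by (intro powr_mono2) auto
    finally show "(\<Sum>i<n. (s - trunc K s) i powr p) \<le> (\<epsilon> / 2) powr p" .
  qed
  note R = this
  \<comment> \<open>A projection on the left acts on the v i, one on the right on the u i.\<close>
  define W1 where "W1 = (\<lambda>m. \<Sum>i<K. norm (s i *\<^sub>R u i) * norm (prj {m..} (v i)))"
  define W2 where "W2 = (\<lambda>m. \<Sum>i<K. norm (prj {m..} (u i)) * norm (s i *\<^sub>R v i))"
  have "W1 \<longlonglongrightarrow> (\<Sum>i<K. norm (s i *\<^sub>R u i) * 0)" "W2 \<longlonglongrightarrow> (\<Sum>i<K. 0 * norm (s i *\<^sub>R v i))"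
    unfolding W1_def W2_def by (intro tendsto_intros prj_tail_tendsto)+
  then have lim: "W1 \<longlonglongrightarrow> 0" "W2 \<longlonglongrightarrow> 0" by simp_all
  have "\<epsilon> / 2 > 0" using e by simp
  from order_tendstoD(2)[OF lim(1) this] order_tendstoD(2)[OF lim(2) this]
  have "\<forall>\<^sub>F m in sequentially. W1 m < \<epsilon> / 2 \<and> W2 m < \<epsilon> / 2" by (rule eventually_conj)
  then obtain m0 where m0: "\<And>m. m \<ge> m0 \<Longrightarrow> W1 m < \<epsilon> / 2 \<and> W2 m < \<epsilon> / 2"
    unfolding eventually_sequentially by blast
  have W0: "W1 m \<ge> 0" "W2 m \<ge> 0" for m by (auto simp: W1_def W2_def sum_nonneg)
  have "schatten_le p (prj {m..} o\<^sub>L T) \<epsilon> \<and> schatten_le p (T o\<^sub>L prj {m..}) \<epsilon>" if m: "m \<ge> m0" for m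
  proof
    have inS: "\<langle>S x, y\<rangle> = (\<Sum>i<K. of_real (s i) * \<langle>x, u i\<rangle> * \<langle>v i, y\<rangle>)" for x y
      by (simp add: S_def t_def inner.sum_left inner_scale_left)
    have "schatten_le p (prj {m..} o\<^sub>L Blinfun S) (W1 m)"
      unfolding W1_def
    proof (rule schatten_le_sum_rank_one[OF p])
      fix x y
      have "norm \<langle>(prj {m..} o\<^sub>L Blinfun S) x, y\<rangle> = norm (\<Sum>i<K. of_real (s i) * \<langle>x, u i\<rangle> * \<langle>v i, prj {m..} y\<rangle>)"
        by (simp add: S prj_selfadjoint inS)
      also have "\<dots> \<le> (\<Sum>i<K. norm (of_real (s i) * \<langle>x, u i\<rangle> * \<langle>v i, prj {m..} y\<rangle>))" by (rule norm_sum)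
      also have "\<dots> = (\<Sum>i<K. norm \<langle>x, s i *\<^sub>R u i\<rangle> * norm \<langle>y, prj {m..} (v i)\<rangle>)"
        by (simp add: norm_mult inner.scaleR_right prj_selfadjoint[symmetric] inner_norm_commute[of _ y])
      finally show "norm \<langle>(prj {m..} o\<^sub>L Blinfun S) x, y\<rangle> \<le> \<dots>" .
    qed
    then have "schatten_le p ((prj {m..} o\<^sub>L R) + (prj {m..} o\<^sub>L Blinfun S)) (\<epsilon> / 2 + W1 m)"
      using schatten_le_add[OF p _ W0(1) schatten_le_prj_left[OF p _ R]] e by simp
    moreover have "(prj {m..} o\<^sub>L R) + (prj {m..} o\<^sub>L Blinfun S) = prj {m..} o\<^sub>L T"
      by (rule blinfun_eqI) (simp add: plus_blinfun.rep_eq Rx S blinfun.diff_right)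
    ultimately show "schatten_le p (prj {m..} o\<^sub>L T) \<epsilon>"
      using schatten_le_mono[OF p, of _ "\<epsilon> / 2 + W1 m" \<epsilon>] m0[OF m] W0[of m] e by simp
    have "schatten_le p (Blinfun S o\<^sub>L prj {m..}) (W2 m)"
      unfolding W2_def
    proof (rule schatten_le_sum_rank_one[OF p])
      fix x y
      have "norm \<langle>(Blinfun S o\<^sub>L prj {m..}) x, y\<rangle> = norm (\<Sum>i<K. of_real (s i) * \<langle>prj {m..} x, u i\<rangle> * \<langle>v i, y\<rangle>)"
        by (simp add: S inS)
      also have "\<dots> \<le> (\<Sum>i<K. norm (of_real (s i) * \<langle>prj {m..} x, u i\<rangle> * \<langle>v i, y\<rangle>))" by (rule norm_sum)
      also have "\<dots> = (\<Sum>i<K. norm \<langle>x, prj {m..} (u i)\<rangle> * norm \<langle>y, s i *\<^sub>R v i\<rangle>)"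
        by (simp add: norm_mult inner.scaleR_right prj_selfadjoint inner_norm_commute[of _ y] mult_ac)
      finally show "norm \<langle>(Blinfun S o\<^sub>L prj {m..}) x, y\<rangle> \<le> \<dots>" .
    qed
    then have "schatten_le p ((R o\<^sub>L prj {m..}) + (Blinfun S o\<^sub>L prj {m..})) (\<epsilon> / 2 + W2 m)"
      using schatten_le_add[OF p _ W0(2) schatten_le_prj_right[OF p _ R]] e by simp
    moreover have "(R o\<^sub>L prj {m..}) + (Blinfun S o\<^sub>L prj {m..}) = T o\<^sub>L prj {m..}"
      by (rule blinfun_eqI) (simp add: plus_blinfun.rep_eq Rx S)
    ultimately show "schatten_le p (T o\<^sub>L prj {m..}) \<epsilon>"
      using schatten_le_mono[OF p, of _ "\<epsilon> / 2 + W2 m" \<epsilon>] m0[OF m] W0[of m] e by simp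
  qed
  then show ?thesis by blast
qed

text \<open>The removed part consists of the first n rows and of what remains of the first n
  columns. Each of the two is a sum of n rank one operators.\<close>

lemma schatten_le_corner:
  fixes T :: "'k::rc_scalar ell2_op"
  assumes p: "p \<ge> 1" and T: "scalar_linear T"
  shows "schatten_le p (T - (prj {n..} o\<^sub>L (T o\<^sub>L prj {n..})))
    ((\<Sum>i<n. norm (hilbert_adjoint T (ell2_unit i))) + (\<Sum>i<n. norm (T (ell2_unit i))))"
proof -
  have split: "prj {..<n} x + prj {n..} x = x" for x :: "'k ell2" by (rule ell2_eqI) auto
  have "T - (prj {n..} o\<^sub>L (T o\<^sub>L prj {n..})) = (prj {..<n} o\<^sub>L T) + (prj {n..} o\<^sub>L (T o\<^sub>L prj {..<n}))"
  proof (rule blinfun_eqI)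
    fix x
    have "T x = prj {..<n} (T x) + prj {n..} (T (prj {..<n} x + prj {n..} x))" by (simp only: split)
    also have "\<dots> = prj {..<n} (T x) + (prj {n..} (T (prj {..<n} x)) + prj {n..} (T (prj {n..} x)))"
      by (simp only: blinfun.add_right)
    finally show "(T - (prj {n..} o\<^sub>L (T o\<^sub>L prj {n..}))) x = ((prj {..<n} o\<^sub>L T) + (prj {n..} o\<^sub>L (T o\<^sub>L prj {..<n}))) x"
      by (simp add: minus_blinfun.rep_eq plus_blinfun.rep_eq algebra_simps)
  qed
  moreover have h1: "schatten_le p (prj {..<n} o\<^sub>L T) (\<Sum>i<n. norm (hilbert_adjoint T (ell2_unit i)))"
  proof -
    have "schatten_le p (prj {..<n} o\<^sub>L T) (\<Sum>i<n. norm (hilbert_adjoint T (ell2_unit i)) * norm (ell2_unit i :: 'k ell2))"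
    proof (rule schatten_le_sum_rank_one[OF p])
      fix x y
      have "\<langle>(prj {..<n} o\<^sub>L T) x, y\<rangle> = (\<Sum>i<n. \<langle>T x, ell2_unit i\<rangle> * \<langle>ell2_unit i, y\<rangle>)"
        by (simp add: prj_lessThan inner.sum_left inner_scale_left inner_unit)
      then show "norm \<langle>(prj {..<n} o\<^sub>L T) x, y\<rangle> \<le>
          (\<Sum>i<n. norm \<langle>x, hilbert_adjoint T (ell2_unit i)\<rangle> * norm \<langle>y, ell2_unit i\<rangle>)"
        by (simp add: hilbert_adjoint(1)[OF T] inner_norm_commute[of y] norm_mult[symmetric] norm_sum)
    qed
    then show ?thesis by simp
  qed
  moreover have h2: "schatten_le p (T o\<^sub>L prj {..<n}) (\<Sum>i<n. norm (T (ell2_unit i)))"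
  proof -
    have "schatten_le p (T o\<^sub>L prj {..<n}) (\<Sum>i<n. norm (ell2_unit i :: 'k ell2) * norm (T (ell2_unit i)))"
    proof (rule schatten_le_sum_rank_one[OF p])
      fix x y
      have "\<langle>(T o\<^sub>L prj {..<n}) x, y\<rangle> = (\<Sum>i<n. \<langle>x, ell2_unit i\<rangle> * \<langle>T (ell2_unit i), y\<rangle>)"
        by (simp add: prj_lessThan blinfun.sum_right scalar_linearD[OF T] inner.sum_left inner_scale_left inner_unit)
      then show "norm \<langle>(T o\<^sub>L prj {..<n}) x, y\<rangle> \<le>
          (\<Sum>i<n. norm \<langle>x, ell2_unit i\<rangle> * norm \<langle>y, T (ell2_unit i)\<rangle>)"
        by (simp add: inner_norm_commute[of y] norm_mult[symmetric] norm_sum)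
    qed
    then show ?thesis by simp
  qed
  ultimately show ?thesis
    using schatten_le_add[OF p _ _ h1 schatten_le_prj_left[OF p _ h2]] by (simp add: sum_nonneg)
qed

section \<open>Block diagonal operators\<close>

definition supported :: "nat set \<Rightarrow> ('k::rc_scalar) ell2_op \<Rightarrow> bool" where
  "supported D T \<longleftrightarrow> (\<forall>x. prj D (T (prj D x)) = T x)"

lemma supportedD: assumes "supported D T" shows "prj D (T x) = T x" "T (prj D x) = T x"
  using assms unfolding supported_def by (metis prj_prj inf.idem)+

lemma supportedI:
  fixes T :: "'k::rc_scalar ell2_op"
  shows "(\<And>x. prj D (T x) = T x) \<Longrightarrow> (\<And>x. T (prj D x) = T x) \<Longrightarrow> supported D T"
  unfolding supported_def by metis

lemma supported_block: "supported D (prj D o\<^sub>L (T o\<^sub>L prj D))"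
  by (simp add: supported_def prj_prj)

lemma supported_mono: assumes T: "supported D T" and sub: "D \<subseteq> E" shows "supported E T"
proof (rule supportedI)
  have "prj E (prj D x) = prj D x" "prj D (prj E x) = prj D x" for x :: "'a ell2"
    using sub by (auto simp: prj_prj Int_absorb1 Int_absorb2)
  then show "prj E (T x) = T x" "T (prj E x) = T x" for x using supportedD[OF T] by metis+
qed

lemma supported_add: "supported D S \<Longrightarrow> supported D T \<Longrightarrow> supported D (S + T)"
  by (rule supportedI) (simp_all add: plus_blinfun.rep_eq blinfun.add_right supportedD)

lemma prj_scale: "prj D (ell2_scale c x) = ell2_scale c (prj D x)"
  by (rule scalar_linearD[OF scalar_linear_prj])

lemma supported_scale: "supported D T \<Longrightarrow> supported D (op_scale c T)"
  by (rule supportedI) (simp_all add: prj_scale supportedD)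

text \<open>Orthogonality leaves a single term of the expansion. This recovers the functional given
  by u k from T and v k, which \<open>svd_supported\<close> uses to locate u k.\<close>

lemma svd_inner:
  fixes T :: "'k::rc_scalar ell2_op"
  assumes svd: "svd T s u v"
  shows "\<langle>T x, v k\<rangle> = of_real (s k) * \<langle>x, u k\<rangle>"
proof -
  have "(\<lambda>i. of_real (s i) * \<langle>x, u i\<rangle> * \<langle>v i, v k\<rangle>) sums \<langle>T x, v k\<rangle>"
    using bounded_linear.sums[OF inner.bounded_linear_left svdD(6)[OF svd, of x]] by (simp add: inner_scale_left)
  moreover have "of_real (s i) * \<langle>x, u i\<rangle> * \<langle>v i, v k\<rangle> = (if i = k then of_real (s k) * \<langle>x, u k\<rangle> else 0)" for i
  proof -
    consider "i \<noteq> k" | "i = k" "s k = 0" | "i = k" "s k > 0" using svdD(3)[OF svd, of k] by fastforce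
    then show ?thesis
      by cases (use orthosystemD(1)[OF svdD(2)[OF svd], of i k] svdD(5)[OF svd, of k] in \<open>auto simp: inner_self\<close>)
  qed
  ultimately have "(\<lambda>i. if i = k then of_real (s k) * \<langle>x, u k\<rangle> else 0) sums \<langle>T x, v k\<rangle>" by simp
  moreover have "(\<lambda>i. if i = k then of_real (s k) * \<langle>x, u k\<rangle> else 0) sums (of_real (s k) * \<langle>x, u k\<rangle>)"
    using sums_single[of k "\<lambda>_. of_real (s k) * \<langle>x, u k\<rangle>"] by simp
  ultimately show ?thesis by (rule sums_unique2)
qed

text \<open>For positive s i, v i is a multiple of a value of T, and the functional of u i factors
  through T. Hence operators with disjoint supports have mutually orthogonal singular
  systems.\<close>

lemma svd_supported:
  assumes svd: "svd T s u v" and T: "supported D T"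
  shows "prj D (u i) = u i" "prj D (v i) = v i"
proof -
  consider "s i = 0" | "s i > 0" using svdD(3)[OF svd, of i] by fastforce
  then have "prj D (u i) = u i \<and> prj D (v i) = v i"
  proof cases
    case 1
    then show ?thesis using svdD(4)[OF svd, of i] by (simp add: blinfun.zero_right)
  next
    case 2
    have "s i *\<^sub>R prj D (v i) = s i *\<^sub>R v i"
      using supportedD(1)[OF T, of "u i"] by (simp add: svd_apply[OF svd] blinfun.scaleR_right)
    then have "prj D (v i) = v i" using 2 by simp
    moreover have "prj D (u i) = u i"
    proof (rule inner_eqI)
      fix z
      have "of_real (s i) * \<langle>prj D z, u i\<rangle> = of_real (s i) * \<langle>z, u i\<rangle>"
        unfolding svd_inner[OF svd, symmetric] supportedD(2)[OF T] ..
      then show "\<langle>z, prj D (u i)\<rangle> = \<langle>z, u i\<rangle>" using 2 by (simp add: prj_selfadjoint)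
    qed
    ultimately show ?thesis by blast
  qed
  then show "prj D (u i) = u i" "prj D (v i) = v i" by auto
qed

definition interleave :: "(nat \<Rightarrow> 'a) \<Rightarrow> (nat \<Rightarrow> 'a) \<Rightarrow> nat \<Rightarrow> 'a" where
  "interleave f g = (\<lambda>i. if even i then f (i div 2) else g (i div 2))"

lemma interleave_sums:
  fixes f g :: "nat \<Rightarrow> 'a::real_normed_vector"
  assumes "f sums a" and "g sums b"
  shows "interleave f g sums (a + b)"
proof -
  have "(\<lambda>n. (if even n then f (n div 2) else 0)) sums a"
  proof -
    have "(if even n then f (n div 2) else 0) = 0" if "n \<notin> range (\<lambda>i. 2 * i)" for n
      using that by (auto elim: evenE)
    then show ?thesis
      using sums_mono_reindex[of "\<lambda>i. 2 * i" "\<lambda>n. if even n then f (n div 2) else 0" a] assms(1)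
      by (simp add: strict_mono_def)
  qed
  moreover have "(\<lambda>n. (if odd n then g (n div 2) else 0)) sums b"
  proof -
    have "(if odd n then g (n div 2) else 0) = 0" if "n \<notin> range (\<lambda>i. 2 * i + 1)" for n
      using that by (auto elim: oddE)
    then show ?thesis
      using sums_mono_reindex[of "\<lambda>i. 2 * i + 1" "\<lambda>n. if odd n then g (n div 2) else 0" b] assms(2)
      by (simp add: strict_mono_def)
  qed
  ultimately have "(\<lambda>n. (if even n then f (n div 2) else 0) + (if odd n then g (n div 2) else 0)) sums (a + b)"
    by (rule sums_add)
  moreover have "(\<lambda>n. (if even n then f (n div 2) else 0) + (if odd n then g (n div 2) else 0)) = interleave f g"
    by (auto simp: interleave_def)
  ultimately show ?thesis by simp
qed

lemma orthosystem_interleave: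
  assumes u: "orthosystem UNIV u" and w: "orthosystem UNIV w" and uw: "\<And>i j. \<langle>u i, w j\<rangle> = 0"
  shows "orthosystem UNIV (interleave u w)"
  unfolding orthosystem_def
proof (intro conjI ballI impI)
  fix i j :: nat assume ij: "i \<noteq> j"
  have wu: "\<langle>w i, u j\<rangle> = 0" for i j using uw by (metis inner_commute sconj_zero)
  have "even i \<Longrightarrow> even j \<Longrightarrow> i div 2 \<noteq> j div 2" "odd i \<Longrightarrow> odd j \<Longrightarrow> i div 2 \<noteq> j div 2"
    using ij by (auto elim!: evenE oddE)
  then show "\<langle>interleave u w i, interleave u w j\<rangle> = 0"
    using orthosystemD(1)[OF u, of "i div 2" "j div 2"] orthosystemD(1)[OF w, of "i div 2" "j div 2"] uw wu
    by (auto simp: interleave_def)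
next
  fix i show "interleave u w i = 0 \<or> norm (interleave u w i) = 1"
    using orthosystemD(2)[OF u, of "i div 2"] orthosystemD(2)[OF w, of "i div 2"] by (auto simp: interleave_def)
qed

text \<open>Orthogonality of the singular systems makes the interleaved expansions an expansion of S
  + T, so the p-th powers of the singular values are simply put together.\<close>

lemma schatten_norm_block_add:
  fixes S T :: "'k::rc_scalar ell2_op"
  assumes p: "p \<ge> 1" and S: "S \<in> schatten_class p" and T: "T \<in> schatten_class p"
    and DS: "supported D S" and ET: "supported E T" and disj: "D \<inter> E = {}"
  shows "schatten_norm p (S + T) powr p = schatten_norm p S powr p + schatten_norm p T powr p"
proof -
  obtain s u v where svd1: "svd S s u v" using svd_exists[OF schatten_classD[OF S]] by blast
  obtain s' u' v' where svd2: "svd T s' u' v'" using svd_exists[OF schatten_classD[OF T]] by blast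
  have orth: "\<langle>x, y\<rangle> = 0" if "prj D x = x" "prj E y = y" for x y :: "'k ell2"
  proof -
    have "prj D y = prj D (prj E y)" using that by simp
    also have "\<dots> = 0" by (rule ell2_eqI) (simp add: prj_prj disj)
    finally have "prj D y = 0" .
    then have "\<langle>prj D x, y\<rangle> = 0" by (simp add: prj_selfadjoint inner.zero_right)
    then show ?thesis using that by simp
  qed
  have svd: "svd (S + T) (interleave s s') (interleave u u') (interleave v v')"
    unfolding svd_def
  proof (intro conjI allI)
    show "orthosystem UNIV (interleave u u')"
      by (rule orthosystem_interleave[OF svdD(1)[OF svd1] svdD(1)[OF svd2]
            orth[OF svd_supported(1)[OF svd1 DS] svd_supported(1)[OF svd2 ET]]])
    show "orthosystem UNIV (interleave v v')"
      by (rule orthosystem_interleave[OF svdD(2)[OF svd1] svdD(2)[OF svd2]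
            orth[OF svd_supported(2)[OF svd1 DS] svd_supported(2)[OF svd2 ET]]])
    fix i
    show "interleave s s' i = 0 \<and> interleave u u' i = 0 \<and> interleave v v' i = 0 \<or>
        0 < interleave s s' i \<and> norm (interleave u u' i) = 1 \<and> norm (interleave v v' i) = 1"
      using svdD(3-5)[OF svd1, of "i div 2"] svdD(3-5)[OF svd2, of "i div 2"]
      by (cases "even i") (auto simp: interleave_def less_le)
  next
    fix x
    have "interleave (\<lambda>i. ell2_scale (of_real (s i) * \<langle>x, u i\<rangle>) (v i)) (\<lambda>i. ell2_scale (of_real (s' i) * \<langle>x, u' i\<rangle>) (v' i))
        sums (S x + T x)" by (rule interleave_sums[OF svdD(6)[OF svd1] svdD(6)[OF svd2]])
    moreover have "interleave (\<lambda>i. ell2_scale (of_real (s i) * \<langle>x, u i\<rangle>) (v i))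
        (\<lambda>i. ell2_scale (of_real (s' i) * \<langle>x, u' i\<rangle>) (v' i)) =
      (\<lambda>i. ell2_scale (of_real (interleave s s' i) * \<langle>x, interleave u u' i\<rangle>) (interleave v v' i))"
      by (auto simp: interleave_def)
    ultimately show "(\<lambda>i. ell2_scale (of_real (interleave s s' i) * \<langle>x, interleave u u' i\<rangle>) (interleave v v' i)) sums (S + T) x"
      by (simp add: plus_blinfun.rep_eq)
  qed
  have ST: "S + T \<in> schatten_class p" by (rule schatten_class_add(1)[OF p S T])
  have s: "s \<in> lp p" "s' \<in> lp p" "interleave s s' \<in> lp p"
    using svd_norm(1)[OF p schatten_classD[OF S] svd1] svd_norm(1)[OF p schatten_classD[OF T] svd2]
      svd_norm(1)[OF p schatten_classD[OF ST] svd] S T ST by blast+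
  have "interleave (\<lambda>i. norm (s i) powr p) (\<lambda>i. norm (s' i) powr p) sums (lpn p s powr p + lpn p s' powr p)"
    unfolding lpn_powr[OF p s(1)] lpn_powr[OF p s(2)]
    using s by (intro interleave_sums summable_sums) (auto simp: lp_def)
  moreover have "interleave (\<lambda>i. norm (s i) powr p) (\<lambda>i. norm (s' i) powr p) = (\<lambda>i. norm (interleave s s' i) powr p)"
    by (auto simp: interleave_def)
  ultimately have "lpn p (interleave s s') powr p = lpn p s powr p + lpn p s' powr p"
    unfolding lpn_powr[OF p s(3)] by (simp add: sums_iff)
  then show ?thesis
    using svd_norm(2)[OF p schatten_classD[OF S] svd1 S] svd_norm(2)[OF p schatten_classD[OF T] svd2 T]
      svd_norm(2)[OF p schatten_classD[OF ST] svd ST] by simp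
qed

lemma schatten_zero: "p \<ge> 1 \<Longrightarrow> (0 :: 'k::rc_scalar ell2_op) \<in> schatten_class p"
  "p \<ge> 1 \<Longrightarrow> schatten_norm p (0 :: 'k ell2_op) = 0"
proof -
  have "schatten_le p (0 :: 'k ell2_op) 0" if "p \<ge> 1"
    unfolding schatten_le_def by (simp add: inner.zero_left)
  moreover have "scalar_linear (0 :: 'k ell2_op)" by (simp add: scalar_linear_def)
  moreover have "compact_op (0 :: 'k ell2_op)"
    by (rule compact_opI[of "{0}"]) auto
  ultimately show "p \<ge> 1 \<Longrightarrow> (0 :: 'k ell2_op) \<in> schatten_class p"
    "p \<ge> 1 \<Longrightarrow> schatten_norm p (0 :: 'k ell2_op) = 0"
    using schatten_leI[of p "0 :: 'k ell2_op" 0] by (auto intro: antisym)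
qed

lemma schatten_norm_block_sum:
  fixes B :: "nat \<Rightarrow> 'k::rc_scalar ell2_op"
  assumes p: "p \<ge> 1" and B: "\<And>k. B k \<in> schatten_class p" and D: "\<And>k. supported (D k) (B k)"
    and disj: "\<And>j k. j \<noteq> k \<Longrightarrow> D j \<inter> D k = {}"
  shows "(\<Sum>k<n. op_scale (c k) (B k)) \<in> schatten_class p"
    "schatten_norm p (\<Sum>k<n. op_scale (c k) (B k)) powr p = (\<Sum>k<n. (norm (c k) * schatten_norm p (B k)) powr p)"
proof -
  have cB: "op_scale (c k) (B k) \<in> schatten_class p" for k by (rule schatten_class_scale(1)[OF p B])
  have "(\<Sum>k<n. op_scale (c k) (B k)) \<in> schatten_class p \<and> supported (\<Union>k<n. D k) (\<Sum>k<n. op_scale (c k) (B k)) \<and>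
    schatten_norm p (\<Sum>k<n. op_scale (c k) (B k)) powr p = (\<Sum>k<n. (norm (c k) * schatten_norm p (B k)) powr p)"
  proof (induction n)
    case 0
    then show ?case using schatten_zero[OF p, where 'k = 'k] p by (simp add: supported_def blinfun.zero_right)
  next
    case (Suc n)
    let ?S = "\<Sum>k<n. op_scale (c k) (B k)"
    have S: "?S \<in> schatten_class p" "supported (\<Union>k<n. D k) ?S"
      "schatten_norm p ?S powr p = (\<Sum>k<n. (norm (c k) * schatten_norm p (B k)) powr p)"
      by (fact conjunct1[OF Suc], fact conjunct1[OF conjunct2[OF Suc]], fact conjunct2[OF conjunct2[OF Suc]])
    have "D k \<inter> D n = {}" if "k < n" for k using disj[of k n] that by simp
    then have "(\<Union>k<n. D k) \<inter> D n = {}" unfolding Int_UN_distrib2 by auto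
    then have "schatten_norm p (?S + op_scale (c n) (B n)) powr p =
        schatten_norm p ?S powr p + schatten_norm p (op_scale (c n) (B n)) powr p"
      by (rule schatten_norm_block_add[OF p S(1) cB S(2) supported_scale[OF D]])
    moreover have "(\<Union>k<n. D k) \<subseteq> (\<Union>k<Suc n. D k)" "D n \<subseteq> (\<Union>k<Suc n. D k)"
      by (auto simp: lessThan_Suc)
    then have "supported (\<Union>k<Suc n. D k) (?S + op_scale (c n) (B n))"
      by (intro supported_add supported_mono[OF S(2)] supported_mono[OF supported_scale[OF D[of n]]])
    ultimately show ?case
      unfolding sum.lessThan_Suc using S(3) schatten_class_add(1)[OF p S(1) cB[of n]]
      by (simp add: schatten_class_scale(2)[OF p B])
  qed
  then show "(\<Sum>k<n. op_scale (c k) (B k)) \<in> schatten_class p"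
    "schatten_norm p (\<Sum>k<n. op_scale (c k) (B k)) powr p = (\<Sum>k<n. (norm (c k) * schatten_norm p (B k)) powr p)"
    by auto
qed

section \<open>Convex transitive norms on copies of the sequence spaces\<close>

interpretation op: vector_space op_scale by (rule vector_space_op_scale)

text \<open>The norm M and its isometries are pulled back along J, which turns the image of
  \<open>lp p\<close> into an instance of \<open>lp_convex_transitive\<close>. Injectivity of J,
  from the lower norm bound, carries identities back to sequences.\<close>

lemma convex_transitive_lp_copy:
  fixes J :: "(nat \<Rightarrow> 'k::rc_scalar) \<Rightarrow> 'k ell2_op"
  assumes p: "p > 1" and C: "C > 0"
    and Jadd: "\<And>a b. a \<in> lp p \<Longrightarrow> b \<in> lp p \<Longrightarrow> J (a + b) = J a + J b"
    and Jsmul: "\<And>c a. a \<in> lp p \<Longrightarrow> J (smul c a) = op_scale c (J a)"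
    and M: "norm_on op_scale (J ` lp p) M"
    and lo: "\<And>a. a \<in> lp p \<Longrightarrow> lpn p a \<le> C * M (J a)"
    and up: "\<And>a. a \<in> lp p \<Longrightarrow> M (J a) \<le> C * lpn p a"
    and ct: "convex_transitive op_scale (J ` lp p) M"
  shows "p = 2"
proof -
  define Y where "Y = J ` lp p"
  have p1: "p \<ge> 1" using p by simp
  have JY: "J a \<in> Y" if "a \<in> lp p" for a using that by (simp add: Y_def)
  have M0: "M y \<ge> 0" "M y = 0 \<longleftrightarrow> y = 0" if "y \<in> Y" for y using M that unfolding norm_on_def Y_def by blast+
  have Mscale: "M (op_scale c y) = norm c * M y" if "y \<in> Y" for c y using M that unfolding norm_on_def Y_def by blast
  have Mtri: "M (y + z) \<le> M y + M z" if "y \<in> Y" "z \<in> Y" for y z using M that unfolding norm_on_def Y_def by blast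
  have Yadd: "y + z \<in> Y" if "y \<in> Y" "z \<in> Y" for y z
  proof -
    obtain a b where "a \<in> lp p" "y = J a" "b \<in> lp p" "z = J b" using \<open>y \<in> Y\<close> \<open>z \<in> Y\<close> unfolding Y_def by blast
    then show ?thesis using JY[OF lp_add(1)[OF p1]] Jadd by metis
  qed
  have Yscale: "op_scale c y \<in> Y" if "y \<in> Y" for c y
  proof -
    obtain a where "a \<in> lp p" "y = J a" using \<open>y \<in> Y\<close> unfolding Y_def by blast
    then show ?thesis using JY[OF lp_smul(1)[OF p1]] Jsmul by metis
  qed
  have Ydiff: "y - z \<in> Y" if "y \<in> Y" "z \<in> Y" for y z
    using Yadd[OF that(1) Yscale[OF that(2), of "- 1"]] by (simp add: op_scale_minus_one)
  have Jdiff: "J (a - b) = J a - J b" if "a \<in> lp p" "b \<in> lp p" for a b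
    using Jadd[OF lp_diff(1)[OF p1 that] that(2)] by simp
  have J0: "J 0 = 0" using Jdiff[OF zero_in_lp[OF p1] zero_in_lp[OF p1]] by simp
  have Jsum: "J (sum f I) = (\<Sum>i\<in>I. J (f i))" if "\<And>i. i \<in> I \<Longrightarrow> f i \<in> lp p" "finite I" for f and I :: "nat set"
  proof -
    have "sum f I \<in> lp p \<and> J (sum f I) = (\<Sum>i\<in>I. J (f i))" using that(2,1)
    proof (induction I)
      case (insert i I)
      then have h: "f i \<in> lp p" "sum f I \<in> lp p" "J (sum f I) = (\<Sum>i\<in>I. J (f i))" by blast+
      show ?case
        unfolding sum.insert[OF insert(1,2)] using lp_add(1)[OF p1 h(1,2)] Jadd[OF h(1,2)] h(3) by metis
    qed (simp only: sum.empty J0 zero_in_lp[OF p1])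
    then show ?thesis by blast
  qed
  have inj: "a = b" if ab: "a \<in> lp p" "b \<in> lp p" "J a = J b" for a b
  proof -
    have d: "a - b \<in> lp p" by (rule lp_diff(1)[OF p1 ab(1,2)])
    have "J (a - b) = 0" using Jdiff[OF ab(1,2)] ab(3) by simp
    then have "M (J (a - b)) = 0" using M0(2)[OF JY[OF d]] by simp
    then have "lpn p (a - b) \<le> 0" using lo[OF d] by simp
    then have "norm ((a - b) k) \<le> 0" for k using norm_le_lpn[OF p1 d, of k] by (rule order_trans[rotated])
    then show ?thesis by (intro ext) (simp add: minus_fun_app)
  qed
  define iso where "iso = isometries op_scale Y M"
  have isoD: "T (y + z) = T y + T z" "T (op_scale c y) = op_scale c (T y)" "T y \<in> Y" "M (T y) = M y"
    if "T \<in> iso" "y \<in> Y" "z \<in> Y" for T y z c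
    using that unfolding iso_def isometries_def linear_between_def by blast+
  have iso_surj: "\<exists>y\<in>Y. T y = z" if "T \<in> iso" "z \<in> Y" for T z
  proof -
    have "T ` Y = Y" using that(1) unfolding iso_def isometries_def by simp
    then show ?thesis using that(2) by (metis imageE)
  qed
  have isoI: "T \<in> iso" if "\<And>y z. y \<in> Y \<Longrightarrow> z \<in> Y \<Longrightarrow> T (y + z) = T y + T z"
    "\<And>c y. y \<in> Y \<Longrightarrow> T (op_scale c y) = op_scale c (T y)"
    "\<And>y. y \<in> Y \<Longrightarrow> T y \<in> Y" "\<And>z. z \<in> Y \<Longrightarrow> \<exists>y\<in>Y. T y = z" "\<And>y. y \<in> Y \<Longrightarrow> M (T y) = M y" for T
  proof -
    have "T ` Y = Y"
    proof
      show "T ` Y \<subseteq> Y" using that(3) by blast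
      show "Y \<subseteq> T ` Y" using that(4) by (metis imageI subsetI)
    qed
    then show ?thesis using that(1,2,5) unfolding iso_def isometries_def linear_between_def by simp
  qed
  have iso_inj: "y = z" if "T \<in> iso" "y \<in> Y" "z \<in> Y" "T y = T z" for T y z
  proof -
    have "T (y + op_scale (- 1) z) = T y + op_scale (- 1) (T z)"
      using isoD(1)[OF that(1,2) Yscale[OF that(3), of "- 1"]] isoD(2)[OF that(1,3,3), of "- 1"] by simp
    then have "T (y - z) = 0" using that(4) by (simp add: op_scale_minus_one)
    moreover have "0 \<in> Y" using JY[OF zero_in_lp[OF p1]] J0 by simp
    ultimately have "M (y - z) = 0" using isoD(4)[OF that(1) Ydiff[OF that(2,3)] Ydiff[OF that(2,3)]] M0(2) by metis
    then show ?thesis using M0(2)[OF Ydiff[OF that(2,3)]] by simp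
  qed
  \<comment> \<open>An isometry is an arbitrary function outside Y, so its inverse is obtained by
    choosing preimages inside Y.\<close>
  have iso_inv: "\<exists>S\<in>iso. \<forall>y\<in>Y. S (T y) = y \<and> T (S y) = y" if T: "T \<in> iso" for T
  proof -
    have "\<forall>z. \<exists>y. z \<in> Y \<longrightarrow> y \<in> Y \<and> T y = z" using iso_surj[OF T] by blast
    then obtain S where S: "\<And>z. z \<in> Y \<Longrightarrow> S z \<in> Y" "\<And>z. z \<in> Y \<Longrightarrow> T (S z) = z" by metis
    have ST: "S (T y) = y" if "y \<in> Y" for y
      by (rule iso_inj[OF T S(1)[OF isoD(3)[OF T that that]] that S(2)[OF isoD(3)[OF T that that]]])
    have "S \<in> iso"
    proof (rule isoI)
      fix y z assume yz: "y \<in> Y" "z \<in> Y"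
      have "T (S y + S z) = y + z" using isoD(1)[OF T S(1)[OF yz(1)] S(1)[OF yz(2)]] S(2) yz by simp
      then show "S (y + z) = S y + S z" using ST[OF Yadd[OF S(1)[OF yz(1)] S(1)[OF yz(2)]]] by simp
    next
      fix c y assume y: "y \<in> Y"
      have "T (op_scale c (S y)) = op_scale c y" using isoD(2)[OF T S(1)[OF y] S(1)[OF y]] S(2)[OF y] by simp
      then show "S (op_scale c y) = op_scale c (S y)" using ST[OF Yscale[OF S(1)[OF y], of c]] by simp
    next
      fix y assume y: "y \<in> Y"
      show "S y \<in> Y" by (rule S(1)[OF y])
      show "\<exists>z\<in>Y. S z = y" using ST[OF y] isoD(3)[OF T y y] by blast
      show "M (S y) = M y" using isoD(4)[OF T S(1)[OF y] S(1)[OF y]] S(2)[OF y] by simp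
    qed
    then show ?thesis using ST S(2) by blast
  qed
  \<comment> \<open>All lifts are collected, not one per isometry, so values outside
    \<open>lp p\<close> remain free and inverses and unimodular multiples are again in G.\<close>
  define G where "G = {g. \<exists>T\<in>iso. \<forall>a\<in>lp p. g a \<in> lp p \<and> J (g a) = T (J a)}"
  have lift: "\<exists>g\<in>G. \<forall>a\<in>lp p. J (g a) = T (J a)" if T: "T \<in> iso" for T
  proof -
    have "\<forall>a. \<exists>b. a \<in> lp p \<longrightarrow> b \<in> lp p \<and> J b = T (J a)"
    proof
      fix a
      show "\<exists>b. a \<in> lp p \<longrightarrow> b \<in> lp p \<and> J b = T (J a)"
      proof (cases "a \<in> lp p")
        case True
        have "T (J a) \<in> J ` lp p" using isoD(3)[OF T JY[OF True] JY[OF True]] by (simp only: Y_def)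
        then show ?thesis by (metis imageE)
      qed simp
    qed
    then obtain g where "\<And>a. a \<in> lp p \<Longrightarrow> g a \<in> lp p \<and> J (g a) = T (J a)" by metis
    then show ?thesis using T unfolding G_def by blast
  qed
  interpret lp_convex_transitive p "\<lambda>a. M (J a)" C G
  proof
    show "1 < p" "0 < C" by fact+
    fix a b :: "nat \<Rightarrow> 'k" and c :: 'k
    assume a: "a \<in> lp p"
    show "M (J (smul c a)) = norm c * M (J a)" by (simp only: Jsmul[OF a] Mscale[OF JY[OF a]])
    show "lpn p a \<le> C * M (J a)" "M (J a) \<le> C * lpn p a" by (rule lo[OF a], rule up[OF a])
    show "M (J (a + b)) \<le> M (J a) + M (J b)" if "b \<in> lp p"
      unfolding Jadd[OF a that] by (rule Mtri[OF JY[OF a] JY[OF that]])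
  next
    fix g assume g: "g \<in> G"
    then obtain T where T: "T \<in> iso" and gT: "\<And>a. a \<in> lp p \<Longrightarrow> g a \<in> lp p" "\<And>a. a \<in> lp p \<Longrightarrow> J (g a) = T (J a)"
      unfolding G_def by blast
    show "g a \<in> lp p" if "a \<in> lp p" for a by (rule gT(1)[OF that])
    show "g (a + b) = g a + g b" if ab: "a \<in> lp p" "b \<in> lp p" for a b
    proof (rule inj)
      show "g (a + b) \<in> lp p" "g a + g b \<in> lp p"
        by (rule gT(1)[OF lp_add(1)[OF p1 ab]], rule lp_add(1)[OF p1 gT(1)[OF ab(1)] gT(1)[OF ab(2)]])
      show "J (g (a + b)) = J (g a + g b)"
        unfolding gT(2)[OF lp_add(1)[OF p1 ab]] Jadd[OF ab] isoD(1)[OF T JY[OF ab(1)] JY[OF ab(2)]]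
          Jadd[OF gT(1)[OF ab(1)] gT(1)[OF ab(2)]] gT(2)[OF ab(1)] gT(2)[OF ab(2)] ..
    qed
    show "g (smul c a) = smul c (g a)" if a: "a \<in> lp p" for c a
    proof (rule inj)
      show "g (smul c a) \<in> lp p" "smul c (g a) \<in> lp p"
        by (rule gT(1)[OF lp_smul(1)[OF p1 a]], rule lp_smul(1)[OF p1 gT(1)[OF a]])
      show "J (g (smul c a)) = J (smul c (g a))"
        unfolding gT(2)[OF lp_smul(1)[OF p1 a]] Jsmul[OF a] isoD(2)[OF T JY[OF a] JY[OF a]]
          Jsmul[OF gT(1)[OF a]] gT(2)[OF a] ..
    qed
    show "M (J (g a)) = M (J a)" if a: "a \<in> lp p" for a
      unfolding gT(2)[OF a] by (rule isoD(4)[OF T JY[OF a] JY[OF a]])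
    show "\<exists>h\<in>G. \<forall>a\<in>lp p. h (g a) = a \<and> g (h a) = a"
    proof -
      obtain S where S: "S \<in> iso" "\<And>y. y \<in> Y \<Longrightarrow> S (T y) = y" "\<And>y. y \<in> Y \<Longrightarrow> T (S y) = y" using iso_inv[OF T] by blast
      obtain h where "h \<in> G" "\<forall>a\<in>lp p. h a \<in> lp p \<and> J (h a) = S (J a)" using lift[OF S(1)] G_def by blast
      then have h: "h \<in> G" "\<And>a. a \<in> lp p \<Longrightarrow> h a \<in> lp p" "\<And>a. a \<in> lp p \<Longrightarrow> J (h a) = S (J a)" by auto
      have "h (g a) = a \<and> g (h a) = a" if a: "a \<in> lp p" for a
      proof
        have "J (h (g a)) = J a" unfolding h(3)[OF gT(1)[OF a]] gT(2)[OF a] by (rule S(2)[OF JY[OF a]])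
        then show "h (g a) = a" by (rule inj[OF h(2)[OF gT(1)[OF a]] a])
        have "J (g (h a)) = J a" unfolding gT(2)[OF h(2)[OF a]] h(3)[OF a] by (rule S(3)[OF JY[OF a]])
        then show "g (h a) = a" by (rule inj[OF gT(1)[OF h(2)[OF a]] a])
      qed
      then show ?thesis using h(1) by blast
    qed
    show "(\<lambda>x. smul u (g x)) \<in> G" if u: "norm u = 1" for u
    proof -
      have u0: "u \<noteq> 0" using u by auto
      have "(\<lambda>y. op_scale u (T y)) \<in> iso"
      proof (rule isoI)
        fix y z assume yz: "y \<in> Y" "z \<in> Y"
        show "op_scale u (T (y + z)) = op_scale u (T y) + op_scale u (T z)"
          by (simp add: isoD(1)[OF T yz] op.scale_right_distrib)
      next
        fix c y assume y: "y \<in> Y"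
        show "op_scale u (T (op_scale c y)) = op_scale c (op_scale u (T y))"
          by (simp add: isoD(2)[OF T y y] mult.commute)
      next
        fix y assume y: "y \<in> Y"
        show "op_scale u (T y) \<in> Y" by (rule Yscale[OF isoD(3)[OF T y y]])
        show "M (op_scale u (T y)) = M y" using Mscale[OF isoD(3)[OF T y y], of u] isoD(4)[OF T y y] u by simp
        obtain z where z: "z \<in> Y" "T z = op_scale (inverse u) y" using iso_surj[OF T Yscale[OF y]] by blast
        have "op_scale u (T z) = y" using u0 by (simp add: z(2))
        then show "\<exists>z\<in>Y. op_scale u (T z) = y" using z(1) by blast
      qed
      moreover have "smul u (g a) \<in> lp p \<and> J (smul u (g a)) = op_scale u (T (J a))" if a: "a \<in> lp p" for a
        using lp_smul(1)[OF p1 gT(1)[OF a]] Jsmul[OF gT(1)[OF a], of u] gT(2)[OF a] by metis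
      ultimately show ?thesis unfolding G_def by (intro CollectI bexI[of _ "\<lambda>y. op_scale u (T y)"]) auto
    qed
  next
    fix x y e
    assume x: "x \<in> lp p" and y: "y \<in> lp p" and Mx: "M (J x) = 1" and My: "M (J y) \<le> 1" and e: "(e::real) > 0"
    have "closed_convex_hull_on Y M {T (J x) | T. T \<in> iso} = {z \<in> Y. M z \<le> 1}"
      using ct JY[OF x] Mx unfolding convex_transitive_def Y_def iso_def by blast
    then have "J y \<in> closed_convex_hull_on Y M {T (J x) | T. T \<in> iso}" using JY[OF y] My by blast
    then obtain w where w: "w \<in> convex hull {T (J x) | T. T \<in> iso}" "M (J y - w) < e"
      using e unfolding closed_convex_hull_on_def by blast
    obtain k and l :: "nat \<Rightarrow> real" and z where l: "\<forall>i\<in>{1..k}. 0 \<le> l i \<and> z i \<in> {T (J x) | T. T \<in> iso}" "sum l {1..k} = 1"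
      "(\<Sum>i = 1..k. l i *\<^sub>R z i) = w"
      using w(1) unfolding convex_hull_indexed by blast
    have "\<forall>i. \<exists>g. i \<in> {1..k} \<longrightarrow> g \<in> G \<and> J (g x) = z i"
    proof
      fix i
      show "\<exists>g. i \<in> {1..k} \<longrightarrow> g \<in> G \<and> J (g x) = z i"
      proof (cases "i \<in> {1..k}")
        case True
        then obtain T where "T \<in> iso" "z i = T (J x)" using l(1) by blast
        then show ?thesis using lift[of T] x by metis
      qed blast
    qed
    then obtain gs where gs: "\<And>i. i \<in> {1..k} \<Longrightarrow> gs i \<in> G" "\<And>i. i \<in> {1..k} \<Longrightarrow> J (gs i x) = z i" by metis
    have gx: "gs i x \<in> lp p" if "i \<in> {1..k}" for i using gs(1)[OF that] x unfolding G_def by blast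
    have sx: "smul (of_real (l i)) (gs i x) \<in> lp p" if "i \<in> {1..k}" for i by (rule lp_smul(1)[OF p1 gx[OF that]])
    have "J (\<Sum>i\<in>{1..k}. smul (of_real (l i)) (gs i x)) = (\<Sum>i\<in>{1..k}. J (smul (of_real (l i)) (gs i x)))"
      by (rule Jsum[OF sx]) auto
    also have "\<dots> = (\<Sum>i = 1..k. l i *\<^sub>R z i)"
      by (intro sum.cong refl) (simp add: Jsmul[OF gx] gs(2) op_scale_of_real)
    finally have Jw: "J (\<Sum>i\<in>{1..k}. smul (of_real (l i)) (gs i x)) = w" using l(3) by simp
    have "(\<Sum>i\<in>{1..k}. smul (of_real (l i)) (gs i x)) \<in> lp p"
    proof -
      have "finite S \<Longrightarrow> S \<subseteq> {1..k} \<Longrightarrow> (\<Sum>i\<in>S. smul (of_real (l i)) (gs i x)) \<in> lp p" for S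
      proof (induction S rule: finite_induct)
        case (insert i S)
        then have "i \<in> {1..k}" "S \<subseteq> {1..k}" by auto
        then show ?case unfolding sum.insert[OF insert(1,2)] by (intro lp_add(1)[OF p1 sx insert(3)])
      qed (simp only: sum.empty zero_in_lp[OF p1])
      then show ?thesis by blast
    qed
    then have "M (J (y - (\<Sum>i\<in>{1..k}. smul (of_real (l i)) (gs i x)))) < e"
      using Jdiff[OF y] Jw w(2) by metis
    then show "\<exists>(I :: nat set) l gs. finite I \<and> (\<forall>i\<in>I. l i \<ge> (0::real) \<and> gs i \<in> G) \<and> sum l I = 1 \<and>
        M (J (y - (\<Sum>i\<in>I. smul (of_real (l i)) (gs i x)))) < e"
      using l(1,2) gs(1) by (intro exI[of _ "{1..k}"] exI[of _ l] exI[of _ gs]) auto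
  qed
  show ?thesis by (rule p_eq_2)
qed

section \<open>Copies of the sequence spaces in Schatten classes\<close>

text \<open>The tolerances sum to 1/4, so replacing all T k by the blocks B k changes a linear
  combination by at most a quarter of the l_p norm of its coefficients.\<close>

locale schatten_lp_sequence =
  fixes p :: real and X :: "('k::rc_scalar) ell2_op set"
    and T B :: "nat \<Rightarrow> 'k ell2_op" and D :: "nat \<Rightarrow> nat set"
  assumes p: "p > 1" and XC: "X \<subseteq> schatten_class p" and sub: "module.subspace op_scale X"
    and closed: "\<And>f l. (\<And>n::nat. f n \<in> X) \<Longrightarrow> l \<in> schatten_class p \<Longrightarrow>
      (\<lambda>n. schatten_norm p (f n - l)) \<longlonglongrightarrow> 0 \<Longrightarrow> l \<in> X"
    and TX: "\<And>k. T k \<in> X" and T1: "\<And>k. schatten_norm p (T k) = 1"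
    and BC: "\<And>k. B k \<in> schatten_class p" and BD: "\<And>k. supported (D k) (B k)"
    and disj: "\<And>j k. j \<noteq> k \<Longrightarrow> D j \<inter> D k = {}"
    and TB: "\<And>k. schatten_norm p (T k - B k) \<le> (1/4) * (1/2) ^ Suc k"
begin

lemma p1: "p \<ge> 1" using p by simp

abbreviation N where "N \<equiv> schatten_norm p"

definition S :: "(nat \<Rightarrow> 'k) \<Rightarrow> nat \<Rightarrow> 'k ell2_op" where
  "S c n = (\<Sum>k<n. op_scale (c k) (T k))"

lemma XD: "x \<in> X \<Longrightarrow> x \<in> schatten_class p" using XC by blast

lemma S_X: "S c n \<in> X"
  unfolding S_def by (rule op.subspace_sum[OF sub op.subspace_scale[OF sub TX]])

lemma X_diff: "x \<in> X \<Longrightarrow> y \<in> X \<Longrightarrow> x - y \<in> X" by (rule op.subspace_diff[OF sub])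

lemma N_sum_le:
  fixes f :: "nat \<Rightarrow> 'k ell2_op"
  assumes "\<And>k. f k \<in> schatten_class p"
  shows "(\<Sum>k<n. f k) \<in> schatten_class p \<and> N (\<Sum>k<n. f k) \<le> (\<Sum>k<n. N (f k))"
proof (induction n)
  case (Suc n)
  then show ?case using schatten_class_add[OF p1, of "\<Sum>k<n. f k" "f n"] assms[of n] by (simp add: add_mono)
qed (simp add: schatten_zero[OF p1])

text \<open>Each single tolerance is at most 1/8, so the blocks have norms between 7/8 and 9/8 and
  the block sum lies between these multiples of the l_p norm. The total error of 1/4 leaves factors
  of at least 5/8 and at most 11/8, well within 1/2 and 2.\<close>

lemma S_estimate:
  "lpn p (trunc n c) \<le> 2 * N (S c n)" "N (S c n) \<le> 2 * lpn p (trunc n c)"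
proof -
  define L where "L = lpn p (trunc n c)"
  have L0: "L \<ge> 0" by (simp add: L_def)
  have Lp: "L powr p = (\<Sum>k<n. norm (c k) powr p)"
  proof -
    have "L powr p = (\<Sum>k<n. norm (trunc n c k) powr p)"
      unfolding L_def by (rule lp_finite_support(2)[OF p1]) (simp add: trunc_def)
    then show ?thesis by (simp add: trunc_def)
  qed
  have ck: "norm (c k) \<le> L" if "k < n" for k
    using norm_le_lpn[OF p1 lp_trunc[OF p1], of n c k] that by (simp add: L_def trunc_def)
  define P where "P = (\<Sum>k<n. op_scale (c k) (B k))"
  define E where "E = (\<Sum>k<n. op_scale (c k) (T k - B k))"
  have TBC: "T k - B k \<in> schatten_class p" for k by (rule schatten_class_diff(1)[OF p1 XD[OF TX] BC])
  have SPE: "S c n = P + E"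
    unfolding S_def P_def E_def by (simp add: op.scale_right_diff_distrib flip: sum.distrib)
  have P: "P \<in> schatten_class p" "N P powr p = (\<Sum>k<n. (norm (c k) * N (B k)) powr p)"
    unfolding P_def by (rule schatten_norm_block_sum[OF p1 BC BD disj]; assumption)+
  have E: "E \<in> schatten_class p" "N E \<le> L / 4"
  proof -
    show "E \<in> schatten_class p" unfolding E_def using N_sum_le[of "\<lambda>k. op_scale (c k) (T k - B k)" n, OF schatten_class_scale(1)[OF p1 TBC]] by blast
    have "N E \<le> (\<Sum>k<n. N (op_scale (c k) (T k - B k)))"
      unfolding E_def using N_sum_le[of "\<lambda>k. op_scale (c k) (T k - B k)" n, OF schatten_class_scale(1)[OF p1 TBC]] by blast
    also have "\<dots> \<le> (\<Sum>k<n. L * ((1/4) * (1/2) ^ Suc k))"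
      unfolding schatten_class_scale(2)[OF p1 TBC] using ck L0 TB by (intro sum_mono mult_mono) auto
    also have "\<dots> = L / 4 * (\<Sum>k<n. (1/2) ^ Suc k)" by (simp add: sum_distrib_left mult_ac)
    also have "(\<Sum>k<n. (1/2::real) ^ Suc k) = 1 - (1/2) ^ n" by (induction n) (auto simp: field_simps)
    also have "L / 4 * (1 - (1/2) ^ n) \<le> L / 4 * 1" using L0 by (intro mult_left_mono) auto
    finally show "N E \<le> L / 4" by simp
  qed
  have NB: "7/8 \<le> N (B k)" "N (B k) \<le> 9/8" for k
  proof -
    have "(1/4) * (1/2) ^ Suc k \<le> (1/4) * (1/2::real) ^ Suc 0" by (intro mult_left_mono power_decreasing) auto
    then have d: "N (T k - B k) \<le> 1/8" using TB[of k] by simp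
    have "N ((T k - B k) + B k) \<le> N (T k - B k) + N (B k)" by (rule schatten_class_add(2)[OF p1 TBC BC])
    then show "7/8 \<le> N (B k)" using d T1[of k] by simp
    have "N (T k - (T k - B k)) \<le> N (T k) + N (T k - B k)" by (rule schatten_class_diff(2)[OF p1 XD[OF TX] TBC])
    then show "N (B k) \<le> 9/8" using d T1[of k] by simp
  qed
  have root: "a \<le> b" if "a powr p \<le> b powr p" "a \<ge> 0" "b \<ge> 0" for a b
    using powr_less_mono2[of p b a] that p by (meson less_le_trans not_le zero_less_one less_trans)
  have cB: "7/8 * norm (c k) \<le> norm (c k) * N (B k)" "norm (c k) * N (B k) \<le> 9/8 * norm (c k)" for k
    using mult_left_mono[OF NB(1)[of k], of "norm (c k)"] mult_left_mono[OF NB(2)[of k], of "norm (c k)"]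
    by (simp_all add: mult.commute)
  have "N P powr p \<le> (\<Sum>k<n. (9/8 * norm (c k)) powr p)"
    unfolding P(2) using cB(2) p by (intro sum_mono powr_mono2) auto
  also have "\<dots> = (9/8 * L) powr p" by (simp only: powr_mult Lp sum_distrib_left)
  finally have P2: "N P \<le> 9/8 * L" by (rule root) (use L0 in auto)
  have "(7/8 * L) powr p = (\<Sum>k<n. (7/8 * norm (c k)) powr p)" by (simp only: powr_mult Lp sum_distrib_left)
  also have "\<dots> \<le> N P powr p"
    unfolding P(2) using cB(1) p by (intro sum_mono powr_mono2) auto
  finally have P1: "7/8 * L \<le> N P" by (rule root) (use L0 in auto)
  have "N (S c n) \<le> N P + N E" unfolding SPE by (rule schatten_class_add(2)[OF p1 P(1) E(1)])
  then show "N (S c n) \<le> 2 * lpn p (trunc n c)" using P2 E(2) L0 unfolding L_def by linarith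
  have "N ((P + E) - E) \<le> N (P + E) + N E"
    by (rule schatten_class_diff(2)[OF p1 schatten_class_add(1)[OF p1 P(1) E(1)] E(1)])
  then have "N P \<le> N (S c n) + N E" unfolding SPE by simp
  then show "lpn p (trunc n c) \<le> 2 * N (S c n)" using P1 E(2) L0 unfolding L_def by linarith
qed

lemma S_trunc: "m \<le> n \<Longrightarrow> S (trunc m c) n = S c m"
proof -
  assume mn: "m \<le> n"
  have "S (trunc m c) n = (\<Sum>k\<in>{..<n}. if k \<in> {..<m} then op_scale (c k) (T k) else 0)"
    unfolding S_def by (intro sum.cong) (auto simp: trunc_def)
  also have "\<dots> = S c m"
    unfolding S_def using mn by (subst sum.inter_restrict[symmetric]) (auto simp: Int_absorb1 intro!: sum.cong)
  finally show ?thesis .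
qed

lemma S_minus: "S (a - b) n = S a n - S b n"
  unfolding S_def by (simp add: minus_fun_app op.scale_left_diff_distrib sum_subtractf)

lemma S_add: "S (a + b) n = S a n + S b n"
  unfolding S_def by (simp add: op.scale_left_distrib sum.distrib)

lemma S_smul: "S (smul c a) n = op_scale c (S a n)"
  unfolding S_def by (simp add: op.scale_sum_right)

lemma limit_exists:
  assumes c: "c \<in> lp p"
  shows "\<exists>L\<in>X. (\<lambda>n. N (S c n - L)) \<longlonglongrightarrow> 0"
proof -
  have "\<exists>L\<in>schatten_class p. (\<lambda>n. N (S c n - L)) \<longlonglongrightarrow> 0"
  proof (rule schatten_class_complete[OF p1 XD[OF S_X]])
    fix e :: real assume e: "e > 0"
    then have "\<forall>\<^sub>F n in sequentially. lpn p (c - trunc n c) < e / 4"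
      by (intro order_tendstoD(2)[OF lpn_trunc_tendsto[OF p1 c]]) simp
    then obtain M where M: "\<And>n. n \<ge> M \<Longrightarrow> lpn p (c - trunc n c) < e / 4" unfolding eventually_sequentially by blast
    have "N (S c m - S c n) \<le> e" if mn: "m \<ge> M" "n \<ge> M" for m n
    proof -
      \<comment> \<open>Both partial sums are written with the common length k, so that
        \<open>S_estimate\<close> applies to their difference.\<close>
      define d where "d = trunc m c - trunc n c"
      define k where "k = max m n"
      have d: "trunc k d = d" by (rule ext) (auto simp: d_def k_def minus_fun_app trunc_def)
      have "S c m - S c n = S d k" unfolding d_def S_minus k_def by (simp add: S_trunc)
      then have "N (S c m - S c n) \<le> 2 * lpn p d" using S_estimate(2)[of d k] d by simp
      also have "d = (c - trunc n c) - (c - trunc m c)" unfolding d_def by simp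
      also have "lpn p \<dots> \<le> lpn p (c - trunc n c) + lpn p (c - trunc m c)"
        by (intro lp_diff(2)[OF p1] lp_diff(1)[OF p1] c lp_trunc[OF p1])
      finally show ?thesis using M[OF mn(1)] M[OF mn(2)] by simp
    qed
    then show "\<exists>M. \<forall>m\<ge>M. \<forall>n\<ge>M. N (S c m - S c n) \<le> e" by blast
  qed
  then obtain L where L: "L \<in> schatten_class p" "(\<lambda>n. N (S c n - L)) \<longlonglongrightarrow> 0" by blast
  then have "L \<in> X" by (intro closed[OF S_X])
  then show ?thesis using L(2) by blast
qed

text \<open>The sum of the series of the c k T k in the Schatten norm. The topology of the ambient
  type is that of the operator norm, so the limit is chosen explicitly; \<open>J_unique\<close>
  shows it is determined.\<close>

definition J :: "(nat \<Rightarrow> 'k) \<Rightarrow> 'k ell2_op" where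
  "J c = (SOME L. L \<in> X \<and> (\<lambda>n. N (S c n - L)) \<longlonglongrightarrow> 0)"

lemma J: assumes "c \<in> lp p" shows "J c \<in> X" "(\<lambda>n. N (S c n - J c)) \<longlonglongrightarrow> 0"
proof -
  have "\<exists>L. L \<in> X \<and> (\<lambda>n. N (S c n - L)) \<longlonglongrightarrow> 0" using limit_exists[OF assms] by blast
  from someI_ex[OF this] show "J c \<in> X" "(\<lambda>n. N (S c n - J c)) \<longlonglongrightarrow> 0" unfolding J_def by blast+
qed

lemma N_eq_0: "x \<in> X \<Longrightarrow> N x = 0 \<Longrightarrow> x = 0"
  using norm_le_schatten_norm[OF p1 XD, of x] by simp

lemma J_unique:
  assumes c: "c \<in> lp p" and L: "L \<in> X" "(\<lambda>n. N (S c n - L)) \<longlonglongrightarrow> 0"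
  shows "J c = L"
proof -
  have le: "N (J c - L) \<le> N (S c n - L) + N (S c n - J c)" for n
    using schatten_class_diff(2)[OF p1 XD[OF X_diff[OF S_X L(1)]] XD[OF X_diff[OF S_X J(1)[OF c]]], of c n c n] by simp
  have "(\<lambda>n. N (S c n - L) + N (S c n - J c)) \<longlonglongrightarrow> 0 + 0" by (intro tendsto_add L(2) J(2) c)
  then have "N (J c - L) \<le> 0 + 0" by (rule tendsto_lowerbound) (use le in auto)
  then have "N (J c - L) = 0" by (simp add: antisym)
  then show ?thesis using N_eq_0[OF X_diff[OF J(1)[OF c] L(1)]] by simp
qed

lemma J_add:
  assumes a: "a \<in> lp p" and b: "b \<in> lp p" shows "J (a + b) = J a + J b"
proof (rule J_unique[OF lp_add(1)[OF p1 a b] op.subspace_add[OF sub J(1)[OF a] J(1)[OF b]]])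
  have "(\<lambda>n. N (S a n - J a) + N (S b n - J b)) \<longlonglongrightarrow> 0 + 0" by (intro tendsto_add J(2) a b)
  then have lim: "(\<lambda>n. N (S a n - J a) + N (S b n - J b)) \<longlonglongrightarrow> 0" by simp
  have e: "S (a + b) n - (J a + J b) = (S a n - J a) + (S b n - J b)" for n by (simp add: S_add)
  show "(\<lambda>n. N (S (a + b) n - (J a + J b))) \<longlonglongrightarrow> 0"
    unfolding e
    by (rule tendsto_sandwich[OF _ _ tendsto_const lim])
      (auto intro!: always_eventually schatten_class_add(2)[OF p1] XD X_diff S_X J(1) a b)
qed

lemma J_smul:
  assumes a: "a \<in> lp p" shows "J (smul c a) = op_scale c (J a)"
proof (rule J_unique[OF lp_smul(1)[OF p1 a] op.subspace_scale[OF sub J(1)[OF a]]])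
  have "S (smul c a) n - op_scale c (J a) = op_scale c (S a n - J a)" for n
    by (simp add: S_smul op.scale_right_diff_distrib)
  then have "N (S (smul c a) n - op_scale c (J a)) = norm c * N (S a n - J a)" for n
    using schatten_class_scale(2)[OF p1 XD[OF X_diff[OF S_X J(1)[OF a]]]] by simp
  then show "(\<lambda>n. N (S (smul c a) n - op_scale c (J a))) \<longlonglongrightarrow> 0"
    using tendsto_mult_left[OF J(2)[OF a], of "norm c"] by simp
qed

lemma J_bounds:
  assumes c: "c \<in> lp p" shows "lpn p c \<le> 2 * N (J c)" "N (J c) \<le> 2 * lpn p c"
proof -
  have SC: "S c n \<in> schatten_class p" for n by (rule XD[OF S_X])
  have JC: "J c \<in> schatten_class p" by (rule XD[OF J(1)[OF c]])
  have dC: "S c n - J c \<in> schatten_class p" for n by (rule schatten_class_diff(1)[OF p1 SC JC])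
  have tr: "trunc n c \<in> lp p" "c - trunc n c \<in> lp p" for n by (intro lp_diff(1)[OF p1] lp_trunc[OF p1] c)+
  have "lpn p c \<le> 2 * (N (J c) + N (S c n - J c)) + lpn p (c - trunc n c)" for n
  proof -
    have "lpn p (trunc n c + (c - trunc n c)) \<le> lpn p (trunc n c) + lpn p (c - trunc n c)"
      by (rule lp_add(2)[OF p1 tr])
    moreover have "trunc n c + (c - trunc n c) = c" by simp
    moreover have "N (J c + (S c n - J c)) \<le> N (J c) + N (S c n - J c)" by (rule schatten_class_add(2)[OF p1 JC dC])
    moreover have "J c + (S c n - J c) = S c n" by simp
    ultimately show ?thesis using S_estimate(1)[of n c] by simp
  qed
  moreover have "(\<lambda>n. 2 * (N (J c) + N (S c n - J c)) + lpn p (c - trunc n c)) \<longlonglongrightarrow> 2 * (N (J c) + 0) + 0"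
    by (intro tendsto_intros J(2) c lpn_trunc_tendsto[OF p1])
  ultimately have "lpn p c \<le> 2 * (N (J c) + 0) + 0" by (intro tendsto_lowerbound) auto
  then show "lpn p c \<le> 2 * N (J c)" by simp
  have "N (J c) \<le> 2 * lpn p c + N (S c n - J c)" for n
  proof -
    have "N (S c n - (S c n - J c)) \<le> N (S c n) + N (S c n - J c)" by (rule schatten_class_diff(2)[OF p1 SC dC])
    then show ?thesis using S_estimate(2)[of c n] lpn_trunc_le[OF p1 c, of n] by simp
  qed
  moreover have "(\<lambda>n. 2 * lpn p c + N (S c n - J c)) \<longlonglongrightarrow> 2 * lpn p c + 0" by (intro tendsto_intros J(2) c)
  ultimately have "N (J c) \<le> 2 * lpn p c + 0" by (intro tendsto_lowerbound) auto
  then show "N (J c) \<le> 2 * lpn p c" by simp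
qed

lemma J_diff:
  assumes a: "a \<in> lp p" and b: "b \<in> lp p" shows "J (a - b) = J a - J b"
proof -
  have "J ((a - b) + b) = J (a - b) + J b" by (rule J_add[OF lp_diff(1)[OF p1 a b] b])
  moreover have "(a - b) + b = a" by simp
  ultimately show ?thesis by simp
qed

lemma J_range_closed: "closed_inf_dim_subspace op_scale N X (J ` lp p)"
  unfolding closed_inf_dim_subspace_def
proof (intro conjI allI impI)
  show "J ` lp p \<subseteq> X" using J(1) by blast
  have J0: "J 0 = 0" using J_diff[OF zero_in_lp[OF p1] zero_in_lp[OF p1]] by simp
  show "op.subspace (J ` lp p)"
  proof (rule op.subspaceI)
    show "0 \<in> J ` lp p" using J0 zero_in_lp[OF p1] by (metis imageI)
    fix x y assume "x \<in> J ` lp p" "y \<in> J ` lp p"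
    then obtain a b where "a \<in> lp p" "x = J a" "b \<in> lp p" "y = J b" by blast
    then show "x + y \<in> J ` lp p" using J_add lp_add(1)[OF p1] by (metis imageI)
  next
    fix c x assume "x \<in> J ` lp p"
    then obtain a where "a \<in> lp p" "x = J a" by blast
    then show "op_scale c x \<in> J ` lp p" using J_smul lp_smul(1)[OF p1] by (metis imageI)
  qed
  show "l \<in> J ` lp p" if h: "(\<forall>n. f n \<in> J ` lp p) \<and> l \<in> X \<and> (\<lambda>n. N (f n - l)) \<longlonglongrightarrow> 0" for f l
  proof -
    have "\<forall>n. \<exists>a. a \<in> lp p \<and> f n = J a" using h by blast
    then obtain a where a: "\<And>n. a n \<in> lp p" "\<And>n. f n = J (a n)" by metis
    have l: "l \<in> X" and lim: "(\<lambda>n. N (f n - l)) \<longlonglongrightarrow> 0" using h by auto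
    have fX: "f n \<in> X" for n unfolding a(2) by (rule J(1)[OF a(1)])
    have "\<exists>x\<in>lp p. (\<lambda>n. lpn p (a n - x)) \<longlonglongrightarrow> 0"
    proof (rule lp_complete[OF p1 a(1)])
      fix e :: real assume "e > 0"
      then have "\<forall>\<^sub>F n in sequentially. N (f n - l) < e / 4" by (intro order_tendstoD(2)[OF lim]) simp
      then obtain M where M: "\<And>n. n \<ge> M \<Longrightarrow> N (f n - l) < e / 4" unfolding eventually_sequentially by blast
      have "lpn p (a m - a n) \<le> e" if "m \<ge> M" "n \<ge> M" for m n
      proof -
        have e: "J (a m - a n) = (f m - l) - (f n - l)" by (simp add: J_diff[OF a(1) a(1)] a(2))
        have "N (J (a m - a n)) \<le> N (f m - l) + N (f n - l)"
          unfolding e by (rule schatten_class_diff(2)[OF p1 XD[OF X_diff[OF fX l]] XD[OF X_diff[OF fX l]]])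
        then show ?thesis
          using M[OF that(1)] M[OF that(2)] J_bounds(1)[OF lp_diff(1)[OF p1 a(1) a(1)], of m n] by linarith
      qed
      then show "\<exists>M. \<forall>m\<ge>M. \<forall>n\<ge>M. lpn p (a m - a n) \<le> e" by blast
    qed
    then obtain x where x: "x \<in> lp p" "(\<lambda>n. lpn p (a n - x)) \<longlonglongrightarrow> 0" by blast
    have le: "N (J x - l) \<le> N (f n - l) + 2 * lpn p (a n - x)" for n
    proof -
      have e: "J x - l = (f n - l) - J (a n - x)" by (simp add: J_diff[OF a(1) x(1)] a(2))
      have "N (J x - l) \<le> N (f n - l) + N (J (a n - x))"
        unfolding e by (rule schatten_class_diff(2)[OF p1 XD[OF X_diff[OF fX l]] XD[OF J(1)[OF lp_diff(1)[OF p1 a(1) x(1)]]]])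
      then show ?thesis using J_bounds(2)[OF lp_diff(1)[OF p1 a(1) x(1)], of n] by linarith
    qed
    have "(\<lambda>n. N (f n - l) + 2 * lpn p (a n - x)) \<longlonglongrightarrow> 0 + 2 * 0" by (intro tendsto_intros lim x(2))
    then have "N (J x - l) \<le> 0 + 2 * 0" by (rule tendsto_lowerbound) (use le in auto)
    then have "N (J x - l) = 0" by (simp add: antisym)
    then have "l = J x" using N_eq_0[OF X_diff[OF J(1)[OF x(1)] l]] by simp
    then show ?thesis using x(1) by blast
  qed
  show "\<nexists>F. finite F \<and> J ` lp p \<subseteq> op.span F"
  proof
    assume "\<exists>F. finite F \<and> J ` lp p \<subseteq> op.span F"
    then obtain F where F: "finite F" "J ` lp p \<subseteq> op.span F" by blast
    define e where "e = (\<lambda>k. J (unitseq k))"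
    have lin: "J (\<lambda>k. if k < n then c k else 0) = (\<Sum>k<n. op_scale (c k) (e k))" for c n
    proof (induction n)
      case 0
      have "(\<lambda>k. if k < (0::nat) then c k else 0) = 0" by (rule ext) simp
      then show ?case using J0 by simp
    next
      case (Suc n)
      have s: "(\<lambda>k. if k < Suc n then c k else 0) = (\<lambda>k. if k < n then c k else 0) + smul (c n) (unitseq n)"
        by (rule ext) (auto simp: unitseq_def less_Suc_eq)
      have m: "(\<lambda>k. if k < n then c k else 0) \<in> lp p" by (rule lp_finite_support(1)[OF p1, where m = n]) simp
      show ?case
        unfolding s J_add[OF m lp_smul(1)[OF p1 lp_unitseq[OF p1]]] J_smul[OF lp_unitseq[OF p1]] Suc sum.lessThan_Suc e_def ..
    qed
    have zero: "c k = 0" if "(\<Sum>k<n. op_scale (c k) (e k)) = 0" "k < n" for c n k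
    proof -
      have m: "(\<lambda>k. if k < n then c k else 0) \<in> lp p" by (rule lp_finite_support(1)[OF p1, where m = n]) simp
      have le0: "lpn p (\<lambda>k. if k < n then c k else 0) \<le> 0"
        using J_bounds(1)[OF m] that(1) by (simp add: lin schatten_zero(2)[OF p1])
      from order_trans[OF norm_le_lpn[OF p1 m, of k] le0] show ?thesis using that(2) by simp
    qed
    have inj: "inj e"
    proof (rule injI)
      fix i j assume ij: "e i = e j"
      show "i = j"
      proof (rule ccontr)
        assume ne: "i \<noteq> j"
        define n where "n = Suc (max i j)"
        define c :: "nat \<Rightarrow> 'k" where "c = (\<lambda>k. if k = i then 1 else if k = j then - 1 else 0)"
        have "(\<Sum>k<n. op_scale (c k) (e k)) = (\<Sum>k\<in>{i, j}. op_scale (c k) (e k))"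
          by (rule sum.mono_neutral_right) (auto simp: n_def c_def)
        also have "\<dots> = 0" using ne ij by (simp add: c_def op_scale_minus_one)
        finally have "c i = 0" by (rule zero) (simp add: n_def)
        then show False by (simp add: c_def)
      qed
    qed
    \<comment> \<open>One more than \<open>card F\<close> independent vectors cannot lie in the span
      of F.\<close>
    define n where "n = Suc (card F)"
    have ind: "op.independent (e ` {..<n})"
      unfolding op.independent_explicit_module
    proof (intro allI impI)
      fix V u v assume V: "finite V" "V \<subseteq> e ` {..<n}" "(\<Sum>v\<in>V. op_scale (u v) v) = 0" "v \<in> V"
      define c where "c = (\<lambda>k. if e k \<in> V then u (e k) else 0)"
      obtain k where k: "k < n" "v = e k" using V(2,4) by blast
      have "(\<Sum>k<n. op_scale (c k) (e k)) = (\<Sum>k\<in>{k. k < n \<and> e k \<in> V}. op_scale (u (e k)) (e k))"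
        by (rule sum.mono_neutral_cong_right) (auto simp: c_def)
      also have "\<dots> = (\<Sum>v\<in>e ` {k. k < n \<and> e k \<in> V}. op_scale (u v) v)"
        by (rule sum.reindex_cong[symmetric]) (auto intro: inj_on_subset[OF inj])
      also have "e ` {k. k < n \<and> e k \<in> V} = V" using V(2) by auto
      finally have "(\<Sum>k<n. op_scale (c k) (e k)) = 0" using V(3) by simp
      then have "c k = 0" using k(1) by (rule zero)
      then show "u v = 0" using k V(4) by (simp add: c_def)
    qed
    have "e ` {..<n} \<subseteq> op.span F" using F(2) lp_unitseq[OF p1] unfolding e_def by blast
    then have "card (e ` {..<n}) \<le> card F" using op.independent_span_bound[OF F(1) ind] by blast
    moreover have "card (e ` {..<n}) = n" using card_image[OF inj_on_subset[OF inj subset_UNIV]] by simp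
    ultimately show False by (simp add: n_def)
  qed
qed

theorem p_eq_2_if_convex_transitive:
  assumes "\<exists>M. norm_on op_scale (J ` lp p) M \<and> equivalent_on (J ` lp p) N M \<and> convex_transitive op_scale (J ` lp p) M"
  shows "p = 2"
proof -
  obtain M where M: "norm_on op_scale (J ` lp p) M" "equivalent_on (J ` lp p) N M" "convex_transitive op_scale (J ` lp p) M"
    using assms by blast
  obtain a b where ab: "a > 0" "b > 0" and eq: "\<And>y. y \<in> J ` lp p \<Longrightarrow> a * N y \<le> M y \<and> M y \<le> b * N y"
    using M(2) unfolding equivalent_on_def by blast
  define C where "C = max (2 / a) (2 * b)"
  have C: "C > 0" "2 / a \<le> C" "2 * b \<le> C" using ab by (auto simp: C_def less_max_iff_disj)
  show ?thesis
  proof (rule convex_transitive_lp_copy[OF p C(1) J_add J_smul M(1) _ _ M(3)])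
    fix c :: "nat \<Rightarrow> 'k" assume c: "c \<in> lp p"
    have y: "J c \<in> J ` lp p" using c by blast
    have M0: "M (J c) \<ge> 0" using M(1) y unfolding norm_on_def by blast
    have "lpn p c \<le> 2 * N (J c)" by (rule J_bounds(1)[OF c])
    also have "\<dots> = 2 / a * (a * N (J c))" using ab by simp
    also have "\<dots> \<le> 2 / a * M (J c)" using eq[OF y] ab by (intro mult_left_mono) auto
    also have "\<dots> \<le> C * M (J c)" using C M0 by (intro mult_right_mono) auto
    finally show "lpn p c \<le> C * M (J c)" .
    have "M (J c) \<le> b * N (J c)" using eq[OF y] by blast
    also have "\<dots> \<le> b * (2 * lpn p c)" using J_bounds(2)[OF c] ab by (intro mult_left_mono) auto
    also have "\<dots> \<le> C * lpn p c" using C mult_right_mono[OF C(3), of "lpn p c"] by (simp add: mult_ac)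
    finally show "M (J c) \<le> C * lpn p c" .
  qed
qed

end

section \<open>The dichotomy\<close>

text \<open>Three errors of \<epsilon> / 3 each: the first n rows and columns, the rows from m on,
  and the columns from m on. The factor 6 arises because the n rows and the n columns each receive
  \<epsilon> / 6; n + 1 in place of n avoids dividing by 0.\<close>

lemma schatten_block_approximation:
  fixes T :: "('k::rc_scalar) ell2_op"
  assumes p: "p \<ge> 1" and T: "T \<in> schatten_class p" and e: "\<epsilon> > 0"
    and small: "\<And>i. i < n \<Longrightarrow> norm (T (ell2_unit i)) \<le> \<epsilon> / (6 * (real n + 1))"
      "\<And>i. i < n \<Longrightarrow> norm (hilbert_adjoint T (ell2_unit i)) \<le> \<epsilon> / (6 * (real n + 1))"
  shows "\<exists>m\<ge>n. schatten_norm p (T - (prj {n..<m} o\<^sub>L (T o\<^sub>L prj {n..<m}))) \<le> \<epsilon>"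
proof -
  have e3: "\<epsilon> / 3 > 0" using e by simp
  obtain m0 where m0: "\<And>m. m \<ge> m0 \<Longrightarrow> schatten_le p (prj {m..} o\<^sub>L T) (\<epsilon> / 3) \<and> schatten_le p (T o\<^sub>L prj {m..}) (\<epsilon> / 3)"
    using schatten_tail[OF p T e3] by blast
  define m where "m = max n m0"
  have m: "m \<ge> n" "schatten_le p (prj {m..} o\<^sub>L T) (\<epsilon> / 3)" "schatten_le p (T o\<^sub>L prj {m..}) (\<epsilon> / 3)"
    using m0[of m] by (auto simp: m_def)
  define d where "d = \<epsilon> / (6 * (real n + 1))"
  have d0: "d \<ge> 0" using e by (simp add: d_def)
  have "(\<Sum>i<n. norm (hilbert_adjoint T (ell2_unit i))) \<le> (\<Sum>i<n. d)"
    "(\<Sum>i<n. norm (T (ell2_unit i))) \<le> (\<Sum>i<n. d)"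
    using small unfolding d_def[symmetric] by - (rule sum_mono; simp)+
  moreover have "real n * d \<le> \<epsilon> / 6"
  proof -
    have "real n * d \<le> (real n + 1) * d" using d0 by (intro mult_right_mono) auto
    also have "\<dots> = \<epsilon> / 6" by (simp add: d_def divide_simps)
    finally show ?thesis .
  qed
  ultimately have corner: "(\<Sum>i<n. norm (hilbert_adjoint T (ell2_unit i))) + (\<Sum>i<n. norm (T (ell2_unit i))) \<le> \<epsilon> / 3"
    by simp
  define E1 where "E1 = T - (prj {n..} o\<^sub>L (T o\<^sub>L prj {n..}))"
  \<comment> \<open>T minus its compression to the first m coordinates, split into two tails.
    Compressing this to the coordinates from n on gives what is left after E1.\<close>
  define E2 where "E2 = (prj {m..} o\<^sub>L T) + (prj {..<m} o\<^sub>L (T o\<^sub>L prj {m..}))"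
  have E1: "schatten_le p E1 (\<epsilon> / 3)"
    unfolding E1_def
    by (rule schatten_le_mono[OF p schatten_le_corner[OF p schatten_classD(1)[OF T]] _ corner])
      (auto intro!: add_nonneg_nonneg sum_nonneg)
  have E2: "schatten_le p E2 (\<epsilon> / 3 + \<epsilon> / 3)"
    unfolding E2_def using e by (intro schatten_le_add[OF p] schatten_le_prj_left[OF p] m) auto
  have "schatten_le p (prj {n..} o\<^sub>L (E2 o\<^sub>L prj {n..})) (\<epsilon> / 3 + \<epsilon> / 3)"
    using e by (intro schatten_le_prj_left[OF p] schatten_le_prj_right[OF p] E2) auto
  then have "schatten_le p (E1 + (prj {n..} o\<^sub>L (E2 o\<^sub>L prj {n..}))) (\<epsilon> / 3 + (\<epsilon> / 3 + \<epsilon> / 3))"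
    using e by (intro schatten_le_add[OF p] E1) auto
  moreover have "E1 + (prj {n..} o\<^sub>L (E2 o\<^sub>L prj {n..})) = T - (prj {n..<m} o\<^sub>L (T o\<^sub>L prj {n..<m}))"
  proof (rule blinfun_eqI)
    fix x :: "'k ell2"
    have Q: "{n..} \<inter> {..<m} = {n..<m}" "{..<m} \<inter> {n..} = {n..<m}" by auto
    have sp: "y = prj {..<m} y + prj {m..} y" for y :: "'k ell2" by (rule ell2_eqI) auto
    define z where "z = prj {n..} x"
    have "T z = prj {..<m} (T z) + prj {m..} (T z)" by (rule sp)
    also have "prj {..<m} (T z) = prj {..<m} (T (prj {..<m} z)) + prj {..<m} (T (prj {m..} z))"
      by (subst sp[of z]) (simp add: blinfun.add_right)
    finally have Tz: "T z = prj {..<m} (T (prj {..<m} z)) + prj {..<m} (T (prj {m..} z)) + prj {m..} (T z)" .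
    have alg: "u = a + b + c \<Longrightarrow> c + b = u - a" for u a b c :: "'k ell2" by simp
    have "E2 z = prj {m..} (T z) + prj {..<m} (T (prj {m..} z))" by (simp add: E2_def plus_blinfun.rep_eq)
    also have "\<dots> = T z - prj {..<m} (T (prj {..<m} z))" by (rule alg[OF Tz])
    finally have "prj {n..} (E2 z) = prj {n..} (T z) - prj {n..<m} (T (prj {n..<m} x))"
      by (simp add: blinfun.diff_right prj_prj Q z_def)
    then show "(E1 + (prj {n..} o\<^sub>L (E2 o\<^sub>L prj {n..}))) x = (T - (prj {n..<m} o\<^sub>L (T o\<^sub>L prj {n..<m}))) x"
      by (simp add: plus_blinfun.rep_eq minus_blinfun.rep_eq E1_def z_def)
  qed
  ultimately have le: "schatten_le p (T - (prj {n..<m} o\<^sub>L (T o\<^sub>L prj {n..<m}))) \<epsilon>" by simp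
  have "prj {n..<m} o\<^sub>L (T o\<^sub>L prj {n..<m}) \<in> schatten_class p"
    by (intro schatten_class_prj[OF p] T)
  then have "T - (prj {n..<m} o\<^sub>L (T o\<^sub>L prj {n..<m})) \<in> schatten_class p" by (rule schatten_class_diff(1)[OF p T])
  then have "schatten_norm p (T - (prj {n..<m} o\<^sub>L (T o\<^sub>L prj {n..<m}))) \<le> \<epsilon>"
    using schatten_leI(2)[OF p _ _ less_imp_le[OF e] le] schatten_classD by blast
  then show ?thesis using m(1) by blast
qed

text \<open>
  The region is L-shaped: the first \<open>n\<close> rows together with the first \<open>n\<close> columns, not just the
  \<open>n\<close> by \<open>n\<close> block.
\<close>

definition corner_entries :: "nat \<Rightarrow> ('k::rc_scalar) ell2_op \<Rightarrow> nat \<Rightarrow> 'k" where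
  "corner_entries n T k = (case prod_decode k of (i, j) \<Rightarrow> if i < n \<or> j < n then coord (T (ell2_unit j)) i else 0)"

definition corner_vector :: "nat \<Rightarrow> ('k::rc_scalar) ell2_op \<Rightarrow> 'k ell2" where
  "corner_vector n T = Abs_ell2 (corner_entries n T)"

lemma row_entry: "scalar_linear T \<Longrightarrow> norm (coord (hilbert_adjoint T (ell2_unit i)) j) = norm (coord (T (ell2_unit j)) i)"
  by (metis hilbert_adjoint(1) inner_norm_commute inner_unit)

lemma norm_square_ell2: "(norm x)\<^sup>2 = (\<Sum>n. (norm (coord x n))\<^sup>2)"
  by (simp add: norm_ell2.rep_eq suminf_nonneg ell2_summable)

text \<open>The region is covered by n rows and n columns, each of Euclidean norm at most
  \<open>norm T\<close>, with the n by n block counted twice; this gives the factor 2 n. Conversely,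
  each of these rows and columns occurs completely among the entries, so its norm is controlled in
  full, as the block approximation requires.\<close>

lemma corner_vector:
  fixes T :: "'k::rc_scalar ell2_op"
  assumes T: "scalar_linear T"
  shows "coord (corner_vector n T) = corner_entries n T"
    "norm (corner_vector n T) \<le> sqrt (2 * real n) * norm T"
    "i < n \<Longrightarrow> norm (T (ell2_unit i)) \<le> norm (corner_vector n T)"
    "i < n \<Longrightarrow> norm (hilbert_adjoint T (ell2_unit i)) \<le> norm (corner_vector n T)"
proof -
  define g where "g = (\<lambda>i j. (norm (coord (T (ell2_unit j)) i))\<^sup>2)"
  have T1: "(norm (T (ell2_unit j)))\<^sup>2 \<le> (norm T)\<^sup>2" for j
    using norm_blinfun[of T "ell2_unit j"] by (intro power_mono) auto
  have col: "summable (\<lambda>i. g i j)" "(\<Sum>i. g i j) = (norm (T (ell2_unit j)))\<^sup>2" for j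
    unfolding g_def by (rule ell2_summable, rule norm_square_ell2[symmetric])
  have row: "summable (\<lambda>j. g i j)" "(\<Sum>j. g i j) = (norm (hilbert_adjoint T (ell2_unit i)))\<^sup>2" for i
    unfolding g_def row_entry[OF T, symmetric] by (rule ell2_summable, rule norm_square_ell2[symmetric])
  have adj: "(norm (hilbert_adjoint T (ell2_unit i)))\<^sup>2 \<le> (norm T)\<^sup>2" for i
  proof -
    define w where "w = hilbert_adjoint T (ell2_unit i)"
    have "(norm w)\<^sup>2 = norm \<langle>w, w\<rangle>" by (simp add: inner_self norm_power)
    also have "\<dots> = norm \<langle>T w, ell2_unit i\<rangle>" by (simp add: hilbert_adjoint(1)[OF T] w_def)
    also have "\<dots> \<le> norm (T w) * 1" using Cauchy_Schwarz[of "T w" "ell2_unit i"] by simp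
    also have "\<dots> \<le> norm T * norm w" using norm_blinfun[of T w] by simp
    finally have "norm w * norm w \<le> norm T * norm w" by (simp add: power2_eq_square)
    then have "norm w \<le> norm T" by (cases "w = 0") (auto simp: mult_le_cancel_right)
    then show ?thesis unfolding w_def by (intro power_mono) auto
  qed
  have bound: "(\<Sum>k<K. (norm (corner_entries n T k))\<^sup>2) \<le> 2 * real n * (norm T)\<^sup>2" for K
  proof -
    define h where "h = (\<lambda>(i, j). if i < n \<or> j < n then g i j else 0)"
    have h0: "h x \<ge> 0" for x by (auto simp: h_def g_def split: prod.split)
    have "(\<Sum>k<K. (norm (corner_entries n T k))\<^sup>2) = (\<Sum>k<K. h (prod_decode k))"
      by (intro sum.cong) (auto simp: corner_entries_def h_def g_def split: prod.split)
    also have "\<dots> = (\<Sum>x\<in>prod_decode ` {..<K}. h x)"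
      by (rule sum.reindex_cong[symmetric]) (auto intro: inj_on_subset[OF inj_prod_decode])
    also have "\<dots> \<le> (\<Sum>x\<in>{..<K} \<times> {..<K}. h x)"
    proof (rule sum_mono2)
      \<comment> \<open>\<open>prod_encode\<close> dominates both of its arguments, so the first K
        positions decode into a square of side K.\<close>
      show "prod_decode ` {..<K} \<subseteq> {..<K} \<times> {..<K}"
      proof
        fix x assume "x \<in> prod_decode ` {..<K}"
        then obtain k where k: "k < K" "x = prod_decode k" by blast
        obtain i j where x: "x = (i, j)" by fastforce
        then have "k = prod_encode (i, j)" using k by (metis prod_decode_inverse)
        then have "i \<le> k" "j \<le> k" using le_prod_encode_1 le_prod_encode_2 by metis+
        then show "x \<in> {..<K} \<times> {..<K}" using k(1) unfolding x by simp
      qed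
    qed (auto simp: h0)
    also have "\<dots> \<le> (\<Sum>x\<in>{..<K} \<times> {..<K}. (if fst x < n then g (fst x) (snd x) else 0) + (if snd x < n then g (fst x) (snd x) else 0))"
      by (rule sum_mono) (auto simp: h_def g_def)
    also have "\<dots> = (\<Sum>i<K. \<Sum>j<K. if i < n then g i j else 0) + (\<Sum>i<K. \<Sum>j<K. if j < n then g i j else 0)"
      by (simp add: sum.distrib sum.cartesian_product split_beta)
    also have "(\<Sum>i<K. \<Sum>j<K. if j < n then g i j else 0) = (\<Sum>j<K. \<Sum>i<K. if j < n then g i j else 0)" by (rule sum.swap)
    also have "(\<Sum>j<K. \<Sum>i<K. if j < n then g i j else 0) \<le> (\<Sum>j<K. if j \<in> {..<n} then (norm T)\<^sup>2 else 0)"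
    proof (rule sum_mono)
      fix j
      have "(\<Sum>i<K. g i j) \<le> (norm T)\<^sup>2"
        by (rule order_trans[OF sum_le_suminf[OF col(1)]]) (simp_all add: g_def T1 col(2)[unfolded g_def])
      then show "(\<Sum>i<K. if j < n then g i j else 0) \<le> (if j \<in> {..<n} then (norm T)\<^sup>2 else 0)" by simp
    qed
    also have "(\<Sum>i<K. \<Sum>j<K. if i < n then g i j else 0) \<le> (\<Sum>i<K. if i \<in> {..<n} then (norm T)\<^sup>2 else 0)"
    proof (rule sum_mono)
      fix i
      have "(\<Sum>j<K. g i j) \<le> (norm T)\<^sup>2"
        by (rule order_trans[OF sum_le_suminf[OF row(1)]]) (simp_all add: g_def adj row(2)[unfolded g_def])
      then show "(\<Sum>j<K. if i < n then g i j else 0) \<le> (if i \<in> {..<n} then (norm T)\<^sup>2 else 0)" by simp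
    qed
    also have "(\<Sum>i<K. if i \<in> {..<n} then (norm T)\<^sup>2 else 0) \<le> real n * (norm T)\<^sup>2"
    proof -
      have "(\<Sum>i<K. if i \<in> {..<n} then (norm T)\<^sup>2 else 0) = (\<Sum>i\<in>{..<K} \<inter> {..<n}. (norm T)\<^sup>2)"
        by (rule sum.inter_restrict[symmetric]) simp
      also have "\<dots> \<le> (\<Sum>i\<in>{..<n}. (norm T)\<^sup>2)" by (rule sum_mono2) auto
      finally show ?thesis by simp
    qed
    finally show ?thesis by simp
  qed
  have sm: "summable (\<lambda>k. (norm (corner_entries n T k))\<^sup>2)"
    by (rule summableI_nonneg_bounded[OF _ bound]) simp
  show c: "coord (corner_vector n T) = corner_entries n T"
    unfolding corner_vector_def by (rule coord_Abs) (simp add: mem_lp_2 sm)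
  have nc: "(norm (corner_vector n T))\<^sup>2 = (\<Sum>k. (norm (corner_entries n T k))\<^sup>2)" by (simp add: norm_square_ell2 c)
  have "(norm (corner_vector n T))\<^sup>2 \<le> (sqrt (2 * real n) * norm T)\<^sup>2"
    unfolding nc using suminf_le_const[OF sm bound] by (simp add: power_mult_distrib)
  then show "norm (corner_vector n T) \<le> sqrt (2 * real n) * norm T" by (rule power2_le_imp_le) simp
  \<comment> \<open>A row or column is listed without repetition along an injective sequence f of
    positions.\<close>
  have line: "norm x \<le> norm (corner_vector n T)"
    if x: "\<And>j. norm (coord x j) = norm (corner_entries n T (f j))" and f: "inj f" for x :: "'k ell2" and f
  proof -
    have "(norm x)\<^sup>2 \<le> (norm (corner_vector n T))\<^sup>2"
      unfolding norm_square_ell2[of x]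
    proof (rule suminf_le_const[OF ell2_summable])
      fix K
      have "(\<Sum>j<K. (norm (coord x j))\<^sup>2) = (\<Sum>k\<in>f ` {..<K}. (norm (corner_entries n T k))\<^sup>2)"
        unfolding x by (rule sum.reindex_cong[symmetric]) (auto intro: inj_on_subset[OF f])
      also have "\<dots> \<le> (norm (corner_vector n T))\<^sup>2" unfolding nc by (rule sum_le_suminf[OF sm]) auto
      finally show "(\<Sum>j<K. (norm (coord x j))\<^sup>2) \<le> (norm (corner_vector n T))\<^sup>2" .
    qed
    then show ?thesis by (rule power2_le_imp_le) simp
  qed
  show "norm (T (ell2_unit i)) \<le> norm (corner_vector n T)" if "i < n"
    by (rule line[of _ "\<lambda>j. prod_encode (j, i)"]) (use that in \<open>auto simp: corner_entries_def inj_def\<close>)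
  show "norm (hilbert_adjoint T (ell2_unit i)) \<le> norm (corner_vector n T)" if "i < n"
    by (rule line[of _ "\<lambda>j. prod_encode (i, j)"]) (use that in \<open>auto simp: corner_entries_def inj_def row_entry[OF T]\<close>)
qed

lemma corner_vector_linear:
  shows "scalar_linear S \<Longrightarrow> scalar_linear T \<Longrightarrow> corner_vector n (S + T) = corner_vector n S + corner_vector n T"
    "scalar_linear T \<Longrightarrow> corner_vector n (op_scale c T) = ell2_scale c (corner_vector n T)"
  by (rule ell2_eqI; simp add: corner_vector(1) scalar_linear_intros;
      simp add: corner_entries_def plus_blinfun.rep_eq split: prod.split)+

text \<open>Since no \<open>corner_vector n\<close> dominates a multiple of the Schatten norm, each
  n admits a normalized element of X whose first n rows and columns are negligible. Such an element
  is close to a block starting at n, and the end of that block serves as the next n.\<close>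

lemma gliding_hump:
  fixes X :: "('k::rc_scalar) ell2_op set"
  assumes p: "p \<ge> 1" and XC: "X \<subseteq> schatten_class p" and sub: "op.subspace X"
    and small: "\<And>n c. c > 0 \<Longrightarrow> \<exists>T\<in>X. norm (corner_vector n T) < c * schatten_norm p T"
    and \<delta>: "\<And>k::nat. \<delta> k > (0::real)"
  shows "\<exists>T B D. (\<forall>k. T k \<in> X \<and> schatten_norm p (T k) = 1 \<and> B k \<in> schatten_class p \<and> supported (D k) (B k) \<and>
    schatten_norm p (T k - B k) \<le> \<delta> k) \<and> (\<forall>j k::nat. j \<noteq> k \<longrightarrow> D j \<inter> D k = {})"
proof -
  have step: "\<exists>T m. T \<in> X \<and> schatten_norm p T = 1 \<and> m \<ge> n \<and>
      schatten_norm p (T - (prj {n..<m} o\<^sub>L (T o\<^sub>L prj {n..<m}))) \<le> \<epsilon>" if e: "\<epsilon> > 0" for n and \<epsilon> :: real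
  proof -
    \<comment> \<open>The size that \<open>schatten_block_approximation\<close> allows for each
      single row and column.\<close>
    define c where "c = \<epsilon> / (6 * (real n + 1))"
    have c: "c > 0" using e by (simp add: c_def)
    obtain R where R: "R \<in> X" "norm (corner_vector n R) < c * schatten_norm p R" using small[OF c] by blast
    have "c * schatten_norm p R > 0" using R(2) norm_ge_zero[of "corner_vector n R"] by linarith
    then have NR: "schatten_norm p R > 0" using c by (simp add: zero_less_mult_iff)
    have RC: "R \<in> schatten_class p" using R(1) XC by blast
    define T where "T = op_scale (of_real (1 / schatten_norm p R)) R"
    have TX: "T \<in> X" unfolding T_def by (rule op.subspace_scale[OF sub R(1)])
    have TC: "T \<in> schatten_class p" using TX XC by blast
    have T1: "schatten_norm p T = 1" using NR by (simp add: T_def schatten_class_scale(2)[OF p RC] norm_divide)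
    have "norm (corner_vector n T) \<le> c"
      using R(2) NR unfolding T_def corner_vector_linear(2)[OF schatten_classD(1)[OF RC]]
      by (simp add: norm_ell2_scale norm_divide field_simps)
    then have "norm (T (ell2_unit i)) \<le> c" "norm (hilbert_adjoint T (ell2_unit i)) \<le> c" if "i < n" for i
      using corner_vector(3,4)[OF schatten_classD(1)[OF TC] that] by (meson order_trans)+
    then show ?thesis using schatten_block_approximation[OF p TC e, of n] TX T1 unfolding c_def by blast
  qed
  then have "\<forall>n k. \<exists>T m. T \<in> X \<and> schatten_norm p T = 1 \<and> m \<ge> n \<and>
      schatten_norm p (T - (prj {n..<m} o\<^sub>L (T o\<^sub>L prj {n..<m}))) \<le> \<delta> k" using \<delta> by blast
  then obtain Tc mc where Tm: "\<And>n k. Tc n k \<in> X" "\<And>n k. schatten_norm p (Tc n k) = 1" "\<And>n k. mc n k \<ge> n"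
    "\<And>n k. schatten_norm p (Tc n k - (prj {n..<mc n k} o\<^sub>L (Tc n k o\<^sub>L prj {n..<mc n k}))) \<le> \<delta> k"
    by metis
  \<comment> \<open>n (Suc k) is the end of the block chosen for start n k and tolerance \<delta> k,
    so consecutive blocks are adjacent intervals.\<close>
  define n where "n = rec_nat 0 (\<lambda>k n. mc n k)"
  have nS: "n (Suc k) = mc (n k) k" for k by (simp add: n_def)
  have mono: "n j \<le> n k" if "j \<le> k" for j k
    by (rule lift_Suc_mono_le[OF _ that]) (use Tm(3) nS in simp)
  define T where "T = (\<lambda>k. Tc (n k) k)"
  define D where "D = (\<lambda>k. {n k..<n (Suc k)})"
  define B where "B = (\<lambda>k. prj (D k) o\<^sub>L (T k o\<^sub>L prj (D k)))"
  have "T k \<in> X \<and> schatten_norm p (T k) = 1 \<and> B k \<in> schatten_class p \<and> supported (D k) (B k) \<and>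
    schatten_norm p (T k - B k) \<le> \<delta> k" for k
  proof (intro conjI)
    show "T k \<in> X" "schatten_norm p (T k) = 1" by (simp_all add: T_def Tm)
    then have "T k \<in> schatten_class p" using XC by blast
    then show "B k \<in> schatten_class p" unfolding B_def by (intro schatten_class_prj[OF p])
    show "supported (D k) (B k)" unfolding B_def by (rule supported_block)
    show "schatten_norm p (T k - B k) \<le> \<delta> k" using Tm(4)[of "n k" k] by (simp add: B_def T_def D_def nS)
  qed
  moreover have "D j \<inter> D k = {}" if "j \<noteq> k" for j k
  proof -
    have "D j \<inter> D k = {}" if "j < k" for j k using mono[of "Suc j" k] that by (auto simp: D_def)
    then show ?thesis using that by (metis Int_commute linorder_neqE_nat)
  qed
  ultimately show ?thesis by blast
qed

section \<open>Subspaces isomorphic to the Hilbert space\<close>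

text \<open>The two bounds make \<Psi> an isomorphism onto its range W, which is closed because X is
  complete. A maximal orthonormal system in the unit sphere of W is a basis of W, and the
  coefficients along it map W isometrically onto the whole Hilbert space, provided the system is
  infinite.\<close>

lemma isomorphic_ell2:
  fixes X :: "('k::rc_scalar) ell2_op set" and \<Psi> :: "'k ell2_op \<Rightarrow> 'k ell2"
  assumes p: "p \<ge> 1" and XC: "X \<subseteq> schatten_class p" and sub: "op.subspace X"
    and closed: "\<And>f l. (\<And>n::nat. f n \<in> X) \<Longrightarrow> l \<in> schatten_class p \<Longrightarrow>
      (\<lambda>n. schatten_norm p (f n - l)) \<longlonglongrightarrow> 0 \<Longrightarrow> l \<in> X"
    and inf: "\<nexists>F. finite F \<and> X \<subseteq> op.span F"
    and add: "\<And>S T. S \<in> X \<Longrightarrow> T \<in> X \<Longrightarrow> \<Psi> (S + T) = \<Psi> S + \<Psi> T"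
    and scale: "\<And>c T. T \<in> X \<Longrightarrow> \<Psi> (op_scale c T) = ell2_scale c (\<Psi> T)"
    and lo: "c > 0" "\<And>T. T \<in> X \<Longrightarrow> c * schatten_norm p T \<le> norm (\<Psi> T)"
    and up: "d > 0" "\<And>T. T \<in> X \<Longrightarrow> norm (\<Psi> T) \<le> d * schatten_norm p T"
  shows "isomorphic_normed op_scale X (schatten_norm p) ell2_scale (UNIV :: 'k ell2 set) norm"
proof -
  have diff: "\<Psi> (S - T) = \<Psi> S - \<Psi> T" if "S \<in> X" "T \<in> X" for S T
    using add[OF op.subspace_diff[OF sub that] that(2)] by simp
  have XD: "S - T \<in> X" if "S \<in> X" "T \<in> X" for S T by (rule op.subspace_diff[OF sub that])
  have C: "T \<in> schatten_class p" if "T \<in> X" for T using that XC by blast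
  have inj: "S = T" if "S \<in> X" "T \<in> X" "\<Psi> S = \<Psi> T" for S T
  proof -
    have "c * schatten_norm p (S - T) \<le> 0" using lo(2)[OF XD[OF that(1,2)]] diff[OF that(1,2)] that(3) by simp
    then have "schatten_norm p (S - T) \<le> 0" using lo(1) by (simp add: mult_le_0_iff)
    then have "norm (S - T) \<le> 0" using norm_le_schatten_norm[OF p C[OF XD[OF that(1,2)]]] by linarith
    then show ?thesis by simp
  qed
  define W where "W = \<Psi> ` X"
  have Wadd: "x + y \<in> W" if xy: "x \<in> W" "y \<in> W" for x y
  proof -
    obtain S T where "S \<in> X" "x = \<Psi> S" "T \<in> X" "y = \<Psi> T" using xy unfolding W_def by blast
    then show ?thesis using add op.subspace_add[OF sub] unfolding W_def by (metis imageI)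
  qed
  have Wscale: "ell2_scale a x \<in> W" if xW: "x \<in> W" for a x
  proof -
    obtain S where "S \<in> X" "x = \<Psi> S" using xW unfolding W_def by blast
    then show ?thesis using scale op.subspace_scale[OF sub] unfolding W_def by (metis imageI)
  qed
  have W0: "0 \<in> W"
  proof -
    have "\<Psi> 0 = ell2_scale 0 (\<Psi> 0)" using scale[OF op.subspace_0[OF sub], of 0] by simp
    then have "\<Psi> 0 = 0" by simp
    then show ?thesis using op.subspace_0[OF sub] unfolding W_def by (metis imageI)
  qed
  have Wsum: "sum f I \<in> W" if "\<And>i. i \<in> I \<Longrightarrow> f i \<in> W" for f and I :: "nat set"
    using that by (induction I rule: infinite_finite_induct) (auto intro: Wadd simp: W0)
  have Wlim: "l \<in> W" if f: "\<And>n::nat. f n \<in> W" and l: "f \<longlonglongrightarrow> l" for f l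
  proof -
    have "\<forall>n. \<exists>T. T \<in> X \<and> f n = \<Psi> T" using f unfolding W_def by blast
    then obtain T where T: "\<And>n. T n \<in> X" "\<And>n. f n = \<Psi> (T n)" by metis
    have "\<exists>L\<in>schatten_class p. (\<lambda>n. schatten_norm p (T n - L)) \<longlonglongrightarrow> 0"
    proof (rule schatten_class_complete[OF p C[OF T(1)]])
      fix e :: real assume e: "e > 0"
      have "Cauchy f" using l by (rule LIMSEQ_imp_Cauchy)
      then obtain M where M: "\<And>m n. m \<ge> M \<Longrightarrow> n \<ge> M \<Longrightarrow> dist (f m) (f n) < c * e"
        unfolding Cauchy_def using lo(1) e by (metis mult_pos_pos)
      have "schatten_norm p (T m - T n) \<le> e" if "m \<ge> M" "n \<ge> M" for m n
      proof -
        have "c * schatten_norm p (T m - T n) \<le> norm (f m - f n)"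
          using lo(2)[OF XD[OF T(1) T(1)], of m n] by (simp add: diff[OF T(1) T(1)] T(2))
        also have "\<dots> \<le> c * e" using M[OF that] by (simp add: dist_norm)
        finally show ?thesis using lo(1) by simp
      qed
      then show "\<exists>M. \<forall>m\<ge>M. \<forall>n\<ge>M. schatten_norm p (T m - T n) \<le> e" by blast
    qed
    then obtain L where L: "L \<in> schatten_class p" "(\<lambda>n. schatten_norm p (T n - L)) \<longlonglongrightarrow> 0" by blast
    have LX: "L \<in> X" by (rule closed[OF T(1) L])
    have "(\<lambda>n. f n - \<Psi> L) \<longlonglongrightarrow> 0"
    proof (rule tendsto_norm_zero_cancel, rule tendsto_sandwich[OF _ _ tendsto_const])
      show "\<forall>\<^sub>F n in sequentially. norm (f n - \<Psi> L) \<le> d * schatten_norm p (T n - L)"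
        using up(2)[OF XD[OF T(1) LX]] by (simp add: diff[OF T(1) LX] T(2))
      show "(\<lambda>n. d * schatten_norm p (T n - L)) \<longlonglongrightarrow> 0" using tendsto_mult_left[OF L(2), of d] by simp
    qed simp
    then have "f \<longlonglongrightarrow> \<Psi> L" by (rule LIM_zero_cancel)
    then have "l = \<Psi> L" using l LIMSEQ_unique by blast
    then show ?thesis using LX unfolding W_def by blast
  qed
  define Q where "Q = {w \<in> W. norm w = 1}"
  have Q1: "norm q = 1" if q: "q \<in> Q" for q using q unfolding Q_def by simp
  obtain w :: "nat \<Rightarrow> 'k ell2" where w4: "orthosystem UNIV w \<and> range w \<subseteq> insert 0 Q \<and>
      (\<forall>q\<in>Q. \<exists>i. \<langle>q, w i\<rangle> \<noteq> 0) \<and> ((\<forall>i. w i \<noteq> 0) \<or> finite (range w))"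
    using maximal_orthosystem[of Q, OF Q1] by (rule exE)
  have w: "orthosystem UNIV w" "range w \<subseteq> insert 0 Q" by (rule conjunct1[OF w4], rule conjunct1[OF conjunct2[OF w4]])
  have max: "\<exists>i. \<langle>q, w i\<rangle> \<noteq> 0" if "q \<in> Q" for q
    using conjunct1[OF conjunct2[OF conjunct2[OF w4]]] that by (rule bspec)
  have alt: "(\<forall>i. w i \<noteq> 0) \<or> finite (range w)" by (rule conjunct2[OF conjunct2[OF conjunct2[OF w4]]])
  have "insert 0 Q \<subseteq> W" using W0 unfolding Q_def by simp
  then have wW: "w i \<in> W" for i using subset_trans[OF w(2)] rangeI[of w i] by (metis subsetD)
  have sumW: "(\<Sum>i. ell2_scale (a i) (w i)) \<in> W" if "summable (\<lambda>i. (norm (a i))\<^sup>2)" for a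
  proof (rule Wlim)
    show "(\<lambda>n. \<Sum>i<n. ell2_scale (a i) (w i)) \<longlonglongrightarrow> (\<Sum>i. ell2_scale (a i) (w i))"
      by (rule summable_LIMSEQ[OF orthosystem_sums(1)[OF w(1) that]])
    show "(\<Sum>i<n. ell2_scale (a i) (w i)) \<in> W" for n by (rule Wsum[OF Wscale[OF wW]])
  qed
  have expand: "(\<Sum>i. ell2_scale \<langle>x, w i\<rangle> (w i)) = x" if x: "x \<in> W" for x
  proof (rule ccontr)
    assume ne: "(\<Sum>i. ell2_scale \<langle>x, w i\<rangle> (w i)) \<noteq> x"
    define y where "y = x - (\<Sum>i. ell2_scale \<langle>x, w i\<rangle> (w i))"
    have y0: "y \<noteq> 0" using ne by (simp add: y_def)
    have "x + ell2_scale (- 1) (\<Sum>i. ell2_scale \<langle>x, w i\<rangle> (w i)) \<in> W"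
      by (intro Wadd x Wscale sumW bessel_summable(1)[OF w(1)])
    moreover have "ell2_scale (- 1) z = - z" for z :: "'k ell2" by (rule ell2_eqI) simp
    ultimately have yW: "y \<in> W" by (simp add: y_def)
    define q where "q = ell2_scale (of_real (1 / norm y)) y"
    have "q \<in> Q" using y0 Wscale[OF yW] by (simp add: Q_def q_def norm_ell2_scale norm_divide)
    then obtain i where "\<langle>q, w i\<rangle> \<noteq> 0" using max by blast
    moreover have "\<langle>y, w i\<rangle> = 0" unfolding y_def by (rule expansion_orthogonal[OF w(1)])
    ultimately show False by (simp add: q_def inner_scale_left)
  qed
  \<comment> \<open>Otherwise the preimages of the finitely many nonzero w i would span X. By the
    alternative \<open>alt\<close>, no w i is then zero, so every square-summable sequence occurs as
    a coefficient sequence.\<close>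
  have "\<not> finite (range w)"
  proof
    assume fin: "finite (range w)"
    define I where "I = {i. w i \<noteq> 0}"
    have inj_w: "inj_on w I"
    proof (rule inj_onI, rule ccontr)
      fix i j assume "i \<in> I" "j \<in> I" "w i = w j" "i \<noteq> j"
      then have "\<langle>w i, w i\<rangle> = 0" using orthosystemD(1)[OF w(1), of i j] by simp
      then show False using \<open>i \<in> I\<close> by (simp add: inner_self I_def)
    qed
    have "finite (w ` I)" by (rule finite_subset[OF _ fin]) blast
    then have I: "finite I" using inj_w by (rule finite_imageD)
    define V where "V = (\<lambda>i. inv_into X \<Psi> (w i))"
    have V: "V i \<in> X" "\<Psi> (V i) = w i" for i
      using wW[of i] unfolding W_def V_def by (rule inv_into_into, rule f_inv_into_f)
    have "X \<subseteq> op.span (V ` I)"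
    proof
      fix T assume T: "T \<in> X"
      define R where "R = (\<Sum>i\<in>I. op_scale \<langle>\<Psi> T, w i\<rangle> (V i))"
      have "\<Psi> (\<Sum>i\<in>J. op_scale (a i) (V i)) = (\<Sum>i\<in>J. ell2_scale (a i) (w i)) \<and> (\<Sum>i\<in>J. op_scale (a i) (V i)) \<in> X"
        if "finite J" for J and a :: "nat \<Rightarrow> 'k"
        using that
      proof (induction J)
        case empty
        have "\<Psi> 0 = ell2_scale 0 (\<Psi> 0)" using scale[OF op.subspace_0[OF sub], of 0] by simp
        then show ?case using op.subspace_0[OF sub] by simp
      next
        case (insert i J)
        have sX: "op_scale (a i) (V i) \<in> X" by (rule op.subspace_scale[OF sub V(1)])
        then show ?case
          using insert add[OF sX, of "\<Sum>i\<in>J. op_scale (a i) (V i)"] scale[OF V(1), of "a i" i] V(2)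
            op.subspace_add[OF sub sX] by simp
      qed
      from this[OF I, of "\<lambda>i. \<langle>\<Psi> T, w i\<rangle>"]
      have R: "\<Psi> R = (\<Sum>i\<in>I. ell2_scale \<langle>\<Psi> T, w i\<rangle> (w i))" "R \<in> X" unfolding R_def by auto
      have "(\<Sum>i. ell2_scale \<langle>\<Psi> T, w i\<rangle> (w i)) = (\<Sum>i\<in>I. ell2_scale \<langle>\<Psi> T, w i\<rangle> (w i))"
        by (rule suminf_finite[OF I]) (simp add: I_def)
      then have "\<Psi> R = \<Psi> T" using R(1) expand[of "\<Psi> T"] T unfolding W_def by simp
      then have "R = T" by (rule inj[OF R(2) T])
      moreover have "R \<in> op.span (V ` I)"
        unfolding R_def by (intro op.span_sum op.span_scale op.span_base) auto
      ultimately show "T \<in> op.span (V ` I)" by simp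
    qed
    then show False using inf I by blast
  qed
  then have wn: "norm (w i) = 1" for i using alt orthosystemD(2)[OF w(1), of i] by auto
  define U where "U = (\<lambda>T. Abs_ell2 (\<lambda>i. \<langle>\<Psi> T, w i\<rangle>))"
  have cU: "coord (U T) i = \<langle>\<Psi> T, w i\<rangle>" for T i
  proof -
    have "(\<lambda>i. \<langle>\<Psi> T, w i\<rangle>) \<in> lp 2" using bessel_summable(1)[OF w(1)] by (simp add: mem_lp_2)
    then show ?thesis unfolding U_def by (simp only: coord_Abs)
  qed
  have nU: "norm (U T) = norm (\<Psi> T)" if "T \<in> X" for T
  proof -
    have "(norm (U T))\<^sup>2 = (\<Sum>i. (norm \<langle>\<Psi> T, w i\<rangle>)\<^sup>2)" by (simp add: norm_square_ell2 cU)
    moreover have "(norm (\<Psi> T))\<^sup>2 \<le> (\<Sum>i. (norm \<langle>\<Psi> T, w i\<rangle>)\<^sup>2)"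
      using orthosystem_sums(3)[OF w(1) bessel_summable(1)[OF w(1)], of "\<Psi> T"] expand[of "\<Psi> T"] that
      unfolding W_def by simp
    ultimately have "(norm (U T))\<^sup>2 = (norm (\<Psi> T))\<^sup>2" using bessel_summable(2)[OF w(1), of "\<Psi> T"] by simp
    then show ?thesis by simp
  qed
  have lin: "linear_between op_scale ell2_scale X U"
    unfolding linear_between_def
    by (auto intro!: ell2_eqI simp: cU add scale inner.add_left inner_scale_left)
  have "bij_betw U X UNIV"
    unfolding bij_betw_def
  proof
    show "inj_on U X"
    proof (rule inj_onI)
      fix S T assume ST: "S \<in> X" "T \<in> X" "U S = U T"
      have "U (S - T) = U S - U T"
        by (rule ell2_eqI) (simp add: cU diff[OF ST(1,2)] inner.diff_left)
      then have "norm (\<Psi> (S - T)) = 0" using nU[OF XD[OF ST(1,2)]] ST(3) by simp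
      then show "S = T" using diff[OF ST(1,2)] inj[OF ST(1,2)] by simp
    qed
    have "\<exists>T\<in>X. U T = x" for x
    proof -
      have "(\<Sum>i. ell2_scale (coord x i) (w i)) \<in> W" by (rule sumW[OF ell2_summable])
      then obtain T where T: "T \<in> X" "(\<Sum>i. ell2_scale (coord x i) (w i)) = \<Psi> T" unfolding W_def by blast
      have "coord (U T) k = coord x k" for k
        unfolding cU T(2)[symmetric] orthosystem_sums(2)[OF w(1) ell2_summable] by (simp add: wn)
      then have "U T = x" by (rule ell2_eqI)
      then show ?thesis using T(1) by blast
    qed
    then show "U ` X = UNIV" by (metis UNIV_eq_I imageI)
  qed
  moreover have "equivalent_on X (schatten_norm p) (\<lambda>v. norm (U v))"
    unfolding equivalent_on_def using lo up nU by (intro exI[of _ c] exI[of _ d] conjI) auto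
  ultimately show ?thesis unfolding isomorphic_normed_def using lin by blast
qed

theorem corollary2p21:
  fixes p :: real and X :: "('k::rc_scalar) ell2_op set"
  assumes "1 < p" and "p \<noteq> 2"
    and "closed_inf_dim_subspace op_scale (schatten_norm p) (schatten_class p) X"
    and "\<And>Y. closed_inf_dim_subspace op_scale (schatten_norm p) X Y \<Longrightarrow>
           \<exists>M. norm_on op_scale Y M \<and> equivalent_on Y (schatten_norm p) M
             \<and> convex_transitive op_scale Y M"
  shows "isomorphic_normed op_scale X (schatten_norm p)
           ell2_scale (UNIV :: 'k ell2 set) norm"
proof -
  have p1: "p \<ge> 1" using assms(1) by simp
  have XC: "X \<subseteq> schatten_class p" and sub: "op.subspace X"
    and inf: "\<nexists>F. finite F \<and> X \<subseteq> op.span F"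
    and closed: "\<And>f l. (\<And>n::nat. f n \<in> X) \<Longrightarrow> l \<in> schatten_class p \<Longrightarrow>
      (\<lambda>n. schatten_norm p (f n - l)) \<longlonglongrightarrow> 0 \<Longrightarrow> l \<in> X"
    using assms(3) unfolding closed_inf_dim_subspace_def by blast+
  have lin: "scalar_linear T" if "T \<in> X" for T using that XC schatten_classD(1) by blast
  show ?thesis
  proof (cases "\<exists>n c. c > 0 \<and> (\<forall>T\<in>X. c * schatten_norm p T \<le> norm (corner_vector n T))")
    case True
    then obtain n c where c: "c > 0" "\<And>T. T \<in> X \<Longrightarrow> c * schatten_norm p T \<le> norm (corner_vector n T)" by blast
    \<comment> \<open>The summand 1 in d makes it positive without a case distinction on n.\<close>
    show ?thesis
    proof (rule isomorphic_ell2[OF p1 XC sub closed inf, where \<Psi> = "corner_vector n" and c = c and d = "sqrt (2 * real n) + 1"])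
      fix T assume T: "T \<in> X"
      have "norm (corner_vector n T) \<le> sqrt (2 * real n) * norm T" by (rule corner_vector(2)[OF lin[OF T]])
      also have "\<dots> \<le> (sqrt (2 * real n) + 1) * schatten_norm p T"
        using norm_le_schatten_norm[OF p1, of T] T XC by (intro mult_mono) auto
      finally show "norm (corner_vector n T) \<le> (sqrt (2 * real n) + 1) * schatten_norm p T" .
    qed (use c in \<open>auto simp: corner_vector_linear lin intro: add_nonneg_pos\<close>)
  next
    case False
    then have small: "\<exists>T\<in>X. norm (corner_vector n T) < c * schatten_norm p T" if "c > 0" for n c
      using that by (meson not_le)
    have \<delta>: "(1/4) * (1/2::real) ^ Suc k > 0" for k by simp
    obtain T B D where TB: "\<forall>k. T k \<in> X \<and> schatten_norm p (T k) = 1 \<and> B k \<in> schatten_class p \<and>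
        supported (D k) (B k) \<and> schatten_norm p (T k - B k) \<le> (1/4) * (1/2) ^ Suc k"
      and disj: "\<forall>j k::nat. j \<noteq> k \<longrightarrow> D j \<inter> D k = {}"
      using gliding_hump[OF p1 XC sub small, where \<delta> = "\<lambda>k. (1/4) * (1/2) ^ Suc k", OF _ \<delta>] by metis
    interpret schatten_lp_sequence p X T B D
      by unfold_locales (use assms(1) XC sub closed TB disj in blast)+
    have "p = 2" by (rule p_eq_2_if_convex_transitive[OF assms(4)[OF J_range_closed]])
    then show ?thesis using assms(2) by simp
  qed
qed

end
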